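(* For every function $f$ with $\lim_{n\to\infty} f(n) = 0$, assuming Gap-ETH, no polynomial-time algorithm can, given a graph $G$ on $n$ vertices and a positive integer $k \le n$, distinguish between the following two cases: (1) there exist $k$ vertices of $G$ that induce a $k$-clique; (2) every $k$-vertex induced subgraph of $G$ has density at most $n^{-f(n)}$.
   Context: All graphs are simple, unweighted and undirected. The density of a graph on $N \ge 2$ vertices with edge set $E$ is $|E|/\binom{N}{2}$; a $k$-subgraph means the subgraph induced on a set of $k$ vertices. For a 3SAT formula $\phi$, $\mathrm{val}(\phi)$ denotes the maximum fraction of clauses of $\phi$ simultaneously satisfied by an assignment. Gap-ETH is the hypothesis that there exists a constant $\varepsilon > 0$ such that no $2^{o(m)}$-time algorithm can, given a 3SAT formula $\phi$ with $m$ clauses, distinguish between the case where $\phi$ is satisfiable and the case where $\mathrm{val}(\phi) \le 1 - \varepsilon$. Algorithms are deterministic. *)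

theory Defs
  imports Complex_Main "HOL-Library.Landau_Symbols"
begin


text \<open>
  States and tape symbols are initial segments of the natural numbers. Symbol 0 is the blank;
  state 0 is initial, and the halting states are 1 (accept) and 2 (reject).
  The value of \<open>tm_delta\<close> matters only on the finite domain fixed by \<open>turing_machine\<close> below,
  so a machine is a finite object. Tapes are infinite in both directions.
\<close>

datatype direction = Go_Left | Stay | Go_Right

record tm =
  tm_tapes :: nat
  tm_symbols :: nat
  tm_states :: nat
  tm_delta :: "nat \<Rightarrow> nat list \<Rightarrow> nat \<times> (nat \<times> direction) list"

definition turing_machine :: "tm \<Rightarrow> bool" where
  "turing_machine M \<longleftrightarrow>
     1 \<le> tm_tapes M \<and> 4 \<le> tm_symbols M \<and> 3 \<le> tm_states M \<and>
     (\<forall>q ss. q < tm_states M \<and> length ss = tm_tapes M \<and> set ss \<subseteq> {..<tm_symbols M} \<longrightarrow>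
        (case tm_delta M q ss of (q', acts) \<Rightarrow>
           q' < tm_states M \<and> length acts = tm_tapes M \<and>
           fst ` set acts \<subseteq> {..<tm_symbols M}))"

type_synonym tape = "(int \<Rightarrow> nat) \<times> int" \<comment> \<open>cell contents and head position\<close>
type_synonym config = "nat \<times> tape list"

fun head_shift :: "direction \<Rightarrow> int" where
  "head_shift Go_Left = -1"
| "head_shift Stay = 0"
| "head_shift Go_Right = 1"

fun read_tape :: "tape \<Rightarrow> nat" where
  "read_tape (c, h) = c h"

fun act_tape :: "nat \<times> direction \<Rightarrow> tape \<Rightarrow> tape" where
  "act_tape (s, d) (c, h) = (c(h := s), h + head_shift d)"

fun tm_step :: "tm \<Rightarrow> config \<Rightarrow> config" where
  "tm_step M (q, ts) =
     (if q \<in> {1, 2} then (q, ts)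
      else (case tm_delta M q (map read_tape ts) of (q', acts) \<Rightarrow> (q', map2 act_tape acts ts)))"

definition tm_init :: "tm \<Rightarrow> nat list \<Rightarrow> config" where
  "tm_init M w =
     (0, (\<lambda>i. if 0 \<le> i \<and> i < int (length w) then w ! nat i else 0, 0)
           # replicate (tm_tapes M - 1) (\<lambda>_. 0, 0))"

definition tm_state_after :: "tm \<Rightarrow> nat list \<Rightarrow> nat \<Rightarrow> nat" where
  "tm_state_after M w t = fst ((tm_step M ^^ t) (tm_init M w))"

definition accepts :: "tm \<Rightarrow> nat list \<Rightarrow> bool" where
  "accepts M w \<longleftrightarrow> (\<exists>t. tm_state_after M w t = 1)"

definition rejects :: "tm \<Rightarrow> nat list \<Rightarrow> bool" where
  "rejects M w \<longleftrightarrow> (\<exists>t. tm_state_after M w t = 2)"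

definition halts_within :: "tm \<Rightarrow> nat list \<Rightarrow> real \<Rightarrow> bool" where
  "halts_within M w b \<longleftrightarrow> (\<exists>t. real t \<le> b \<and> tm_state_after M w t \<in> {1, 2})"

text \<open>
  Promise problems on a set \<open>I\<close> of instances that are presented to the machine through \<open>enc\<close>.
  Time bounds are imposed on all instances, also those outside the promise.
\<close>

definition distinguishes ::
    "tm \<Rightarrow> ('i \<Rightarrow> nat list) \<Rightarrow> 'i set \<Rightarrow> ('i \<Rightarrow> bool) \<Rightarrow> ('i \<Rightarrow> bool) \<Rightarrow> bool" where
  "distinguishes M enc I yes no \<longleftrightarrow>
     (\<forall>x\<in>I. (yes x \<longrightarrow> accepts M (enc x)) \<and> (no x \<longrightarrow> rejects M (enc x)))"

definition polynomial_time :: "tm \<Rightarrow> ('i \<Rightarrow> nat list) \<Rightarrow> 'i set \<Rightarrow> bool" where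
  "polynomial_time M enc I \<longleftrightarrow>
     (\<exists>c d :: nat. \<forall>x\<in>I. halts_within M (enc x) (real (c * length (enc x) ^ d + c)))"

text \<open>
  Time \<open>2 powr g m\<close> with \<open>g\<close> in \<open>o(m)\<close>, where \<open>m\<close> is the parameter \<open>par x\<close> of the instance. Changing \<open>g\<close> at finitely many
  arguments does not affect membership in \<open>o(m)\<close>, so the bound is asymptotic.
\<close>

definition subexponential_time :: "tm \<Rightarrow> ('i \<Rightarrow> nat list) \<Rightarrow> 'i set \<Rightarrow> ('i \<Rightarrow> nat) \<Rightarrow> bool" where
  "subexponential_time M enc I par \<longleftrightarrow>
     (\<exists>g :: nat \<Rightarrow> real. g \<in> o(\<lambda>m. real m) \<and>
        (\<forall>x\<in>I. halts_within M (enc x) (2 powr g (par x))))"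



type_synonym literal = "nat \<times> bool" \<comment> \<open>variable and sign, \<open>True\<close> for a positive literal\<close>
type_synonym clause = "literal list"
type_synonym formula = "clause list"

definition clause_sat :: "(nat \<Rightarrow> bool) \<Rightarrow> clause \<Rightarrow> bool" where
  "clause_sat a C \<longleftrightarrow> (\<exists>(v, b) \<in> set C. a v = b)"

text \<open>
  A formula with \<open>m\<close> clauses mentions at most \<open>3 * m\<close> variables; they are named by numbers below
  \<open>3 * m\<close>. Without such a bound the input length, and hence the running time, could not be
  bounded in terms of \<open>m\<close>. The formula without clauses is excluded because its value is undefined.
\<close>

definition threesat_instances :: "formula set" where
  "threesat_instances =
     {\<phi>. \<phi> \<noteq> [] \<and>
         (\<forall>C\<in>set \<phi>. 1 \<le> length C \<and> length C \<le> 3 \<and> (\<forall>(v, b)\<in>set C. v < 3 * length \<phi>))}"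

definition satisfiable :: "formula \<Rightarrow> bool" where
  "satisfiable \<phi> \<longleftrightarrow> (\<exists>a. \<forall>C\<in>set \<phi>. clause_sat a C)"

definition val :: "formula \<Rightarrow> real" where
  "val \<phi> = Max (range (\<lambda>a. real (length (filter (clause_sat a) \<phi>)) / real (length \<phi>)))"

text \<open>
  Instances are words over the symbols 1 and 2 (the bits 0 and 1) and 3 (a delimiter).
  Numbers are written in unary; as all numbers involved are at most \<open>3 * m\<close> (for formulas) or \<open>n\<close>
  (for graphs), this changes the input length at most polynomially.
  A literal is its sign, its variable and a delimiter; a clause is closed by an extra delimiter.
\<close>

fun encode_literal :: "literal \<Rightarrow> nat list" where
  "encode_literal (v, b) = (if b then 2 else 1) # replicate v 1 @ [3]"

definition encode_clause :: "clause \<Rightarrow> nat list" where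
  "encode_clause C = concat (map encode_literal C) @ [3]"

definition encode_formula :: "formula \<Rightarrow> nat list" where
  "encode_formula \<phi> = concat (map encode_clause \<phi>)"

definition gap_ETH :: bool where
  "gap_ETH \<longleftrightarrow>
     (\<exists>\<epsilon>::real. \<epsilon> > 0 \<and>
        \<not> (\<exists>M. turing_machine M \<and>
               subexponential_time M encode_formula threesat_instances length \<and>
               distinguishes M encode_formula threesat_instances
                 satisfiable (\<lambda>\<phi>. val \<phi> \<le> 1 - \<epsilon>)))"



text \<open>A simple graph on \<open>n\<close> vertices has vertex set \<open>{..<n}\<close> and is given by its set of edges.\<close>

definition simple_graph :: "nat \<Rightarrow> nat set set \<Rightarrow> bool" where
  "simple_graph n E \<longleftrightarrow> E \<subseteq> {e. e \<subseteq> {..<n} \<and> card e = 2}"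

definition induced_edges :: "nat set set \<Rightarrow> nat set \<Rightarrow> nat set set" where
  "induced_edges E S = {e\<in>E. e \<subseteq> S}"

definition density :: "nat set \<Rightarrow> nat set set \<Rightarrow> real" where
  "density V E = real (card E) / real (card V choose 2)"

definition clique :: "nat set set \<Rightarrow> nat set \<Rightarrow> bool" where
  "clique E S \<longleftrightarrow> (\<forall>u\<in>S. \<forall>v\<in>S. u \<noteq> v \<longrightarrow> {u, v} \<in> E)"

type_synonym dks_instance = "nat \<times> nat set set \<times> nat" \<comment> \<open>\<open>n\<close>, edge set, \<open>k\<close>\<close>

definition dks_instances :: "dks_instance set" where
  "dks_instances = {(n, E, k). simple_graph n E \<and> 1 \<le> k \<and> k \<le> n}"

fun encode_dks :: "dks_instance \<Rightarrow> nat list" where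
  "encode_dks (n, E, k) =
     replicate n 1 @ [3] @ replicate k 1 @ [3] @
     [if {i, j} \<in> E then 2 else 1. i \<leftarrow> [0..<n], j \<leftarrow> [0..<n]]"

fun has_k_clique :: "dks_instance \<Rightarrow> bool" where
  "has_k_clique (n, E, k) \<longleftrightarrow> (\<exists>S. S \<subseteq> {..<n} \<and> card S = k \<and> clique E S)"

text \<open>
  The density of a one-vertex graph is undefined, so an instance with \<open>k = 1\<close> (which always has a
  1-clique) is not sparse. Dropping \<open>2 \<le> k\<close> would put these instances into both cases, because
  \<open>0 / 0 = 0\<close>, and make distinguishing impossible for a trivial reason.
\<close>

fun all_k_subgraphs_sparse :: "(nat \<Rightarrow> real) \<Rightarrow> dks_instance \<Rightarrow> bool" where
  "all_k_subgraphs_sparse f (n, E, k) \<longleftrightarrow>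
     2 \<le> k \<and>
     (\<forall>S. S \<subseteq> {..<n} \<and> card S = k \<longrightarrow> density S (induced_edges E S) \<le> real n powr (- f n))"

end

theory Submission
  imports Defs "HOL-Library.FuncSet" "HOL-Real_Asymp.Real_Asymp"
begin

text \<open>
  Let \<open>M\<close> distinguish the two cases in polynomial time, and let \<open>\<phi>\<close> be a formula with \<open>m\<close> clauses. For a parameter \<open>b\<close>, group
  the clauses into about \<open>m / b\<close> blocks. A vertex picks, for every block and every literal position, a clause of the
  block and a value for the variable of its literal; two vertices are adjacent if their choices are consistent and do not
  falsify a clause together. An assignment that satisfies all blocks yields a clique on a fixed number of
  vertices. Conversely, convexity turns a \<open>k\<close>-subgraph of density at least \<open>n powr (- f n)\<close> into many small bicliques. A
  biclique determines a partial assignment, and every block that this violates costs a constant factor in the number of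
  bicliques of its type; so some assignment satisfies nearly all blocks.

  The answer of \<open>M\<close> only says that a nearly satisfying assignment exists. To find one, fix the values of the
  variables in \<open>b\<close> levels, about \<open>3 * m / b\<close> variables at a time: at each level try all values, together with a
  small set of blocks to drop, and let \<open>M\<close> decide whether the choice extends. All the
  graphs involved have \<open>2 powr (O (log b / b) * m)\<close> vertices.

  As \<open>f\<close> need not be computable, it is not known from which \<open>m\<close> on the answers for a given \<open>b\<close> can be
  trusted. The search therefore runs through \<open>b = m, m - 1, \<dots>\<close>. It accepts only when it has computed a nearly satisfying
  assignment, and it rejects only when every choice at the first level is refused, which cannot happen for a satisfiable
  formula; when it gets stuck at a later level, it passes to \<open>b - 1\<close>. Hence it never errs, and for each fixed \<open>b\<close> it stops
  at \<open>b\<close> or earlier if \<open>m\<close> is large.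
\<close>

subsection \<open>Structured programs on tapes\<close>

text \<open>A clique on \<open>\<beta> ^ (3 * q)\<close> vertices has
  \<open>\<beta> ^ (6 * q)\<close> ordered pairs, and no type of biclique admits more: at each
  digit, a position picked on one side leaves two values there, a position picked on both sides
  leaves one value on each, so by AM-GM the two sides together have at most
  \<open>\<beta> * \<beta>\<close> choices. A violated block costs a factor
  \<open>1 - 1 / \<beta> ^ 6\<close>. The number of types is exponential in \<open>q\<close> as
  well, but for bicliques with \<open>t\<close> vertices on each side the cost is raised to the
  power \<open>t\<close> and the number of types is not. So if a fixed fraction of the blocks is
  violated, a constant \<open>t\<close> wins, and the density is at most
  \<open>2 * 2 powr (- q / t ^ 2)\<close>. Since the number of vertices is
  \<open>2 powr O(q)\<close> for fixed \<beta>, this is a fixed negative power of it, which lies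
  below \<open>n powr (- f n)\<close> for large \<open>n\<close> because \<open>f\<close> tends to
  0. Gap-ETH speaks of Turing machines, so the search must become one. Its expressions denote
  polynomially bounded functions by construction, and the number of vertices enters only as the
  value of a counter that a loop has raised.\<close>

type_synonym store = "nat \<Rightarrow> tape"

text \<open>Tests look at the symbol under one head, so that one machine step decides them.
  \<open>Act\<close> rewrites and moves several tapes at once; this allows a multi-tape machine to
  be simulated with constant overhead per step.\<close>

datatype com =
    Act "nat list" "(nat \<Rightarrow> nat) \<Rightarrow> nat \<Rightarrow> nat \<times> direction"
  | Seq com com (infixr ";;" 60)
  | Cond nat "nat \<Rightarrow> bool" com com
  | Loop nat "nat \<Rightarrow> bool" com

definition act_on :: "nat list \<Rightarrow> ((nat \<Rightarrow> nat) \<Rightarrow> nat \<Rightarrow> nat \<times> direction) \<Rightarrow> store \<Rightarrow> store" where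
  "act_on ks F \<sigma> =
     (\<lambda>k. if k \<in> set ks
          then act_tape (F (\<lambda>i. if i \<in> set ks then read_tape (\<sigma> i) else 0) k) (\<sigma> k) else \<sigma> k)"

text \<open>The number counts machine steps, including one for unfolding a sequence or testing a
  condition. \<open>Weaken\<close> makes it an upper bound, so that costs can be rounded up to
  uniform expressions.\<close>

inductive exec :: "com \<Rightarrow> store \<Rightarrow> nat \<Rightarrow> store \<Rightarrow> bool" where
  Act: "exec (Act ks F) \<sigma> 1 (act_on ks F \<sigma>)"
| Seq: "exec c1 \<sigma> n \<sigma>1 \<Longrightarrow> exec c2 \<sigma>1 n' \<sigma>2 \<Longrightarrow> exec (c1 ;; c2) \<sigma> (n + n' + 1) \<sigma>2"
| CondT: "P (read_tape (\<sigma> k)) \<Longrightarrow> exec c1 \<sigma> n \<sigma>1 \<Longrightarrow> exec (Cond k P c1 c2) \<sigma> (n + 1) \<sigma>1"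
| CondF: "\<not> P (read_tape (\<sigma> k)) \<Longrightarrow> exec c2 \<sigma> n \<sigma>1 \<Longrightarrow> exec (Cond k P c1 c2) \<sigma> (n + 1) \<sigma>1"
| LoopT: "P (read_tape (\<sigma> k)) \<Longrightarrow> exec c \<sigma> n \<sigma>1 \<Longrightarrow> exec (Loop k P c) \<sigma>1 n' \<sigma>2 \<Longrightarrow>
    exec (Loop k P c) \<sigma> (n + n' + 1) \<sigma>2"
| LoopF: "\<not> P (read_tape (\<sigma> k)) \<Longrightarrow> exec (Loop k P c) \<sigma> 1 \<sigma>"
| Weaken: "exec c \<sigma> n \<sigma>1 \<Longrightarrow> n \<le> n' \<Longrightarrow> exec c \<sigma> n' \<sigma>1"

primrec tapes :: "com \<Rightarrow> nat set" where
  "tapes (Act ks F) = set ks"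
| "tapes (c1 ;; c2) = tapes c1 \<union> tapes c2"
| "tapes (Cond k P c1 c2) = {k} \<union> tapes c1 \<union> tapes c2"
| "tapes (Loop k P c) = {k} \<union> tapes c"

primrec symbols_below :: "nat \<Rightarrow> com \<Rightarrow> bool" where
  "symbols_below s (Act ks F) \<longleftrightarrow>
     (\<forall>r k. (\<forall>i. r i < s) \<longrightarrow> k \<in> set ks \<longrightarrow> fst (F r k) < s)"
| "symbols_below s (c1 ;; c2) \<longleftrightarrow> symbols_below s c1 \<and> symbols_below s c2"
| "symbols_below s (Cond k P c1 c2) \<longleftrightarrow> symbols_below s c1 \<and> symbols_below s c2"
| "symbols_below s (Loop k P c) \<longleftrightarrow> symbols_below s c"

text \<open>
  The control states of the machine that runs a command are the stacks of commands that remain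
  to be executed; only finitely many of them are reachable.
\<close>

primrec stacks :: "com \<Rightarrow> com list \<Rightarrow> com list set" where
  "stacks (Act ks F) st = {Act ks F # st}"
| "stacks (c1 ;; c2) st = {(c1 ;; c2) # st} \<union> stacks c1 (c2 # st) \<union> stacks c2 st"
| "stacks (Cond k P c1 c2) st = {Cond k P c1 c2 # st} \<union> stacks c1 st \<union> stacks c2 st"
| "stacks (Loop k P c) st = {Loop k P c # st} \<union> stacks c (Loop k P c # st)"

fun next_stack :: "com list \<Rightarrow> (nat \<Rightarrow> nat) \<Rightarrow> com list" where
  "next_stack [] r = []"
| "next_stack (Act ks F # st) r = st"
| "next_stack ((c1 ;; c2) # st) r = c1 # c2 # st"
| "next_stack (Cond k P c1 c2 # st) r = (if P (r k) then c1 # st else c2 # st)"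
| "next_stack (Loop k P c # st) r = (if P (r k) then c # Loop k P c # st else st)"

fun stack_act :: "com list \<Rightarrow> (nat \<Rightarrow> nat) \<Rightarrow> nat \<Rightarrow> nat \<times> direction" where
  "stack_act (Act ks F # st) r k =
     (if k \<in> set ks then F (\<lambda>i. if i \<in> set ks then r i else 0) k else (r k, Stay))"
| "stack_act st r k = (r k, Stay)"

fun stack_step :: "com list \<times> store \<Rightarrow> com list \<times> store" where
  "stack_step (st, \<sigma>) =
     (next_stack st (\<lambda>i. read_tape (\<sigma> i)),
      \<lambda>k. act_tape (stack_act st (\<lambda>i. read_tape (\<sigma> i)) k) (\<sigma> k))"

lemma finite_tapes: "finite (tapes c)"
  by (induction c) auto

lemma finite_stacks: "finite (stacks c st)"
  by (induction c arbitrary: st) auto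

lemma stacks_self: "c # st \<in> stacks c st"
  by (cases c) auto

text \<open>The finite set \<open>stacks c st\<close> is closed under control steps until the
  continuation \<open>st\<close> is reached. This makes the control of the compiled machine
  finite.\<close>

lemma next_stack_in_stacks:
  "x \<in> stacks c st \<Longrightarrow> next_stack x r \<in> insert st (stacks c st)"
proof (induction c arbitrary: st)
  case (Seq c1 c2)
  consider "x = (c1 ;; c2) # st" | "x \<in> stacks c1 (c2 # st)" | "x \<in> stacks c2 st"
    using Seq.prems by auto
  then show ?case
  proof cases
    case 1
    then show ?thesis using stacks_self[of c1 "c2 # st"] by simp
  next
    case 2
    then show ?thesis using Seq.IH(1)[of "c2 # st"] stacks_self[of c2 st] by auto
  next
    case 3
    then show ?thesis using Seq.IH(2)[of st] by auto
  qed
next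
  case (Cond k P c1 c2)
  then show ?case using stacks_self[of c1 st] stacks_self[of c2 st] by auto
next
  case (Loop k P c)
  consider "x = Loop k P c # st" | "x \<in> stacks c (Loop k P c # st)"
    using Loop.prems by auto
  then show ?case
    using Loop.IH[of "Loop k P c # st"] stacks_self[of c "Loop k P c # st"]
    by cases (simp, auto)
qed auto

lemma stacks_tapes:
  "x \<in> stacks c st \<Longrightarrow> \<Union>(tapes ` set x) \<subseteq> tapes c \<union> \<Union>(tapes ` set st)"
proof (induction c arbitrary: st)
  case (Seq c1 c2)
  consider "x = (c1 ;; c2) # st" | "x \<in> stacks c1 (c2 # st)" | "x \<in> stacks c2 st"
    using Seq.prems by auto
  then show ?case
    using Seq.IH(1)[of "c2 # st"] Seq.IH(2)[of st] by cases (simp, auto)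
next
  case (Loop k P c)
  consider "x = Loop k P c # st" | "x \<in> stacks c (Loop k P c # st)"
    using Loop.prems by auto
  then show ?case
    using Loop.IH[of "Loop k P c # st"] by cases (simp, auto)
qed auto

lemma stacks_symbols_below:
  "x \<in> stacks c st \<Longrightarrow> symbols_below s c \<Longrightarrow> \<forall>y\<in>set st. symbols_below s y \<Longrightarrow>
   \<forall>y\<in>set x. symbols_below s y"
proof (induction c arbitrary: st)
  case (Seq c1 c2)
  from Seq.prems consider "x = (c1 ;; c2) # st" | "x \<in> stacks c1 (c2 # st)" | "x \<in> stacks c2 st"
    by auto
  then show ?case
  proof cases
    case 2
    then show ?thesis using Seq.IH(1)[of "c2 # st"] Seq.prems by simp
  next
    case 3
    then show ?thesis using Seq.IH(2)[of st] Seq.prems by simp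
  qed (use Seq.prems in simp)
next
  case (Cond k P c1 c2)
  from Cond.prems consider "x = Cond k P c1 c2 # st" | "x \<in> stacks c1 st" | "x \<in> stacks c2 st"
    by auto
  then show ?case
  proof cases
    case 1
    then show ?thesis using Cond.prems by simp
  next
    case 2
    then show ?thesis using Cond.IH(1)[of st] Cond.prems by simp
  next
    case 3
    then show ?thesis using Cond.IH(2)[of st] Cond.prems by simp
  qed
next
  case (Loop k P c)
  from Loop.prems consider "x = Loop k P c # st" | "x \<in> stacks c (Loop k P c # st)" by auto
  then show ?case
  proof cases
    case 2
    then show ?thesis using Loop.IH[of "Loop k P c # st"] Loop.prems by simp
  qed (use Loop.prems in simp)
qed simp

lemma act_tape_stay: "act_tape (read_tape t, Stay) t = t"
  by (cases t) auto

text \<open>The continuation \<open>st\<close> is arbitrary because the induction meets the first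
  half of a sequence on top of the second, and a loop body on top of its loop.\<close>

lemma exec_stack_step:
  "exec c \<sigma> n \<sigma>' \<Longrightarrow> \<exists>t\<le>n. (stack_step ^^ t) (c # st, \<sigma>) = (st, \<sigma>')"
proof (induction arbitrary: st rule: exec.induct)
  case (Act ks F \<sigma>)
  show ?case
    by (rule exI[of _ 1]) (auto simp: act_on_def fun_eq_iff act_tape_stay)
next
  case (Seq c1 \<sigma> n \<sigma>1 c2 n' \<sigma>2)
  obtain t1 where t1: "t1 \<le> n" "(stack_step ^^ t1) (c1 # c2 # st, \<sigma>) = (c2 # st, \<sigma>1)"
    using Seq.IH(1) by blast
  obtain t2 where t2: "t2 \<le> n'" "(stack_step ^^ t2) (c2 # st, \<sigma>1) = (st, \<sigma>2)"
    using Seq.IH(2) by blast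
  have "stack_step ((c1 ;; c2) # st, \<sigma>) = (c1 # c2 # st, \<sigma>)"
    by (simp add: act_tape_stay)
  then have "(stack_step ^^ (t2 + t1 + 1)) ((c1 ;; c2) # st, \<sigma>) = (st, \<sigma>2)"
    using t1 t2 by (simp add: funpow_add funpow_swap1 del: stack_step.simps)
  then show ?case using t1(1) t2(1) by (intro exI[of _ "t2 + t1 + 1"]) auto
next
  case (CondT P \<sigma> k c1 n \<sigma>1 c2)
  obtain t1 where t1: "t1 \<le> n" "(stack_step ^^ t1) (c1 # st, \<sigma>) = (st, \<sigma>1)"
    using CondT.IH by blast
  have "stack_step (Cond k P c1 c2 # st, \<sigma>) = (c1 # st, \<sigma>)"
    using CondT.hyps by (simp add: act_tape_stay)
  then have "(stack_step ^^ (t1 + 1)) (Cond k P c1 c2 # st, \<sigma>) = (st, \<sigma>1)"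
    using t1 by (simp add: funpow_add funpow_swap1 del: stack_step.simps)
  then show ?case using t1(1) by (intro exI[of _ "t1 + 1"]) auto
next
  case (CondF P \<sigma> k c2 n \<sigma>1 c1)
  obtain t1 where t1: "t1 \<le> n" "(stack_step ^^ t1) (c2 # st, \<sigma>) = (st, \<sigma>1)"
    using CondF.IH by blast
  have "stack_step (Cond k P c1 c2 # st, \<sigma>) = (c2 # st, \<sigma>)"
    using CondF.hyps by (simp add: act_tape_stay)
  then have "(stack_step ^^ (t1 + 1)) (Cond k P c1 c2 # st, \<sigma>) = (st, \<sigma>1)"
    using t1 by (simp add: funpow_add funpow_swap1 del: stack_step.simps)
  then show ?case using t1(1) by (intro exI[of _ "t1 + 1"]) auto
next
  case (LoopT P \<sigma> k c n \<sigma>1 n' \<sigma>2)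
  obtain t1 where t1: "t1 \<le> n"
      "(stack_step ^^ t1) (c # Loop k P c # st, \<sigma>) = (Loop k P c # st, \<sigma>1)"
    using LoopT.IH(1) by blast
  obtain t2 where t2: "t2 \<le> n'" "(stack_step ^^ t2) (Loop k P c # st, \<sigma>1) = (st, \<sigma>2)"
    using LoopT.IH(2) by blast
  have "stack_step (Loop k P c # st, \<sigma>) = (c # Loop k P c # st, \<sigma>)"
    using LoopT.hyps by (simp add: act_tape_stay)
  then have "(stack_step ^^ (t2 + t1 + 1)) (Loop k P c # st, \<sigma>) = (st, \<sigma>2)"
    using t1 t2 by (simp add: funpow_add funpow_swap1 del: stack_step.simps)
  then show ?case using t1(1) t2(1) by (intro exI[of _ "t2 + t1 + 1"]) auto
next
  case (LoopF P \<sigma> k c)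
  then show ?case by (intro exI[of _ 1]) (simp add: act_tape_stay)
next
  case (Weaken c \<sigma> n \<sigma>1 n')
  then show ?case using le_trans by blast
qed

text \<open>A store has infinitely many tapes but a machine has finitely many; control and actions
  depend only on the tapes that the pending commands mention.\<close>

lemma next_stack_cong:
  "\<forall>i\<in>\<Union>(tapes ` set st). r i = r' i \<Longrightarrow> next_stack st r = next_stack st r'"
  by (induction st r rule: next_stack.induct) auto

lemma stack_act_cong:
  assumes "\<forall>i\<in>\<Union>(tapes ` set st). r i = r' i" "r k = r' k"
  shows "stack_act st r k = stack_act st r' k"
proof (cases "\<exists>ks F st'. st = Act ks F # st'")
  case True
  then obtain ks F st' where st: "st = Act ks F # st'" by blast
  have "(\<lambda>i. if i \<in> set ks then r i else 0) = (\<lambda>i. if i \<in> set ks then r' i else 0)"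
    using assms(1) st by auto
  then show ?thesis using assms(2) st by simp
next
  case False
  then have "stack_act st r k = (r k, Stay)" for r
    by (induction st r k rule: stack_act.induct) auto
  then show ?thesis using assms(2) by simp
qed

lemma stack_act_symbols_below:
  assumes "\<forall>y\<in>set st. symbols_below s y" "\<forall>i. r i < s"
  shows "fst (stack_act st r k) < s"
proof (cases "\<exists>ks F st'. st = Act ks F # st'")
  case True
  then obtain ks F st' where st: "st = Act ks F # st'" by blast
  have "\<forall>i. (if i \<in> set ks then r i else 0) < s"
    using assms(2) by (metis less_nat_zero_code neq0_conv)
  then show ?thesis using assms st by simp
next
  case False
  then have "stack_act st r k = (r k, Stay)"
    by (induction st r k rule: stack_act.induct) auto
  then show ?thesis using assms(2) by simp
qed

definition init_store :: "nat list \<Rightarrow> store" where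
  "init_store w =
     (\<lambda>k. if k = 0 then (\<lambda>i. if 0 \<le> i \<and> i < int (length w) then w ! nat i else 0, 0)
          else (\<lambda>_. 0, 0))"

text \<open>The verdict is a symbol on tape \<open>ans\<close>. The empty stack is a state of its
  own, from which one more step leads to acceptance or rejection; this is the extra 1 in the time
  bound.\<close>

lemma tm_of_com:
  assumes s: "4 \<le> s" "symbols_below s c"
  obtains M where "turing_machine M"
    "\<And>w n \<sigma>. exec c (init_store w) n \<sigma> \<Longrightarrow>
       \<exists>t\<le>n + 1. tm_state_after M w t = (if read_tape (\<sigma> ans) = 1 then 1 else 2)"
proof -
  define K where "K = Suc (Max (insert ans (tapes c)))"
  have K: "ans < K" "\<And>k. k \<in> tapes c \<Longrightarrow> k < K"
    unfolding K_def using finite_tapes[of c] by (auto simp: less_Suc_eq_le)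
  define Q where "Q = insert [] (stacks c [])"
  have finQ: "finite Q" unfolding Q_def using finite_stacks by auto
  obtain h :: "com list \<Rightarrow> nat" where h: "inj_on h Q"
    using finite_imp_inj_to_nat_seg[OF finQ] by blast
  \<comment> \<open>The stack \<open>[c]\<close> must be the initial state 0, and the shift by 3
    keeps the halting states 1 and 2 free.\<close>
  define code where "code st = (if st = [c] then 0 else h st + 3)" for st
  have inj: "inj_on code Q"
    using h unfolding code_def inj_on_def by auto
  have code12: "code st \<noteq> 1" "code st \<noteq> 2" for st unfolding code_def by auto
  define dec where "dec = inv_into Q code"
  have dec: "dec (code st) = st" if "st \<in> Q" for st
    unfolding dec_def using inj that by (rule inv_into_f_f)
  define R where "R ss = (\<lambda>i. if i < K then ss ! i else 0)" for ss :: "nat list"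
  \<comment> \<open>Numbers that code no stack are never reached; their transition only has to be
    well-formed.\<close>
  define \<delta> where "\<delta> q ss =
     (if q \<in> code ` Q then
        (if dec q = [] then (if ss ! ans = 1 then 1 else 2) else code (next_stack (dec q) (R ss)),
         map (stack_act (dec q) (R ss)) [0..<K])
      else (1, map (\<lambda>k. (R ss k, Stay)) [0..<K]))" for q ss
  define B where "B = Max (insert 3 (code ` Q))"
  have B: "3 \<le> B" "\<And>st. st \<in> Q \<Longrightarrow> code st \<le> B"
    unfolding B_def by (rule Max_ge; use finQ in auto)+
  define M where "M = \<lparr>tm_tapes = K, tm_symbols = s, tm_states = Suc B, tm_delta = \<delta>\<rparr>"
  have Qtapes: "\<Union>(tapes ` set st) \<subseteq> {..<K}" if "st \<in> Q" for st
    using that stacks_tapes[of st c "[]"] K unfolding Q_def by auto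
  have Qsym: "\<forall>y\<in>set st. symbols_below s y" if "st \<in> Q" for st
    using that stacks_symbols_below[of st c "[]" s] s unfolding Q_def by auto
  have Qnext: "next_stack st r \<in> Q" if "st \<in> Q" for st r
    using that next_stack_in_stacks[of st c "[]" r] unfolding Q_def by auto
  have M_tm: "turing_machine M"
    unfolding turing_machine_def
  proof (intro conjI allI impI)
    show "1 \<le> tm_tapes M" "4 \<le> tm_symbols M" "3 \<le> tm_states M"
      using s B(1) by (simp_all add: M_def K_def)
    fix q ss assume A: "q < tm_states M \<and> length ss = tm_tapes M \<and> set ss \<subseteq> {..<tm_symbols M}"
    have R: "R ss i < s" for i
      using A s(1) unfolding R_def M_def by (auto simp: subset_iff)
    have q': "fst (\<delta> q ss) < tm_states M"
      using Qnext dec B by (auto simp: \<delta>_def M_def less_Suc_eq_le)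
    have "fst ` set (snd (\<delta> q ss)) \<subseteq> {..<s}"
    proof (cases "q \<in> code ` Q")
      case True
      then have "fst (stack_act (dec q) (R ss) k) < s" for k
        using R dec by (intro stack_act_symbols_below) (auto intro: Qsym[rule_format])
      then show ?thesis using True by (auto simp: \<delta>_def)
    next
      case False
      then show ?thesis using R by (auto simp: \<delta>_def)
    qed
    then show "case tm_delta M q ss of (q', acts) \<Rightarrow> q' < tm_states M \<and>
        length acts = tm_tapes M \<and> fst ` set acts \<subseteq> {..<tm_symbols M}"
      using q' by (auto simp: M_def \<delta>_def split: if_splits prod.splits)
  qed
  have step: "tm_step M (code st, map \<sigma> [0..<K]) =
      (code (fst (stack_step (st, \<sigma>))), map (snd (stack_step (st, \<sigma>))) [0..<K])"
    if st: "st \<in> Q" "st \<noteq> []" for st \<sigma>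
  proof -
    let ?r = "\<lambda>i. read_tape (\<sigma> i)" and ?r' = "R (map read_tape (map \<sigma> [0..<K]))"
    have eq: "?r' i = ?r i" if "i < K" for i using that by (simp add: R_def)
    have e1: "next_stack st ?r' = next_stack st ?r"
      using Qtapes[OF st(1)] eq by (intro next_stack_cong) auto
    have e2: "stack_act st ?r' k = stack_act st ?r k" if "k < K" for k
      using Qtapes[OF st(1)] eq that by (intro stack_act_cong) auto
    have "\<delta> (code st) (map read_tape (map \<sigma> [0..<K])) =
        (code (next_stack st ?r), map (stack_act st ?r) [0..<K])"
      using st e1 e2 dec by (simp add: \<delta>_def)
    then show ?thesis
      using code12 by (simp add: M_def map2_map_map)
  qed
  have steps: "(tm_step M ^^ t) (code st, map \<sigma> [0..<K]) =
      (code (fst ((stack_step ^^ t) (st, \<sigma>))), map (snd ((stack_step ^^ t) (st, \<sigma>))) [0..<K])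
      \<and> fst ((stack_step ^^ t) (st, \<sigma>)) \<in> Q"
    if "st \<in> Q" "\<forall>t'<t. fst ((stack_step ^^ t') (st, \<sigma>)) \<noteq> []" for st \<sigma> t
    using that
  proof (induction t)
    case (Suc t)
    obtain st' \<sigma>' where e: "(stack_step ^^ t) (st, \<sigma>) = (st', \<sigma>')" by fastforce
    have "st' \<noteq> []" using Suc.prems(2) e by (metis fst_conv lessI)
    then show ?case using Suc step[of st' \<sigma>'] e Qnext by simp
  qed auto
  have main: "\<exists>t\<le>n + 1. tm_state_after M w t = (if read_tape (\<sigma> ans) = 1 then 1 else 2)"
    if ex: "exec c (init_store w) n \<sigma>" for w n \<sigma>
  proof -
    let ?S = "\<lambda>t. (stack_step ^^ t) ([c], init_store w)"
    obtain t0 where t0: "t0 \<le> n" "?S t0 = ([], \<sigma>)"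
      using exec_stack_step[OF ex, of "[]"] by blast
    \<comment> \<open>\<open>steps\<close> requires nonempty stacks up to the moment considered, so
      the first time with an empty stack is taken. The empty stack is a fixed point, hence the store
      is the same as at \<open>t0\<close>.\<close>
    define t where "t = (LEAST t. fst (?S t) = [])"
    have t: "fst (?S t) = []" unfolding t_def by (rule LeastI[of _ t0]) (simp add: t0)
    have tle: "t \<le> t0" unfolding t_def by (rule Least_le) (simp add: t0)
    have stay: "stack_step ([], \<sigma>') = ([], \<sigma>')" for \<sigma>' by (simp add: act_tape_stay)
    have stay': "(stack_step ^^ j) ([], \<sigma>') = ([], \<sigma>')" for \<sigma>' j
      by (induction j) (simp_all add: stay del: stack_step.simps)
    obtain \<sigma>' where \<sigma>': "?S t = ([], \<sigma>')" using t by (metis prod.collapse)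
    have "?S t0 = (stack_step ^^ (t0 - t)) (?S t)"
      using tle by (metis comp_apply funpow_add le_add_diff_inverse2)
    then have "?S t0 = ([], \<sigma>')" using stay' \<sigma>' by simp
    then have St: "?S t = ([], \<sigma>)" using t0 \<sigma>' by simp
    have init: "tm_init M w = (code [c], map (init_store w) [0..<K])"
    proof -
      have "[0..<K] = 0 # [1..<K]" using K(1) by (simp add: upt_rec)
      moreover have "map (init_store w) [1..<K] = replicate (K - 1) (\<lambda>_. 0, 0)"
        by (rule nth_equalityI) (auto simp: init_store_def)
      ultimately show ?thesis by (simp add: tm_init_def code_def M_def init_store_def)
    qed
    have cQ: "[c] \<in> Q" unfolding Q_def using stacks_self[of c "[]"] by simp
    have "\<forall>t'<t. fst (?S t') \<noteq> []" unfolding t_def using not_less_Least by blast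
    then have reach: "(tm_step M ^^ t) (tm_init M w) = (code [], map \<sigma> [0..<K])"
      using steps[OF cQ, of t "init_store w"] St init by simp
    have "fst (tm_step M (code [], map \<sigma> [0..<K])) = (if read_tape (\<sigma> ans) = 1 then 1 else 2)"
      using K(1) dec[of "[]"] code12 by (simp add: M_def \<delta>_def Q_def)
    then have "tm_state_after M w (Suc t) = (if read_tape (\<sigma> ans) = 1 then 1 else 2)"
      by (simp add: tm_state_after_def reach)
    then show ?thesis using tle t0(1) by (intro exI[of _ "Suc t"]) auto
  qed
  show ?thesis by (rule that[OF M_tm]) (rule main)
qed

section \<open>Polynomial bounds\<close>

definition polyb :: "(nat \<Rightarrow> nat) \<Rightarrow> bool" where
  "polyb T \<longleftrightarrow> (\<exists>C. \<forall>S. T S \<le> (S + 2) ^ C)"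

lemma polybI: "(\<And>S. T S \<le> (S + 2) ^ C) \<Longrightarrow> polyb T"
  unfolding polyb_def by blast

text \<open>The base \<open>S + 2\<close> is at least 2, so constants are absorbed by the exponent;
  the same helps with sums.\<close>

lemma polyb_const: "polyb (\<lambda>_. k)"
proof (rule polybI)
  fix S
  have "k \<le> 2 ^ k" by (simp add: less_imp_le)
  also have "\<dots> \<le> (S + 2) ^ k" by (rule power_mono) auto
  finally show "k \<le> (S + 2) ^ k" .
qed

lemma polyb_id: "polyb (\<lambda>S. S)"
  by (rule polybI[of _ 1]) simp

lemma polyb_mult:
  assumes "polyb f" "polyb g" shows "polyb (\<lambda>S. f S * g S)"
proof -
  obtain a b where "\<And>S. f S \<le> (S + 2) ^ a" "\<And>S. g S \<le> (S + 2) ^ b"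
    using assms unfolding polyb_def by blast
  then show ?thesis by (intro polybI[of _ "a + b"]) (simp add: power_add mult_mono)
qed

lemma polyb_add:
  assumes "polyb f" "polyb g" shows "polyb (\<lambda>S. f S + g S)"
proof -
  obtain a b where ab: "\<And>S. f S \<le> (S + 2) ^ a" "\<And>S. g S \<le> (S + 2) ^ b"
    using assms unfolding polyb_def by blast
  show ?thesis
  proof (rule polybI[of _ "a + b + 1"])
    fix S :: nat
    have "f S + g S \<le> (S + 2) ^ (a + b) + (S + 2) ^ (a + b)"
      using order_trans[OF ab(1) power_increasing[of a "a + b" "S + 2"]]
        order_trans[OF ab(2) power_increasing[of b "a + b" "S + 2"]] by (intro add_mono) auto
    also have "\<dots> = 2 * (S + 2) ^ (a + b)" by simp
    also have "\<dots> \<le> (S + 2) * (S + 2) ^ (a + b)" by (intro mult_right_mono) auto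
    finally show "f S + g S \<le> (S + 2) ^ (a + b + 1)" by simp
  qed
qed

lemma polyb_comp:
  assumes "polyb f" "polyb g" shows "polyb (\<lambda>S. f (g S))"
proof -
  obtain a where a: "\<And>S. f S \<le> (S + 2) ^ a" using assms(1) unfolding polyb_def by blast
  have "polyb (\<lambda>S. g S + 2)" by (rule polyb_add[OF assms(2) polyb_const])
  then obtain b where b: "\<And>S. g S + 2 \<le> (S + 2) ^ b" unfolding polyb_def by blast
  show ?thesis
  proof (rule polybI[of _ "b * a"])
    fix S
    have "f (g S) \<le> (g S + 2) ^ a" by (rule a)
    also have "\<dots> \<le> ((S + 2) ^ b) ^ a" by (rule power_mono[OF b]) simp
    finally show "f (g S) \<le> (S + 2) ^ (b * a)" by (simp add: power_mult)
  qed
qed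

lemma polyb_power: "polyb f \<Longrightarrow> polyb (\<lambda>S. f S ^ n)"
  by (induction n) (auto intro: polyb_const polyb_mult)

lemmas polyb_intros = polyb_const polyb_id polyb_add polyb_mult polyb_power

subsection \<open>Counters and arrays\<close>

text \<open>A unary block with the head on its last mark, above a blank cell 0: testing for zero is
  reading one symbol, and \<open>cn 0\<close> is a blank tape.\<close>

definition cn :: "nat \<Rightarrow> tape" where
  "cn n = (\<lambda>i. if 1 \<le> i \<and> i \<le> int n then 1 else 0, int n)"

definition ar_at :: "(nat \<Rightarrow> nat) \<Rightarrow> nat \<Rightarrow> tape" where
  "ar_at w p = (\<lambda>i. if i < 0 then 0 else w (nat i), int p)"

abbreviation ar :: "(nat \<Rightarrow> nat) \<Rightarrow> tape" where "ar w \<equiv> ar_at w 0"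

lemma read_cn: "read_tape (cn n) = (if n = 0 then 0 else 1)"
  by (simp add: cn_def)

lemma read_ar_at: "read_tape (ar_at w p) = w p"
  by (simp add: ar_at_def)

definition skip :: com where "skip = Act [] (\<lambda>_ _. (0, Stay))"
definition mv :: "nat \<Rightarrow> direction \<Rightarrow> com" where "mv k dir = Act [k] (\<lambda>r _. (r k, dir))"
definition wr :: "nat \<Rightarrow> nat \<Rightarrow> com" where "wr k s = Act [k] (\<lambda>_ _. (s, Stay))"
definition inc :: "nat \<Rightarrow> com" where "inc k = mv k Go_Right ;; wr k 1"
definition dec :: "nat \<Rightarrow> com" where "dec k = Act [k] (\<lambda>_ _. (0, Go_Left))"
definition nonzero :: "nat \<Rightarrow> bool" where "nonzero s \<longleftrightarrow> s \<noteq> 0"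
definition times :: "nat \<Rightarrow> com \<Rightarrow> com" where "times k c = Loop k nonzero (dec k ;; c)"

lemma exec_SeqI:
  "exec c1 \<sigma> n \<sigma>1 \<Longrightarrow> exec c2 \<sigma>1 n' \<sigma>2 \<Longrightarrow> n + n' + 1 \<le> N \<Longrightarrow> exec (c1 ;; c2) \<sigma> N \<sigma>2"
  using exec.Seq exec.Weaken by blast

lemma act_on_single: "act_on [k] (\<lambda>r _. f (r k)) \<sigma> = \<sigma>(k := act_tape (f (read_tape (\<sigma> k))) (\<sigma> k))"
  by (auto simp: act_on_def fun_eq_iff)

lemma exec_skip: "exec skip \<sigma> 1 \<sigma>"
  using exec.Act[of "[]" _ \<sigma>] by (simp add: skip_def act_on_def)

lemma exec_mv: "exec (mv k dir) \<sigma> 1 (\<sigma>(k := (fst (\<sigma> k), snd (\<sigma> k) + head_shift dir)))"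
  using exec.Act[of "[k]" "\<lambda>r _. (r k, dir)" \<sigma>]
  unfolding mv_def act_on_single[of k "\<lambda>s. (s, dir)"]
  by (cases "\<sigma> k") simp

lemma exec_wr: "exec (wr k s) \<sigma> 1 (\<sigma>(k := ((fst (\<sigma> k))(snd (\<sigma> k) := s), snd (\<sigma> k))))"
  using exec.Act[of "[k]" "\<lambda>_ _. (s, Stay)" \<sigma>]
  unfolding wr_def act_on_single[of k "\<lambda>_. (s, Stay)"]
  by (cases "\<sigma> k") simp

lemma exec_inc:
  assumes "\<sigma> k = cn n" shows "exec (inc k) \<sigma> 3 (\<sigma>(k := cn (Suc n)))"
proof -
  let ?\<sigma> = "\<sigma>(k := (fst (\<sigma> k), snd (\<sigma> k) + head_shift Go_Right))"
  have "?\<sigma>(k := ((fst (?\<sigma> k))(snd (?\<sigma> k) := 1), snd (?\<sigma> k))) = \<sigma>(k := cn (Suc n))"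
    using assms by (auto simp: cn_def fun_eq_iff)
  moreover have "exec (inc k) \<sigma> 3 (?\<sigma>(k := ((fst (?\<sigma> k))(snd (?\<sigma> k) := 1), snd (?\<sigma> k))))"
    unfolding inc_def by (rule exec_SeqI[OF exec_mv exec_wr]) simp
  ultimately show ?thesis by simp
qed

lemma exec_dec:
  assumes "\<sigma> k = cn (Suc n)" shows "exec (dec k) \<sigma> 1 (\<sigma>(k := cn n))"
proof -
  have "act_tape (0, Go_Left) (cn (Suc n)) = cn n"
    by (auto simp: cn_def fun_eq_iff)
  then show ?thesis using exec.Act[of "[k]" "\<lambda>_ _. (0, Go_Left)" \<sigma>] assms
    unfolding dec_def act_on_single[of k "\<lambda>_. (0, Go_Left)"] by simp
qed

lemma exec_mv_right:
  assumes "\<sigma> a = ar_at w p" shows "exec (mv a Go_Right) \<sigma> 1 (\<sigma>(a := ar_at w (Suc p)))"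
  using exec_mv[of a Go_Right \<sigma>] assms by (simp add: ar_at_def add.commute)

lemma exec_mv_left:
  assumes "\<sigma> a = ar_at w (Suc p)" shows "exec (mv a Go_Left) \<sigma> 1 (\<sigma>(a := ar_at w p))"
  using exec_mv[of a Go_Left \<sigma>] assms by (simp add: ar_at_def)

lemma exec_wr_ar:
  assumes "\<sigma> a = ar_at w p" shows "exec (wr a s) \<sigma> 1 (\<sigma>(a := ar_at (w(p := s)) p))"
proof -
  have "((fst (\<sigma> a))(snd (\<sigma> a) := s), snd (\<sigma> a)) = ar_at (w(p := s)) p"
    using assms by (auto simp: ar_at_def fun_eq_iff)
  then show ?thesis using exec_wr[of a s \<sigma>] by simp
qed

text \<open>The family \<open>S\<close> is indexed by the number of rounds left, so the loop runs
  from \<open>S n\<close> to \<open>S 0\<close>; the body starts after the counter has been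
  decremented.\<close>

lemma exec_times:
  assumes "\<And>i. i \<le> n \<Longrightarrow> S i k = cn i"
    and "\<And>i. i < n \<Longrightarrow> exec c ((S (Suc i))(k := cn i)) T (S i)"
  shows "exec (times k c) (S n) (n * (T + 3) + 1) (S 0)"
  using assms
proof (induction n)
  case 0
  then have "S 0 k = cn 0" by simp
  then show ?case unfolding times_def
    using exec.LoopF[of nonzero "S 0" k] by (simp add: read_cn nonzero_def)
next
  case (Suc n)
  have k: "S (Suc n) k = cn (Suc n)" using Suc.prems(1) by simp
  have "exec (dec k ;; c) (S (Suc n)) (T + 2) (S n)"
    by (rule exec_SeqI[OF exec_dec[of "S (Suc n)" k n, OF k] Suc.prems(2)[of n]]) auto
  moreover have "exec (times k c) (S n) (n * (T + 3) + 1) (S 0)"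
    using Suc by simp
  moreover have "nonzero (read_tape (S (Suc n) k))" using k by (simp add: read_cn nonzero_def)
  ultimately have "exec (times k c) (S (Suc n)) (T + 2 + (n * (T + 3) + 1) + 1) (S 0)"
    unfolding times_def by (intro exec.LoopT)
  then show ?case by (rule exec.Weaken) simp
qed

definition addto :: "nat \<Rightarrow> nat \<Rightarrow> com" where "addto k j = times k (inc j)"
definition clear :: "nat \<Rightarrow> com" where "clear k = times k skip"
text \<open>Reading a unary counter destroys it; the value is moved to the target and to a scratch
  counter at once and then restored from there.\<close>

definition copy :: "nat \<Rightarrow> nat \<Rightarrow> nat \<Rightarrow> com" where
  "copy k j t = times k (inc j ;; inc t) ;; addto t k"
definition dec_pos :: "nat \<Rightarrow> com" where "dec_pos k = Cond k nonzero (dec k) skip"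
definition subfrom :: "nat \<Rightarrow> nat \<Rightarrow> com" where "subfrom k j = times k (dec_pos j)"
definition moveto_capped :: "nat \<Rightarrow> nat \<Rightarrow> nat \<Rightarrow> com" where
  "moveto_capped k cap j = times k (Cond cap nonzero (dec cap ;; inc j) skip) ;; clear cap"

lemma exec_addto:
  assumes "\<sigma> k = cn x" "\<sigma> j = cn y" "k \<noteq> j"
  shows "exec (addto k j) \<sigma> (6 * x + 1) (\<sigma>(k := cn 0, j := cn (x + y)))"
proof -
  let ?S = "\<lambda>i. \<sigma>(k := cn i, j := cn (x - i + y))"
  have "exec (times k (inc j)) (?S x) (x * (3 + 3) + 1) (?S 0)"
  proof (rule exec_times)
    fix i assume "i < x"
    then have "(?S (Suc i))(k := cn i, j := cn (Suc (x - Suc i + y))) = ?S i"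
      using assms by (auto simp: fun_eq_iff Suc_diff_Suc)
    then show "exec (inc j) ((?S (Suc i))(k := cn i)) 3 (?S i)"
      using exec_inc[of "(?S (Suc i))(k := cn i)" j "x - Suc i + y"] assms by simp
  qed (use assms in auto)
  moreover have "?S x = \<sigma>" using assms by (auto simp: fun_eq_iff)
  ultimately show ?thesis by (simp add: addto_def algebra_simps)
qed

lemma exec_clear:
  assumes "\<sigma> k = cn x" shows "exec (clear k) \<sigma> (4 * x + 1) (\<sigma>(k := cn 0))"
proof -
  let ?S = "\<lambda>i. \<sigma>(k := cn i)"
  have "exec (times k skip) (?S x) (x * (1 + 3) + 1) (?S 0)"
  proof (rule exec_times)
    fix i
    show "exec skip ((?S (Suc i))(k := cn i)) 1 (?S i)" using exec_skip[of "?S i"] by simp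
  qed auto
  moreover have "?S x = \<sigma>" using assms by auto
  ultimately show ?thesis by (simp add: clear_def algebra_simps)
qed

lemma exec_copy:
  assumes "\<sigma> k = cn x" "\<sigma> j = cn y" "\<sigma> t = cn 0" "k \<noteq> j" "k \<noteq> t" "j \<noteq> t"
  shows "exec (copy k j t) \<sigma> (16 * x + 3) (\<sigma>(j := cn (x + y)))"
proof -
  let ?S = "\<lambda>i. \<sigma>(k := cn i, j := cn (x - i + y), t := cn (x - i))"
  have 1: "exec (times k (inc j ;; inc t)) (?S x) (x * (7 + 3) + 1) (?S 0)"
  proof (rule exec_times)
    fix i assume i: "i < x"
    let ?s = "(?S (Suc i))(k := cn i)"
    have "exec (inc j ;; inc t) ?s 7 (?s(j := cn (Suc (x - Suc i + y)), t := cn (Suc (x - Suc i))))"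
      by (rule exec_SeqI[OF exec_inc exec_inc]) (use assms in auto)
    moreover have "?s(j := cn (Suc (x - Suc i + y)), t := cn (Suc (x - Suc i))) = ?S i"
      using assms i by (auto simp: fun_eq_iff Suc_diff_Suc)
    ultimately show "exec (inc j ;; inc t) ?s 7 (?S i)" by simp
  qed (use assms in auto)
  have 2: "exec (addto t k) (?S 0) (6 * x + 1) ((?S 0)(t := cn 0, k := cn (x + 0)))"
    by (rule exec_addto) (use assms in auto)
  have 3: "?S x = \<sigma>" using assms by (auto simp: fun_eq_iff)
  have 4: "(?S 0)(t := cn 0, k := cn (x + 0)) = \<sigma>(j := cn (x + y))"
    using assms by (auto simp: fun_eq_iff)
  show ?thesis unfolding copy_def
    by (rule exec_SeqI[OF 1[unfolded 3] 2[unfolded 4]]) simp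
qed

lemma exec_dec_pos:
  assumes "\<sigma> k = cn x" shows "exec (dec_pos k) \<sigma> 2 (\<sigma>(k := cn (x - 1)))"
proof (cases x)
  case 0
  then have "\<sigma>(k := cn (x - 1)) = \<sigma>" using assms by auto
  then show ?thesis
    using exec.CondF[of nonzero \<sigma> k skip 1 \<sigma> "dec k"] assms 0 exec_skip
    by (simp add: dec_pos_def read_cn nonzero_def numeral_2_eq_2)
next
  case (Suc n)
  then show ?thesis
    using exec.CondT[of nonzero \<sigma> k "dec k" 1 _ skip] exec_dec[of \<sigma> k n] assms
    by (simp add: dec_pos_def read_cn nonzero_def numeral_2_eq_2)
qed

lemma exec_subfrom:
  assumes "\<sigma> k = cn x" "\<sigma> j = cn y" "k \<noteq> j"
  shows "exec (subfrom k j) \<sigma> (5 * x + 1) (\<sigma>(k := cn 0, j := cn (y - x)))"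
proof -
  let ?S = "\<lambda>i. \<sigma>(k := cn i, j := cn (y - (x - i)))"
  have "exec (times k (dec_pos j)) (?S x) (x * (2 + 3) + 1) (?S 0)"
  proof (rule exec_times)
    fix i assume i: "i < x"
    let ?s = "(?S (Suc i))(k := cn i)"
    have "exec (dec_pos j) ?s 2 (?s(j := cn (y - (x - Suc i) - 1)))"
      by (rule exec_dec_pos) (use assms in auto)
    moreover have "?s(j := cn (y - (x - Suc i) - 1)) = ?S i"
    proof -
      have e: "y - (x - Suc i) - 1 = y - (x - i)" using i by simp
      show ?thesis unfolding e using assms by (simp add: fun_upd_twist)
    qed
    ultimately show "exec (dec_pos j) ?s 2 (?S i)" by simp
  qed (use assms in auto)
  moreover have "?S x = \<sigma>" using assms by (auto simp: fun_eq_iff)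
  ultimately show ?thesis by (simp add: subfrom_def algebra_simps)
qed

lemma exec_moveto_capped:
  assumes "\<sigma> k = cn x" "\<sigma> c = cn y" "\<sigma> j = cn 0" "k \<noteq> j" "k \<noteq> c" "c \<noteq> j"
  shows "exec (moveto_capped k c j) \<sigma> (9 * x + 4 * y + 3)
    (\<sigma>(k := cn 0, c := cn 0, j := cn (min x y)))"
proof -
  let ?S = "\<lambda>i. \<sigma>(k := cn i, c := cn (y - (x - i)), j := cn (min (x - i) y))"
  have 1: "exec (times k (Cond c nonzero (dec c ;; inc j) skip)) (?S x) (x * (6 + 3) + 1) (?S 0)"
  proof (rule exec_times)
    fix i assume i: "i < x"
    let ?s = "(?S (Suc i))(k := cn i)"
    show "exec (Cond c nonzero (dec c ;; inc j) skip) ?s 6 (?S i)"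
    proof (cases "y - (x - Suc i)")
      case 0
      then have "y - (x - i) = y - (x - Suc i)" "min (x - i) y = min (x - Suc i) y" by auto
      then have e: "?S i = ?s" using assms by (simp add: fun_upd_twist)
      have "exec (Cond c nonzero (dec c ;; inc j) skip) ?s (1 + 1) ?s"
        by (rule exec.CondF[OF _ exec_skip]) (use assms 0 in \<open>simp add: read_cn nonzero_def\<close>)
      then have "exec (Cond c nonzero (dec c ;; inc j) skip) ?s 6 ?s"
        by (rule exec.Weaken) simp
      then show ?thesis unfolding e .
    next
      case (Suc z)
      have "exec (dec c ;; inc j) ?s 5 (?s(c := cn z, j := cn (Suc (min (x - Suc i) y))))"
        by (rule exec_SeqI[OF exec_dec exec_inc]) (use assms Suc in auto)
      moreover have "?s(c := cn z, j := cn (Suc (min (x - Suc i) y))) = ?S i"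
      proof -
        have "y - (x - i) = z" "min (x - i) y = Suc (min (x - Suc i) y)" using Suc i by auto
        then show ?thesis using assms by (simp add: fun_upd_twist)
      qed
      ultimately have "exec (Cond c nonzero (dec c ;; inc j) skip) ?s (5 + 1) (?S i)"
        by (intro exec.CondT) (use assms Suc in \<open>auto simp: read_cn nonzero_def\<close>)
      then show ?thesis by simp
    qed
  qed (use assms in auto)
  have 2: "exec (clear c) (?S 0) (4 * (y - x) + 1) ((?S 0)(c := cn 0))"
    by (rule exec_clear) (use assms in auto)
  have 3: "?S x = \<sigma>" using assms by (auto simp: fun_eq_iff)
  have 4: "(?S 0)(c := cn 0) = \<sigma>(k := cn 0, c := cn 0, j := cn (min x y))"
    using assms by (auto simp: fun_eq_iff)
  show ?thesis unfolding moveto_capped_def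
    by (rule exec_SeqI[OF 1[unfolded 3] 2[unfolded 4]]) simp
qed

primrec incs :: "nat \<Rightarrow> nat \<Rightarrow> com" where
  "incs k 0 = skip" | "incs k (Suc n) = inc k ;; incs k n"

lemma exec_incs:
  "\<sigma> k = cn x \<Longrightarrow> exec (incs k n) \<sigma> (4 * n + 1) (\<sigma>(k := cn (x + n)))"
proof (induction n arbitrary: \<sigma> x)
  case 0
  then have "\<sigma>(k := cn x) = \<sigma>" by auto
  then show ?case using exec_skip by simp
next
  case (Suc n)
  let ?\<sigma> = "\<sigma>(k := cn (Suc x))"
  have 2: "exec (incs k n) ?\<sigma> (4 * n + 1) (\<sigma>(k := cn (x + Suc n)))"
    using Suc.IH[of ?\<sigma> "Suc x", OF fun_upd_same] by (simp del: fun_upd_apply)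
  have 1: "exec (inc k) \<sigma> 3 ?\<sigma>" by (rule exec_inc[of \<sigma> k x, OF Suc.prems])
  show ?case unfolding incs.simps by (rule exec_SeqI[OF 1 2]) simp
qed

primrec read_into :: "nat \<Rightarrow> nat \<Rightarrow> nat \<Rightarrow> com" where
  "read_into a k 0 = skip"
| "read_into a k (Suc s) = Cond a (\<lambda>x. x = Suc s) (incs k (Suc s)) (read_into a k s)"

lemma exec_read_into:
  "read_tape (\<sigma> a) \<le> s \<Longrightarrow> \<sigma> k = cn 0 \<Longrightarrow>
   exec (read_into a k s) \<sigma> (5 * s + 2) (\<sigma>(k := cn (read_tape (\<sigma> a))))"
proof (induction s)
  case 0
  then have "\<sigma>(k := cn (read_tape (\<sigma> a))) = \<sigma>" by auto
  then show ?case using exec.Weaken[OF exec_skip[of \<sigma>], of 2] by (simp add: numeral_2_eq_2)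
next
  case (Suc s)
  show ?case
  proof (cases "read_tape (\<sigma> a) = Suc s")
    case True
    have "exec (incs k (Suc s)) \<sigma> (4 * Suc s + 1) (\<sigma>(k := cn (0 + Suc s)))"
      using exec_incs[of \<sigma> k 0 "Suc s"] Suc.prems(2) by simp
    then have "exec (read_into a k (Suc s)) \<sigma> (4 * Suc s + 1 + 1) (\<sigma>(k := cn (0 + Suc s)))"
      unfolding read_into.simps by (rule exec.CondT[rotated]) (rule True)
    then show ?thesis unfolding True add_0 by (rule exec.Weaken) simp
  next
    case False
    then have "exec (read_into a k s) \<sigma> (5 * s + 2) (\<sigma>(k := cn (read_tape (\<sigma> a))))"
      using Suc.IH Suc.prems by (simp del: fun_upd_apply)
    then have "exec (read_into a k (Suc s)) \<sigma> (5 * s + 2 + 1) (\<sigma>(k := cn (read_tape (\<sigma> a))))"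
      unfolding read_into.simps by (rule exec.CondF[rotated]) (rule False)
    then show ?thesis by (rule exec.Weaken) simp
  qed
qed

section \<open>Expressions with polynomially bounded values\<close>

datatype exp =
    V nat
  | Num nat
  | Add exp exp
  | Sub exp exp
  | Sum exp exp
  | It exp exp exp exp
  | Lk nat exp
  | Call exp "exp list"

primrec iter :: "(nat \<Rightarrow> nat \<Rightarrow> nat) \<Rightarrow> nat \<Rightarrow> nat \<Rightarrow> nat" where
  "iter f a 0 = a" | "iter f a (Suc n) = f n (iter f a n)"

text \<open>Variables are levels: they count from the outermost entry, and binders append at the
  end. \<open>It\<close> truncates every intermediate value at \<open>cap\<close>, since free
  iteration could square its value in each round and leave the polynomial range. The body of a
  \<open>Call\<close> sees nothing but the arguments.\<close>

primrec eval :: "exp \<Rightarrow> (nat \<Rightarrow> nat \<Rightarrow> nat) \<Rightarrow> nat list \<Rightarrow> nat" where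
  "eval (V i) A \<rho> = \<rho> ! i"
| "eval (Num n) A \<rho> = n"
| "eval (Add a b) A \<rho> = eval a A \<rho> + eval b A \<rho>"
| "eval (Sub a b) A \<rho> = eval a A \<rho> - eval b A \<rho>"
| "eval (Sum a b) A \<rho> = (\<Sum>i<eval a A \<rho>. eval b A (\<rho> @ [i]))"
| "eval (It n a cap b) A \<rho> =
     iter (\<lambda>i x. min (eval b A (\<rho> @ [i, x])) (eval cap A \<rho>)) (eval a A \<rho>) (eval n A \<rho>)"
| "eval (Lk k a) A \<rho> = A k (eval a A \<rho>)"
| "eval (Call f es) A \<rho> = eval f A (map (\<lambda>e. eval e A \<rho>) es)"

primrec scoped :: "exp \<Rightarrow> nat \<Rightarrow> bool" where
  "scoped (V i) n \<longleftrightarrow> i < n"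
| "scoped (Num k) n \<longleftrightarrow> True"
| "scoped (Add a b) n \<longleftrightarrow> scoped a n \<and> scoped b n"
| "scoped (Sub a b) n \<longleftrightarrow> scoped a n \<and> scoped b n"
| "scoped (Sum a b) n \<longleftrightarrow> scoped a n \<and> scoped b (Suc n)"
| "scoped (It k a cap b) n \<longleftrightarrow> scoped k n \<and> scoped a n \<and> scoped cap n \<and> scoped b (Suc (Suc n))"
| "scoped (Lk k a) n \<longleftrightarrow> k < 2 \<and> scoped a n"
| "scoped (Call f es) n \<longleftrightarrow> scoped f (length es) \<and> list_all (\<lambda>e. scoped e n) es"

primrec eval_args_com :: "(nat \<Rightarrow> com) list \<Rightarrow> nat \<Rightarrow> com" where
  "eval_args_com [] d = skip"
| "eval_args_com (c # cs) d = c d ;; eval_args_com cs (Suc d)"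

primrec clears :: "nat \<Rightarrow> nat \<Rightarrow> com" where
  "clears k 0 = skip" | "clears k (Suc n) = clear k ;; clears (Suc k) n"

text \<open>
  Counter \<open>j\<close> is tape \<open>bs + j\<close>. The list \<open>\<eta>\<close> names the counters that hold the environment;
  the value of the expression is left in counter \<open>d\<close>, and the counters above \<open>d\<close> are scratch space.
\<close>

primrec eval_com :: "nat \<Rightarrow> exp \<Rightarrow> nat list \<Rightarrow> nat \<Rightarrow> com" where
  "eval_com bs (V i) \<eta> d = copy (bs + \<eta> ! i) (bs + d) (bs + d + 1)"
| "eval_com bs (Num n) \<eta> d = incs (bs + d) n"
| "eval_com bs (Add a b) \<eta> d =
     eval_com bs a \<eta> d ;; eval_com bs b \<eta> (d + 1) ;; addto (bs + d + 1) (bs + d)"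
| "eval_com bs (Sub a b) \<eta> d =
     eval_com bs a \<eta> d ;; eval_com bs b \<eta> (d + 1) ;; subfrom (bs + d + 1) (bs + d)"
| "eval_com bs (Sum a b) \<eta> d =
     eval_com bs a \<eta> (d + 1) ;;
     times (bs + d + 1)
       (eval_com bs b (\<eta> @ [d + 2]) (d + 3) ;; addto (bs + d + 3) (bs + d) ;; inc (bs + d + 2)) ;;
     clear (bs + d + 2)"
| "eval_com bs (It n a cap b) \<eta> d =
     eval_com bs a \<eta> d ;; eval_com bs n \<eta> (d + 1) ;;
     times (bs + d + 1)
       (eval_com bs b (\<eta> @ [d + 2, d]) (d + 3) ;; clear (bs + d) ;; eval_com bs cap \<eta> (d + 4) ;;
        moveto_capped (bs + d + 3) (bs + d + 4) (bs + d) ;; inc (bs + d + 2)) ;;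
     clear (bs + d + 2)"
| "eval_com bs (Lk k a) \<eta> d =
     eval_com bs a \<eta> (d + 1) ;;
     times (bs + d + 1) (mv k Go_Right ;; inc (bs + d + 2)) ;;
     read_into k (bs + d) 3 ;;
     times (bs + d + 2) (mv k Go_Left)"
| "eval_com bs (Call f es) \<eta> d =
     eval_args_com (map (\<lambda>e. eval_com bs e \<eta>) es) (d + 1) ;;
     eval_com bs f [d + 1..<d + 1 + length es] (d + 1 + length es) ;;
     addto (bs + d + 1 + length es) (bs + d) ;;
     clears (bs + d + 1) (length es)"

definition frame :: "nat \<Rightarrow> (nat \<Rightarrow> nat \<Rightarrow> nat) \<Rightarrow> nat list \<Rightarrow> nat list \<Rightarrow> nat \<Rightarrow> store \<Rightarrow> bool" where
  "frame bs A \<eta> \<rho> d \<sigma> \<longleftrightarrow>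
     2 \<le> bs \<and> length \<eta> = length \<rho> \<and> (\<forall>j<length \<rho>. \<eta> ! j < d \<and> \<sigma> (bs + \<eta> ! j) = cn (\<rho> ! j)) \<and>
     (\<forall>j\<ge>d. \<sigma> (bs + j) = cn 0) \<and> (\<forall>a<2. \<sigma> a = ar (A a) \<and> (\<forall>i. A a i \<le> 3))"

text \<open>One polynomial bounds both value and time, uniformly in the tape layout and the arrays,
  in terms of the largest entry of the environment. Bounding the value is what allows results to
  enter the environment of further expressions.\<close>

definition computes :: "exp \<Rightarrow> (nat \<Rightarrow> nat) \<Rightarrow> bool" where
  "computes e T \<longleftrightarrow> polyb T \<and>
     (\<forall>bs A \<eta> \<rho> d \<sigma> S. scoped e (length \<rho>) \<and> frame bs A \<eta> \<rho> d \<sigma> \<and> (\<forall>x\<in>set \<rho>. x \<le> S) \<longrightarrow>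
        eval e A \<rho> \<le> T S \<and> exec (eval_com bs e \<eta> d) \<sigma> (T S) (\<sigma>(bs + d := cn (eval e A \<rho>))))"

lemma computesD:
  assumes "computes e T" "scoped e (length \<rho>)" "frame bs A \<eta> \<rho> d \<sigma>" "\<forall>x\<in>set \<rho>. x \<le> S"
  shows "eval e A \<rho> \<le> T S" "exec (eval_com bs e \<eta> d) \<sigma> (T S) (\<sigma>(bs + d := cn (eval e A \<rho>)))"
  using assms unfolding computes_def by blast+

lemma computesI:
  assumes "polyb T"
    and "\<And>bs A \<eta> \<rho> d \<sigma> S. scoped e (length \<rho>) \<Longrightarrow> frame bs A \<eta> \<rho> d \<sigma> \<Longrightarrow> \<forall>x\<in>set \<rho>. x \<le> S \<Longrightarrow>
      eval e A \<rho> \<le> T S \<and> exec (eval_com bs e \<eta> d) \<sigma> (T S) (\<sigma>(bs + d := cn (eval e A \<rho>)))"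
  shows "computes e T"
  using assms unfolding computes_def by blast

lemma frame_upd: "frame bs A \<eta> \<rho> d \<sigma> \<Longrightarrow> d \<le> j \<Longrightarrow> j < d' \<Longrightarrow> frame bs A \<eta> \<rho> d' (\<sigma>(bs + j := t))"
  unfolding frame_def by (auto simp: less_le_trans)

lemma frame_mono: "frame bs A \<eta> \<rho> d \<sigma> \<Longrightarrow> d \<le> d' \<Longrightarrow> frame bs A \<eta> \<rho> d' \<sigma>"
  unfolding frame_def by (auto simp: less_le_trans)

lemma frame_zero: "frame bs A \<eta> \<rho> d \<sigma> \<Longrightarrow> bs + d \<le> j \<Longrightarrow> \<sigma> j = cn 0"
  unfolding frame_def by (metis add_le_cancel_left le_add_diff_inverse le_trans le_add1)

lemma frame_snoc:
  "frame bs A \<eta> \<rho> d \<sigma> \<Longrightarrow> j < d \<Longrightarrow> \<sigma> (bs + j) = cn x \<Longrightarrow> frame bs A (\<eta> @ [j]) (\<rho> @ [x]) d \<sigma>"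
  unfolding frame_def by (auto simp: nth_append less_Suc_eq)

lemma polyb_bound: "polyb T \<Longrightarrow> polyb (\<lambda>S. T (S + f S))" if "polyb f"
  using polyb_comp[of T "\<lambda>S. S + f S"] polyb_add[OF polyb_id that] by simp

lemma computes_V: "computes (V i) (\<lambda>S. 16 * S + 3)"
proof (rule computesI)
  fix bs A \<eta> \<rho> d \<sigma> S
  assume A: "scoped (V i) (length \<rho>)" "frame bs A \<eta> \<rho> d \<sigma>" "\<forall>x\<in>set \<rho>. x \<le> S"
  have i: "\<eta> ! i < d" "\<sigma> (bs + \<eta> ! i) = cn (\<rho> ! i)" "\<rho> ! i \<le> S"
    using A unfolding frame_def by auto
  have "exec (copy (bs + \<eta> ! i) (bs + d) (bs + d + 1)) \<sigma> (16 * \<rho> ! i + 3) (\<sigma>(bs + d := cn (\<rho> ! i + 0)))"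
    by (rule exec_copy) (use i frame_zero[OF A(2)] in \<open>auto simp: add.assoc\<close>)
  then show "eval (V i) A \<rho> \<le> 16 * S + 3 \<and>
    exec (eval_com bs (V i) \<eta> d) \<sigma> (16 * S + 3) (\<sigma>(bs + d := cn (eval (V i) A \<rho>)))"
    using i(3) by (auto elim: exec.Weaken)
qed (intro polyb_intros)

lemma computes_Num: "computes (Num n) (\<lambda>_. 4 * n + 1)"
proof (rule computesI)
  fix bs A \<eta> \<rho> d \<sigma> S
  assume A: "frame bs A \<eta> \<rho> d \<sigma>"
  show "eval (Num n) A \<rho> \<le> 4 * n + 1 \<and>
    exec (eval_com bs (Num n) \<eta> d) \<sigma> (4 * n + 1) (\<sigma>(bs + d := cn (eval (Num n) A \<rho>)))"
    using exec_incs[of \<sigma> "bs + d" 0 n] frame_zero[OF A, of "bs + d"] by simp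
qed (intro polyb_intros)

lemma computes_Add:
  assumes a: "computes a Ta" and b: "computes b Tb"
  shows "computes (Add a b) (\<lambda>S. Ta S + 7 * Tb S + 3)"
proof (rule computesI)
  fix bs A \<eta> \<rho> d \<sigma> S
  assume A: "scoped (Add a b) (length \<rho>)" "frame bs A \<eta> \<rho> d \<sigma>" "\<forall>x\<in>set \<rho>. x \<le> S"
  let ?x = "eval a A \<rho>" and ?y = "eval b A \<rho>"
  note 1 = computesD[OF a _ A(2,3)]
  note 2 = computesD[OF b _ frame_upd[OF A(2), of d "d + 1"] A(3)]
  have 3: "exec (addto (bs + d + 1) (bs + d)) (\<sigma>(bs + d := cn ?x, bs + (d + 1) := cn ?y)) (6 * ?y + 1)
    (\<sigma>(bs + d := cn ?x, bs + (d + 1) := cn ?y, bs + d + 1 := cn 0, bs + d := cn (?y + ?x)))"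
    by (rule exec_addto) auto
  have 4: "\<sigma>(bs + d := cn ?x, bs + (d + 1) := cn ?y, bs + d + 1 := cn 0, bs + d := cn (?y + ?x))
    = \<sigma>(bs + d := cn (eval (Add a b) A \<rho>))"
    using frame_zero[OF A(2)] by (auto simp: fun_eq_iff add.assoc add.commute)
  have "exec (eval_com bs (Add a b) \<eta> d) \<sigma> (Ta S + 7 * Tb S + 3) (\<sigma>(bs + d := cn (eval (Add a b) A \<rho>)))"
    unfolding eval_com.simps
    by (rule exec_SeqI[OF 1(2) exec_SeqI[OF 2(2) 3[unfolded 4] order.refl]])
      (use A(1) 2(1) in auto)
  moreover have "eval (Add a b) A \<rho> \<le> Ta S + 7 * Tb S + 3"
    using 1(1) 2(1) A(1) by simp
  ultimately show "eval (Add a b) A \<rho> \<le> Ta S + 7 * Tb S + 3 \<and>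
    exec (eval_com bs (Add a b) \<eta> d) \<sigma> (Ta S + 7 * Tb S + 3) (\<sigma>(bs + d := cn (eval (Add a b) A \<rho>)))"
    by blast
qed (use a b in \<open>auto simp: computes_def intro!: polyb_intros\<close>)

lemma computes_Sub:
  assumes a: "computes a Ta" and b: "computes b Tb"
  shows "computes (Sub a b) (\<lambda>S. Ta S + 6 * Tb S + 3)"
proof (rule computesI)
  fix bs A \<eta> \<rho> d \<sigma> S
  assume A: "scoped (Sub a b) (length \<rho>)" "frame bs A \<eta> \<rho> d \<sigma>" "\<forall>x\<in>set \<rho>. x \<le> S"
  let ?x = "eval a A \<rho>" and ?y = "eval b A \<rho>"
  note 1 = computesD[OF a _ A(2,3)]
  note 2 = computesD[OF b _ frame_upd[OF A(2), of d "d + 1"] A(3)]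
  have 3: "exec (subfrom (bs + d + 1) (bs + d)) (\<sigma>(bs + d := cn ?x, bs + (d + 1) := cn ?y)) (5 * ?y + 1)
    (\<sigma>(bs + d := cn ?x, bs + (d + 1) := cn ?y, bs + d + 1 := cn 0, bs + d := cn (?x - ?y)))"
    by (rule exec_subfrom) auto
  have 4: "\<sigma>(bs + d := cn ?x, bs + (d + 1) := cn ?y, bs + d + 1 := cn 0, bs + d := cn (?x - ?y))
    = \<sigma>(bs + d := cn (eval (Sub a b) A \<rho>))"
    using frame_zero[OF A(2)] by (auto simp: fun_eq_iff add.assoc)
  have "exec (eval_com bs (Sub a b) \<eta> d) \<sigma> (Ta S + 6 * Tb S + 3) (\<sigma>(bs + d := cn (eval (Sub a b) A \<rho>)))"
    unfolding eval_com.simps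
    by (rule exec_SeqI[OF 1(2) exec_SeqI[OF 2(2) 3[unfolded 4] order.refl]])
      (use A(1) 2(1) in auto)
  moreover have "eval (Sub a b) A \<rho> \<le> Ta S + 6 * Tb S + 3"
    using 1(1) A(1) by simp
  ultimately show "eval (Sub a b) A \<rho> \<le> Ta S + 6 * Tb S + 3 \<and>
    exec (eval_com bs (Sub a b) \<eta> d) \<sigma> (Ta S + 6 * Tb S + 3) (\<sigma>(bs + d := cn (eval (Sub a b) A \<rho>)))"
    by blast
qed (use a b in \<open>auto simp: computes_def intro!: polyb_intros\<close>)

lemma computes_Sum:
  assumes a: "computes a Ta" and b: "computes b Tb"
  shows "computes (Sum a b) (\<lambda>S. 5 * Ta S + Ta S * (7 * Tb (S + Ta S) + 10) + 5)"
    (is "computes _ ?T")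
proof (rule computesI)
  fix bs A \<eta> \<rho> d \<sigma> S
  assume A: "scoped (Sum a b) (length \<rho>)" "frame bs A \<eta> \<rho> d \<sigma>" "\<forall>x\<in>set \<rho>. x \<le> S"
  define n where "n = eval a A \<rho>"
  define f where "f i = eval b A (\<rho> @ [i])" for i
  define s where "s i = (\<Sum>t<n - i. f t)" for i
  \<comment> \<open>With \<open>i\<close> rounds left, counter \<open>d\<close> holds the sum of the
    first \<open>n - i\<close> terms and counter \<open>d + 2\<close> the bound variable.\<close>
  let ?S = "\<lambda>i. \<sigma>(bs + d := cn (s i), bs + d + 1 := cn i, bs + d + 2 := cn (n - i))"
  let ?c = "eval_com bs b (\<eta> @ [d + 2]) (d + 3) ;; addto (bs + d + 3) (bs + d) ;; inc (bs + d + 2)"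
  let ?Tb = "Tb (S + Ta S)"
  have n: "n \<le> Ta S" "exec (eval_com bs a \<eta> (d + 1)) \<sigma> (Ta S) (\<sigma>(bs + (d + 1) := cn n))"
    using computesD[OF a _ frame_mono[OF A(2)] A(3), of "d + 1"] A(1) unfolding n_def by auto
  have sc: "scoped b (length (\<rho> @ [i]))" for i using A(1) by simp
  have bound: "\<forall>x\<in>set (\<rho> @ [i]). x \<le> S + Ta S" if "i < n" for i
    using A(3) n(1) that by (auto simp: trans_le_add1)
  have frame: "frame bs A (\<eta> @ [d + 2]) (\<rho> @ [n - i]) (d + 3) ((?S i)(bs + d + 1 := cn j))" for i j
    using frame_snoc[OF frame_upd[OF frame_upd[OF frame_upd[OF A(2), of d "d + 1" "cn (s i)"], of "d + 1" "d + 2" "cn j"], of "d + 2" "d + 3" "cn (n - i)"], of "d + 2" "n - i"]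
    by (simp add: add.assoc fun_upd_twist)
  have body: "exec ?c ((?S (Suc i))(bs + d + 1 := cn i)) (7 * ?Tb + 6) (?S i)" if i: "i < n" for i
  proof -
    let ?s = "(?S (Suc i))(bs + d + 1 := cn i)"
    let ?v = "f (n - Suc i)"
    have v: "?v \<le> ?Tb" "exec (eval_com bs b (\<eta> @ [d + 2]) (d + 3)) ?s ?Tb (?s(bs + (d + 3) := cn ?v))"
      using computesD[OF b sc frame bound] i unfolding f_def by auto
    let ?s1 = "?s(bs + (d + 3) := cn ?v)"
    have 2: "exec (addto (bs + d + 3) (bs + d)) ?s1 (6 * ?v + 1) (?s1(bs + d + 3 := cn 0, bs + d := cn (?v + s (Suc i))))"
      by (rule exec_addto) auto
    let ?s2 = "?s1(bs + d + 3 := cn 0, bs + d := cn (?v + s (Suc i)))"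
    have 3: "exec (inc (bs + d + 2)) ?s2 3 (?s2(bs + d + 2 := cn (Suc (n - Suc i))))"
      by (rule exec_inc) auto
    have "n - i = Suc (n - Suc i)" using i by simp
    then have "s i = ?v + s (Suc i)" "n - i = Suc (n - Suc i)" unfolding s_def by simp_all
    then have 4: "?s2(bs + d + 2 := cn (Suc (n - Suc i))) = ?S i"
      using frame_zero[OF A(2)] by (auto simp: fun_eq_iff add.assoc)
    show ?thesis
      by (rule exec_SeqI[OF v(2) exec_SeqI[OF 2 3[unfolded 4] order.refl]]) (use v(1) in auto)
  qed
  have loop: "exec (times (bs + d + 1) ?c) (?S n) (n * (7 * ?Tb + 6 + 3) + 1) (?S 0)"
    by (rule exec_times[OF _ body]) auto
  have 3: "\<sigma>(bs + (d + 1) := cn n) = ?S n"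
    using frame_zero[OF A(2)] by (auto simp: fun_eq_iff add.assoc s_def)
  have 4: "exec (clear (bs + d + 2)) (?S 0) (4 * n + 1) ((?S 0)(bs + d + 2 := cn 0))"
    by (rule exec_clear) auto
  have 5: "(?S 0)(bs + d + 2 := cn 0) = \<sigma>(bs + d := cn (eval (Sum a b) A \<rho>))"
    using frame_zero[OF A(2)] by (auto simp: fun_eq_iff add.assoc s_def n_def f_def)
  have "n * (7 * ?Tb + 6 + 3) \<le> Ta S * (7 * ?Tb + 10)" by (rule mult_mono) (use n in auto)
  then have ex: "exec (eval_com bs (Sum a b) \<eta> d) \<sigma> (?T S) (\<sigma>(bs + d := cn (eval (Sum a b) A \<rho>)))"
    unfolding eval_com.simps using n(1)
    by (intro exec_SeqI[OF n(2)[unfolded 3] exec_SeqI[OF loop 4[unfolded 5] order.refl]]) auto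
  have "f i \<le> ?Tb" if "i < n" for i
    using computesD(1)[OF b sc frame bound, of "n - i"] that unfolding f_def by simp
  then have "(\<Sum>i<n. f i) \<le> n * ?Tb" using sum_bounded_above[of "{..<n}" f ?Tb] by simp
  also have "\<dots> \<le> Ta S * (7 * ?Tb + 10)" by (rule mult_mono) (use n in auto)
  finally have "eval (Sum a b) A \<rho> \<le> ?T S" by (simp add: n_def f_def)
  then show "eval (Sum a b) A \<rho> \<le> ?T S \<and>
    exec (eval_com bs (Sum a b) \<eta> d) \<sigma> (?T S) (\<sigma>(bs + d := cn (eval (Sum a b) A \<rho>)))"
    using ex by blast
qed (use a b in \<open>auto simp: computes_def intro!: polyb_intros polyb_bound\<close>)

lemma iter_le: "a \<le> B \<Longrightarrow> (\<And>i x. f i x \<le> B) \<Longrightarrow> iter f a n \<le> B"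
  by (induction n) auto

text \<open>The cap is evaluated afresh in every round, because \<open>moveto_capped\<close>
  consumes it. All intermediate values are at most \<open>Ta S + Tc S\<close>, which bounds the
  environment of the body.\<close>

lemma computes_It:
  assumes n: "computes n Tn" and a: "computes a Ta" and cap: "computes cap Tc" and b: "computes b Tb"
  shows "computes (It n a cap b)
    (\<lambda>S. Ta S + 5 * Tn S + Tn S * (10 * Tb (S + (Tn S + Ta S + Tc S)) + 4 * Ta S + 9 * Tc S + 30) + 10)"
    (is "computes _ ?T")
proof (rule computesI)
  fix bs A \<eta> \<rho> d \<sigma> S
  assume A: "scoped (It n a cap b) (length \<rho>)" "frame bs A \<eta> \<rho> d \<sigma>" "\<forall>x\<in>set \<rho>. x \<le> S"
  define N where "N = eval n A \<rho>"
  define c where "c = eval cap A \<rho>"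
  define f where "f i x = eval b A (\<rho> @ [i, x])" for i x
  define s where "s i = iter (\<lambda>i x. min (f i x) c) (eval a A \<rho>) (N - i)" for i
  let ?S = "\<lambda>i. \<sigma>(bs + d := cn (s i), bs + d + 1 := cn i, bs + d + 2 := cn (N - i))"
  let ?c = "eval_com bs b (\<eta> @ [d + 2, d]) (d + 3) ;; clear (bs + d) ;; eval_com bs cap \<eta> (d + 4) ;;
        moveto_capped (bs + d + 3) (bs + d + 4) (bs + d) ;; inc (bs + d + 2)"
  let ?Tb = "Tb (S + (Tn S + Ta S + Tc S))"
  have a': "eval a A \<rho> \<le> Ta S" "exec (eval_com bs a \<eta> d) \<sigma> (Ta S) (\<sigma>(bs + d := cn (eval a A \<rho>)))"
    using computesD[OF a _ A(2,3)] A(1) by auto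
  have N: "N \<le> Tn S" "exec (eval_com bs n \<eta> (d + 1)) (\<sigma>(bs + d := cn (eval a A \<rho>))) (Tn S)
      (\<sigma>(bs + d := cn (eval a A \<rho>), bs + (d + 1) := cn N))"
    using computesD[OF n _ frame_upd[OF A(2), of d "d + 1"] A(3)] A(1) unfolding N_def by auto
  have cle: "c \<le> Tc S" using computesD(1)[OF cap _ A(2,3)] A(1) unfolding c_def by auto
  have sle: "s i \<le> Ta S + Tc S" for i
    unfolding s_def by (rule iter_le) (use a' cle in \<open>auto simp: min_def\<close>)
  have sc: "scoped b (length (\<rho> @ [i, x]))" for i x using A(1) by simp
  have bound: "\<forall>y\<in>set (\<rho> @ [i, s j]). y \<le> S + (Tn S + Ta S + Tc S)" if "i < N" for i j
    using A(3) N(1) that sle[of j] by (auto simp: trans_le_add1)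
  have frame: "frame bs A (\<eta> @ [d + 2, d]) (\<rho> @ [N - i, s i]) (d + 3) ((?S i)(bs + d + 1 := cn j))" for i j
    using frame_snoc[OF frame_snoc[OF frame_upd[OF frame_upd[OF frame_upd[OF A(2), of d "d + 1" "cn (s i)"], of "d + 1" "d + 2" "cn j"], of "d + 2" "d + 3" "cn (N - i)"], of "d + 2" "N - i"], of d "s i"]
    by (simp add: add.assoc fun_upd_twist)
  have body: "exec ?c ((?S (Suc i))(bs + d + 1 := cn i)) (10 * ?Tb + 4 * Ta S + 9 * Tc S + 20) (?S i)" if i: "i < N" for i
  proof -
    let ?s = "(?S (Suc i))(bs + d + 1 := cn i)"
    let ?v = "f (N - Suc i) (s (Suc i))"
    have v: "?v \<le> ?Tb" "exec (eval_com bs b (\<eta> @ [d + 2, d]) (d + 3)) ?s ?Tb (?s(bs + (d + 3) := cn ?v))"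
      using computesD[OF b sc frame bound] i unfolding f_def by auto
    let ?s1 = "?s(bs + (d + 3) := cn ?v)"
    have 2: "exec (clear (bs + d)) ?s1 (4 * s (Suc i) + 1) (?s1(bs + d := cn 0))"
      by (rule exec_clear) auto
    let ?s2 = "?s1(bs + d := cn 0)"
    have fr: "frame bs A \<eta> \<rho> (d + 4) ?s2"
      using frame_upd[OF frame_upd[OF frame_upd[OF frame_upd[OF A(2), of d "d + 1" "cn 0"], of "d + 1" "d + 2" "cn i"], of "d + 2" "d + 3" "cn (N - Suc i)"], of "d + 3" "d + 4" "cn ?v"]
      by (simp add: add.assoc fun_upd_twist)
    have 3: "exec (eval_com bs cap \<eta> (d + 4)) ?s2 (Tc S) (?s2(bs + (d + 4) := cn c))"
      using computesD(2)[OF cap _ fr A(3)] A(1) unfolding c_def by simp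
    let ?s3 = "?s2(bs + (d + 4) := cn c)"
    have 4: "exec (moveto_capped (bs + d + 3) (bs + d + 4) (bs + d)) ?s3 (9 * ?v + 4 * c + 3)
      (?s3(bs + d + 3 := cn 0, bs + d + 4 := cn 0, bs + d := cn (min ?v c)))"
      by (rule exec_moveto_capped) (auto simp: add.assoc)
    let ?s4 = "?s3(bs + d + 3 := cn 0, bs + d + 4 := cn 0, bs + d := cn (min ?v c))"
    have 5: "exec (inc (bs + d + 2)) ?s4 3 (?s4(bs + d + 2 := cn (Suc (N - Suc i))))"
      by (rule exec_inc) auto
    have "N - i = Suc (N - Suc i)" using i by simp
    then have "s i = min ?v c" "N - i = Suc (N - Suc i)" unfolding s_def by simp_all
    then have 6: "?s4(bs + d + 2 := cn (Suc (N - Suc i))) = ?S i"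
      using frame_zero[OF A(2)] by (auto simp: fun_eq_iff add.assoc)
    show ?thesis
      by (rule exec_SeqI[OF v(2) exec_SeqI[OF 2 exec_SeqI[OF 3 exec_SeqI[OF 4 5[unfolded 6] order.refl] order.refl] order.refl]])
        (use v(1) cle sle[of "Suc i"] in auto)
  qed
  have loop: "exec (times (bs + d + 1) ?c) (?S N) (N * (10 * ?Tb + 4 * Ta S + 9 * Tc S + 20 + 3) + 1) (?S 0)"
    by (rule exec_times[OF _ body]) auto
  have 3: "\<sigma>(bs + d := cn (eval a A \<rho>), bs + (d + 1) := cn N) = ?S N"
    using frame_zero[OF A(2)] by (auto simp: fun_eq_iff add.assoc s_def)
  have 4: "exec (clear (bs + d + 2)) (?S 0) (4 * N + 1) ((?S 0)(bs + d + 2 := cn 0))"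
    by (rule exec_clear) auto
  have 5: "(?S 0)(bs + d + 2 := cn 0) = \<sigma>(bs + d := cn (eval (It n a cap b) A \<rho>))"
    using frame_zero[OF A(2)] by (auto simp: fun_eq_iff add.assoc s_def N_def f_def c_def)
  have "N * (10 * ?Tb + 4 * Ta S + 9 * Tc S + 20 + 3) \<le> Tn S * (10 * ?Tb + 4 * Ta S + 9 * Tc S + 30)"
    by (rule mult_mono) (use N in auto)
  then have ex: "exec (eval_com bs (It n a cap b) \<eta> d) \<sigma> (?T S) (\<sigma>(bs + d := cn (eval (It n a cap b) A \<rho>)))"
    unfolding eval_com.simps using N(1)
    by (intro exec_SeqI[OF a'(2) exec_SeqI[OF N(2)[unfolded 3] exec_SeqI[OF loop 4[unfolded 5] order.refl] order.refl]]) auto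
  have "eval (It n a cap b) A \<rho> = s 0" by (simp add: s_def N_def f_def c_def)
  moreover have "s 0 \<le> ?T S"
  proof (cases N)
    case 0
    then have "s 0 = eval a A \<rho>" by (simp add: s_def)
    then show ?thesis using a'(1) by simp
  next
    case (Suc k)
    then have "1 \<le> Tn S" "s 0 \<le> Tc S" using N(1) cle by (auto simp: s_def min_def)
    then have "s 0 \<le> 1 * (10 * ?Tb + 4 * Ta S + 9 * Tc S + 30)" by simp
    also have "\<dots> \<le> Tn S * (10 * ?Tb + 4 * Ta S + 9 * Tc S + 30)"
      using \<open>1 \<le> Tn S\<close> by (rule mult_right_mono) simp
    finally show ?thesis by simp
  qed
  ultimately show "eval (It n a cap b) A \<rho> \<le> ?T S \<and>
    exec (eval_com bs (It n a cap b) \<eta> d) \<sigma> (?T S) (\<sigma>(bs + d := cn (eval (It n a cap b) A \<rho>)))"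
    using ex by simp
qed (use n a cap b in \<open>auto simp: computes_def intro!: polyb_intros polyb_bound\<close>)

text \<open>The head walks out while counter \<open>d + 2\<close> records the distance, and this
  counter brings it back, so that the array tape ends with its head at 0 as before.\<close>

lemma computes_Lk:
  assumes a: "computes a Ta"
  shows "computes (Lk k a) (\<lambda>S. 14 * Ta S + 40)"
proof (rule computesI)
  fix bs A \<eta> \<rho> d \<sigma> S
  assume A: "scoped (Lk k a) (length \<rho>)" "frame bs A \<eta> \<rho> d \<sigma>" "\<forall>x\<in>set \<rho>. x \<le> S"
  define n where "n = eval a A \<rho>"
  have k: "k < 2" "k < bs" and ak: "\<sigma> k = ar (A k)" "A k i \<le> 3" for i
    using A unfolding frame_def by auto
  let ?S = "\<lambda>i. \<sigma>(k := ar_at (A k) (n - i), bs + d + 1 := cn i, bs + d + 2 := cn (n - i))"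
  let ?S' = "\<lambda>i. \<sigma>(k := ar_at (A k) i, bs + d := cn (A k n), bs + d + 2 := cn i)"
  have n: "n \<le> Ta S" "exec (eval_com bs a \<eta> (d + 1)) \<sigma> (Ta S) (\<sigma>(bs + (d + 1) := cn n))"
    using computesD[OF a _ frame_mono[OF A(2)] A(3), of "d + 1"] A(1) unfolding n_def by auto
  have loop: "exec (times (bs + d + 1) (mv k Go_Right ;; inc (bs + d + 2))) (?S n) (n * (5 + 3) + 1) (?S 0)"
  proof (rule exec_times)
    fix i assume i: "i < n"
    let ?s = "(?S (Suc i))(bs + d + 1 := cn i)"
    have 1: "exec (mv k Go_Right) ?s 1 (?s(k := ar_at (A k) (Suc (n - Suc i))))"
      by (rule exec_mv_right) (use k in auto)
    let ?s1 = "?s(k := ar_at (A k) (Suc (n - Suc i)))"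
    have 2: "exec (inc (bs + d + 2)) ?s1 3 (?s1(bs + d + 2 := cn (Suc (n - Suc i))))"
      by (rule exec_inc) (use k in auto)
    have "n - i = Suc (n - Suc i)" using i by simp
    then have 3: "?s1(bs + d + 2 := cn (Suc (n - Suc i))) = ?S i"
      using k by (auto simp: fun_eq_iff)
    show "exec (mv k Go_Right ;; inc (bs + d + 2)) ?s 5 (?S i)"
      by (rule exec_SeqI[OF 1 2[unfolded 3]]) simp
  qed (use k in auto)
  have 3: "\<sigma>(bs + (d + 1) := cn n) = ?S n"
    using frame_zero[OF A(2)] k ak by (auto simp: fun_eq_iff add.assoc)
  have rt: "read_tape ((?S 0) k) = A k n" using k by (simp add: read_ar_at)
  have 4: "exec (read_into k (bs + d) 3) (?S 0) 17 ((?S 0)(bs + d := cn (A k n)))"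
    using exec_read_into[of "?S 0" k 3 "bs + d"] rt ak k frame_zero[OF A(2)] by (simp del: fun_upd_apply) simp
  have 5: "(?S 0)(bs + d := cn (A k n)) = ?S' n"
    using frame_zero[OF A(2)] k by (auto simp: fun_eq_iff add.assoc)
  have 6: "exec (times (bs + d + 2) (mv k Go_Left)) (?S' n) (n * (1 + 3) + 1) (?S' 0)"
  proof (rule exec_times)
    fix i assume i: "i < n"
    let ?s = "(?S' (Suc i))(bs + d + 2 := cn i)"
    have "exec (mv k Go_Left) ?s 1 (?s(k := ar_at (A k) i))"
      by (rule exec_mv_left) (use k in auto)
    moreover have "?s(k := ar_at (A k) i) = ?S' i" using k by (auto simp: fun_eq_iff)
    ultimately show "exec (mv k Go_Left) ?s 1 (?S' i)" by simp
  qed (use k in auto)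
  have 7: "?S' 0 = \<sigma>(bs + d := cn (eval (Lk k a) A \<rho>))"
    using frame_zero[OF A(2)] k ak by (auto simp: fun_eq_iff add.assoc n_def)
  have "exec (eval_com bs (Lk k a) \<eta> d) \<sigma> (14 * Ta S + 40) (\<sigma>(bs + d := cn (eval (Lk k a) A \<rho>)))"
    unfolding eval_com.simps using n(1)
    by (intro exec_SeqI[OF n(2)[unfolded 3] exec_SeqI[OF loop exec_SeqI[OF 4[unfolded 5] 6[unfolded 7] order.refl] order.refl]]) auto
  moreover have "eval (Lk k a) A \<rho> \<le> 14 * Ta S + 40"
    using ak(2)[of "eval a A \<rho>"] by simp
  ultimately show "eval (Lk k a) A \<rho> \<le> 14 * Ta S + 40 \<and>
    exec (eval_com bs (Lk k a) \<eta> d) \<sigma> (14 * Ta S + 40) (\<sigma>(bs + d := cn (eval (Lk k a) A \<rho>)))"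
    by blast
qed (use a in \<open>auto simp: computes_def intro!: polyb_intros\<close>)

definition put :: "nat \<Rightarrow> nat list \<Rightarrow> store \<Rightarrow> store" where
  "put k vs \<sigma> = (\<lambda>j. if k \<le> j \<and> j < k + length vs then cn (vs ! (j - k)) else \<sigma> j)"

lemma put_Cons: "put k (v # vs) \<sigma> = put (Suc k) vs (\<sigma>(k := cn v))"
  by (auto simp: put_def fun_eq_iff nth_Cons' Suc_le_eq)

lemma put_Nil: "put k [] \<sigma> = \<sigma>"
  by (auto simp: put_def fun_eq_iff)

lemma frame_put: "frame bs A \<eta> \<rho> d \<sigma> \<Longrightarrow> d' = d + length vs \<Longrightarrow> frame bs A \<eta> \<rho> d' (put (bs + d) vs \<sigma>)"
proof (induction vs arbitrary: d \<sigma>)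
  case Nil
  then show ?case by (simp add: put_Nil)
next
  case (Cons v vs)
  then show ?case
    using Cons.IH[OF frame_upd[OF Cons.prems(1), of d "d + 1" "cn v"]] Cons.prems(2)
    by (simp add: put_Cons del: fun_upd_apply)
qed

lemma computes_args:
  assumes "\<forall>e\<in>set es. \<exists>T. computes e T"
  shows "\<exists>T. polyb T \<and> (\<forall>bs A \<eta> \<rho> d \<sigma> S. list_all (\<lambda>e. scoped e (length \<rho>)) es \<and> frame bs A \<eta> \<rho> d \<sigma> \<and>
      (\<forall>x\<in>set \<rho>. x \<le> S) \<longrightarrow> (\<forall>v\<in>set (map (\<lambda>e. eval e A \<rho>) es). v \<le> T S) \<and>
        exec (eval_args_com (map (\<lambda>e. eval_com bs e \<eta>) es) d) \<sigma> (T S) (put (bs + d) (map (\<lambda>e. eval e A \<rho>) es) \<sigma>))"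
  using assms
proof (induction es)
  case Nil
  show ?case
    by (rule exI[of _ "\<lambda>_. 1"]) (use exec_skip in \<open>auto intro: polyb_const simp: put_Nil\<close>)
next
  case (Cons e es)
  obtain T where T: "computes e T" using Cons.prems by auto
  obtain T' where T': "polyb T'" "\<And>bs A \<eta> \<rho> d \<sigma> S. list_all (\<lambda>e. scoped e (length \<rho>)) es \<Longrightarrow> frame bs A \<eta> \<rho> d \<sigma> \<Longrightarrow>
      \<forall>x\<in>set \<rho>. x \<le> S \<Longrightarrow> (\<forall>v\<in>set (map (\<lambda>e. eval e A \<rho>) es). v \<le> T' S) \<and>
        exec (eval_args_com (map (\<lambda>e. eval_com bs e \<eta>) es) d) \<sigma> (T' S) (put (bs + d) (map (\<lambda>e. eval e A \<rho>) es) \<sigma>)"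
    using Cons.IH Cons.prems by (auto simp del: set_map)
  show ?case
  proof (intro exI[of _ "\<lambda>S. T S + T' S + 1"] conjI allI impI)
    show "polyb (\<lambda>S. T S + T' S + 1)" using T T'(1) unfolding computes_def by (intro polyb_intros) auto
    fix bs A \<eta> \<rho> d \<sigma> S
    assume "list_all (\<lambda>e. scoped e (length \<rho>)) (e # es) \<and> frame bs A \<eta> \<rho> d \<sigma> \<and> (\<forall>x\<in>set \<rho>. x \<le> S)"
    then have A: "scoped e (length \<rho>)" "list_all (\<lambda>e. scoped e (length \<rho>)) es" "frame bs A \<eta> \<rho> d \<sigma>" "\<forall>x\<in>set \<rho>. x \<le> S"
      by auto
    note 1 = computesD[OF T A(1,3,4)]
    have "frame bs A \<eta> \<rho> (d + 1) (\<sigma>(bs + d := cn (eval e A \<rho>)))" by (rule frame_upd[OF A(3)]) auto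
    note 2 = T'(2)[OF A(2) this A(4)]
    show "\<forall>v\<in>set (map (\<lambda>e. eval e A \<rho>) (e # es)). v \<le> T S + T' S + 1"
      using 1(1) 2 by fastforce
    show "exec (eval_args_com (map (\<lambda>e. eval_com bs e \<eta>) (e # es)) d) \<sigma> (T S + T' S + 1)
        (put (bs + d) (map (\<lambda>e. eval e A \<rho>) (e # es)) \<sigma>)"
      using exec_SeqI[OF 1(2) 2[THEN conjunct2] order.refl] by (simp add: put_Cons)
  qed
qed

lemma exec_clears:
  "(\<And>v. v \<in> set vs \<Longrightarrow> v \<le> B) \<Longrightarrow>
   exec (clears k (length vs)) (put k vs \<sigma>) (length vs * (4 * B + 2) + 1) (put k (replicate (length vs) 0) \<sigma>)"
proof (induction vs arbitrary: k \<sigma>)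
  case Nil
  then show ?case using exec_skip by simp
next
  case (Cons v vs)
  let ?\<sigma> = "\<sigma>(k := cn v)" and ?\<sigma>' = "\<sigma>(k := cn 0)"
  have 1: "exec (clear k) (put (Suc k) vs ?\<sigma>) (4 * v + 1) ((put (Suc k) vs ?\<sigma>)(k := cn 0))"
    by (rule exec_clear) (simp add: put_def)
  have 2: "(put (Suc k) vs ?\<sigma>)(k := cn 0) = put (Suc k) vs ?\<sigma>'"
    by (auto simp: put_def fun_eq_iff)
  have 3: "exec (clears (Suc k) (length vs)) (put (Suc k) vs ?\<sigma>') (length vs * (4 * B + 2) + 1)
      (put (Suc k) (replicate (length vs) 0) ?\<sigma>')"
    by (rule Cons.IH) (use Cons.prems in auto)
  have "v \<le> B" using Cons.prems by simp
  then have "exec (clears k (Suc (length vs))) (put (Suc k) vs ?\<sigma>) (Suc (length vs) * (4 * B + 2) + 1)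
      (put (Suc k) (replicate (length vs) 0) ?\<sigma>')"
    unfolding clears.simps by (intro exec_SeqI[OF 1[unfolded 2] 3]) simp
  then show ?case by (simp only: put_Cons length_Cons replicate_Suc)
qed

text \<open>The case of \<open>Call\<close>: the arguments are placed in the counters directly above
  \<open>d\<close>, which form the whole environment of the callee. The bound is a composition of
  polynomials.\<close>

lemma computes_Numall:
  assumes f: "\<exists>T. computes f T" and es: "\<forall>e\<in>set es. \<exists>T. computes e T"
  shows "\<exists>T. computes (Call f es) T"
proof -
  obtain Tf where Tf: "computes f Tf" using f by blast
  obtain T where T: "polyb T" "\<And>bs A \<eta> \<rho> d \<sigma> S. list_all (\<lambda>e. scoped e (length \<rho>)) es \<Longrightarrow> frame bs A \<eta> \<rho> d \<sigma> \<Longrightarrow>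
      \<forall>x\<in>set \<rho>. x \<le> S \<Longrightarrow> (\<forall>v\<in>set (map (\<lambda>e. eval e A \<rho>) es). v \<le> T S) \<and>
        exec (eval_args_com (map (\<lambda>e. eval_com bs e \<eta>) es) d) \<sigma> (T S) (put (bs + d) (map (\<lambda>e. eval e A \<rho>) es) \<sigma>)"
    using computes_args[OF es] by blast
  define n where "n = length es"
  have "computes (Call f es) (\<lambda>S. T S + 7 * Tf (T S) + n * (4 * T S + 2) + 5)" (is "computes _ ?T")
  proof (rule computesI)
    fix bs A \<eta> \<rho> d \<sigma> S
    assume A: "scoped (Call f es) (length \<rho>)" "frame bs A \<eta> \<rho> d \<sigma>" "\<forall>x\<in>set \<rho>. x \<le> S"
    define vs where "vs = map (\<lambda>e. eval e A \<rho>) es"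
    have len: "length vs = n" by (simp add: vs_def n_def)
    have 1: "\<forall>v\<in>set vs. v \<le> T S"
      "exec (eval_args_com (map (\<lambda>e. eval_com bs e \<eta>) es) (d + 1)) \<sigma> (T S) (put (bs + (d + 1)) vs \<sigma>)"
      using T(2)[OF _ frame_mono[OF A(2)] A(3), of "d + 1"] A(1) unfolding vs_def by auto
    let ?\<sigma> = "put (bs + (d + 1)) vs \<sigma>"
    have fr: "frame bs A [d + 1..<d + 1 + n] vs (d + 1 + n) ?\<sigma>"
      using frame_put[OF frame_mono[OF A(2), of "d + 1"], of "d + 1 + n" vs] len
      unfolding frame_def by (auto simp: put_def simp del: upt_Suc)
    have 2: "eval f A vs \<le> Tf (T S)"
      "exec (eval_com bs f [d + 1..<d + 1 + n] (d + 1 + n)) ?\<sigma> (Tf (T S)) (?\<sigma>(bs + (d + 1 + n) := cn (eval f A vs)))"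
      using computesD[OF Tf _ fr 1(1)] A(1) len by (auto simp: n_def)
    let ?\<sigma>1 = "?\<sigma>(bs + (d + 1 + n) := cn (eval f A vs))"
    have 3: "exec (addto (bs + d + 1 + n) (bs + d)) ?\<sigma>1 (6 * eval f A vs + 1)
        (?\<sigma>1(bs + d + 1 + n := cn 0, bs + d := cn (eval f A vs + 0)))"
      by (rule exec_addto) (use frame_zero[OF A(2), of "bs + d"] in \<open>auto simp: put_def add.assoc\<close>)
    have 4: "?\<sigma>1(bs + d + 1 + n := cn 0, bs + d := cn (eval f A vs + 0))
        = put (bs + d + 1) vs (\<sigma>(bs + d := cn (eval f A vs)))"
      using frame_zero[OF A(2), of "bs + d + 1 + n"] len by (auto simp: put_def fun_eq_iff add.assoc)
    have 5: "exec (clears (bs + d + 1) n) (put (bs + d + 1) vs (\<sigma>(bs + d := cn (eval f A vs))))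
        (n * (4 * T S + 2) + 1) (put (bs + d + 1) (replicate n 0) (\<sigma>(bs + d := cn (eval f A vs))))"
      using exec_clears[of vs "T S"] 1(1) len by auto
    have 6: "put (bs + d + 1) (replicate n 0) (\<sigma>(bs + d := cn (eval f A vs))) = \<sigma>(bs + d := cn (eval (Call f es) A \<rho>))"
      using frame_zero[OF A(2)] by (auto simp: put_def fun_eq_iff vs_def)
    have "exec (eval_com bs (Call f es) \<eta> d) \<sigma> (?T S) (\<sigma>(bs + d := cn (eval (Call f es) A \<rho>)))"
      unfolding eval_com.simps n_def[symmetric] using 2(1)
      by (intro exec_SeqI[OF 1(2) exec_SeqI[OF 2(2) exec_SeqI[OF 3[unfolded 4] 5[unfolded 6] order.refl] order.refl]]) auto
    then show "eval (Call f es) A \<rho> \<le> ?T S \<and>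
      exec (eval_com bs (Call f es) \<eta> d) \<sigma> (?T S) (\<sigma>(bs + d := cn (eval (Call f es) A \<rho>)))"
      using 2(1) by (auto simp: vs_def)
  qed (use Tf T(1) in \<open>auto simp: computes_def intro!: polyb_intros polyb_comp[of Tf T]\<close>)
  then show ?thesis by blast
qed

text \<open>From here on, polynomial running time of arithmetic, parsing and the graph comes from
  writing them as expressions.\<close>

theorem computes_exp: "\<exists>T. computes e T"
proof (induction e)
  case (Call f es)
  then show ?case by (intro computes_Numall) auto
qed (blast intro: computes_V computes_Num computes_Add computes_Sub computes_Sum computes_It computes_Lk)+

lemma symbols_below_basic:
  assumes "2 \<le> s"
  shows "symbols_below s skip" "symbols_below s (mv k dir)" "symbols_below s (inc k)"
    "symbols_below s (dec k)" "symbols_below s (addto k j)" "symbols_below s (clear k)"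
    "symbols_below s (copy k j t)" "symbols_below s (subfrom k j)" "symbols_below s (moveto_capped k c j)"
    "symbols_below s (incs k n)" "symbols_below s (read_into a k n)" "symbols_below s (clears k n)"
    "symbols_below s (times k body) \<longleftrightarrow> symbols_below s body"
    "symbols_below s (wr k x) \<longleftrightarrow> x < s"
proof -
  have mv: "symbols_below s (mv k dir)" and skip: "symbols_below s skip"
    and inc: "symbols_below s (inc k)" and dec: "symbols_below s (dec k)" for k dir
    using assms by (auto simp: mv_def skip_def inc_def dec_def wr_def)
  show "symbols_below s skip" "symbols_below s (mv k dir)" "symbols_below s (inc k)" "symbols_below s (dec k)"
    by (fact skip mv inc dec)+
  show times: "symbols_below s (times k body) \<longleftrightarrow> symbols_below s body" for k body
    by (simp add: times_def dec)
  show wr: "symbols_below s (wr k x) \<longleftrightarrow> x < s"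
  proof -
    have "\<exists>r :: nat \<Rightarrow> nat. \<forall>i. r i < s" using assms by (intro exI[of _ "\<lambda>_. 0"]) auto
    then show ?thesis by (auto simp: wr_def)
  qed
  show addto: "symbols_below s (addto k j)" and cl: "symbols_below s (clear k)" for k j
    by (simp_all add: addto_def clear_def times inc skip)
  show "symbols_below s (copy k j t)" "symbols_below s (subfrom k j)" "symbols_below s (moveto_capped k c j)"
    by (simp_all add: copy_def subfrom_def moveto_capped_def dec_pos_def times inc skip dec addto cl)
  show incs: "symbols_below s (incs k n)" for k n
    by (induction n) (simp_all add: skip inc)
  show "symbols_below s (read_into a k n)"
    by (induction n) (simp_all add: skip incs inc)
  show "symbols_below s (clears k n)"
    by (induction n arbitrary: k) (simp_all add: skip cl)
qed

lemma symbols_below_eval_com: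
  assumes "2 \<le> s" shows "symbols_below s (eval_com bs e \<eta> d)"
proof (induction e arbitrary: \<eta> d)
  case (Call f es)
  have "symbols_below s (eval_args_com (map (\<lambda>e. eval_com bs e \<eta>) es) d)" for d
    using Call(2) by (induction es arbitrary: d) (auto simp: symbols_below_basic[OF assms])
  then show ?case using Call(1) by (simp add: symbols_below_basic[OF assms])
qed (simp_all add: symbols_below_basic[OF assms])

lemma exec_Loop_seq:
  assumes "\<And>i. i < n \<Longrightarrow> P (read_tape (S i k)) \<and> exec c (S i) T (S (Suc i))"
    and "\<not> P (read_tape (S n k))"
  shows "exec (Loop k P c) (S 0) (n * (T + 1) + 1) (S n)"
  using assms
proof (induction n arbitrary: S)
  case 0
  then show ?case using exec.LoopF[of P "S 0" k c] by simp
next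
  case (Suc n)
  have "exec (Loop k P c) (S 1) (n * (T + 1) + 1) (S (Suc n))"
    using Suc.IH[of "\<lambda>i. S (Suc i)"] Suc.prems by simp
  moreover have "P (read_tape (S 0 k))" "exec c (S 0) T (S 1)" using Suc.prems(1)[of 0] by auto
  ultimately have "exec (Loop k P c) (S 0) (T + (n * (T + 1) + 1) + 1) (S (Suc n))"
    by (intro exec.LoopT)
  then show ?case by (rule exec.Weaken) simp
qed

subsection \<open>Simulating a machine and cleaning up\<close>

lemma exec_mv_tape: "\<sigma> k = (c, h) \<Longrightarrow> exec (mv k dir) \<sigma> 1 (\<sigma>(k := (c, h + head_shift dir)))"
  using exec_mv[of k dir \<sigma>] by simp

lemma exec_scan:
  assumes "\<sigma> k = (c, h)" and "\<And>i. i < n \<Longrightarrow> P (c (h + int i * head_shift dir))"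
    and "\<not> P (c (h + int n * head_shift dir))"
  shows "exec (Loop k P (mv k dir)) \<sigma> (2 * n + 1) (\<sigma>(k := (c, h + int n * head_shift dir)))"
proof -
  let ?S = "\<lambda>i. \<sigma>(k := (c, h + int i * head_shift dir))"
  have "exec (Loop k P (mv k dir)) (?S 0) (n * (1 + 1) + 1) (?S n)"
  proof (rule exec_Loop_seq)
    fix i assume i: "i < n"
    have "exec (mv k dir) (?S i) 1 ((?S i)(k := (c, h + int i * head_shift dir + head_shift dir)))"
      by (rule exec_mv_tape) simp
    then show "P (read_tape (?S i k)) \<and> exec (mv k dir) (?S i) 1 (?S (Suc i))"
      using assms(2)[OF i] by (simp add: algebra_simps)
  qed (use assms in simp)
  moreover have "?S 0 = \<sigma>" using assms(1) by auto
  ultimately show ?thesis by (simp add: mult.commute mult_2_right)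
qed

lemma exec_erase:
  assumes "\<sigma> k = (c, h)" and dir: "head_shift dir \<noteq> 0"
    and "\<And>i. i < n \<Longrightarrow> P (c (h + int i * head_shift dir))"
    and "\<not> P (c (h + int n * head_shift dir))"
  shows "exec (Loop k P (wr k 0 ;; mv k dir)) \<sigma> (4 * n + 1)
    (\<sigma>(k := (\<lambda>x. if \<exists>i<n. x = h + int i * head_shift dir then 0 else c x, h + int n * head_shift dir)))"
proof -
  let ?c = "\<lambda>n x. if \<exists>i<n. x = h + int i * head_shift dir then 0 else c x"
  let ?S = "\<lambda>n. \<sigma>(k := (?c n, h + int n * head_shift dir))"
  have neq: "?c n (h + int i * head_shift dir) = c (h + int i * head_shift dir)" if "n \<le> i" for n i
    using that dir by auto
  have "exec (Loop k P (wr k 0 ;; mv k dir)) (?S 0) (n * (3 + 1) + 1) (?S n)"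
  proof (rule exec_Loop_seq)
    fix i assume i: "i < n"
    let ?h = "h + int i * head_shift dir"
    have 1: "exec (wr k 0) (?S i) 1 ((?S i)(k := ((?c i)(?h := 0), ?h)))"
      using exec_wr[of k 0 "?S i"] by simp
    have 2: "exec (mv k dir) ((?S i)(k := ((?c i)(?h := 0), ?h))) 1
        ((?S i)(k := ((?c i)(?h := 0), ?h), k := ((?c i)(?h := 0), ?h + head_shift dir)))"
      by (rule exec_mv_tape) simp
    have "(?c i)(?h := 0) = ?c (Suc i)" by (auto simp: fun_eq_iff less_Suc_eq)
    then have 3: "(?S i)(k := ((?c i)(?h := 0), ?h), k := ((?c i)(?h := 0), ?h + head_shift dir)) = ?S (Suc i)"
      by (simp add: algebra_simps)
    have "exec (wr k 0 ;; mv k dir) (?S i) 3 (?S (Suc i))"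
      by (rule exec_SeqI[OF 1 2[unfolded 3]]) simp
    moreover have "P (read_tape (?S i k))" using assms(3)[OF i] neq[of i i] by simp
    ultimately show "P (read_tape (?S i k)) \<and> exec (wr k 0 ;; mv k dir) (?S i) 3 (?S (Suc i))" by blast
  next
    show "\<not> P (read_tape (?S n k))" using assms(4) neq[of n n] by simp
  qed
  moreover have "?S 0 = \<sigma>" using assms(1) by auto
  ultimately show ?thesis by (simp add: mult.commute)
qed

text \<open>
  While machine \<open>M\<close> with \<open>s\<close> symbols is simulated, a visited cell with symbol \<open>x\<close> holds \<open>x\<close>, or \<open>s\<close> if
  \<open>x = 0\<close>, and the origin holds \<open>s + 1 + x\<close>. So the visited cells are exactly the nonzero
  ones and can be erased afterwards.
\<close>

definition decode_sym :: "nat \<Rightarrow> nat \<Rightarrow> nat" where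
  "decode_sym s x = (if x < s then x else if x = s then 0 else x - (s + 1))"

definition encode_sym :: "nat \<Rightarrow> nat \<Rightarrow> nat \<Rightarrow> nat" where
  "encode_sym s old x = (if old > s then s + 1 + x else if x = 0 then s else x)"

definition sim_tape :: "nat \<Rightarrow> nat \<Rightarrow> tape \<Rightarrow> tape \<Rightarrow> bool" where
  "sim_tape s W t t' \<longleftrightarrow> snd t' = snd t \<and> (\<forall>x. fst t x < s \<and> decode_sym s (fst t' x) = fst t x \<and>
     (fst t' x > s \<longleftrightarrow> x = 0) \<and> fst t' x \<le> 2 * s) \<and>
     (\<exists>lo hi. (\<forall>x. fst t' x \<noteq> 0 \<longleftrightarrow> lo \<le> x \<and> x \<le> hi) \<and> lo \<le> 0 \<and> 0 \<le> hi \<and>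
        lo \<le> snd t \<and> snd t \<le> hi \<and> hi - lo \<le> int W)"

lemma sim_tape_mono: "sim_tape s W t t' \<Longrightarrow> W \<le> W' \<Longrightarrow> sim_tape s W' t t'"
  unfolding sim_tape_def by (meson of_nat_mono order_trans)

definition touch :: "nat \<Rightarrow> tape \<Rightarrow> tape" where
  "touch s t = act_tape (if read_tape t = 0 then s else read_tape t, Stay) t"

text \<open>The visited cells form an interval that contains the head, so a move adds at most one
  cell; hence \<open>W\<close> grows to \<open>Suc W\<close>.\<close>

lemma sim_tape_step:
  assumes "sim_tape s W t t'" "x < s" "0 < s"
  shows "sim_tape s (Suc W) (act_tape (x, dir) t)
    (touch s (act_tape (encode_sym s (read_tape t') x, dir) t'))"
proof -
  obtain c h where t: "t = (c, h)" by (cases t)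
  obtain c' h' where t': "t' = (c', h')" by (cases t')
  have h': "h' = h" using assms(1) t t' by (simp add: sim_tape_def)
  have c: "c y < s" "decode_sym s (c' y) = c y" "c' y > s \<longleftrightarrow> y = 0" "c' y \<le> 2 * s" for y
    using assms(1) t t' by (simp_all add: sim_tape_def)
  obtain lo hi where lh: "\<And>y. c' y \<noteq> 0 \<longleftrightarrow> lo \<le> y \<and> y \<le> hi" "lo \<le> 0" "0 \<le> hi" "lo \<le> h" "h \<le> hi" "hi - lo \<le> int W"
    using assms(1) unfolding t t' sim_tape_def fst_conv snd_conv by auto
  let ?e = "encode_sym s (c' h) x"
  let ?h = "h + head_shift dir"
  have e: "?e \<noteq> 0" "decode_sym s ?e = x" "?e > s \<longleftrightarrow> h = 0" "?e \<le> 2 * s"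
    using assms(2,3) c(3)[of h] by (auto simp: encode_sym_def decode_sym_def)
  define d where "d = c'(h := ?e)"
  define d' where "d' = d(?h := if d ?h = 0 then s else d ?h)"
  have d: "d y \<noteq> 0 \<longleftrightarrow> lo \<le> y \<and> y \<le> hi" for y using lh e unfolding d_def by auto
  have res: "touch s (act_tape (encode_sym s (read_tape t') x, dir) t') = (d', ?h)"
    unfolding t' h' touch_def d'_def d_def by simp
  have d': "d' y \<noteq> 0 \<longleftrightarrow> min lo ?h \<le> y \<and> y \<le> max hi ?h" for y
    using d[of y] d[of ?h] assms(3) lh(4,5) unfolding d'_def by (cases dir) (auto split: if_splits)
  have "decode_sym s s = 0" by (simp add: decode_sym_def)
  moreover have dec0: "decode_sym s 0 = 0" using assms(3) by (simp add: decode_sym_def)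
  ultimately have "decode_sym s (d' y) = decode_sym s (d y)" for y unfolding d'_def by auto
  moreover have "decode_sym s (d y) = (c(h := x)) y" for y using c e unfolding d_def by auto
  moreover have "d' y > s \<longleftrightarrow> d y > s" "d' y \<le> 2 * s" for y
    using c(4) e(4) unfolding d'_def d_def by auto
  moreover have "d y > s \<longleftrightarrow> y = 0" for y using c e unfolding d_def by auto
  moreover have "(c(h := x)) y < s" for y using c assms(2) by simp
  moreover have "max hi ?h - min lo ?h \<le> int (Suc W)" using lh by (cases dir) auto
  ultimately show ?thesis
    unfolding res t sim_tape_def act_tape.simps fst_conv snd_conv
    using lh d'
    by (intro conjI allI exI[of _ "min lo ?h"] exI[of _ "max hi ?h"]) auto
qed

text \<open>The head may start anywhere in the visited interval. It goes to the right end and erases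
  back to the origin, which is recognised by its mark above \<open>s\<close>; then it does the same
  from the left end. The origin is erased last, so the head is left at cell 0.\<close>

definition clean :: "nat \<Rightarrow> nat \<Rightarrow> com" where
  "clean s k =
     Loop k nonzero (mv k Go_Right) ;; mv k Go_Left ;;
     Loop k (\<lambda>x. x \<le> s) (wr k 0 ;; mv k Go_Left) ;; mv k Go_Left ;;
     Loop k nonzero (mv k Go_Left) ;; mv k Go_Right ;;
     Loop k (\<lambda>x. x \<le> s) (wr k 0 ;; mv k Go_Right) ;; wr k 0"

lemma exec_clean:
  assumes "sim_tape s W t (\<sigma> k)"
  shows "exec (clean s k) \<sigma> (20 * (W + 2)) (\<sigma>(k := ar (\<lambda>_. 0)))"
proof -
  obtain c h where t: "\<sigma> k = (c, h)" by (cases "\<sigma> k")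
  have c: "c y > s \<longleftrightarrow> y = 0" for y
    using assms t by (simp add: sim_tape_def)
  obtain lo hi where lh: "\<And>y. c y \<noteq> 0 \<longleftrightarrow> lo \<le> y \<and> y \<le> hi" "lo \<le> 0" "0 \<le> hi" "lo \<le> h" "h \<le> hi" "hi - lo \<le> int W"
    using assms unfolding t sim_tape_def fst_conv snd_conv by auto
  \<comment> \<open>The contents after the right half and after both halves have been
    erased.\<close>
  define c2 where "c2 x = (if 1 \<le> x \<and> x \<le> hi then 0 else c x)" for x
  define c3 where "c3 x = (if x = 0 then c 0 else 0)" for x :: int
  have 1: "exec (Loop k nonzero (mv k Go_Right)) \<sigma> (2 * nat (hi + 1 - h) + 1) (\<sigma>(k := (c, hi + 1)))"
    using exec_scan[of \<sigma> k c h "nat (hi + 1 - h)" nonzero Go_Right] t lh(4,5) lh(1)[of "hi + 1"] lh(1)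
    by (force simp: nonzero_def)
  have 2: "exec (mv k Go_Left) (\<sigma>(k := (c, hi + 1))) 1 (\<sigma>(k := (c, hi)))"
    using exec_mv_tape[of "\<sigma>(k := (c, hi + 1))" k c "hi + 1" Go_Left] by simp
  have 3: "exec (Loop k (\<lambda>x. x \<le> s) (wr k 0 ;; mv k Go_Left)) (\<sigma>(k := (c, hi))) (4 * nat hi + 1) (\<sigma>(k := (c2, 0)))"
  proof -
    have "(\<lambda>x. if \<exists>i<nat hi. x = hi + int i * head_shift Go_Left then 0 else c x) = c2"
    proof
      fix x
      have "(\<exists>i<nat hi. x = hi + int i * head_shift Go_Left) \<longleftrightarrow> 1 \<le> x \<and> x \<le> hi"
        by (auto intro!: exI[of _ "nat (hi - x)"])
      then show "(if \<exists>i<nat hi. x = hi + int i * head_shift Go_Left then 0 else c x) = c2 x"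
        by (simp add: c2_def)
    qed
    moreover have "\<not> s < c (hi + int i * head_shift Go_Left)" if "i < nat hi" for i using c that by auto
    ultimately show ?thesis
      using exec_erase[of "\<sigma>(k := (c, hi))" k c hi Go_Left "nat hi" "\<lambda>x. x \<le> s"] lh(3) c[of 0]
      by (simp add: not_less)
  qed
  have 4: "exec (mv k Go_Left) (\<sigma>(k := (c2, 0))) 1 (\<sigma>(k := (c2, -1)))"
    using exec_mv_tape[of "\<sigma>(k := (c2, 0))" k c2 0 Go_Left] by simp
  have 5: "exec (Loop k nonzero (mv k Go_Left)) (\<sigma>(k := (c2, -1))) (2 * nat (- lo) + 1) (\<sigma>(k := (c2, lo - 1)))"
  proof -
    have "c2 (lo - 1) = 0" using lh(1)[of "lo - 1"] by (auto simp: c2_def)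
    moreover have "c2 (- 1 - int i) \<noteq> 0" if "i < nat (- lo)" for i
      using lh(1)[of "- 1 - int i"] lh(3) that by (auto simp: c2_def)
    moreover have "- 1 - int (nat (- lo)) = lo - 1" using lh(2) by simp
    ultimately show ?thesis
      using exec_scan[of "\<sigma>(k := (c2, -1))" k c2 "-1" "nat (- lo)" nonzero Go_Left] by (simp add: nonzero_def)
  qed
  have 6: "exec (mv k Go_Right) (\<sigma>(k := (c2, lo - 1))) 1 (\<sigma>(k := (c2, lo)))"
    using exec_mv_tape[of "\<sigma>(k := (c2, lo - 1))" k c2 "lo - 1" Go_Right] by simp
  have 7: "exec (Loop k (\<lambda>x. x \<le> s) (wr k 0 ;; mv k Go_Right)) (\<sigma>(k := (c2, lo))) (4 * nat (- lo) + 1) (\<sigma>(k := (c3, 0)))"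
  proof -
    have "(\<lambda>x. if \<exists>i<nat (- lo). x = lo + int i * head_shift Go_Right then 0 else c2 x) = c3"
    proof
      fix x
      have "(\<exists>i<nat (- lo). x = lo + int i * head_shift Go_Right) \<longleftrightarrow> lo \<le> x \<and> x < 0"
        by (auto intro!: exI[of _ "nat (x - lo)"])
      then show "(if \<exists>i<nat (- lo). x = lo + int i * head_shift Go_Right then 0 else c2 x) = c3 x"
        using lh(1)[of x] lh(2,3) by (auto simp: c2_def c3_def)
    qed
    moreover have "c2 (lo + int i) \<le> s" if "i < nat (- lo)" for i
      using c[of "lo + int i"] that by (auto simp: c2_def)
    moreover have "\<not> c2 0 \<le> s" using c[of 0] by (simp add: c2_def)
    ultimately show ?thesis
      using exec_erase[of "\<sigma>(k := (c2, lo))" k c2 lo Go_Right "nat (- lo)" "\<lambda>x. x \<le> s"] lh(2)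
      by simp
  qed
  have 8: "exec (wr k 0) (\<sigma>(k := (c3, 0))) 1 (\<sigma>(k := ar (\<lambda>_. 0)))"
  proof -
    have "c3(0 := 0) = (\<lambda>_. 0)" by (auto simp: c3_def fun_eq_iff)
    then show ?thesis using exec_wr[of k 0 "\<sigma>(k := (c3, 0))"] by (simp add: ar_at_def)
  qed
  obtain n1 n2 n3 where n: "nat (hi + 1 - h) = n1" "nat hi = n2" "nat (- lo) = n3" by blast
  have "n1 \<le> W + 1" "n2 + n3 \<le> W" unfolding n[symmetric] using lh by linarith+
  then show ?thesis unfolding clean_def
    by (intro exec_SeqI[OF 1 exec_SeqI[OF 2 exec_SeqI[OF 3 exec_SeqI[OF 4 exec_SeqI[OF 5 exec_SeqI[OF 6
      exec_SeqI[OF 7 8 order.refl] order.refl] order.refl] order.refl] order.refl] order.refl], unfolded n]) simp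
qed

primrec cleans :: "nat \<Rightarrow> nat \<Rightarrow> nat \<Rightarrow> com" where
  "cleans s k 0 = skip"
| "cleans s k (Suc n) = clean s k ;; cleans s (Suc k) n"

lemma exec_cleans:
  assumes "\<And>j. k \<le> j \<Longrightarrow> j < k + n \<Longrightarrow> \<exists>t. sim_tape s W t (\<sigma> j)"
  shows "exec (cleans s k n) \<sigma> (n * (20 * (W + 2) + 1) + 1)
    (\<lambda>j. if k \<le> j \<and> j < k + n then ar (\<lambda>_. 0) else \<sigma> j)"
  using assms
proof (induction n arbitrary: k \<sigma>)
  case 0
  have "(\<lambda>j. if k \<le> j \<and> j < k + 0 then ar (\<lambda>_. 0) else \<sigma> j) = \<sigma>" by (auto simp: fun_eq_iff)
  then show ?case using exec_skip[of \<sigma>] by simp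
next
  case (Suc n)
  obtain t where "sim_tape s W t (\<sigma> k)" using Suc.prems[of k] by auto
  note 1 = exec_clean[of s W t \<sigma> k, OF this]
  let ?\<sigma> = "\<sigma>(k := ar (\<lambda>_. 0))"
  have 2: "exec (cleans s (Suc k) n) ?\<sigma> (n * (20 * (W + 2) + 1) + 1)
      (\<lambda>j. if Suc k \<le> j \<and> j < Suc k + n then ar (\<lambda>_. 0) else ?\<sigma> j)"
    by (rule Suc.IH) (use Suc.prems in auto)
  have 3: "(\<lambda>j. if Suc k \<le> j \<and> j < Suc k + n then ar (\<lambda>_. 0) else ?\<sigma> j) =
      (\<lambda>j. if k \<le> j \<and> j < k + Suc n then ar (\<lambda>_. 0) else \<sigma> j)"
    by (auto simp: fun_eq_iff)
  show ?case unfolding cleans.simps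
    by (rule exec_SeqI[OF 1 2[unfolded 3]]) simp
qed

text \<open>Truncation makes every written symbol less than \<open>s\<close> for arbitrary readings,
  as \<open>symbols_below\<close> demands; on the symbols that occur in a simulation it is the
  identity.\<close>

definition cap :: "nat \<Rightarrow> nat \<Rightarrow> nat" where "cap s x = (if x < s then x else 0)"

lemma tm_step_halted: "q \<in> {1, 2} \<Longrightarrow> (tm_step M ^^ t) (q, ts) = (q, ts)"
  by (induction t) auto

definition word_array :: "nat list \<Rightarrow> nat \<Rightarrow> nat" where
  "word_array w i = (if i < length w then w ! i else 0)"

declare upt_Suc [simp del]

context
  fixes M :: tm and s :: nat
  assumes M: "turing_machine M" and s: "2 * tm_symbols M < s" "tm_states M < s"
begin

text \<open>
  Tapes \<open>2, \<dots>, tm_tapes M + 1\<close> hold the tapes of \<open>M\<close>, and the next one holds its state in cell 0.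
\<close>

abbreviation (input) "mtapes \<equiv> [2..<2 + tm_tapes M]"
abbreviation (input) "stape \<equiv> 2 + tm_tapes M"

definition sim_act :: "(nat \<Rightarrow> nat) \<Rightarrow> nat \<Rightarrow> nat \<times> direction" where
  "sim_act r k =
     (case tm_delta M (r stape) (map (\<lambda>j. decode_sym (tm_symbols M) (r (2 + j))) [0..<tm_tapes M]) of
        (q, acts) \<Rightarrow>
          if k = stape then (cap s q, Stay)
          else (cap s (encode_sym (tm_symbols M) (r k) (fst (acts ! (k - 2)))), snd (acts ! (k - 2))))"

definition sim_body :: com where
  "sim_body = Act (mtapes @ [stape]) sim_act ;;
     Act mtapes (\<lambda>r k. (if r k = 0 then tm_symbols M else r k, Stay))"

definition run_tm :: "nat \<Rightarrow> com" where
  "run_tm ans =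
     Act mtapes (\<lambda>r k. (cap s (tm_symbols M + 1 + r k), Stay)) ;;
     Loop stape (\<lambda>q. q \<notin> {1, 2}) sim_body ;;
     cleans (tm_symbols M) 2 (tm_tapes M) ;;
     Cond stape (\<lambda>q. q = 1) (inc ans) skip ;;
     wr stape 0"

lemma symbols_below_run_tm: "symbols_below s (run_tm ans)"
proof -
  have s2: "2 \<le> s" "0 < s" using M s unfolding turing_machine_def by auto
  have cap: "cap s x < s" for x using s2 by (simp add: cap_def)
  have "symbols_below s (cleans (tm_symbols M) k n)" for k n
    by (induction n arbitrary: k) (simp_all add: clean_def symbols_below_basic[OF s2(1)] s2)
  moreover have "symbols_below s sim_body"
    using s s2 cap by (auto simp: sim_body_def sim_act_def split: prod.splits)
  ultimately show ?thesis
    by (simp add: run_tm_def symbols_below_basic[OF s2(1)] s2 cap)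
qed

definition sim :: "nat \<Rightarrow> store \<Rightarrow> config \<Rightarrow> store \<Rightarrow> bool" where
  "sim W \<sigma>0 cfg \<sigma> \<longleftrightarrow> fst cfg < tm_states M \<and> length (snd cfg) = tm_tapes M \<and>
     \<sigma> stape = ((\<lambda>_. 0)(0 := fst cfg), 0) \<and>
     (\<forall>j<tm_tapes M. sim_tape (tm_symbols M) W (snd cfg ! j) (\<sigma> (2 + j))) \<and>
     (\<forall>k. k \<notin> {2..stape} \<longrightarrow> \<sigma> k = \<sigma>0 k)"

lemma sim_step:
  assumes sim: "sim W \<sigma>0 cfg \<sigma>" and q: "fst cfg \<notin> {1, 2}"
  obtains \<sigma>' where "exec sim_body \<sigma> 3 \<sigma>'" "sim (Suc W) \<sigma>0 (tm_step M cfg) \<sigma>'"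
proof -
  let ?s = "tm_symbols M"
  obtain q ts where cfg: "cfg = (q, ts)" by (cases cfg)
  obtain q' acts where \<delta>: "tm_delta M q (map read_tape ts) = (q', acts)" by fastforce
  have st: "\<sigma> stape = ((\<lambda>_. 0)(0 := q), 0)" "q < tm_states M" "length ts = tm_tapes M"
    and T: "\<And>j. j < tm_tapes M \<Longrightarrow> sim_tape ?s W (ts ! j) (\<sigma> (2 + j))"
    and oth: "\<And>k. k \<notin> {2..stape} \<Longrightarrow> \<sigma> k = \<sigma>0 k"
    using sim unfolding sim_def cfg by auto
  have rd: "read_tape (ts ! j) < ?s \<and> decode_sym ?s (read_tape (\<sigma> (2 + j))) = read_tape (ts ! j) \<and>
      read_tape (\<sigma> (2 + j)) \<le> 2 * ?s" if "j < tm_tapes M" for j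
    using T[OF that] by (cases "ts ! j"; cases "\<sigma> (2 + j)") (auto simp: sim_tape_def)
  have "set (map read_tape ts) \<subseteq> {..<?s}"
  proof
    fix x assume "x \<in> set (map read_tape ts)"
    then obtain j where "j < tm_tapes M" "x = read_tape (ts ! j)" using st(3) by (auto simp: in_set_conv_nth)
    then show "x \<in> {..<?s}" using rd by blast
  qed
  then have "case tm_delta M q (map read_tape ts) of (q', acts) \<Rightarrow> q' < tm_states M \<and>
      length acts = tm_tapes M \<and> fst ` set acts \<subseteq> {..<?s}"
    using M st unfolding turing_machine_def by simp
  then have wf: "q' < tm_states M" "length acts = tm_tapes M" "fst ` set acts \<subseteq> {..<?s}"
    unfolding \<delta> by auto
  have act: "fst (acts ! j) < ?s" if "j < tm_tapes M" for j
    using wf that by (auto simp: image_subset_iff)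
  let ?\<sigma>1 = "act_on (mtapes @ [stape]) sim_act \<sigma>"
  let ?\<sigma>2 = "act_on mtapes (\<lambda>r k. (if r k = 0 then ?s else r k, Stay)) ?\<sigma>1"
  let ?r = "\<lambda>i. if i \<in> set (mtapes @ [stape]) then read_tape (\<sigma> i) else 0"
  have mp: "map (\<lambda>j. decode_sym ?s (?r (2 + j))) [0..<tm_tapes M] = map read_tape ts"
    by (rule nth_equalityI) (use rd st(3) in auto)
  have rs: "?r stape = q" using st(1) by simp
  have sa: "sim_act ?r k =
      (if k = stape then (cap s q', Stay)
       else (cap s (encode_sym ?s (?r k) (fst (acts ! (k - 2)))), snd (acts ! (k - 2))))" for k
    unfolding sim_act_def mp rs \<delta> by simp
  have e1: "?\<sigma>1 stape = ((\<lambda>_. 0)(0 := q'), 0)"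
  proof -
    have "?\<sigma>1 stape = act_tape (sim_act ?r stape) (\<sigma> stape)" by (simp add: act_on_def)
    also have "\<dots> = act_tape (cap s q', Stay) ((\<lambda>_. 0)(0 := q), 0)" unfolding sa st(1) by simp
    finally show ?thesis using wf(1) s by (simp add: cap_def)
  qed
  have e2: "?\<sigma>1 (2 + j) = act_tape (encode_sym ?s (read_tape (\<sigma> (2 + j))) (fst (acts ! j)), snd (acts ! j)) (\<sigma> (2 + j))"
    if j: "j < tm_tapes M" for j
  proof -
    have "encode_sym ?s (read_tape (\<sigma> (2 + j))) (fst (acts ! j)) < s"
      using act[OF j] s by (auto simp: encode_sym_def)
    moreover have "?\<sigma>1 (2 + j) = act_tape (sim_act ?r (2 + j)) (\<sigma> (2 + j))"
      using j by (simp add: act_on_def del: upt_Suc)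
    ultimately show ?thesis unfolding sa using j by (simp add: cap_def del: upt_Suc)
  qed
  have e3: "?\<sigma>2 stape = ?\<sigma>1 stape" by (simp add: act_on_def)
  have e4: "?\<sigma>2 (2 + j) = touch ?s (?\<sigma>1 (2 + j))" if "j < tm_tapes M" for j
  proof -
    have "act_on mtapes (\<lambda>r k. (if r k = 0 then ?s else r k, Stay)) \<tau> (2 + j) = touch ?s (\<tau> (2 + j))" for \<tau>
      using that by (simp add: act_on_def touch_def)
    then show ?thesis .
  qed
  have e5: "?\<sigma>2 k = \<sigma> k" if "k \<notin> {2..stape}" for k
    using that by (auto simp: act_on_def)
  have ts': "tm_step M cfg = (q', map2 act_tape acts ts)"
    using q \<delta> unfolding cfg by simp
  have s0: "0 < ?s" using M unfolding turing_machine_def by simp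
  have "sim (Suc W) \<sigma>0 (tm_step M cfg) ?\<sigma>2"
    unfolding sim_def ts' fst_conv snd_conv
  proof (intro conjI allI impI)
    fix j assume j: "j < tm_tapes M"
    have "map2 act_tape acts ts ! j = act_tape (fst (acts ! j), snd (acts ! j)) (ts ! j)"
      using j wf(2) st(3) by simp
    then show "sim_tape ?s (Suc W) (map2 act_tape acts ts ! j) (?\<sigma>2 (2 + j))"
      using sim_tape_step[OF T[OF j] act[OF j] s0, of "snd (acts ! j)"] e4[OF j] e2[OF j] by simp
  qed (use wf st e1 e3 e5 oth in auto)
  moreover have "exec sim_body \<sigma> 3 ?\<sigma>2"
    unfolding sim_body_def by (rule exec_SeqI[OF exec.Act exec.Act]) simp
  ultimately show ?thesis by (rule that[rotated])
qed

text \<open>The time \<open>t\<close> may lie after the first halting time: the loop then stops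
  earlier, and a halted configuration does not change any more.\<close>

lemma sim_loop:
  assumes "sim W \<sigma>0 cfg \<sigma>" "fst ((tm_step M ^^ t) cfg) \<in> {1, 2}"
  shows "\<exists>\<sigma>'. exec (Loop stape (\<lambda>q. q \<notin> {1, 2}) sim_body) \<sigma> (4 * t + 1) \<sigma>' \<and>
    sim (W + t) \<sigma>0 ((tm_step M ^^ t) cfg) \<sigma>'"
  using assms
proof (induction t arbitrary: W cfg \<sigma>)
  case 0
  then have "read_tape (\<sigma> stape) \<in> {1, 2}" by (auto simp: sim_def)
  then show ?case using 0 exec.LoopF[of "\<lambda>q. q \<notin> {1, 2}" \<sigma> stape sim_body] by (intro exI[of _ \<sigma>]) auto
next
  case (Suc t)
  have rd: "read_tape (\<sigma> stape) = fst cfg" using Suc.prems(1) by (simp add: sim_def)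
  show ?case
  proof (cases "fst cfg \<in> {1, 2}")
    case True
    have "sim (W + Suc t) \<sigma>0 cfg \<sigma>"
      using Suc.prems(1) sim_tape_mono[of _ W _ _ "W + Suc t"] unfolding sim_def by simp
    moreover have "(tm_step M ^^ Suc t) cfg = cfg" using tm_step_halted[OF True] by (metis prod.collapse)
    moreover have "exec (Loop stape (\<lambda>q. q \<notin> {1, 2}) sim_body) \<sigma> (4 * Suc t + 1) \<sigma>"
      by (rule exec.Weaken[OF exec.LoopF]) (use True rd in auto)
    ultimately show ?thesis by metis
  next
    case False
    obtain \<sigma>' where \<sigma>': "exec sim_body \<sigma> 3 \<sigma>'" "sim (Suc W) \<sigma>0 (tm_step M cfg) \<sigma>'"
      using sim_step[OF Suc.prems(1) False] .
    have e: "(tm_step M ^^ Suc t) cfg = (tm_step M ^^ t) (tm_step M cfg)" by (simp add: funpow_swap1)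
    obtain \<sigma>'' where \<sigma>'': "exec (Loop stape (\<lambda>q. q \<notin> {1, 2}) sim_body) \<sigma>' (4 * t + 1) \<sigma>''"
      "sim (Suc W + t) \<sigma>0 ((tm_step M ^^ Suc t) cfg) \<sigma>''"
      using Suc.IH[OF \<sigma>'(2)] Suc.prems(2) unfolding e by blast
    have "exec (Loop stape (\<lambda>q. q \<notin> {1, 2}) sim_body) \<sigma> (3 + (4 * t + 1) + 1) \<sigma>''"
      by (rule exec.LoopT[OF _ \<sigma>'(1) \<sigma>''(1)]) (use False rd in simp)
    then have "exec (Loop stape (\<lambda>q. q \<notin> {1, 2}) sim_body) \<sigma> (4 * Suc t + 1) \<sigma>''"
      by (rule exec.Weaken) simp
    then show ?thesis using \<sigma>''(2) by (auto simp del: funpow.simps)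
  qed
qed

text \<open>The input must be free of blanks, because its cells count as visited from the start and
  visited cells are recognised by being nonzero. Afterwards the simulation tapes are blank again, so
  the command can be run repeatedly.\<close>

lemma exec_run_tm:
  assumes w: "set w \<subseteq> {1..3}"
    and \<sigma>: "\<sigma> 2 = ar (word_array w)" "\<And>k. 3 \<le> k \<Longrightarrow> k \<le> stape \<Longrightarrow> \<sigma> k = ar (\<lambda>_. 0)"
    and ans: "stape < ans" "\<sigma> ans = cn x"
    and halt: "tm_state_after M w t \<in> {1, 2}"
  shows "exec (run_tm ans) \<sigma> (tm_tapes M * (20 * (length w + t + 2) + 1) + 4 * t + 20)
    (\<sigma>(2 := ar (\<lambda>_. 0), ans := cn (if tm_state_after M w t = 1 then Suc x else x)))"
proof -
  let ?s = "tm_symbols M" and ?K = "tm_tapes M"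
  have tm: "1 \<le> ?K" "4 \<le> ?s" "3 \<le> tm_states M" using M unfolding turing_machine_def by auto
  let ?\<sigma>1 = "act_on mtapes (\<lambda>r k. (cap s (?s + 1 + r k), Stay)) \<sigma>"
  define wt where "wt j = (if j = 0 then word_array w else (\<lambda>_. 0))" for j :: nat
  have wt: "\<sigma> (2 + j) = ar (wt j)" if "j < ?K" for j
    using \<sigma> that by (cases "j = 0") (auto simp: wt_def)
  have wi: "1 \<le> w ! i \<and> w ! i \<le> 3" if "i < length w" for i
    using w nth_mem[OF that] by auto
  have wt3: "wt j i \<le> 3" "wt j i \<noteq> 0 \<longleftrightarrow> j = 0 \<and> i < length w" for j i
    using wi[of i] unfolding wt_def word_array_def by auto
  have \<sigma>1: "?\<sigma>1 (2 + j) = (\<lambda>x. if x < 0 then 0 else if x = 0 then ?s + 1 + wt j 0 else wt j (nat x), 0)"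
    if "j < ?K" for j
  proof -
    have "cap s (?s + 1 + wt j 0) = ?s + 1 + wt j 0" using wt3(1)[of j 0] s tm by (simp add: cap_def)
    then show ?thesis using wt[OF that] that
      by (simp add: act_on_def ar_at_def) (auto simp: fun_eq_iff)
  qed
  have init: "sim (length w) \<sigma> (tm_init M w) ?\<sigma>1"
    unfolding sim_def
  proof (intro conjI allI impI)
    show "fst (tm_init M w) < tm_states M" "length (snd (tm_init M w)) = ?K"
      using tm by (auto simp: tm_init_def)
    show "?\<sigma>1 stape = ((\<lambda>_. 0)(0 := fst (tm_init M w)), 0)"
      using \<sigma>(2)[of stape] tm by (auto simp: act_on_def tm_init_def ar_at_def fun_eq_iff)
    show "?\<sigma>1 k = \<sigma> k" if "k \<notin> {2..stape}" for k using that by (auto simp: act_on_def)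
    fix j assume j: "j < ?K"
    let ?t = "(\<lambda>x. if x < 0 then 0 else wt j (nat x), 0::int)"
    have t: "snd (tm_init M w) ! j = ?t"
      using j by (cases j) (auto simp: tm_init_def wt_def word_array_def fun_eq_iff)
    have "sim_tape ?s (length w) ?t (?\<sigma>1 (2 + j))"
      unfolding \<sigma>1[OF j] sim_tape_def fst_conv snd_conv
    proof (intro conjI allI exI)
      fix x :: int
      let ?c = "if x < 0 then 0 else if x = 0 then ?s + 1 + wt j 0 else wt j (nat x)"
      show "(if x < 0 then 0 else wt j (nat x)) < ?s" using wt3(1)[of j "nat x"] tm by auto
      show "decode_sym ?s ?c = (if x < 0 then 0 else wt j (nat x))"
        using wt3(1)[of j "nat x"] tm by (auto simp: decode_sym_def)
      show "?c > ?s \<longleftrightarrow> x = 0" "?c \<le> 2 * ?s" using wt3(1)[of j "nat x"] wt3(1)[of j 0] tm by auto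
      show "?c \<noteq> 0 \<longleftrightarrow> 0 \<le> x \<and> x \<le> (if j = 0 \<and> w \<noteq> [] then int (length w) - 1 else 0)"
        using wt3(2)[of j "nat x"] by auto
    qed (cases w, auto)
    then show "sim_tape ?s (length w) (snd (tm_init M w) ! j) (?\<sigma>1 (2 + j))" unfolding t .
  qed
  let ?cfg = "(tm_step M ^^ t) (tm_init M w)"
  obtain \<sigma>2 where \<sigma>2: "exec (Loop stape (\<lambda>q. q \<notin> {1, 2}) sim_body) ?\<sigma>1 (4 * t + 1) \<sigma>2"
    "sim (length w + t) \<sigma> ?cfg \<sigma>2"
    using sim_loop[OF init, of t] halt unfolding tm_state_after_def by blast
  let ?\<sigma>3 = "\<lambda>j. if 2 \<le> j \<and> j < 2 + ?K then ar (\<lambda>_. 0) else \<sigma>2 j"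
  have 1: "exec (Act mtapes (\<lambda>r k. (cap s (?s + 1 + r k), Stay))) \<sigma> 1 ?\<sigma>1" by (rule exec.Act)
  have 3: "exec (cleans ?s 2 ?K) \<sigma>2 (?K * (20 * (length w + t + 2) + 1) + 1) ?\<sigma>3"
  proof (rule exec_cleans)
    fix j assume "2 \<le> j" "j < 2 + ?K"
    then show "\<exists>x. sim_tape ?s (length w + t) x (\<sigma>2 j)"
      using \<sigma>2(2) unfolding sim_def by (metis add_diff_inverse_nat nat_add_left_cancel_less not_less)
  qed
  have rd: "read_tape (?\<sigma>3 stape) = tm_state_after M w t"
    using \<sigma>2(2) by (simp add: sim_def tm_state_after_def)
  have a3: "?\<sigma>3 ans = cn x" using \<sigma>2(2) ans by (simp add: sim_def)
  let ?\<sigma>4 = "?\<sigma>3(ans := cn (if tm_state_after M w t = 1 then Suc x else x))"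
  have 4: "exec (Cond stape (\<lambda>q. q = 1) (inc ans) skip) ?\<sigma>3 4 ?\<sigma>4"
  proof (cases "tm_state_after M w t = 1")
    case True
    have "exec (Cond stape (\<lambda>q. q = 1) (inc ans) skip) ?\<sigma>3 (3 + 1) (?\<sigma>3(ans := cn (Suc x)))"
      by (rule exec.CondT[OF _ exec_inc[of ?\<sigma>3 ans x, OF a3]]) (simp only: rd True)
    then show ?thesis unfolding if_P[OF True] by (rule exec.Weaken) simp
  next
    case False
    have e: "?\<sigma>4 = ?\<sigma>3" unfolding if_not_P[OF False] by (rule fun_upd_idem[of ?\<sigma>3 ans "cn x", OF a3])
    have "exec (Cond stape (\<lambda>q. q = 1) (inc ans) skip) ?\<sigma>3 (1 + 1) ?\<sigma>3"
      by (rule exec.CondF[OF _ exec_skip]) (simp only: rd False not_False_eq_True)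
    then show ?thesis unfolding e by (rule exec.Weaken) simp
  qed
  have 5: "exec (wr stape 0) ?\<sigma>4 1 (?\<sigma>4(stape := ar (\<lambda>_. 0)))"
  proof -
    have "((fst (?\<sigma>4 stape))(snd (?\<sigma>4 stape) := 0), snd (?\<sigma>4 stape)) = ar (\<lambda>_. 0)"
      using \<sigma>2(2) ans by (auto simp: sim_def ar_at_def fun_eq_iff)
    then show ?thesis using exec_wr[of stape 0 ?\<sigma>4] by simp
  qed
  have 6: "?\<sigma>4(stape := ar (\<lambda>_. 0)) = \<sigma>(2 := ar (\<lambda>_. 0), ans := cn (if tm_state_after M w t = 1 then Suc x else x))"
  proof
    fix k
    consider "k = stape" | "k = 2" "k \<noteq> stape" | "3 \<le> k" "k < stape" | "k = ans" "k > stape" | "k \<notin> {2..stape}" "k \<noteq> ans"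
      using ans(1) by (metis Suc_leI atLeastAtMost_iff linorder_neqE_nat not_le numeral_2_eq_2 numeral_3_eq_3)
    then show "(?\<sigma>4(stape := ar (\<lambda>_. 0))) k = (\<sigma>(2 := ar (\<lambda>_. 0), ans := cn (if tm_state_after M w t = 1 then Suc x else x))) k"
    proof cases
      case 1
      then show ?thesis using \<sigma>(2)[of stape] ans(1) tm(1) by simp
    next
      case 2
      then show ?thesis using ans(1) tm(1) by simp
    next
      case 3
      then show ?thesis using \<sigma>(2)[of k] ans(1) by simp
    next
      case 4
      then show ?thesis by simp
    next
      case 5
      then have "\<sigma>2 k = \<sigma> k" using \<sigma>2(2) unfolding sim_def by blast
      then show ?thesis using 5 by auto
    qed
  qed
  show ?thesis unfolding run_tm_def
    by (rule exec_SeqI[OF 1 exec_SeqI[OF \<sigma>2(1) exec_SeqI[OF 3 exec_SeqI[OF 4 5[unfolded 6] order.refl] order.refl] order.refl]]) simp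
qed

end

declare upt_Suc [simp]

section \<open>Assignments and array fills on a fixed store layout\<close>

definition st :: "nat \<Rightarrow> (nat \<Rightarrow> nat \<Rightarrow> nat) \<Rightarrow> nat list \<Rightarrow> store" where
  "st bs A \<rho> k = (if k < bs then ar (A k) else if k - bs < length \<rho> then cn (\<rho> ! (k - bs)) else cn 0)"

definition small_arrays :: "(nat \<Rightarrow> nat \<Rightarrow> nat) \<Rightarrow> bool" where
  "small_arrays A \<longleftrightarrow> (\<forall>a<2. \<forall>i. A a i \<le> 3)"

lemma frame_st:
  "2 \<le> bs \<Longrightarrow> small_arrays A \<Longrightarrow> frame bs A [0..<length \<rho>] \<rho> (length \<rho>) (st bs A \<rho>)"
  by (auto simp: frame_def st_def small_arrays_def)

lemma st_counter: "x < length \<rho> \<Longrightarrow> st bs A \<rho> (bs + x) = cn (\<rho> ! x)"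
  by (simp add: st_def)

lemma st_update: "x < length \<rho> \<Longrightarrow> (st bs A \<rho>)(bs + x := cn v) = st bs A (\<rho>[x := v])"
  by (auto simp: fun_eq_iff st_def nth_list_update)

lemma st_scratch_update: "length \<rho> \<le> x \<Longrightarrow> (st bs A \<rho>)(bs + x := cn 0) = st bs A \<rho>"
  by (auto simp: fun_eq_iff st_def)

lemma st_array_update: "a < bs \<Longrightarrow> (st bs A \<rho>)(a := ar w) = st bs (A(a := w)) \<rho>"
  by (auto simp: fun_eq_iff st_def)

definition assign :: "nat \<Rightarrow> nat \<Rightarrow> nat \<Rightarrow> exp \<Rightarrow> com" where
  "assign bs n x e = eval_com bs e [0..<n] n ;; clear (bs + x) ;; addto (bs + n) (bs + x)"

lemma exec_assign:
  assumes "scoped e n" "x < n"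
  shows "\<exists>T. polyb T \<and> (\<forall>bs A \<rho> S. 2 \<le> bs \<longrightarrow> small_arrays A \<longrightarrow> length \<rho> = n \<longrightarrow> (\<forall>y\<in>set \<rho>. y \<le> S) \<longrightarrow>
     eval e A \<rho> \<le> T S \<and> exec (assign bs n x e) (st bs A \<rho>) (T S) (st bs A (\<rho>[x := eval e A \<rho>])))"
proof -
  obtain T where T: "computes e T" using computes_exp by blast
  have "eval e A \<rho> \<le> 7 * T S + 4 * S + 4 \<and>
      exec (assign bs n x e) (st bs A \<rho>) (7 * T S + 4 * S + 4) (st bs A (\<rho>[x := eval e A \<rho>]))"
    if A: "2 \<le> bs" "small_arrays A" "length \<rho> = n" "\<forall>y\<in>set \<rho>. y \<le> S" for bs A \<rho> S
  proof -
    let ?\<sigma> = "st bs A \<rho>" and ?v = "eval e A \<rho>"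
    have 1: "?v \<le> T S" "exec (eval_com bs e [0..<n] n) ?\<sigma> (T S) (?\<sigma>(bs + n := cn ?v))"
      using computesD[OF T _ frame_st[OF A(1,2)] A(4)] A(3) assms(1) by auto
    let ?\<sigma>1 = "?\<sigma>(bs + n := cn ?v)"
    have 2: "exec (clear (bs + x)) ?\<sigma>1 (4 * (\<rho> ! x) + 1) (?\<sigma>1(bs + x := cn 0))"
      by (rule exec_clear) (use assms(2) A(3) in \<open>auto simp: st_counter\<close>)
    let ?\<sigma>2 = "?\<sigma>1(bs + x := cn 0)"
    have 3: "exec (addto (bs + n) (bs + x)) ?\<sigma>2 (6 * ?v + 1) (?\<sigma>2(bs + n := cn 0, bs + x := cn (?v + 0)))"
      by (rule exec_addto) (use assms(2) in auto)
    have "?\<sigma>2(bs + n := cn 0, bs + x := cn (?v + 0)) = (?\<sigma>(bs + n := cn 0))(bs + x := cn ?v)"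
      using assms(2) by (auto simp: fun_eq_iff)
    also have "\<dots> = st bs A (\<rho>[x := ?v])"
      using assms(2) A(3) by (simp add: st_scratch_update st_update del: fun_upd_apply)
    finally have 4: "?\<sigma>2(bs + n := cn 0, bs + x := cn (?v + 0)) = st bs A (\<rho>[x := ?v])" .
    have "\<rho> ! x \<le> S" using A(3,4) assms(2) by simp
    then have "exec (assign bs n x e) ?\<sigma> (7 * T S + 4 * S + 4) (st bs A (\<rho>[x := ?v]))"
      unfolding assign_def using 1(1)
      by (intro exec_SeqI[OF 1(2) exec_SeqI[OF 2 3[unfolded 4] order.refl]]) simp
    then show ?thesis using 1(1) by simp
  qed
  moreover have "polyb (\<lambda>S. 7 * T S + 4 * S + 4)"
    using T unfolding computes_def by (intro polyb_intros) auto
  ultimately show ?thesis by blast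
qed

lemma symbols_below_assign: "2 \<le> s \<Longrightarrow> symbols_below s (assign bs n x e)"
  by (simp add: assign_def symbols_below_basic symbols_below_eval_com)

primrec write_from :: "nat \<Rightarrow> nat \<Rightarrow> nat \<Rightarrow> nat \<Rightarrow> com" where
  "write_from a c s 0 = wr a s"
| "write_from a c s (Suc j) = Cond c nonzero (dec c ;; write_from a c (Suc s) j) (wr a s)"

lemma exec_write_from:
  "\<sigma> c = cn v \<Longrightarrow> v \<le> j \<Longrightarrow> \<sigma> a = ar_at w p \<Longrightarrow> a \<noteq> c \<Longrightarrow>
   exec (write_from a c s j) \<sigma> (3 * j + 2) (\<sigma>(c := cn 0, a := ar_at (w(p := s + v)) p))"
proof (induction j arbitrary: \<sigma> v s)
  case 0
  then have "\<sigma>(c := cn 0) = \<sigma>" by (auto simp: fun_eq_iff)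
  then have e: "\<sigma>(c := cn 0, a := ar_at (w(p := s + v)) p) = \<sigma>(a := ar_at (w(p := s)) p)"
    using 0 by simp
  show ?case unfolding e write_from.simps
    by (rule exec.Weaken[OF exec_wr_ar[of \<sigma> a w p s, OF 0(3)]]) simp
next
  case (Suc j)
  show ?case
  proof (cases v)
    case 0
    then have "\<sigma>(c := cn 0) = \<sigma>" using Suc by (auto simp: fun_eq_iff)
    then have e: "\<sigma>(c := cn 0, a := ar_at (w(p := s + v)) p) = \<sigma>(a := ar_at (w(p := s)) p)"
      using 0 by simp
    have "exec (write_from a c s (Suc j)) \<sigma> (1 + 1) (\<sigma>(a := ar_at (w(p := s)) p))"
      unfolding write_from.simps
      by (rule exec.CondF[OF _ exec_wr_ar[of \<sigma> a w p s, OF Suc.prems(3)]]) (use 0 Suc in \<open>simp add: read_cn nonzero_def\<close>)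
    then show ?thesis unfolding e by (rule exec.Weaken) simp
  next
    case (Suc u)
    let ?\<sigma> = "\<sigma>(c := cn u)"
    have 1: "exec (dec c) \<sigma> 1 ?\<sigma>" by (rule exec_dec) (use Suc Suc.prems in simp)
    have "exec (write_from a c (Suc s) j) ?\<sigma> (3 * j + 2) (?\<sigma>(c := cn 0, a := ar_at (w(p := Suc s + u)) p))"
      by (rule Suc.IH) (use Suc Suc.prems in auto)
    then have 2: "exec (write_from a c (Suc s) j) ?\<sigma> (3 * j + 2) (\<sigma>(c := cn 0, a := ar_at (w(p := s + v)) p))"
      using Suc by simp
    have "exec (dec c ;; write_from a c (Suc s) j) \<sigma> (3 * j + 4) (\<sigma>(c := cn 0, a := ar_at (w(p := s + v)) p))"
      by (rule exec_SeqI[OF 1 2]) simp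
    then have "exec (write_from a c s (Suc j)) \<sigma> (3 * j + 4 + 1) (\<sigma>(c := cn 0, a := ar_at (w(p := s + v)) p))"
      unfolding write_from.simps by (rule exec.CondT[rotated]) (use Suc Suc.prems in \<open>simp add: read_cn nonzero_def\<close>)
    then show ?thesis by (rule exec.Weaken) simp
  qed
qed

lemma symbols_below_write_from: "2 \<le> t \<Longrightarrow> s + j < t \<Longrightarrow> symbols_below t (write_from a c s j)"
  by (induction j arbitrary: s) (auto simp: symbols_below_basic)

text \<open>Lookups reach the arrays 0 and 1 only, so writing the query word to tape 2 does not
  disturb the expressions that produce it.\<close>

lemma eval_cong:
  "scoped e (length \<rho>) \<Longrightarrow> A 0 = A' 0 \<Longrightarrow> A 1 = A' 1 \<Longrightarrow> eval e A \<rho> = eval e A' \<rho>"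
proof (induction e arbitrary: \<rho>)
  case (Lk k a)
  then have "A k = A' k" by (cases k) (auto simp: less_Suc_eq numeral_2_eq_2)
  then show ?case using Lk by simp
next
  case (Call f es)
  have "map (\<lambda>e. eval e A \<rho>) es = map (\<lambda>e. eval e A' \<rho>) es"
    using Call by (auto simp: list_all_iff)
  moreover have "eval f A vs = eval f A' vs" if "length vs = length es" for vs
    using Call that by simp
  ultimately show ?case by (simp del: map_eq_conv)
qed auto

definition fill :: "nat \<Rightarrow> nat \<Rightarrow> nat \<Rightarrow> exp \<Rightarrow> exp \<Rightarrow> exp \<Rightarrow> com" where
  "fill bs n a off len e =
     eval_com bs len [0..<n] n ;;
     times (bs + n)
       (eval_com bs e ([0..<n] @ [n + 1]) (n + 2) ;;
        eval_com bs off [0..<n] (n + 3) ;;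
        copy (bs + n + 1) (bs + n + 3) (bs + n + 4) ;;
        times (bs + n + 3) (mv a Go_Right ;; inc (bs + n + 4)) ;;
        write_from a (bs + n + 2) 0 3 ;;
        times (bs + n + 4) (mv a Go_Left) ;;
        inc (bs + n + 1)) ;;
     clear (bs + n + 1)"

lemma symbols_below_fill: "4 \<le> s \<Longrightarrow> symbols_below s (fill bs n a off len e)"
  by (simp add: fill_def symbols_below_basic symbols_below_eval_com symbols_below_write_from)

lemma exec_walk_right:
  assumes "\<sigma> a = ar_at w 0" "\<sigma> k = cn p" "\<sigma> j = cn 0" "distinct [a, k, j]"
  shows "exec (times k (mv a Go_Right ;; inc j)) \<sigma> (8 * p + 1) (\<sigma>(a := ar_at w p, k := cn 0, j := cn p))"
proof -
  let ?S = "\<lambda>i. \<sigma>(a := ar_at w (p - i), k := cn i, j := cn (p - i))"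
  have "exec (times k (mv a Go_Right ;; inc j)) (?S p) (p * (5 + 3) + 1) (?S 0)"
  proof (rule exec_times)
    fix i assume i: "i < p"
    let ?s = "(?S (Suc i))(k := cn i)"
    have 1: "exec (mv a Go_Right) ?s 1 (?s(a := ar_at w (Suc (p - Suc i))))"
      by (rule exec_mv_right) (use assms in auto)
    let ?s1 = "?s(a := ar_at w (Suc (p - Suc i)))"
    have 2: "exec (inc j) ?s1 3 (?s1(j := cn (Suc (p - Suc i))))"
      by (rule exec_inc) (use assms in auto)
    have "p - i = Suc (p - Suc i)" using i by simp
    then have 3: "?s1(j := cn (Suc (p - Suc i))) = ?S i"
      using assms by (auto simp: fun_eq_iff)
    show "exec (mv a Go_Right ;; inc j) ?s 5 (?S i)"
      by (rule exec_SeqI[OF 1 2[unfolded 3]]) simp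
  qed (use assms in auto)
  moreover have "?S p = \<sigma>" using assms by (auto simp: fun_eq_iff)
  ultimately show ?thesis by (simp add: mult.commute)
qed

lemma exec_walk_left:
  assumes "\<sigma> a = ar_at w p" "\<sigma> j = cn p" "a \<noteq> j"
  shows "exec (times j (mv a Go_Left)) \<sigma> (4 * p + 1) (\<sigma>(a := ar_at w 0, j := cn 0))"
proof -
  let ?S = "\<lambda>i. \<sigma>(a := ar_at w i, j := cn i)"
  have "exec (times j (mv a Go_Left)) (?S p) (p * (1 + 3) + 1) (?S 0)"
  proof (rule exec_times)
    fix i assume i: "i < p"
    let ?s = "(?S (Suc i))(j := cn i)"
    have "exec (mv a Go_Left) ?s 1 (?s(a := ar_at w i))"
      by (rule exec_mv_left) (use assms in auto)
    moreover have "?s(a := ar_at w i) = ?S i" using assms by (auto simp: fun_eq_iff)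
    ultimately show "exec (mv a Go_Left) ?s 1 (?S i)" by simp
  qed (use assms in auto)
  moreover have "?S p = \<sigma>" using assms by (auto simp: fun_eq_iff)
  ultimately show ?thesis by (simp add: mult.commute)
qed

text \<open>Both \<open>e\<close> and \<open>off\<close> are evaluated again in every round, while
  the array is partly overwritten; hence the hypothesis that they do not depend on it. Values of at
  most 3 keep the array legal for later lookups.\<close>

lemma exec_fill:
  assumes sc: "scoped off n" "scoped len n" "scoped e (Suc n)"
  shows "\<exists>T. polyb T \<and> (\<forall>bs A \<rho> S a. 2 \<le> bs \<longrightarrow> small_arrays A \<longrightarrow> length \<rho> = n \<longrightarrow> (\<forall>y\<in>set \<rho>. y \<le> S) \<longrightarrow> a < bs \<longrightarrow>
     (\<forall>w i. eval e (A(a := w)) (\<rho> @ [i]) = eval e A (\<rho> @ [i]) \<and> eval off (A(a := w)) \<rho> = eval off A \<rho>) \<longrightarrow>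
     (\<forall>i<eval len A \<rho>. eval e A (\<rho> @ [i]) \<le> 3) \<longrightarrow>
     eval len A \<rho> \<le> T S \<and>
     exec (fill bs n a off len e) (st bs A \<rho>) (T S)
       (st bs (A(a := (\<lambda>j. if eval off A \<rho> \<le> j \<and> j < eval off A \<rho> + eval len A \<rho>
                            then eval e A (\<rho> @ [j - eval off A \<rho>]) else A a j))) \<rho>))"
proof -
  obtain To Tl Te where T: "computes off To" "computes len Tl" "computes e Te" using computes_exp by blast
  define B where "B S = Te (S + Tl S) + 15 * To S + 30 * Tl S + 40" for S
  define R where "R S = 5 * Tl S + Tl S * (B S + 3) + 10" for S
  have "eval len A \<rho> \<le> R S \<and> exec (fill bs n a off len e) (st bs A \<rho>) (R S)
       (st bs (A(a := (\<lambda>j. if eval off A \<rho> \<le> j \<and> j < eval off A \<rho> + eval len A \<rho>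
                            then eval e A (\<rho> @ [j - eval off A \<rho>]) else A a j))) \<rho>)"
    if H: "2 \<le> bs" "small_arrays A" "length \<rho> = n" "\<forall>y\<in>set \<rho>. y \<le> S" "a < bs"
      and ev: "\<And>w i. eval e (A(a := w)) (\<rho> @ [i]) = eval e A (\<rho> @ [i])" "\<And>w. eval off (A(a := w)) \<rho> = eval off A \<rho>"
      and le3: "\<And>i. i < eval len A \<rho> \<Longrightarrow> eval e A (\<rho> @ [i]) \<le> 3"
    for bs A \<rho> S a
  proof -
    define o' where "o' = eval off A \<rho>"
    define L where "L = eval len A \<rho>"
    define f where "f i = eval e A (\<rho> @ [i])" for i
    define w where "w i = (\<lambda>j. if o' \<le> j \<and> j < o' + (L - i) then f (j - o') else A a j)" for i
    let ?A = "\<lambda>i. A(a := w i)"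
    let ?S = "\<lambda>i. (st bs (?A i) \<rho>)(bs + n := cn i, bs + n + 1 := cn (L - i))"
    let ?c = "eval_com bs e ([0..<n] @ [n + 1]) (n + 2) ;;
        eval_com bs off [0..<n] (n + 3) ;;
        copy (bs + n + 1) (bs + n + 3) (bs + n + 4) ;;
        times (bs + n + 3) (mv a Go_Right ;; inc (bs + n + 4)) ;;
        write_from a (bs + n + 2) 0 3 ;;
        times (bs + n + 4) (mv a Go_Left) ;;
        inc (bs + n + 1)"
    have small: "small_arrays (?A i)" for i
      using H(2) le3 unfolding small_arrays_def w_def f_def L_def by auto
    have fr: "frame bs (?A i) [0..<n] \<rho> n (st bs (?A i) \<rho>)" for i
      using frame_st[OF H(1) small[of i], of \<rho>] H(3) by simp
    have L: "L \<le> Tl S" "exec (eval_com bs len [0..<n] n) (st bs A \<rho>) (Tl S) ((st bs A \<rho>)(bs + n := cn L))"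
      using computesD[OF T(2) _ frame_st[OF H(1,2)] H(4)] H(3) sc(2) unfolding L_def by auto
    have wL: "?A L = A" by (auto simp: w_def fun_eq_iff)
    have ole: "o' \<le> To S" using computesD(1)[OF T(1) _ frame_st[OF H(1,2)] H(4)] sc(1) H(3) unfolding o'_def by simp
    have body: "exec ?c ((?S (Suc i))(bs + n := cn i)) (B S) (?S i)" if i: "i < L" for i
    proof -
      define t where "t = L - Suc i"
      have t: "L - i = Suc t" "t < L" using i by (auto simp: t_def)
      let ?s = "(?S (Suc i))(bs + n := cn i)"
      have b1: "\<forall>y\<in>set (\<rho> @ [t]). y \<le> S + Tl S" using H(4) L(1) t by (auto simp: trans_le_add1)
      have "frame bs (?A (Suc i)) ([0..<n] @ [n + 1]) (\<rho> @ [t]) (n + 2) ?s"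
        using frame_snoc[OF frame_upd[OF frame_upd[OF fr, of n "n + 1" "Suc i" "cn i"], of "n + 1" "n + 2" "cn t"], of "n + 1" t]
        by (simp add: add.assoc fun_upd_twist t_def)
      note 1 = computesD[OF T(3) _ this b1]
      have f1: "exec (eval_com bs e ([0..<n] @ [n + 1]) (n + 2)) ?s (Te (S + Tl S)) (?s(bs + (n + 2) := cn (f t)))"
        using 1(2) sc(3) H(3) ev(1) by (simp add: f_def del: fun_upd_apply)
      have ft: "f t \<le> 3" using le3 t unfolding f_def L_def by simp
      let ?s1 = "?s(bs + (n + 2) := cn (f t))"
      have "frame bs (?A (Suc i)) [0..<n] \<rho> (n + 3) ?s1"
        using frame_upd[OF frame_upd[OF frame_upd[OF fr, of n "n + 1" "Suc i" "cn i"], of "n + 1" "n + 2" "cn t"], of "n + 2" "n + 3" "cn (f t)"]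
        by (simp add: add.assoc fun_upd_twist t_def)
      note 2 = computesD[OF T(1) _ this H(4)]
      have f2: "exec (eval_com bs off [0..<n] (n + 3)) ?s1 (To S) (?s1(bs + (n + 3) := cn o'))"
        using 2(2) sc(1) H(3) ev(2) by (simp add: o'_def del: fun_upd_apply)
      let ?s2 = "?s1(bs + (n + 3) := cn o')"
      have f3: "exec (copy (bs + n + 1) (bs + n + 3) (bs + n + 4)) ?s2 (16 * t + 3) (?s2(bs + n + 3 := cn (t + o')))"
        by (rule exec_copy) (use H(3) in \<open>auto simp: t_def st_def add.assoc\<close>)
      let ?s3 = "?s2(bs + n + 3 := cn (t + o'))"
      have f4: "exec (times (bs + n + 3) (mv a Go_Right ;; inc (bs + n + 4))) ?s3 (8 * (t + o') + 1)
          (?s3(a := ar_at (w (Suc i)) (t + o'), bs + n + 3 := cn 0, bs + n + 4 := cn (t + o')))"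
        by (rule exec_walk_right) (use H(3,5) in \<open>auto simp: t_def st_def\<close>)
      let ?s4 = "?s3(a := ar_at (w (Suc i)) (t + o'), bs + n + 3 := cn 0, bs + n + 4 := cn (t + o'))"
      have f5: "exec (write_from a (bs + n + 2) 0 3) ?s4 (3 * 3 + 2)
          (?s4(bs + n + 2 := cn 0, a := ar_at ((w (Suc i))(t + o' := 0 + f t)) (t + o')))"
        by (rule exec_write_from) (use H(5) ft in \<open>auto simp: add.assoc\<close>)
      let ?s5 = "?s4(bs + n + 2 := cn 0, a := ar_at ((w (Suc i))(t + o' := 0 + f t)) (t + o'))"
      have f6: "exec (times (bs + n + 4) (mv a Go_Left)) ?s5 (4 * (t + o') + 1)
          (?s5(a := ar_at ((w (Suc i))(t + o' := 0 + f t)) 0, bs + n + 4 := cn 0))"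
        by (rule exec_walk_left) (use H(5) in auto)
      let ?s6 = "?s5(a := ar_at ((w (Suc i))(t + o' := 0 + f t)) 0, bs + n + 4 := cn 0)"
      have f7: "exec (inc (bs + n + 1)) ?s6 3 (?s6(bs + n + 1 := cn (Suc t)))"
        by (rule exec_inc) (use H(5) in \<open>auto simp: t_def\<close>)
      have ww: "(w (Suc i))(t + o' := 0 + f t) = w i"
        using t by (auto simp: fun_eq_iff w_def)
      have e: "?s6(bs + n + 1 := cn (Suc t)) = ?S i"
        unfolding ww using H(3,5) t by (auto simp: fun_eq_iff st_def add.assoc)
      show ?thesis
        by (rule exec_SeqI[OF f1 exec_SeqI[OF f2 exec_SeqI[OF f3 exec_SeqI[OF f4 exec_SeqI[OF f5
          exec_SeqI[OF f6 f7[unfolded e] order.refl] order.refl] order.refl] order.refl] order.refl]])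
          (use ole t L(1) in \<open>simp add: B_def\<close>)
    qed
    have loop: "exec (times (bs + n) ?c) (?S L) (L * (B S + 3) + 1) (?S 0)"
      by (rule exec_times[OF _ body]) auto
    have e1: "(st bs A \<rho>)(bs + n := cn L) = ?S L"
      unfolding wL using H(3) by (auto simp: fun_eq_iff st_def)
    have f8: "exec (clear (bs + n + 1)) (?S 0) (4 * L + 1) ((?S 0)(bs + n + 1 := cn 0))"
      by (rule exec_clear) auto
    have e2: "(?S 0)(bs + n + 1 := cn 0) = st bs (?A 0) \<rho>"
      using H(3) by (auto simp: fun_eq_iff st_def)
    have "L * (B S + 3) \<le> Tl S * (B S + 3)" using L by simp
    then have "exec (fill bs n a off len e) (st bs A \<rho>) (R S) (st bs (?A 0) \<rho>)"
      unfolding fill_def using L(1)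
      by (intro exec_SeqI[OF L(2)[unfolded e1] exec_SeqI[OF loop f8[unfolded e2] order.refl]]) (unfold R_def, linarith)
    moreover have "L \<le> R S" using L(1) by (simp add: R_def)
    ultimately show ?thesis unfolding w_def o'_def L_def f_def by simp
  qed
  moreover have "polyb R"
    unfolding R_def B_def using T unfolding computes_def by (intro polyb_intros polyb_bound) auto
  ultimately show ?thesis by blast
qed

subsection \<open>Bicliques in dense graphs\<close>

text \<open>The tangent of the power function at the mean lies below its graph, which is Bernoulli's
  inequality; summed over \<open>X\<close>, the linear terms cancel.\<close>

lemma power_mean:
  fixes f :: "'a \<Rightarrow> real"
  assumes "finite X" "X \<noteq> {}" "\<And>x. x \<in> X \<Longrightarrow> 0 \<le> f x"
  shows "(sum f X / card X) ^ t * card X \<le> (\<Sum>x\<in>X. f x ^ t)"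
proof -
  define a where "a = sum f X / card X"
  have c: "real (card X) > 0" using assms by (simp add: card_gt_0_iff)
  have a0: "0 \<le> a" unfolding a_def using assms(3) by (simp add: sum_nonneg)
  show ?thesis
  proof (cases "a = 0 \<or> t = 0")
    case True
    show ?thesis
    proof (cases t)
      case (Suc n)
      then have "a ^ t = 0" using True by simp
      then have "(sum f X / card X) ^ t * card X = 0" unfolding a_def by simp
      then show ?thesis using assms(3) by (simp only: sum_nonneg zero_le_power)
    qed simp
  next
    case False
    then have ap: "a > 0" using a0 by simp
    have tangent: "a ^ t + real t * a ^ t * (f x / a - 1) \<le> f x ^ t" if "x \<in> X" for x
    proof -
      have "1 + real t * (f x / a - 1) \<le> (1 + (f x / a - 1)) ^ t"
        by (rule Bernoulli_inequality) (use ap assms(3)[OF that] in simp)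
      then have "a ^ t * (1 + real t * (f x / a - 1)) \<le> a ^ t * (f x / a) ^ t"
        using ap by (intro mult_left_mono) auto
      also have "\<dots> = f x ^ t" using ap by (simp add: power_divide)
      finally show ?thesis by (simp add: algebra_simps)
    qed
    have "(\<Sum>x\<in>X. f x / a - 1) = 0"
    proof -
      have "(\<Sum>x\<in>X. f x / a - 1) = sum f X / a - card X"
        by (simp add: sum_subtractf sum_divide_distrib)
      then show ?thesis using c ap unfolding a_def by (auto simp: field_simps)
    qed
    then have "a ^ t * card X = (\<Sum>x\<in>X. a ^ t + real t * a ^ t * (f x / a - 1))"
      by (simp add: sum.distrib sum_distrib_left[symmetric])
    also have "\<dots> \<le> (\<Sum>x\<in>X. f x ^ t)" by (rule sum_mono) (rule tangent)
    finally show ?thesis by (simp add: a_def)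
  qed
qed

text \<open>Repetitions are allowed, so that the number of tuples is an exact power and no binomial
  coefficients appear.\<close>

definition tuples :: "'a set \<Rightarrow> nat \<Rightarrow> 'a list set" where
  "tuples X t = {xs. set xs \<subseteq> X \<and> length xs = t}"

lemma finite_tuples: "finite X \<Longrightarrow> finite (tuples X t)"
  unfolding tuples_def by (rule finite_lists_length_eq)

lemma card_tuples: "finite X \<Longrightarrow> card (tuples X t) = card X ^ t"
  unfolding tuples_def by (rule card_lists_length_eq)

definition bicliques :: "('a \<Rightarrow> 'a \<Rightarrow> bool) \<Rightarrow> 'a set \<Rightarrow> nat \<Rightarrow> ('a list \<times> 'a list) set" where
  "bicliques R W t = {(xs, ys). xs \<in> tuples W t \<and> ys \<in> tuples W t \<and> (\<forall>u\<in>set xs. \<forall>v\<in>set ys. R u v)}"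

text \<open>Jensen's inequality is used twice, first for the degrees and then for the common degrees of tuples.\<close>

lemma card_bicliques_ge:
  fixes R :: "'a \<Rightarrow> 'a \<Rightarrow> bool"
  assumes W: "finite W" "W \<noteq> {}"
  defines "h \<equiv> card {(u, v). u \<in> W \<and> v \<in> W \<and> R u v}"
  shows "(real h / real (card W) ^ 2) ^ (t * t) * real (card W) ^ (2 * t) \<le> real (card (bicliques R W t))"
proof -
  define k where "k = real (card W)"
  have k: "k > 0" unfolding k_def using W by (simp add: card_gt_0_iff)
  define d where "d v = card {u \<in> W. R u v}" for v
  define n where "n xs = card {v \<in> W. \<forall>u\<in>set xs. R u v}" for xs
  have "{(u, v). u \<in> W \<and> v \<in> W \<and> R u v} = prod.swap ` (SIGMA v:W. {u \<in> W. R u v})" by auto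
  then have "h = card (SIGMA v:W. {u \<in> W. R u v})"
    unfolding h_def by (simp add: card_image inj_on_def)
  then have h: "h = (\<Sum>v\<in>W. d v)" unfolding d_def using W by (simp add: card_SigmaI)
  have ind: "real (card {x \<in> X. P x}) = (\<Sum>x\<in>X. of_bool (P x))" if "finite X" for X :: "'b set" and P
    using that by (simp add: Int_def of_bool_def sum.If_cases)
  have dt: "real (d v) ^ t = (\<Sum>xs\<in>tuples W t. of_bool (\<forall>u\<in>set xs. R u v))" for v
  proof -
    have "tuples {u \<in> W. R u v} t = {xs \<in> tuples W t. \<forall>u\<in>set xs. R u v}"
      unfolding tuples_def by auto
    then have "d v ^ t = card {xs \<in> tuples W t. \<forall>u\<in>set xs. R u v}"
      unfolding d_def using W by (simp add: card_tuples[symmetric])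
    then show ?thesis using ind[OF finite_tuples[OF W(1)]] by (simp flip: of_nat_power)
  qed
  \<comment> \<open>Double counting of the pairs of a tuple and a common neighbour of it.\<close>
  have "(\<Sum>xs\<in>tuples W t. real (n xs)) = (\<Sum>xs\<in>tuples W t. \<Sum>v\<in>W. of_bool (\<forall>u\<in>set xs. R u v))"
    unfolding n_def using ind[OF W(1)] by simp
  also have "\<dots> = (\<Sum>v\<in>W. real (d v) ^ t)" unfolding dt by (rule sum.swap)
  also have "\<dots> \<ge> (real h / k) ^ t * k"
    using power_mean[OF W, of "\<lambda>v. real (d v)" t] unfolding h k_def by simp
  finally have sum_n: "(real h / k) ^ t * k \<le> (\<Sum>xs\<in>tuples W t. real (n xs))" .
  have ct: "real (card (tuples W t)) = k ^ t" unfolding k_def using W by (simp add: card_tuples)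
  have ne: "tuples W t \<noteq> {}"
  proof -
    obtain w where "w \<in> W" using W by auto
    then have "replicate t w \<in> tuples W t" unfolding tuples_def by auto
    then show ?thesis by auto
  qed
  have "bicliques R W t = (SIGMA xs:tuples W t. tuples {v \<in> W. \<forall>u\<in>set xs. R u v} t)"
    unfolding bicliques_def tuples_def by auto
  then have "card (bicliques R W t) = (\<Sum>xs\<in>tuples W t. n xs ^ t)"
    unfolding n_def using W by (simp add: card_SigmaI finite_tuples card_tuples)
  then have cb: "real (card (bicliques R W t)) = (\<Sum>xs\<in>tuples W t. real (n xs) ^ t)" by simp
  have "(real h / k ^ 2) ^ (t * t) * k ^ (2 * t) = (((real h / k) ^ t * k) / k ^ t) ^ t * k ^ t"
  proof -
    have "((real h / k) ^ t * k) / k ^ t = (real h / k ^ 2) ^ t * k"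
      using k by (simp add: power_divide power2_eq_square power_mult_distrib)
    then show ?thesis by (simp add: power_mult_distrib power_mult[symmetric] mult_2 power_add mult.assoc)
  qed
  also have "\<dots> \<le> ((\<Sum>xs\<in>tuples W t. real (n xs)) / k ^ t) ^ t * k ^ t"
    using k sum_n by (intro mult_right_mono power_mono divide_right_mono) auto
  also have "\<dots> \<le> (\<Sum>xs\<in>tuples W t. real (n xs) ^ t)"
    using power_mean[OF finite_tuples[OF W(1)] ne, of "\<lambda>xs. real (n xs)" t] unfolding ct by simp
  finally show ?thesis unfolding cb k_def .
qed

subsection \<open>Digits\<close>

definition dig :: "nat \<Rightarrow> nat \<Rightarrow> nat \<Rightarrow> nat" where "dig b u j = u div b ^ j mod b"

lemma dig_less: "0 < b \<Longrightarrow> dig b u j < b" by (simp add: dig_def)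

lemma dig_eq_mod: "(\<forall>j<n. dig b u j = dig b v j) \<Longrightarrow> u mod b ^ n = v mod b ^ n"
  by (induction n) (auto simp: dig_def mod_mult2_eq mult.commute[of b])

lemma dig_inj:
  assumes "u < b ^ n" "v < b ^ n" "\<forall>j<n. dig b u j = dig b v j" shows "u = v"
  using dig_eq_mod[OF assms(3)] assms(1,2) by simp

lemma bij_digits:
  assumes "0 < b"
  shows "bij_betw (\<lambda>u. \<lambda>j\<in>{..<n}. dig b u j) {..<b ^ n} ({..<n} \<rightarrow>\<^sub>E {..<b})"
proof -
  let ?f = "\<lambda>u. \<lambda>j\<in>{..<n}. dig b u j"
  have inj: "inj_on ?f {..<b ^ n}"
  proof (rule inj_onI)
    fix u v assume "u \<in> {..<b ^ n}" "v \<in> {..<b ^ n}" "?f u = ?f v"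
    then have uv: "u < b ^ n" "v < b ^ n" and eq: "\<And>j. ?f u j = ?f v j" by (auto dest: fun_cong)
    have "dig b u j = dig b v j" if "j < n" for j using eq[of j] that by simp
    then show "u = v" using dig_inj[of u b n v] uv by simp
  qed
  moreover have "?f ` {..<b ^ n} = {..<n} \<rightarrow>\<^sub>E {..<b}"
  proof (rule card_subset_eq)
    show "finite ({..<n} \<rightarrow>\<^sub>E {..<b})" by (intro finite_PiE) auto
    show "?f ` {..<b ^ n} \<subseteq> {..<n} \<rightarrow>\<^sub>E {..<b}"
      using dig_less[OF assms] by (auto simp: PiE_iff split: if_splits)
    show "card (?f ` {..<b ^ n}) = card ({..<n} \<rightarrow>\<^sub>E {..<b})"
      using inj by (simp add: card_image card_PiE)
  qed
  ultimately show ?thesis by (simp add: bij_betw_def)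
qed

lemma card_digits:
  assumes "0 < b" "\<And>j. j < n \<Longrightarrow> X j \<subseteq> {..<b}"
  shows "card {u. u < b ^ n \<and> (\<forall>j<n. dig b u j \<in> X j)} = (\<Prod>j<n. card (X j))"
proof -
  let ?f = "\<lambda>u. \<lambda>j\<in>{..<n}. dig b u j"
  let ?U = "{u. u < b ^ n \<and> (\<forall>j<n. dig b u j \<in> X j)}"
  have bij: "bij_betw ?f {..<b ^ n} ({..<n} \<rightarrow>\<^sub>E {..<b})" by (rule bij_digits[OF assms(1)])
  have "?f ` ?U = Pi\<^sub>E {..<n} X"
  proof
    show "?f ` ?U \<subseteq> Pi\<^sub>E {..<n} X"
    proof
      fix g assume "g \<in> ?f ` ?U"
      then obtain u where "u \<in> ?U" "g = ?f u" by blast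
      then show "g \<in> Pi\<^sub>E {..<n} X" by (simp add: PiE_iff)
    qed
    show "Pi\<^sub>E {..<n} X \<subseteq> ?f ` ?U"
    proof
      fix g assume g: "g \<in> Pi\<^sub>E {..<n} X"
      then have "g \<in> {..<n} \<rightarrow>\<^sub>E {..<b}" using assms(2) by (auto simp: PiE_iff)
      then have "g \<in> ?f ` {..<b ^ n}" unfolding bij_betw_imp_surj_on[OF bij] .
      then obtain u where u: "u < b ^ n" "?f u = g" by (elim imageE) simp
      have "dig b u j \<in> X j" if "j < n" for j
        using PiE_mem[OF g, of j] that u(2) by auto
      then show "g \<in> ?f ` ?U" using u by blast
    qed
  qed
  moreover have "inj_on ?f ?U" using bij unfolding bij_betw_def by (auto elim: inj_on_subset)
  ultimately have "card ?U = card (Pi\<^sub>E {..<n} X)" using card_image[of ?f ?U] by (simp only:)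
  then show ?thesis by (simp add: card_PiE)
qed

text \<open>AM-GM in the form \<open>4 * x * y \<le> (x + y) ^ 2\<close>.\<close>

lemma mult_le_square_nat:
  fixes x y z :: nat assumes "x + y \<le> 2 * z" shows "x * y \<le> z * z"
proof -
  have "4 * (int x * int y) \<le> (int x + int y)\<^sup>2"
    using zero_le_power2[of "int x - int y"] by (simp add: power2_eq_square algebra_simps)
  also have "\<dots> \<le> (2 * int z)\<^sup>2" using assms by (intro power_mono) auto
  finally have "int (x * y) \<le> int (z * z)" by (simp add: power2_eq_square)
  then show ?thesis by linarith
qed

lemma mult3_less:
  fixes a b c z :: nat
  assumes "a \<le> z" "b \<le> z" "c \<le> z" "a < z \<or> b < z \<or> c < z"
  shows "a * (b * c) < z * (z * z)"
proof -
  have z: "(z - 1) * (z * z) < z * (z * z)" using assms by (intro mult_strict_right_mono) auto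
  from assms(4) show ?thesis
  proof (elim disjE)
    assume "a < z"
    then have "a * (b * c) \<le> (z - 1) * (z * z)" using assms by (intro mult_le_mono) auto
    then show ?thesis using z by linarith
  next
    assume "b < z"
    then have "b * (a * c) \<le> (z - 1) * (z * z)" using assms by (intro mult_le_mono) auto
    then have "b * (a * c) < z * (z * z)" using z by linarith
    then show ?thesis by (simp add: mult.left_commute)
  next
    assume "c < z"
    then have "c * (a * b) \<le> (z - 1) * (z * z)" using assms by (intro mult_le_mono) auto
    then have "c * (a * b) < z * (z * z)" using z by linarith
    then show ?thesis by (simp add: mult_ac)
  qed
qed

subsection \<open>The graph of a constraint satisfaction problem\<close>

text \<open>
  There are \<open>m\<close> clauses; block \<open>i\<close> consists of the \<open>\<beta>\<close> clauses \<open>cl i d\<close>. A vertex \<open>u\<close> picks, for every block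
  \<open>i\<close> and every \<open>r < 3\<close>, one clause of the block and a value for the variable of its \<open>r\<close>-th literal:
  both are read off digit \<open>3 * i + r\<close> of \<open>u\<close> in base \<open>2 * \<beta>\<close>. The dropped blocks \<open>D\<close> impose no
  constraints, and \<open>p\<close> is a partial assignment.
\<close>

locale csp =
  fixes m q \<beta> :: nat and var :: "nat \<Rightarrow> nat \<Rightarrow> nat" and sgn :: "nat \<Rightarrow> nat \<Rightarrow> bool"
    and p :: "nat \<Rightarrow> bool option" and D :: "nat set"
  assumes \<beta>: "2 \<le> \<beta>"
begin

text \<open>The index wraps around, so that every block has \<beta> entries even past the end of the
  formula.\<close>

definition cl :: "nat \<Rightarrow> nat \<Rightarrow> nat" where "cl i d = (\<beta> * i + d) mod m"
definition pos :: "nat \<Rightarrow> nat \<Rightarrow> nat" where "pos u j = dig (2 * \<beta>) u j div 2"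
definition bit :: "nat \<Rightarrow> nat \<Rightarrow> bool" where "bit u j = odd (dig (2 * \<beta>) u j)"
definition pvar :: "nat \<Rightarrow> nat \<Rightarrow> nat" where "pvar j d = var (cl (j div 3) d) (j mod 3)"
definition falsified :: "nat \<Rightarrow> nat \<Rightarrow> nat \<Rightarrow> nat \<Rightarrow> bool" where
  "falsified u i d r \<longleftrightarrow> pos u (3 * i + r) = d \<and> bit u (3 * i + r) \<noteq> sgn (cl i d) r"
definition agrees :: "nat \<Rightarrow> bool" where
  "agrees u \<longleftrightarrow> (\<forall>j<3 * q. p (pvar j (pos u j)) \<in> {None, Some (bit u j)})"
text \<open>Two vertices can jointly falsify a clause that neither falsifies alone, so the block
  condition is on pairs. The relation may hold between a vertex and itself; loops are removed only
  in \<open>edges\<close>, which keeps the counting of ordered pairs free of exceptions.\<close>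

definition compat :: "nat \<Rightarrow> nat \<Rightarrow> bool" where
  "compat u v \<longleftrightarrow> agrees u \<and> agrees v \<and>
     (\<forall>j<3 * q. \<forall>j'<3 * q. pvar j (pos u j) = pvar j' (pos v j') \<longrightarrow> bit u j = bit v j') \<and>
     (\<forall>i<q. i \<notin> D \<longrightarrow> (\<forall>d<\<beta>. \<exists>r<3. \<not> falsified u i d r \<and> \<not> falsified v i d r))"
definition extends :: "(nat \<Rightarrow> bool) \<Rightarrow> bool" where
  "extends a \<longleftrightarrow> (\<forall>x. p x \<in> {None, Some (a x)})"
definition block_ok :: "(nat \<Rightarrow> bool) \<Rightarrow> nat \<Rightarrow> bool" where
  "block_ok a i \<longleftrightarrow> (\<forall>d<\<beta>. \<exists>r<3. a (var (cl i d) r) = sgn (cl i d) r)"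
definition N :: nat where "N = (2 * \<beta>) ^ (3 * q)"

lemma compat_sym: "compat u v \<longleftrightarrow> compat v u"
proof -
  have "compat v u" if c: "compat u v" for u v
  proof -
    have "bit v j = bit u j'" if "j < 3 * q" "j' < 3 * q" "pvar j (pos v j) = pvar j' (pos u j')" for j j'
      using c that unfolding compat_def by metis
    then show ?thesis using c unfolding compat_def by blast
  qed
  then show ?thesis by blast
qed

lemma pos_less: "pos u j < \<beta>"
  using dig_less[of "2 * \<beta>" u j] \<beta> by (auto simp: pos_def)

lemma pvar_block: "r < 3 \<Longrightarrow> pvar (3 * i + r) d = var (cl i d) r"
  by (simp add: pvar_def)

text \<open>The vertices of the clique pick positions freely and take the values from
  \<open>a\<close>; at each place this leaves \<beta> of the \<open>2 * \<beta>\<close>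
  digits.\<close>

lemma clique_of_assignment:
  assumes a: "extends a" and ok: "\<And>i. i < q \<Longrightarrow> i \<notin> D \<Longrightarrow> block_ok a i"
  obtains S where "S \<subseteq> {..<N}" "card S = \<beta> ^ (3 * q)" "\<And>u v. u \<in> S \<Longrightarrow> v \<in> S \<Longrightarrow> compat u v"
proof -
  let ?X = "\<lambda>j. {x. x < 2 * \<beta> \<and> odd x = a (pvar j (x div 2))}"
  let ?S = "{u. u < (2 * \<beta>) ^ (3 * q) \<and> (\<forall>j<3 * q. dig (2 * \<beta>) u j \<in> ?X j)}"
  have S: "bit u j = a (pvar j (pos u j))" if "u \<in> ?S" "j < 3 * q" for u j
    using that by (auto simp: bit_def pos_def)
  have "card (?X j) = \<beta>" for j
  proof -
    have "?X j = (\<lambda>d. 2 * d + of_bool (a (pvar j d))) ` {..<\<beta>}"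
    proof
      show "?X j \<subseteq> (\<lambda>d. 2 * d + of_bool (a (pvar j d))) ` {..<\<beta>}"
      proof
        fix x assume "x \<in> ?X j"
        then have "x = 2 * (x div 2) + of_bool (a (pvar j (x div 2)))" "x div 2 < \<beta>"
          by (auto simp: of_bool_def elim: oddE)
        then show "x \<in> (\<lambda>d. 2 * d + of_bool (a (pvar j d))) ` {..<\<beta>}" by blast
      qed
    qed auto
    moreover have "inj_on (\<lambda>d. 2 * d + of_bool (a (pvar j d))) {..<\<beta>}"
      by (rule inj_onI) (auto simp: of_bool_def split: if_splits; presburger)
    ultimately show ?thesis by (simp add: card_image)
  qed
  then have prod: "(\<Prod>j<3 * q. card (?X j)) = \<beta> ^ (3 * q)" by simp
  have "card ?S = (\<Prod>j<3 * q. card (?X j))"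
    by (rule card_digits) (use \<beta> in auto)
  then have "card ?S = \<beta> ^ (3 * q)" unfolding prod .
  moreover have "compat u v" if uv: "u \<in> ?S" "v \<in> ?S" for u v
    unfolding compat_def
  proof (intro conjI allI impI)
    have "agrees u" if "u \<in> ?S" for u
      unfolding agrees_def using a S[OF that] by (auto simp: extends_def)
    then show "agrees u" "agrees v" using uv by blast+
    show "bit u j = bit v j'" if "j < 3 * q" "j' < 3 * q" "pvar j (pos u j) = pvar j' (pos v j')" for j j'
      using S[OF uv(1) that(1)] S[OF uv(2) that(2)] that(3) by simp
    fix i d assume i: "i < q" "i \<notin> D" "d < \<beta>"
    then obtain r where r: "r < 3" "a (var (cl i d) r) = sgn (cl i d) r" using ok unfolding block_ok_def by blast
    have "3 * i + r < 3 * q" using r(1) i(1) by simp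
    then have "\<not> falsified w i d r" if "w \<in> ?S" for w
      using S[OF that, of "3 * i + r"] r unfolding falsified_def by (auto simp: pvar_block)
    then show "\<exists>r<3. \<not> falsified u i d r \<and> \<not> falsified v i d r" using r(1) uv by blast
  qed
  moreover have "?S \<subseteq> {..<N}" by (auto simp: N_def)
  ultimately show ?thesis using that by blast
qed

text \<open>
  The type of a biclique \<open>(L, R)\<close> consists of the positions picked in \<open>L\<close>, the positions picked in \<open>R\<close> and the positions picked
  in \<open>L\<close> with value \<open>True\<close>. A position that is picked on both sides has one common value.
\<close>

definition picked :: "nat list \<Rightarrow> (nat \<times> nat) set" where
  "picked L = {(j, pos u j) | u j. u \<in> set L \<and> j < 3 * q}"
definition picked_true :: "nat list \<Rightarrow> (nat \<times> nat) set" where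
  "picked_true L = {(j, pos u j) | u j. u \<in> set L \<and> j < 3 * q \<and> bit u j}"

text \<open>The digits at place \<open>j\<close> that remain for a vertex on the side of
  \<open>A\<close> when the type \<open>(A, B, T)\<close> is fixed; exchanging \<open>A\<close> and
  \<open>B\<close> gives the other side.\<close>

definition choices :: "(nat \<times> nat) set \<Rightarrow> (nat \<times> nat) set \<Rightarrow> (nat \<times> nat) set \<Rightarrow> nat \<Rightarrow> nat set" where
  "choices A B T j = {x. x < 2 * \<beta> \<and> (j, x div 2) \<in> A \<and> ((j, x div 2) \<in> B \<longrightarrow> (odd x \<longleftrightarrow> (j, x div 2) \<in> T))}"

lemma finite_choices: "finite (choices A B T j)"
  unfolding choices_def by auto

lemma card_choices_le:
  "card (choices A B T j) \<le> (\<Sum>d<\<beta>. if (j, d) \<in> A then (if (j, d) \<in> B then 1 else 2) else 0)"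
proof -
  have sub: "choices A B T j \<subseteq> (\<Union>d<\<beta>. {x \<in> choices A B T j. x div 2 = d})"
    by (auto simp: choices_def)
  have "card (choices A B T j) \<le> card (\<Union>d<\<beta>. {x \<in> choices A B T j. x div 2 = d})"
    by (rule card_mono[OF _ sub]) (auto simp: finite_choices)
  also have "\<dots> \<le> (\<Sum>d<\<beta>. card {x \<in> choices A B T j. x div 2 = d})" by (rule card_UN_le) simp
  also have "\<dots> \<le> (\<Sum>d<\<beta>. if (j, d) \<in> A then (if (j, d) \<in> B then 1 else 2) else 0)"
  proof (rule sum_mono)
    fix d
    let ?X = "{x \<in> choices A B T j. x div 2 = d}"
    show "card ?X \<le> (if (j, d) \<in> A then (if (j, d) \<in> B then 1 else 2) else 0)"
    proof (cases "(j, d) \<in> A")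
      case True
      show ?thesis
      proof (cases "(j, d) \<in> B")
        case False
        have "?X \<subseteq> {2 * d, 2 * d + 1}" by auto
        then have "card ?X \<le> card {2 * d, 2 * d + 1}" by (intro card_mono) auto
        then show ?thesis using True False by simp
      next
        case B: True
        have "?X \<subseteq> {2 * d + of_bool ((j, d) \<in> T)}"
        proof
          fix x assume "x \<in> ?X"
          then have "x div 2 = d" "odd x \<longleftrightarrow> (j, d) \<in> T" using B by (auto simp: choices_def)
          then show "x \<in> {2 * d + of_bool ((j, d) \<in> T)}" by (auto simp: of_bool_def elim: oddE)
        qed
        then have "card ?X \<le> card {2 * d + of_bool ((j, d) \<in> T)}" by (intro card_mono) auto
        then show ?thesis using True B by simp
      qed
    next
      case False
      then have "?X = {}" by (auto simp: choices_def)
      then have "card ?X = 0" by (simp only: card.empty)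
      then show ?thesis using False by simp
    qed
  qed
  finally show ?thesis .
qed

text \<open>A position in only one of \<open>A\<close> and \<open>B\<close> leaves two digits on
  that side, a position in both leaves one digit on each side. So the two cardinalities add up to at
  most \<open>2 * \<beta>\<close>, and AM-GM applies. A position in neither set lowers the sum by 2,
  which makes the inequality strict.\<close>

lemma card_choices_mult:
  "card (choices A B T j) * card (choices B A T j) \<le> \<beta> * \<beta>"
  "d < \<beta> \<Longrightarrow> (j, d) \<notin> A \<union> B \<Longrightarrow> card (choices A B T j) * card (choices B A T j) < \<beta> * \<beta>"
proof -
  let ?f = "\<lambda>A B d. if (j, d) \<in> A then (if (j, d) \<in> B then 1 else 2 :: nat) else 0"
  have le: "card (choices A B T j) + card (choices B A T j) \<le> (\<Sum>d<\<beta>. ?f A B d + ?f B A d)"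
    unfolding sum.distrib by (rule add_mono) (rule card_choices_le)+
  have "(\<Sum>d<\<beta>. ?f A B d + ?f B A d) \<le> (\<Sum>d<\<beta>. 2)" by (rule sum_mono) auto
  then show "card (choices A B T j) * card (choices B A T j) \<le> \<beta> * \<beta>"
    using le by (intro mult_le_square_nat) auto
  assume d: "d < \<beta>" "(j, d) \<notin> A \<union> B"
  have "(\<Sum>d'<\<beta>. ?f A B d' + ?f B A d') \<le> (\<Sum>d'<\<beta>. if d' = d then 0 else 2)"
    by (rule sum_mono) (use d in auto)
  also have "\<dots> = (\<Sum>d'\<in>{..<\<beta>} - {d}. 2)"
    using d(1) by (subst sum.remove[of _ d]) auto
  also have "\<dots> = 2 * (\<beta> - 1)" using d(1) by simp
  finally have "card (choices A B T j) * card (choices B A T j) \<le> (\<beta> - 1) * (\<beta> - 1)"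
    using le by (intro mult_le_square_nat) auto
  also have "\<dots> < \<beta> * \<beta>" using \<beta> by (intro mult_strict_mono) auto
  finally show "card (choices A B T j) * card (choices B A T j) < \<beta> * \<beta>" .
qed

definition typed_pairs :: "(nat \<times> nat) set \<Rightarrow> (nat \<times> nat) set \<Rightarrow> (nat \<times> nat) set \<Rightarrow> (nat \<times> nat) set" where
  "typed_pairs A B T = {(u, v). u < N \<and> v < N \<and> compat u v \<and>
     (\<forall>j<3 * q. dig (2 * \<beta>) u j \<in> choices A B T j \<and> dig (2 * \<beta>) v j \<in> choices B A T j)}"

text \<open>Every left vertex that picks the position is compatible with \<open>v\<close> and hence
  shares its value, so a single left vertex decides membership in
  \<open>picked_true L\<close>.\<close>

lemma common_value:
  assumes bc0: "\<forall>u\<in>set L. \<forall>v\<in>set R. compat u v"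
    and u: "u \<in> set L" "v \<in> set R" "j < 3 * q" "pos u j = d" "pos v j = d"
  shows "bit u j \<longleftrightarrow> (j, d) \<in> picked_true L" "bit v j \<longleftrightarrow> (j, d) \<in> picked_true L"
proof -
  note bc = bc0[rule_format]
  have eq: "bit u' j = bit v j" if "u' \<in> set L" "pos u' j = d" for u'
    using bc[OF that(1) u(2)] u that unfolding compat_def by metis
  show "bit v j \<longleftrightarrow> (j, d) \<in> picked_true L"
    using eq u unfolding picked_true_def by auto
  then show "bit u j \<longleftrightarrow> (j, d) \<in> picked_true L" using eq[OF u(1,4)] by simp
qed

lemma biclique_digits:
  assumes bc0: "\<forall>u\<in>set L. \<forall>v\<in>set R. compat u v" and j: "j < 3 * q"
  shows "u \<in> set L \<Longrightarrow> dig (2 * \<beta>) u j \<in> choices (picked L) (picked R) (picked_true L) j"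
    and "v \<in> set R \<Longrightarrow> dig (2 * \<beta>) v j \<in> choices (picked R) (picked L) (picked_true L) j"
proof -
  have d: "dig (2 * \<beta>) w j < 2 * \<beta>" for w using dig_less \<beta> by simp
  show "dig (2 * \<beta>) u j \<in> choices (picked L) (picked R) (picked_true L) j" if u: "u \<in> set L"
  proof -
    have "(j, pos u j) \<in> picked L" using u j unfolding picked_def by blast
    moreover have "bit u j \<longleftrightarrow> (j, pos u j) \<in> picked_true L" if "(j, pos u j) \<in> picked R"
    proof -
      obtain v where "v \<in> set R" "pos v j = pos u j" using \<open>(j, pos u j) \<in> picked R\<close> unfolding picked_def by auto
      then show ?thesis using common_value(1)[OF bc0 u _ j refl] by blast
    qed
    ultimately show ?thesis using d unfolding choices_def by (auto simp: pos_def bit_def)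
  qed
  show "dig (2 * \<beta>) v j \<in> choices (picked R) (picked L) (picked_true L) j" if v: "v \<in> set R"
  proof -
    have "(j, pos v j) \<in> picked R" using v j unfolding picked_def by blast
    moreover have "bit v j \<longleftrightarrow> (j, pos v j) \<in> picked_true L" if "(j, pos v j) \<in> picked L"
    proof -
      obtain u where "u \<in> set L" "pos u j = pos v j" using \<open>(j, pos v j) \<in> picked L\<close> unfolding picked_def by auto
      then show ?thesis using common_value(2)[OF bc0 _ v j] by blast
    qed
    ultimately show ?thesis using d unfolding choices_def by (auto simp: pos_def bit_def)
  qed
qed

text \<open>The local picture of a pair of vertices in block \<open>i\<close>; a pair below
  \<open>N\<close> is determined by its \<open>q\<close> local pictures.\<close>

definition block_digits :: "nat \<Rightarrow> nat \<times> nat \<Rightarrow> (nat \<times> nat) \<times> (nat \<times> nat) \<times> (nat \<times> nat)" where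
  "block_digits i = (\<lambda>(u, v).
     ((dig (2 * \<beta>) u (3 * i), dig (2 * \<beta>) v (3 * i)),
      (dig (2 * \<beta>) u (3 * i + 1), dig (2 * \<beta>) v (3 * i + 1)),
      (dig (2 * \<beta>) u (3 * i + 2), dig (2 * \<beta>) v (3 * i + 2))))"

lemma block_digits_inj:
  assumes "\<forall>i<q. block_digits i (u, v) = block_digits i (u', v')" "u < N" "v < N" "u' < N" "v' < N"
  shows "u = u' \<and> v = v'"
proof -
  have "dig (2 * \<beta>) u j = dig (2 * \<beta>) u' j \<and> dig (2 * \<beta>) v j = dig (2 * \<beta>) v' j" if "j < 3 * q" for j
  proof -
    have "j div 3 < q" using that by (simp add: less_mult_imp_div_less mult.commute)
    then have e: "block_digits (j div 3) (u, v) = block_digits (j div 3) (u', v')" using assms(1) by blast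
    have "j mod 3 < 3" by simp
    then consider "j = 3 * (j div 3)" | "j = 3 * (j div 3) + 1" | "j = 3 * (j div 3) + 2" by linarith
    then show ?thesis
    proof cases
      case 1
      show ?thesis using e unfolding block_digits_def by (subst (1 2 3 4) 1) simp
    next
      case 2
      show ?thesis using e unfolding block_digits_def by (subst (1 2 3 4) 2) simp
    next
      case 3
      show ?thesis using e unfolding block_digits_def by (subst (1 2 3 4) 3) simp
    qed
  qed
  then show ?thesis using dig_inj[of u "2 * \<beta>" "3 * q" u'] dig_inj[of v "2 * \<beta>" "3 * q" v'] assms(2-)
    unfolding N_def by blast
qed

text \<open>
  A block whose constraint is violated by the assignment that the biclique
  determines admits fewer than \<open>\<beta> ^ 6\<close> local pictures of a pair of vertices, because either a position of a
  violated clause is picked on neither side or else some pair of local choices falsifies the clause.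
\<close>

lemma card_typed_pairs_le:
  assumes bc0: "\<forall>u\<in>set L. \<forall>v\<in>set R. compat u v" and ne: "L \<noteq> []" "R \<noteq> []"
    and bad: "\<forall>a. extends a \<longrightarrow> s0 \<le> card {i. i < q \<and> i \<notin> D \<and> \<not> block_ok a i}"
  shows "real (card (typed_pairs (picked L) (picked R) (picked_true L)))
    \<le> real \<beta> ^ (6 * q) * (1 - 1 / real \<beta> ^ 6) ^ s0"
proof -
  note bc = bc0[rule_format]
  define A B T where "A = picked L" and "B = picked R" and "T = picked_true L"
  \<comment> \<open>The assignment that the biclique determines: \<open>p\<close> has priority, and
    another variable is true if some position picked on both sides carries the value
    \<open>True\<close> for it. All remaining variables are false by default.\<close>
  define a where "a x = (case p x of Some b \<Rightarrow> b | None \<Rightarrow> \<exists>j d. (j, d) \<in> A \<inter> B \<inter> T \<and> pvar j d = x)" for x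
  have ext: "extends a" unfolding extends_def a_def by (auto split: option.split)
  \<comment> \<open>Different positions can hold the same variable. They agree because a left vertex
    that picks one of them is compatible with a right vertex that picks the other.\<close>
  have aT: "a (pvar j d) \<longleftrightarrow> (j, d) \<in> T" if jd: "(j, d) \<in> A \<inter> B" for j d
  proof -
    obtain u v where uv: "u \<in> set L" "v \<in> set R" "pos u j = d" "pos v j = d" "j < 3 * q"
      using jd unfolding A_def B_def picked_def by auto
    have T: "bit u j \<longleftrightarrow> (j, d) \<in> T" "bit v j \<longleftrightarrow> (j, d) \<in> T"
      using common_value[OF bc0 uv(1,2,5,3,4)] unfolding T_def by auto
    show ?thesis
    proof (cases "p (pvar j d)")
      case (Some b)
      have "agrees u" using bc[OF uv(1,2)] unfolding compat_def by blast
      then have "b = bit u j" using Some uv unfolding agrees_def by auto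
      then show ?thesis using T Some by (simp add: a_def)
    next
      case None
      have "(j, d) \<in> T" if j': "(j', d') \<in> A \<inter> B \<inter> T" "pvar j' d' = pvar j d" for j' d'
      proof -
        obtain u' where u': "u' \<in> set L" "pos u' j' = d'" "j' < 3 * q" "bit u' j'"
          using j' unfolding T_def picked_true_def by auto
        have "bit u' j' = bit v j"
          using bc[OF u'(1) uv(2)] u' uv j'(2) unfolding compat_def by metis
        then show ?thesis using u'(4) T by simp
      qed
      then show ?thesis using None jd unfolding a_def by auto
    qed
  qed
  let ?P = "typed_pairs A B T"
  define I where "I = {i. i < q \<and> i \<notin> D \<and> \<not> block_ok a i}"
  have I: "s0 \<le> card I" "finite I" "I \<subseteq> {..<q}" using bad ext unfolding I_def by auto
  let ?X = "\<lambda>j. choices A B T j \<times> choices B A T j"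
  let ?X3 = "\<lambda>i. ?X (3 * i) \<times> ?X (3 * i + 1) \<times> ?X (3 * i + 2)"
  define c where "c i = card (block_digits i ` ?P)" for i
  have finP: "finite ?P"
    by (rule finite_subset[of _ "{..<N} \<times> {..<N}"]) (auto simp: typed_pairs_def)
  have cX: "card (?X j) \<le> \<beta> ^ 2" "finite (?X j)" for j
    using card_choices_mult(1)[of A B T j] by (auto simp: card_cartesian_product power2_eq_square finite_choices)
  have sub: "block_digits i ` ?P \<subseteq> ?X3 i" if "i < q" for i
    using that by (auto simp: typed_pairs_def block_digits_def)
  have finX3: "finite (?X3 i)" for i by (intro finite_cartesian_product cX(2))
  have b6: "\<beta> ^ 6 = \<beta> ^ 2 * (\<beta> ^ 2 * \<beta> ^ 2)" by (simp flip: power_add)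
  have cX3: "card (?X3 i) \<le> \<beta> ^ 6" for i
    unfolding card_cartesian_product[of "?X (3 * i)"] card_cartesian_product[of "?X (3 * i + 1)"] b6
    by (intro mult_mono cX) auto
  have c_le: "c i \<le> \<beta> ^ 6" if "i < q" for i
    unfolding c_def by (rule order_trans[OF card_mono[OF finX3 sub[OF that]] cX3])
  have c_less: "c i < \<beta> ^ 6" if i: "i \<in> I" for i
  proof -
    have iq: "i < q" "i \<notin> D" and "\<not> block_ok a i" using i unfolding I_def by auto
    then obtain d where d: "d < \<beta>" "\<And>r. r < 3 \<Longrightarrow> a (var (cl i d) r) \<noteq> sgn (cl i d) r"
      unfolding block_ok_def by blast
    show ?thesis
    proof (cases "\<exists>r<3. (3 * i + r, d) \<notin> A \<union> B")
      case True
      then obtain r where r: "r < 3" "(3 * i + r, d) \<notin> A \<union> B" by blast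
      have lt: "card (?X (3 * i + r)) < \<beta> ^ 2"
        using card_choices_mult(2)[OF d(1) r(2), of T] by (simp add: card_cartesian_product power2_eq_square)
      have "card (?X3 i) < \<beta> ^ 6"
        unfolding card_cartesian_product[of "?X (3 * i)"] card_cartesian_product[of "?X (3 * i + 1)"] b6
      proof (rule mult3_less)
        consider "r = 0" | "r = 1" | "r = 2" using r(1) by linarith
        then show "card (?X (3 * i)) < \<beta>\<^sup>2 \<or> card (?X (3 * i + 1)) < \<beta>\<^sup>2 \<or> card (?X (3 * i + 2)) < \<beta>\<^sup>2"
          using lt by cases simp_all
      qed (rule cX)+
      then show ?thesis unfolding c_def
        by (rule le_less_trans[OF card_mono[OF finX3 sub[OF iq(1)]]])
    next
      case False
      obtain u0 v0 where uv0: "u0 \<in> set L" "v0 \<in> set R" using ne by (meson list.set_sel(1))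
      \<comment> \<open>\<open>x r\<close> is the digit that picks clause \<open>d\<close> and
        falsifies its \<open>r\<close>-th literal. The picture \<open>w\<close> puts it on a side
        that picks this position, and completes the other side by a digit of \<open>v0\<close> or
        \<open>u0\<close>.\<close>
      define x where "x r = 2 * d + of_bool (\<not> sgn (cl i d) r)" for r
      define w where "w r = (if (3 * i + r, d) \<in> A then (x r, dig (2 * \<beta>) v0 (3 * i + r))
        else (dig (2 * \<beta>) u0 (3 * i + r), x r))" for r
      have xd: "x r div 2 = d" "odd (x r) \<longleftrightarrow> \<not> sgn (cl i d) r" "x r < 2 * \<beta>" for r
        using d(1) by (auto simp: x_def)
      have wX: "w r \<in> ?X (3 * i + r)" if r: "r < 3" for r
      proof -
        have lt: "3 * i + r < 3 * q" using r iq(1) by simp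
        \<comment> \<open>If both sides pick the position, the prescribed value is that of
          \<open>a\<close>, which falsifies the literal; so \<open>x r\<close> is among the choices.
          If one side picks it, the value is free there.\<close>
        have "a (var (cl i d) r) \<longleftrightarrow> \<not> sgn (cl i d) r" using d(2)[OF r] by auto
        then have T: "(3 * i + r, d) \<in> T \<longleftrightarrow> \<not> sgn (cl i d) r" if "(3 * i + r, d) \<in> A \<inter> B"
          using aT[OF that] pvar_block[OF r] by simp
        have "x r \<in> choices A B T (3 * i + r)" if "(3 * i + r, d) \<in> A"
          using that T xd[of r] by (auto simp: choices_def)
        moreover have "x r \<in> choices B A T (3 * i + r)" if "(3 * i + r, d) \<notin> A"
          using that False r xd[of r] by (auto simp: choices_def)
        ultimately show ?thesis
          using biclique_digits[OF bc0 lt] uv0 unfolding w_def A_def B_def T_def by auto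
      qed
      let ?w = "(w 0, w 1, w 2)"
      have w_in: "?w \<in> ?X3 i" using wX[of 0] wX[of 1] wX[of 2] by simp
      \<comment> \<open>In \<open>w\<close> each of the three literals of clause \<open>d\<close> is
        falsified by one of the two vertices, which \<open>compat\<close> forbids.\<close>
      have w_out: "?w \<notin> block_digits i ` ?P"
      proof
        assume "?w \<in> block_digits i ` ?P"
        then obtain u v where uv: "(u, v) \<in> ?P" "block_digits i (u, v) = ?w" by auto
        then have wr: "(dig (2 * \<beta>) u (3 * i + r), dig (2 * \<beta>) v (3 * i + r)) = w r" if "r < 3" for r
          using that by (auto simp: block_digits_def less_Suc_eq numeral_3_eq_3 numeral_2_eq_2)
        have "compat u v" using uv(1) unfolding typed_pairs_def by simp
        then obtain r where r: "r < 3" "\<not> falsified u i d r" "\<not> falsified v i d r"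
          unfolding compat_def using iq d(1) by blast
        have "dig (2 * \<beta>) u (3 * i + r) = x r \<or> dig (2 * \<beta>) v (3 * i + r) = x r"
          using wr[OF r(1)] unfolding w_def by (auto split: if_splits)
        then show False using r xd[of r] unfolding falsified_def by (auto simp: pos_def bit_def)
      qed
      have "block_digits i ` ?P \<noteq> ?X3 i"
      proof
        assume e: "block_digits i ` ?P = ?X3 i"
        show False using w_out unfolding e using w_in by (rule notE)
      qed
      with sub[OF iq(1)] have "block_digits i ` ?P \<subset> ?X3 i" by (rule psubsetI)
      then have "c i < card (?X3 i)" unfolding c_def by (rule psubset_card_mono[OF finX3])
      then show ?thesis using cX3[of i] by linarith
    qed
  qed
  \<comment> \<open>Pairs embed into the product of their sets of local pictures, and each block in
    \<open>I\<close> contributes at most \<open>\<beta> ^ 6 - 1\<close> to it.\<close>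
  let ?g = "\<lambda>x. \<lambda>i\<in>{..<q}. block_digits i x"
  have "inj_on ?g ?P"
  proof (rule inj_onI)
    fix x y assume xy: "x \<in> ?P" "y \<in> ?P" "?g x = ?g y"
    obtain u v u' v' where e: "x = (u, v)" "y = (u', v')" by (meson surj_pair)
    have "\<forall>i<q. block_digits i (u, v) = block_digits i (u', v')"
      using fun_cong[OF xy(3)] unfolding e restrict_apply lessThan_iff by presburger
    then show "x = y" using block_digits_inj[of u v u' v'] xy(1,2) e unfolding typed_pairs_def by auto
  qed
  then have "card ?P = card (?g ` ?P)" by (simp add: card_image)
  also have "\<dots> \<le> card (Pi\<^sub>E {..<q} (\<lambda>i. block_digits i ` ?P))"
    by (rule card_mono) (use finP in \<open>auto intro!: finite_PiE simp: PiE_iff split: if_splits\<close>)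
  also have "\<dots> = (\<Prod>i<q. c i)" by (simp add: card_PiE c_def)
  finally have "real (card ?P) \<le> (\<Prod>i<q. real (c i))" unfolding of_nat_prod[symmetric] of_nat_le_iff .
  also have "\<dots> \<le> (\<Prod>i<q. real \<beta> ^ 6 * (if i \<in> I then 1 - 1 / real \<beta> ^ 6 else 1))"
  proof (rule prod_mono)
    fix i assume i: "i \<in> {..<q}"
    have b0: "real \<beta> ^ 6 > 0" using \<beta> by simp
    show "0 \<le> real (c i) \<and> real (c i) \<le> real \<beta> ^ 6 * (if i \<in> I then 1 - 1 / real \<beta> ^ 6 else 1)"
    proof (cases "i \<in> I")
      case True
      have "real (c i) + 1 \<le> real (\<beta> ^ 6)" using c_less[OF True] by linarith
      then show ?thesis using True b0 by (simp add: algebra_simps)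
    next
      case False
      have "c i \<le> \<beta> ^ 6" using c_le[of i] i by simp
      then have "real (c i) \<le> real (\<beta> ^ 6)" by linarith
      then show ?thesis using False by simp
    qed
  qed
  also have "\<dots> = real \<beta> ^ (6 * q) * (1 - 1 / real \<beta> ^ 6) ^ card I"
  proof -
    have "(\<Prod>i<q. if i \<in> I then 1 - 1 / real \<beta> ^ 6 else 1) = (1 - 1 / real \<beta> ^ 6) ^ card I"
      using I(3) by (simp add: prod.If_cases Int_absorb1)
    then show ?thesis by (simp add: prod.distrib power_mult)
  qed
  also have "\<dots> \<le> real \<beta> ^ (6 * q) * (1 - 1 / real \<beta> ^ 6) ^ s0"
  proof -
    have "1 \<le> real \<beta> ^ 6" using \<beta> by simp
    then show ?thesis using I(1) by (intro mult_left_mono power_decreasing) (auto simp: divide_simps)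
  qed
  finally show ?thesis unfolding A_def B_def T_def .
qed

text \<open>Zipping the two sides maps the bicliques of one type injectively to
  \<open>t\<close>-tuples of typed pairs. A type consists of three sets of positions, whence the
  factor \<open>8 ^ (3 * q * \<beta>)\<close>.\<close>

lemma card_bicliques_le:
  assumes W: "W \<subseteq> {..<N}" and t: "0 < t"
    and bad: "\<forall>a. extends a \<longrightarrow> s0 \<le> card {i. i < q \<and> i \<notin> D \<and> \<not> block_ok a i}"
  shows "real (card (bicliques compat W t))
    \<le> 8 ^ (3 * q * \<beta>) * (real \<beta> ^ (6 * q) * (1 - 1 / real \<beta> ^ 6) ^ s0) ^ t"
proof -
  let ?B = "bicliques compat W t"
  let ?pos = "{..<3 * q} \<times> {..<\<beta>}"
  let ?types = "Pow ?pos \<times> Pow ?pos \<times> Pow ?pos"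
  let ?bound = "(real \<beta> ^ (6 * q) * (1 - 1 / real \<beta> ^ 6) ^ s0) ^ t"
  define ty where "ty = (\<lambda>(L, R). (picked L, picked R, picked_true L))"
  have finB: "finite ?B"
    by (rule finite_subset[of _ "tuples W t \<times> tuples W t"])
      (use W finite_subset finite_tuples in \<open>auto simp: bicliques_def intro!: finite_tuples\<close>)
  have rho: "0 \<le> 1 - 1 / real \<beta> ^ 6"
  proof -
    have "1 \<le> real \<beta> ^ 6" using \<beta> by simp
    then show ?thesis by (simp add: divide_simps)
  qed
  have tyB: "ty ` ?B \<subseteq> ?types"
    using pos_less by (auto simp: ty_def picked_def picked_true_def)
  have fib: "real (card {x \<in> ?B. ty x = \<tau>}) \<le> ?bound" for \<tau>
  proof (cases "{x \<in> ?B. ty x = \<tau>} = {}")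
    case True
    then have "card {x \<in> ?B. ty x = \<tau>} = 0" by (simp only: card.empty)
    then show ?thesis using rho by simp
  next
    case False
    then obtain L R where LR: "(L, R) \<in> ?B" "ty (L, R) = \<tau>" by auto
    then have bc: "\<forall>u\<in>set L. \<forall>v\<in>set R. compat u v" and "length L = t" "length R = t"
      unfolding bicliques_def tuples_def by auto
    then have ne: "L \<noteq> []" "R \<noteq> []" using t by auto
    let ?P = "typed_pairs (picked L) (picked R) (picked_true L)"
    have finP: "finite ?P"
      by (rule finite_subset[of _ "{..<N} \<times> {..<N}"]) (auto simp: typed_pairs_def)
    let ?z = "\<lambda>(xs, ys). zip xs ys"
    have "inj_on ?z {x \<in> ?B. ty x = \<tau>}"
    proof (rule inj_onI)
      fix x y assume xy: "x \<in> {x \<in> ?B. ty x = \<tau>}" "y \<in> {x \<in> ?B. ty x = \<tau>}" "?z x = ?z y"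
      obtain xs ys xs' ys' where e: "x = (xs, ys)" "y = (xs', ys')" by (meson surj_pair)
      have "length xs = t" "length ys = t" "length xs' = t" "length ys' = t"
        using xy(1,2) e by (auto simp: bicliques_def tuples_def)
      then show "x = y" using xy(3) e by (metis case_prod_conv map_fst_zip map_snd_zip)
    qed
    moreover have "?z ` {x \<in> ?B. ty x = \<tau>} \<subseteq> tuples ?P t"
    proof
      fix zs assume "zs \<in> ?z ` {x \<in> ?B. ty x = \<tau>}"
      then obtain xs ys where xy: "(xs, ys) \<in> ?B" "ty (xs, ys) = \<tau>" "zs = zip xs ys" by auto
      have eq: "picked xs = picked L" "picked ys = picked R" "picked_true xs = picked_true L"
        using xy(2) LR(2) unfolding ty_def by auto
      have c: "\<forall>u\<in>set xs. \<forall>v\<in>set ys. compat u v" and len: "length xs = t" "length ys = t"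
        and sub: "set xs \<subseteq> W" "set ys \<subseteq> W"
        using xy(1) unfolding bicliques_def tuples_def by auto
      have "(u, v) \<in> ?P" if "(u, v) \<in> set zs" for u v
      proof -
        have uv: "u \<in> set xs" "v \<in> set ys" using that xy(3) by (auto dest: set_zip_leftD set_zip_rightD)
        have "dig (2 * \<beta>) u j \<in> choices (picked xs) (picked ys) (picked_true xs) j"
          "dig (2 * \<beta>) v j \<in> choices (picked ys) (picked xs) (picked_true xs) j" if "j < 3 * q" for j
          by (rule biclique_digits(1)[OF c that uv(1)], rule biclique_digits(2)[OF c that uv(2)])
        moreover have "u < N" "v < N" using uv sub W by auto
        ultimately show ?thesis using c uv unfolding typed_pairs_def eq by blast
      qed
      then show "zs \<in> tuples ?P t" using xy(3) len unfolding tuples_def by auto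
    qed
    ultimately have "card {x \<in> ?B. ty x = \<tau>} \<le> card (tuples ?P t)"
      by (intro card_inj_on_le[OF _ _ finite_tuples[OF finP]])
    then have "card {x \<in> ?B. ty x = \<tau>} \<le> card ?P ^ t" unfolding card_tuples[OF finP] .
    then have "real (card {x \<in> ?B. ty x = \<tau>}) \<le> real (card ?P) ^ t"
      unfolding of_nat_power[symmetric] of_nat_le_iff .
    also have "\<dots> \<le> ?bound" by (rule power_mono[OF card_typed_pairs_le[OF bc ne bad]]) auto
    finally show ?thesis .
  qed
  have "?B = (\<Union>\<tau>\<in>?types. {x \<in> ?B. ty x = \<tau>})" using tyB by blast
  then have "card ?B \<le> (\<Sum>\<tau>\<in>?types. card {x \<in> ?B. ty x = \<tau>})"
    using card_UN_le[of ?types "\<lambda>\<tau>. {x \<in> ?B. ty x = \<tau>}"] by auto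
  then have "real (card ?B) \<le> (\<Sum>\<tau>\<in>?types. real (card {x \<in> ?B. ty x = \<tau>}))"
    unfolding of_nat_sum[symmetric] of_nat_le_iff .
  also have "\<dots> \<le> real (card ?types) * ?bound" using sum_bounded_above[of ?types, OF fib] by simp
  also have "card ?types = 8 ^ (3 * q * \<beta>)"
  proof -
    have "card ?types = 2 ^ (3 * q * \<beta>) * (2 ^ (3 * q * \<beta>) * 2 ^ (3 * q * \<beta>))"
      by (simp add: card_cartesian_product card_Pow)
    also have "\<dots> = (2 * (2 * 2)) ^ (3 * q * \<beta>)" by (simp only: power_mult_distrib)
    finally show ?thesis by simp
  qed
  finally show ?thesis by simp
qed

text \<open>The main term of the upper bound, \<open>\<beta> ^ (6 * q * t)\<close>, equals
  \<open>card W ^ (2 * t)\<close> and cancels against the lower bound on the number of bicliques.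
  Here the size of \<open>W\<close> matters: it is that of the clique in the satisfiable
  case.\<close>

lemma dense_bound:
  assumes W: "W \<subseteq> {..<N}" "card W = \<beta> ^ (3 * q)" and t: "0 < t"
    and bad: "\<forall>a. extends a \<longrightarrow> s0 \<le> card {i. i < q \<and> i \<notin> D \<and> \<not> block_ok a i}"
  shows "(real (card {(u, v). u \<in> W \<and> v \<in> W \<and> compat u v}) / real (card W) ^ 2) ^ (t * t)
    \<le> 8 ^ (3 * q * \<beta>) * (1 - 1 / real \<beta> ^ 6) ^ (s0 * t)"
proof -
  let ?\<alpha> = "real (card {(u, v). u \<in> W \<and> v \<in> W \<and> compat u v}) / real (card W) ^ 2"
  have b: "real \<beta> > 0" using \<beta> by simp
  have fin: "finite W" "W \<noteq> {}" using W \<beta> finite_subset by auto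
  have "?\<alpha> ^ (t * t) * real (card W) ^ (2 * t) \<le> real (card (bicliques compat W t))"
    by (rule card_bicliques_ge[OF fin])
  also have "\<dots> \<le> 8 ^ (3 * q * \<beta>) * (real \<beta> ^ (6 * q) * (1 - 1 / real \<beta> ^ 6) ^ s0) ^ t"
    by (rule card_bicliques_le[OF W(1) t bad])
  also have "\<dots> = (8 ^ (3 * q * \<beta>) * (1 - 1 / real \<beta> ^ 6) ^ (s0 * t)) * real (card W) ^ (2 * t)"
  proof -
    have "real (card W) ^ (2 * t) = (real \<beta> ^ (6 * q)) ^ t"
      unfolding W(2) of_nat_power power_mult[symmetric] by (simp add: mult_ac)
    then show ?thesis by (simp only: power_mult_distrib power_mult mult_ac)
  qed
  finally show ?thesis by (rule mult_right_le_imp_le) (use b in \<open>simp add: W(2)\<close>)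
qed

definition edges :: "nat set set" where
  "edges = {{u, v} | u v. u < N \<and> v < N \<and> u \<noteq> v \<and> compat u v}"

text \<open>The dense bound normalises ordered pairs by \<open>k ^ 2\<close>, the density normalises
  edges by \<open>k * (k - 1) / 2\<close>; the factor 2 comes from
  \<open>k - 1 \<ge> k / 2\<close>.\<close>

lemma density_bound:
  assumes W: "W \<subseteq> {..<N}" "card W = \<beta> ^ (3 * q)" and t: "0 < t" and q: "0 < q"
    and bad: "\<forall>a. extends a \<longrightarrow> s0 \<le> card {i. i < q \<and> i \<notin> D \<and> \<not> block_ok a i}"
    and small: "8 ^ (3 * q * \<beta>) * (1 - 1 / real \<beta> ^ 6) ^ (s0 * t) \<le> (1 / 2) ^ q"
  shows "density W (induced_edges edges W) \<le> 2 * 2 powr (- (real q / (real t * real t)))"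
proof -
  define k where "k = card W"
  define H where "H = {(u, v). u \<in> W \<and> v \<in> W \<and> compat u v}"
  define h where "h = card H"
  define \<alpha> where "\<alpha> = real h / real k ^ 2"
  have finW: "finite W" using W(1) finite_subset by blast
  have finH: "finite H" unfolding H_def by (rule finite_subset[of _ "W \<times> W"]) (use finW in auto)
  have k2: "2 \<le> k"
  proof -
    have "2 ^ 1 \<le> \<beta> ^ 1" using \<beta> by simp
    also have "\<dots> \<le> \<beta> ^ (3 * q)" using q \<beta> by (intro power_increasing) auto
    finally show ?thesis using W(2) by (simp add: k_def)
  qed
  have "\<alpha> ^ (t * t) \<le> (1 / 2) ^ q"
    using dense_bound[OF W t bad] small unfolding \<alpha>_def h_def H_def k_def by linarith
  have \<alpha>: "\<alpha> \<le> 2 powr (- (real q / (real t * real t)))"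
  proof (cases "\<alpha> = 0")
    case False
    have "0 \<le> \<alpha>" unfolding \<alpha>_def by simp
    then have pos: "\<alpha> > 0" using False by linarith
    have "\<alpha> = (\<alpha> ^ (t * t)) powr (1 / (real t * real t))"
      using pos t by (simp add: powr_realpow[symmetric] powr_powr)
    also have "\<dots> \<le> ((1 / 2) ^ q) powr (1 / (real t * real t))"
      using \<open>\<alpha> ^ (t * t) \<le> (1 / 2) ^ q\<close> pos by (intro powr_mono2) auto
    also have "((1 / 2 :: real) ^ q) = 2 powr (- real q)"
      by (simp add: powr_minus powr_realpow power_one_over field_simps)
    finally show ?thesis by (simp add: powr_powr)
  qed simp
  let ?P = "{(u, v). u \<in> W \<and> v \<in> W \<and> u < v \<and> compat u v}"
  have finP: "finite ?P" by (rule finite_subset[OF _ finH]) (auto simp: H_def)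
  have "induced_edges edges W \<subseteq> (\<lambda>(u, v). {u, v}) ` ?P"
  proof
    fix e assume "e \<in> induced_edges edges W"
    then obtain u v where e: "e = {u, v}" "u \<noteq> v" "compat u v" "u \<in> W" "v \<in> W"
      unfolding induced_edges_def edges_def by auto
    show "e \<in> (\<lambda>(u, v). {u, v}) ` ?P"
    proof (cases "u < v")
      case True
      then show ?thesis using e by (intro image_eqI[of _ _ "(u, v)"]) auto
    next
      case False
      then show ?thesis using e compat_sym by (intro image_eqI[of _ _ "(v, u)"]) auto
    qed
  qed
  then have eP: "card (induced_edges edges W) \<le> card ?P"
    by (rule order_trans[OF card_mono[OF finite_imageI[OF finP]] card_image_le[OF finP]])
  have "card (?P \<union> prod.swap ` ?P) = card ?P + card (prod.swap ` ?P)"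
    by (rule card_Un_disjoint) (use finP in auto)
  also have "card (prod.swap ` ?P) = card ?P" by (rule card_image) simp
  finally have "card ?P + card ?P = card (?P \<union> prod.swap ` ?P)" by simp
  also have "\<dots> \<le> h" unfolding h_def
    by (rule card_mono[OF finH]) (use compat_sym in \<open>auto simp: H_def\<close>)
  finally have eh: "2 * real (card (induced_edges edges W)) \<le> real h" using eP by linarith
  have choose: "real (k choose 2) = real k * (real k - 1) / 2"
  proof -
    have "even (k * (k - 1))" by auto
    then have "2 * (k choose 2) = k * (k - 1)" by (simp add: choose_two)
    then have "2 * real (k choose 2) = real k * (real k - 1)"
    proof -
      have "real (2 * (k choose 2)) = real (k * (k - 1))" using \<open>2 * (k choose 2) = k * (k - 1)\<close> by (rule arg_cong)
      then show ?thesis using k2 by (simp add: of_nat_diff)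
    qed
    then show ?thesis by simp
  qed
  have "density W (induced_edges edges W) = real (card (induced_edges edges W)) / real (k choose 2)"
    by (simp add: density_def k_def)
  also have "\<dots> = 2 * real (card (induced_edges edges W)) / (real k * (real k - 1))"
    unfolding choose by simp
  also have "\<dots> \<le> real h / (real k * (real k - 1))"
    using eh k2 by (intro divide_right_mono) auto
  also have "\<dots> \<le> real h / (real k * (real k / 2))"
    using k2 by (intro divide_left_mono mult_left_mono mult_pos_pos) auto
  also have "\<dots> = 2 * \<alpha>" by (simp add: \<alpha>_def power2_eq_square)
  finally show ?thesis using \<alpha> by linarith
qed

end

text \<open>Here \<open>1 / \<kappa>\<close> is the fraction of blocks that every assignment
  violates. The side length \<open>t\<close> depends on \<beta> and \<kappa> only, so the density
  falls below a fixed negative power of \<open>N\<close>; only the threshold \<open>q0\<close>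
  depends on \<open>f\<close>.\<close>

lemma csp_sparse:
  fixes f :: "nat \<Rightarrow> real"
  assumes \<beta>: "2 \<le> \<beta>" and f: "f \<longlonglongrightarrow> 0"
  shows "\<exists>q0. \<forall>q\<ge>q0. \<forall>m var sgn p D s0. q \<le> \<kappa> * s0 \<longrightarrow>
     (\<forall>a. csp.extends p a \<longrightarrow> s0 \<le> card {i. i < q \<and> i \<notin> D \<and> \<not> csp.block_ok m \<beta> var sgn a i}) \<longrightarrow>
     all_k_subgraphs_sparse f (csp.N q \<beta>, csp.edges m q \<beta> var sgn p D, \<beta> ^ (3 * q))"
proof -
  define \<rho> where "\<rho> = 1 - 1 / real \<beta> ^ 6"
  have "1 < real \<beta> ^ 6" using \<beta> by simp
  then have \<rho>: "0 < \<rho>" "\<rho> < 1" unfolding \<rho>_def using \<beta> by (auto simp: divide_simps)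
  have "(\<lambda>t. \<rho> ^ t) \<longlonglongrightarrow> 0" using \<rho> by (intro LIMSEQ_power_zero) auto
  then have lim: "(\<lambda>t. 8 ^ (3 * \<beta>) * \<rho> ^ t) \<longlonglongrightarrow> 8 ^ (3 * \<beta>) * 0" by (rule tendsto_mult_left)
  have "eventually (\<lambda>t. 8 ^ (3 * \<beta>) * \<rho> ^ t < 1 / 2) sequentially"
    by (rule order_tendstoD(2)[OF lim]) simp
  then obtain t1 where t1: "8 ^ (3 * \<beta>) * \<rho> ^ t1 < 1 / 2" unfolding eventually_sequentially by blast
  \<comment> \<open>As \<open>s0\<close> is at least \<open>q / \<kappa>\<close>, the factor
    \<kappa> in \<open>t\<close> turns \<open>\<rho> ^ (s0 * t)\<close> into at most
    \<open>\<rho> ^ (q * t1)\<close>; the successor keeps \<open>t\<close> positive.\<close>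
  define t where "t = Suc (\<kappa> * t1)"
  define T where "T = real t * real t"
  have t0: "0 < t" by (simp add: t_def)
  then have "0 < T" by (simp add: T_def)
  note t0 = t0 this
  define l where "l = log 2 (2 * real \<beta>)"
  have l: "0 < l" using \<beta> by (simp add: l_def)
  \<comment> \<open>With \<open>N = 2 powr (3 * l * q)\<close>, this threshold makes
    \<open>N powr f N\<close> at most \<open>2 powr (q / (2 * T))\<close>, which is half of the gain
    in the exponent. The other half pays for the factor 2 of the density bound and requires
    \<open>2 * t * t \<le> q\<close>.\<close>
  have "eventually (\<lambda>n. f n < 1 / (6 * T * l)) sequentially"
    using f t0(2) l by (intro order_tendstoD(2)) auto
  then obtain n0 where n0: "\<And>n. n0 \<le> n \<Longrightarrow> f n < 1 / (6 * T * l)" unfolding eventually_sequentially by blast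
  define q0 where "q0 = Suc (n0 + 2 * t * t)"
  show ?thesis
  proof (intro exI[of _ q0] allI impI)
    fix q m var sgn p D s0
    assume q: "q0 \<le> q" "q \<le> \<kappa> * s0"
      and bad: "\<forall>a. csp.extends p a \<longrightarrow> s0 \<le> card {i. i < q \<and> i \<notin> D \<and> \<not> csp.block_ok m \<beta> var sgn a i}"
    interpret csp m q \<beta> var sgn p D by unfold_locales (rule \<beta>)
    have q1: "0 < q" using q(1) by (simp add: q0_def)
    have "8 ^ (3 * q * \<beta>) * \<rho> ^ (s0 * t) \<le> 8 ^ (3 * q * \<beta>) * \<rho> ^ (q * t1)"
    proof (intro mult_left_mono power_decreasing)
      have "q * t1 \<le> (\<kappa> * s0) * t1" using q(2) by (rule mult_le_mono1)
      also have "\<dots> \<le> s0 * t" by (simp add: t_def algebra_simps)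
      finally show "q * t1 \<le> s0 * t" .
    qed (use \<rho> in auto)
    also have "\<dots> = (8 ^ (3 * \<beta>) * \<rho> ^ t1) ^ q"
      by (simp add: power_mult_distrib power_mult[symmetric] mult_ac)
    also have "\<dots> \<le> (1 / 2) ^ q" using t1 \<rho> by (intro power_mono) auto
    finally have small: "8 ^ (3 * q * \<beta>) * (1 - 1 / real \<beta> ^ 6) ^ (s0 * t) \<le> (1 / 2) ^ q"
      unfolding \<rho>_def .
    have "q \<le> N"
    proof -
      have "q < 2 ^ q" by simp
      also have "(2::nat) ^ q \<le> (2 * \<beta>) ^ q" using \<beta> by (intro power_mono) auto
      also have "\<dots> \<le> (2 * \<beta>) ^ (3 * q)" using \<beta> by (intro power_increasing) auto
      finally show ?thesis by (simp add: N_def)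
    qed
    then have fN: "f N < 1 / (6 * T * l)" using n0 q(1) by (simp add: q0_def)
    have "real N = (2 * real \<beta>) ^ (3 * q)" unfolding N_def of_nat_power of_nat_mult by simp
    also have "\<dots> = (2 * real \<beta>) powr real (3 * q)" using \<beta> by (intro powr_realpow[symmetric]) simp
    also have "2 * real \<beta> = 2 powr l" using \<beta> by (simp add: l_def)
    finally have N2: "real N = 2 powr (l * real (3 * q))" by (simp add: powr_powr)
    have "1 - real q / T \<le> - (l * (3 * real q) * f N)"
    proof -
      have "l * (3 * real q) * f N \<le> l * (3 * real q) * (1 / (6 * T * l))"
        using fN l by (intro mult_left_mono) auto
      also have "\<dots> = real q / (2 * T)" using l t0 by (simp add: field_simps)
      finally have 1: "l * (3 * real q) * f N \<le> real q / (2 * T)" .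
      have "real (2 * t * t) \<le> real q" using q(1) unfolding q0_def by linarith
      then have "1 \<le> real q / (2 * T)" using t0(2) by (simp add: T_def divide_simps)
      moreover have "real q / T = 2 * (real q / (2 * T))" by simp
      ultimately show ?thesis using 1 by linarith
    qed
    then have "2 powr (1 - real q / T) \<le> real N powr (- f N)"
      unfolding N2 powr_powr by (simp add: algebra_simps)
    moreover have "2 powr (1 - real q / T) = 2 * 2 powr (- (real q / T))"
      using powr_add[of 2 1 "- (real q / T)"] by simp
    ultimately have final: "2 * 2 powr (- (real q / T)) \<le> real N powr (- f N)" by linarith
    have "2 ^ 1 \<le> \<beta> ^ 1" using \<beta> by simp
    also have "\<dots> \<le> \<beta> ^ (3 * q)" using q1 \<beta> by (intro power_increasing) auto
    finally have "2 \<le> \<beta> ^ (3 * q)" by simp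
    moreover have "density S (induced_edges edges S) \<le> real N powr (- f N)"
      if "S \<subseteq> {..<N} \<and> card S = \<beta> ^ (3 * q)" for S
      using density_bound[OF conjunct1[OF that] conjunct2[OF that] t0(1) q1 bad small] final
      unfolding T_def by linarith
    ultimately show "all_k_subgraphs_sparse f (N, edges, \<beta> ^ (3 * q))" by simp
  qed
qed

subsection \<open>Arithmetic and logic in the expression language\<close>

text \<open>Operands are passed by \<open>Call\<close> because variables are levels: an operand
  placed directly under the binder of \<open>Sum\<close> would have the levels of its own binders
  shifted. The same holds for the operations below that use \<open>Call\<close>.\<close>

definition eMul :: "exp \<Rightarrow> exp \<Rightarrow> exp" where "eMul a b = Call (Sum (V 0) (V 1)) [a, b]"
definition eNot :: "exp \<Rightarrow> exp" where "eNot a = Sub (Num 1) a"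
definition eLe :: "exp \<Rightarrow> exp \<Rightarrow> exp" where "eLe a b = eNot (Sub a b)"
definition eLt :: "exp \<Rightarrow> exp \<Rightarrow> exp" where "eLt a b = eLe (Add a (Num 1)) b"
definition eEq :: "exp \<Rightarrow> exp \<Rightarrow> exp" where "eEq a b = eNot (Add (Sub a b) (Sub b a))"
definition eIf :: "exp \<Rightarrow> exp \<Rightarrow> exp \<Rightarrow> exp" where
  "eIf c a b = Add (eMul (eNot (eNot c)) a) (eMul (eNot c) b)"
definition eAnd :: "exp \<Rightarrow> exp \<Rightarrow> exp" where "eAnd a b = eNot (eNot (eMul a b))"
definition eOr :: "exp \<Rightarrow> exp \<Rightarrow> exp" where "eOr a b = eNot (eNot (Add a b))"
definition eAll :: "exp \<Rightarrow> exp \<Rightarrow> exp" where "eAll n a = eNot (Sum n (eNot a))"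
definition eEx :: "exp \<Rightarrow> exp \<Rightarrow> exp" where "eEx n a = eNot (eNot (Sum n a))"
definition eDiv :: "exp \<Rightarrow> exp \<Rightarrow> exp" where
  "eDiv a b = Call (Sum (V 0) (eLe (eMul (Add (V 2) (Num 1)) (V 1)) (V 0))) [a, b]"
definition eMod :: "exp \<Rightarrow> exp \<Rightarrow> exp" where
  "eMod a b = Call (Sub (V 0) (eMul (V 1) (eDiv (V 0) (V 1)))) [a, b]"
text \<open>A power is exponential in its exponent, so it is available only up to a cap
  \<open>c\<close>.\<close>

definition ePow :: "exp \<Rightarrow> exp \<Rightarrow> exp \<Rightarrow> exp" where
  "ePow a n c = Call (It (V 1) (Num 1) (V 2) (eMul (V 4) (V 0))) [a, n, c]"
definition eDig :: "exp \<Rightarrow> exp \<Rightarrow> exp \<Rightarrow> exp" where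
  "eDig b u j = Call (eMod (It (V 2) (V 1) (V 1) (eDiv (V 4) (V 0))) (V 0)) [b, u, j]"

lemma scoped_arith [simp]:
  "scoped (eMul a b) n \<longleftrightarrow> scoped a n \<and> scoped b n"
  "scoped (eNot a) n \<longleftrightarrow> scoped a n"
  "scoped (eLe a b) n \<longleftrightarrow> scoped a n \<and> scoped b n"
  "scoped (eLt a b) n \<longleftrightarrow> scoped a n \<and> scoped b n"
  "scoped (eEq a b) n \<longleftrightarrow> scoped a n \<and> scoped b n"
  "scoped (eIf c a b) n \<longleftrightarrow> scoped c n \<and> scoped a n \<and> scoped b n"
  "scoped (eAnd a b) n \<longleftrightarrow> scoped a n \<and> scoped b n"
  "scoped (eOr a b) n \<longleftrightarrow> scoped a n \<and> scoped b n"
  "scoped (eAll a b) n \<longleftrightarrow> scoped a n \<and> scoped b (Suc n)"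
  "scoped (eEx a b) n \<longleftrightarrow> scoped a n \<and> scoped b (Suc n)"
  "scoped (eDiv a b) n \<longleftrightarrow> scoped a n \<and> scoped b n"
  "scoped (eMod a b) n \<longleftrightarrow> scoped a n \<and> scoped b n"
  "scoped (ePow a b c) n \<longleftrightarrow> scoped a n \<and> scoped b n \<and> scoped c n"
  "scoped (eDig a b c) n \<longleftrightarrow> scoped a n \<and> scoped b n \<and> scoped c n"
  by (auto simp: eMul_def eNot_def eLe_def eLt_def eEq_def eIf_def eAnd_def eOr_def eAll_def eEx_def
      eDiv_def eMod_def ePow_def eDig_def)

lemma eval_logic [simp]:
  "eval (eMul a b) A \<rho> = eval a A \<rho> * eval b A \<rho>"
  "eval (eNot a) A \<rho> = of_bool (eval a A \<rho> = 0)"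
  "eval (eLe a b) A \<rho> = of_bool (eval a A \<rho> \<le> eval b A \<rho>)"
  "eval (eLt a b) A \<rho> = of_bool (eval a A \<rho> < eval b A \<rho>)"
  "eval (eEq a b) A \<rho> = of_bool (eval a A \<rho> = eval b A \<rho>)"
  "eval (eIf c a b) A \<rho> = (if eval c A \<rho> \<noteq> 0 then eval a A \<rho> else eval b A \<rho>)"
  "eval (eAnd a b) A \<rho> = of_bool (eval a A \<rho> \<noteq> 0 \<and> eval b A \<rho> \<noteq> 0)"
  "eval (eOr a b) A \<rho> = of_bool (eval a A \<rho> \<noteq> 0 \<or> eval b A \<rho> \<noteq> 0)"
  "eval (eAll n a) A \<rho> = of_bool (\<forall>i<eval n A \<rho>. eval a A (\<rho> @ [i]) \<noteq> 0)"
  "eval (eEx n a) A \<rho> = of_bool (\<exists>i<eval n A \<rho>. eval a A (\<rho> @ [i]) \<noteq> 0)"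
proof -
  show mul: "eval (eMul a b) A \<rho> = eval a A \<rho> * eval b A \<rho>" for a b by (simp add: eMul_def)
  show nt: "eval (eNot a) A \<rho> = of_bool (eval a A \<rho> = 0)" for a \<rho> by (simp add: eNot_def)
  show le: "eval (eLe a b) A \<rho> = of_bool (eval a A \<rho> \<le> eval b A \<rho>)" for a b by (simp add: eLe_def nt)
  show "eval (eLt a b) A \<rho> = of_bool (eval a A \<rho> < eval b A \<rho>)" by (simp add: eLt_def le Suc_le_eq)
  show "eval (eEq a b) A \<rho> = of_bool (eval a A \<rho> = eval b A \<rho>)" by (auto simp: eEq_def nt)
  show "eval (eIf c a b) A \<rho> = (if eval c A \<rho> \<noteq> 0 then eval a A \<rho> else eval b A \<rho>)"
    by (auto simp: eIf_def nt mul)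
  show "eval (eAnd a b) A \<rho> = of_bool (eval a A \<rho> \<noteq> 0 \<and> eval b A \<rho> \<noteq> 0)" by (auto simp: eAnd_def nt mul)
  show "eval (eOr a b) A \<rho> = of_bool (eval a A \<rho> \<noteq> 0 \<or> eval b A \<rho> \<noteq> 0)" by (auto simp: eOr_def nt)
  show "eval (eAll n a) A \<rho> = of_bool (\<forall>i<eval n A \<rho>. eval a A (\<rho> @ [i]) \<noteq> 0)" by (auto simp: eAll_def nt)
  show "eval (eEx n a) A \<rho> = of_bool (\<exists>i<eval n A \<rho>. eval a A (\<rho> @ [i]) \<noteq> 0)" by (auto simp: eEx_def nt)
qed

lemma sum_of_bool_less: "d \<le> n \<Longrightarrow> (\<Sum>i<n. of_bool (i < d)) = (d::nat)"
proof -
  assume "d \<le> n"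
  then have "{..<n} \<inter> {i. i < d} = {..<d}" by auto
  then show ?thesis by (simp add: of_bool_def sum.If_cases)
qed

lemma eval_eDiv [simp]:
  assumes "0 < eval b A \<rho>" shows "eval (eDiv a b) A \<rho> = eval a A \<rho> div eval b A \<rho>"
proof -
  let ?x = "eval a A \<rho>" and ?y = "eval b A \<rho>"
  have "(t + 1) * ?y \<le> ?x \<longleftrightarrow> t < ?x div ?y" for t
    using assms by (metis Suc_eq_plus1 Suc_le_eq less_eq_div_iff_mult_less_eq)
  then have "eval (eDiv a b) A \<rho> = (\<Sum>t<?x. of_bool (t < ?x div ?y))"
    by (simp add: eDiv_def)
  then show ?thesis using sum_of_bool_less[OF div_le_dividend[of ?x ?y]] by simp
qed

lemma eval_eMod [simp]:
  assumes "0 < eval b A \<rho>" shows "eval (eMod a b) A \<rho> = eval a A \<rho> mod eval b A \<rho>"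
  using assms by (simp add: eMod_def minus_mult_div_eq_mod)

text \<open>Multiplying by a positive number never leads below the cap again, so capping in every
  round equals capping at the end.\<close>

lemma eval_ePow [simp]:
  assumes "0 < eval a A \<rho>" "0 < eval c A \<rho>"
  shows "eval (ePow a n c) A \<rho> = min (eval a A \<rho> ^ eval n A \<rho>) (eval c A \<rho>)"
proof -
  let ?x = "eval a A \<rho>" and ?c = "eval c A \<rho>"
  have "iter (\<lambda>i acc. min (acc * ?x) ?c) 1 n = min (?x ^ n) ?c" for n
  proof (induction n)
    case (Suc n)
    show ?case
    proof (cases "?x ^ n \<le> ?c")
      case False
      have "?c * 1 \<le> ?c * ?x" "?x ^ n * 1 \<le> ?x ^ n * ?x" using assms by (intro mult_left_mono; simp)+
      then have "?c \<le> ?c * ?x" "?c \<le> ?x ^ n * ?x" using False by linarith+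
      then have "min (?c * ?x) ?c = ?c" "min (?x ^ n * ?x) ?c = ?c" by (simp_all only: min_absorb2)
      moreover have "min (?x ^ n) ?c = ?c" using False by simp
      ultimately show ?thesis using Suc by (simp add: mult.commute)
    qed (use Suc in \<open>simp add: mult.commute\<close>)
  qed (use assms in auto)
  then show ?thesis by (simp add: ePow_def)
qed

lemma eval_eDig [simp]:
  assumes "0 < eval b A \<rho>"
  shows "eval (eDig b u j) A \<rho> = dig (eval b A \<rho>) (eval u A \<rho>) (eval j A \<rho>)"
proof -
  let ?b = "eval b A \<rho>" and ?u = "eval u A \<rho>"
  have "iter (\<lambda>i acc. min (acc div ?b) ?u) ?u n = ?u div ?b ^ n" for n
  proof (induction n)
    case (Suc n)
    have "?u div ?b ^ n div ?b \<le> ?u" using div_le_dividend le_trans by blast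
    then show ?case using Suc by (simp add: div_mult2_eq[symmetric] mult.commute)
  qed simp
  then show ?thesis using assms by (simp add: eDig_def dig_def)
qed

subsection \<open>Parsing a formula\<close>

text \<open>Clauses with fewer than three literals are padded by repeating the last one, which does
  not change when they are satisfied.\<close>

definition lit :: "formula \<Rightarrow> nat \<Rightarrow> nat \<Rightarrow> literal" where
  "lit \<phi> c r = \<phi> ! c ! min r (length (\<phi> ! c) - 1)"

text \<open>
  In an encoded formula a literal ends at the next delimiter, and a clause ends at the next pair of adjacent
  delimiters.
\<close>

definition fLitEnd :: exp where
  "fLitEnd = Add (V 0) (Sum (V 1) (eAll (Add (V 2) (Num 1)) (eNot (eEq (Lk 0 (Add (V 0) (V 3))) (Num 3)))))"
definition fClauseEnd :: exp where
  "fClauseEnd = Add (Add (V 0) (Sum (V 1) (eAll (Add (V 2) (Num 1))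
     (eNot (eAnd (eEq (Lk 0 (Add (V 0) (V 3))) (Num 3)) (eEq (Lk 0 (Add (Add (V 0) (V 3)) (Num 1))) (Num 3))))))) (Num 2)"
definition fClausePos :: exp where
  "fClausePos = It (V 0) (Num 0) (V 1) (Call fClauseEnd [V 3, V 1])"
definition fLitPos :: exp where
  "fLitPos = It (V 1) (Call fClausePos [V 0, V 2]) (V 2)
     (eIf (eEq (Lk 0 (Add (Call fLitEnd [V 4, V 2]) (Num 1))) (Num 3)) (V 4) (Add (Call fLitEnd [V 4, V 2]) (Num 1)))"
definition fSign :: exp where
  "fSign = eEq (Lk 0 (Call fLitPos [V 0, V 1, V 2])) (Num 2)"
definition fVar :: exp where
  "fVar = Sub (Sub (Call fLitEnd [Call fLitPos [V 0, V 1, V 2], V 2]) (Call fLitPos [V 0, V 1, V 2])) (Num 1)"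
definition fClauses :: exp where
  "fClauses = Sum (V 0) (eLt (Call fClausePos [V 1, V 0]) (V 0))"

lemma scoped_parse [simp]:
  "scoped fLitEnd 2" "scoped fClauseEnd 2" "scoped fClausePos 2" "scoped fLitPos 3" "scoped fSign 3" "scoped fVar 3"
  "scoped fClauses 1"
proof -
  show 1: "scoped fLitEnd 2" "scoped fClauseEnd 2" by (simp_all add: fLitEnd_def fClauseEnd_def)
  show 2: "scoped fClausePos 2" using 1 by (simp add: fClausePos_def numeral_2_eq_2)
  show 3: "scoped fLitPos 3" using 1 2 by (simp add: fLitPos_def numeral_2_eq_2)
  show "scoped fSign 3" "scoped fVar 3" using 1 3
    by (simp_all add: fSign_def fVar_def numeral_2_eq_2 numeral_3_eq_3)
  show "scoped fClauses 1" using 2 by (simp add: fClauses_def numeral_2_eq_2)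
qed

lemma word_array_append: "word_array (xs @ ys) (length xs + i) = word_array ys i"
  by (simp add: word_array_def nth_append)

text \<open>Searching for the first \<open>P\<close> is expressed by counting the initial stretches
  without \<open>P\<close>.\<close>

lemma sum_first:
  fixes P :: "nat \<Rightarrow> bool"
  assumes "d \<le> n" "P d" "\<And>s. s < d \<Longrightarrow> \<not> P s"
  shows "(\<Sum>t<n. of_bool (\<forall>s<Suc t. \<not> P s)) = d"
proof -
  have "(\<forall>s<Suc t. \<not> P s) \<longleftrightarrow> t < d" for t using assms(2,3) by (metis less_Suc_eq less_trans not_less_eq)
  then show ?thesis using sum_of_bool_less[OF assms(1)] by simp
qed

definition enc_lits :: "clause \<Rightarrow> nat list" where "enc_lits C = concat (map encode_literal C)"

lemma enc_lits_simps: "enc_lits [] = []" "enc_lits ((v, b) # C) = (if b then 2 else 1) # replicate v 1 @ 3 # enc_lits C"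
  by (auto simp: enc_lits_def)

lemma word_array_lit:
  "word_array (enc_lits ((v, b) # C) @ ys) 0 = (if b then 2 else 1)"
  "s < v \<Longrightarrow> word_array (enc_lits ((v, b) # C) @ ys) (Suc s) = 1"
  "word_array (enc_lits ((v, b) # C) @ ys) (Suc v) = 3"
  "word_array (enc_lits ((v, b) # C) @ ys) (Suc (Suc v) + i) = word_array (enc_lits C @ ys) i"
  using word_array_append[of "(if b then 2 else 1) # replicate v 1 @ [3]" "enc_lits C @ ys" i]
  by (simp_all add: enc_lits_simps word_array_def nth_append)

lemma length_enc_lits_ge: "C \<noteq> [] \<Longrightarrow> 2 \<le> length (enc_lits C)"
  by (cases C) (auto simp: enc_lits_def)

text \<open>Every literal starts with a sign symbol, which is not a delimiter; so two delimiters are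
  adjacent only at the end of a clause.\<close>

lemma first_double_delimiter:
  fixes ys C
  assumes "C \<noteq> []"
  shows "word_array (enc_lits C @ 3 # ys) (length (enc_lits C) - 1) = 3 \<and>
    word_array (enc_lits C @ 3 # ys) (Suc (length (enc_lits C) - 1)) = 3 \<and>
    (\<forall>s<length (enc_lits C) - 1.
       \<not> (word_array (enc_lits C @ 3 # ys) s = 3 \<and> word_array (enc_lits C @ 3 # ys) (Suc s) = 3))"
  using assms
proof (induction C)
  case (Cons l C)
  obtain v b where l: "l = (v, b)" by (cases l)
  let ?w = "word_array (enc_lits ((v, b) # C) @ 3 # ys)"
  note wl = word_array_lit[where v = v and b = b and C = C and ys = "3 # ys"]
  have small: "?w s \<noteq> 3" if "s \<le> v" for s using that wl(1) wl(2)[of "s - 1"] by (cases s) auto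
  have len: "length (enc_lits ((v, b) # C)) = Suc (Suc v) + length (enc_lits C)" by (simp add: enc_lits_simps)
  show ?case
  proof (cases "C = []")
    case True
    have "?w (Suc (Suc v)) = 3" using wl(4)[of 0] True by (simp add: enc_lits_simps word_array_def)
    then show ?thesis using True small wl(3) unfolding l len by (auto simp: enc_lits_simps less_Suc_eq_le)
  next
    case False
    let ?w' = "word_array (enc_lits C @ 3 # ys)"
    have IH: "?w' (length (enc_lits C) - 1) = 3" "?w' (Suc (length (enc_lits C) - 1)) = 3"
      "\<And>s. s < length (enc_lits C) - 1 \<Longrightarrow> \<not> (?w' s = 3 \<and> ?w' (Suc s) = 3)"
      using Cons.IH False by blast+
    have ge: "2 \<le> length (enc_lits C)" by (rule length_enc_lits_ge[OF False])
    then have e: "length (enc_lits ((v, b) # C)) - 1 = Suc (Suc v) + (length (enc_lits C) - 1)"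
      unfolding len by simp
    have "\<not> (?w s = 3 \<and> ?w (Suc s) = 3)" if "s < Suc (Suc v) + (length (enc_lits C) - 1)" for s
    proof -
      consider "s \<le> v" | "s = Suc v" | "Suc (Suc v) \<le> s" by linarith
      then show ?thesis
      proof cases
        case 2
        obtain v' b' C' where "C = (v', b') # C'" using False by (metis list.exhaust surj_pair)
        then have "?w (Suc s) \<noteq> 3" using 2 wl(4)[of 0] word_array_lit(1)[where v = v' and b = b' and C = C' and ys = "3 # ys"] by auto
        then show ?thesis by simp
      next
        case 3
        then obtain i where i: "s = Suc (Suc v) + i" using le_Suc_ex by blast
        then show ?thesis using IH(3)[of i] wl(4)[of i] wl(4)[of "Suc i"] that by auto
      qed (use small in simp)
    qed
    then show ?thesis unfolding l e using IH(1,2) wl(4)[of "length (enc_lits C) - 1"] wl(4)[of "Suc (length (enc_lits C) - 1)"]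
      by simp
  qed
qed simp

locale formula_word =
  fixes \<phi> :: formula and A :: "nat \<Rightarrow> nat \<Rightarrow> nat"
  assumes \<phi>: "\<phi> \<in> threesat_instances"
    and A0: "A 0 = word_array (encode_formula \<phi>)"
begin

definition m :: nat where "m = length \<phi>"
definition len :: nat where "len = length (encode_formula \<phi>)"
definition start :: "nat \<Rightarrow> nat" where "start c = length (encode_formula (take c \<phi>))"

lemma m_pos: "0 < m"
  using \<phi> by (auto simp: m_def threesat_instances_def)

lemma clause: "c < m \<Longrightarrow> 1 \<le> length (\<phi> ! c) \<and> length (\<phi> ! c) \<le> 3 \<and> (\<forall>(v, b)\<in>set (\<phi> ! c). v < 3 * m)"
  using \<phi> by (auto simp: m_def threesat_instances_def)

lemma encode_formula_append: "encode_formula (xs @ ys) = encode_formula xs @ encode_formula ys"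
  by (simp add: encode_formula_def)

lemma encode_clause_eq: "encode_clause C = enc_lits C @ [3]"
  by (simp add: encode_clause_def enc_lits_def)

lemma encode_split:
  assumes "c < m"
  shows "encode_formula \<phi> = encode_formula (take c \<phi>) @ enc_lits (\<phi> ! c) @ 3 # encode_formula (drop (Suc c) \<phi>)"
proof -
  have "\<phi> = take c \<phi> @ [\<phi> ! c] @ drop (Suc c) \<phi>" using assms unfolding m_def by (simp add: id_take_nth_drop[symmetric])
  then have "encode_formula \<phi> = encode_formula (take c \<phi> @ [\<phi> ! c] @ drop (Suc c) \<phi>)" by (rule arg_cong)
  then show ?thesis unfolding encode_formula_append by (simp add: encode_formula_def encode_clause_eq)
qed

lemma A0_start: "c < m \<Longrightarrow> A 0 (start c + i) = word_array (enc_lits (\<phi> ! c) @ 3 # encode_formula (drop (Suc c) \<phi>)) i"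
  unfolding A0 start_def by (subst encode_split) (assumption, rule word_array_append)

lemma start_Suc: "c < m \<Longrightarrow> start (Suc c) = start c + length (enc_lits (\<phi> ! c)) + 1"
  unfolding start_def m_def by (simp add: take_Suc_conv_app_nth encode_formula_append) (simp add: encode_formula_def encode_clause_eq)

lemma start_m: "start m = len"
  by (simp add: start_def m_def len_def)

lemma start_le: "c \<le> m \<Longrightarrow> start c \<le> len"
  unfolding start_def len_def by (metis append_take_drop_id encode_formula_append length_append le_add1)

lemma start_less: "c < m \<Longrightarrow> start c < len"
  using start_Suc[of c] start_le[of "Suc c"] by simp

lemma m_le_len: "m \<le> len"
proof -
  have "c \<le> start c" if "c \<le> m" for c using that
  proof (induction c)
    case (Suc c)
    then show ?case using start_Suc[of c] by simp
  qed simp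
  then show ?thesis using start_m by (metis order_refl)
qed

lemma eval_fClauseEnd:
  assumes "c < m" shows "eval fClauseEnd A [start c, len] = start (Suc c)"
proof -
  let ?d = "length (enc_lits (\<phi> ! c)) - 1"
  have ne: "\<phi> ! c \<noteq> []" using clause[OF assms] by auto
  note fd = first_double_delimiter[OF ne, where ys = "encode_formula (drop (Suc c) \<phi>)"]
  have P: "A 0 (start c + ?d) = 3 \<and> A 0 (Suc (start c + ?d)) = 3"
    "\<not> (A 0 (start c + s) = 3 \<and> A 0 (Suc (start c + s)) = 3)" if "s < ?d" for s
    using fd that A0_start[OF assms, of ?d] A0_start[OF assms, of "Suc ?d"] A0_start[OF assms, of s] A0_start[OF assms, of "Suc s"]
    by (auto simp del: word_array_append)
  have P1: "A 0 (start c + ?d) = 3 \<and> A 0 (Suc (start c + ?d)) = 3"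
    using fd A0_start[OF assms, of ?d] A0_start[OF assms, of "Suc ?d"] by auto
  have dle: "?d \<le> len" using start_Suc[OF assms] start_le[of "Suc c"] assms by simp
  have "(\<Sum>t<len. of_bool (\<forall>s<Suc t. \<not> (A 0 (start c + s) = 3 \<and> A 0 (Suc (start c + s)) = 3))) = ?d"
    by (rule sum_first[OF dle]) (use P(2) P1 in auto)
  then show ?thesis using start_Suc[OF assms] length_enc_lits_ge[OF ne]
    by (simp add: fClauseEnd_def)
qed

text \<open>Past the last clause the cap holds the position at \<open>len\<close>;
  \<open>fClauses\<close> counts the clauses by noticing this.\<close>

lemma eval_fClausePos: "eval fClausePos A [c, len] = (if c \<le> m then start c else len)"
proof -
  let ?f = "\<lambda>i acc. min (eval fClauseEnd A [acc, len]) len"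
  have "iter ?f 0 c = (if c \<le> m then start c else len)"
  proof (induction c)
    case 0
    then show ?case by (simp add: start_def encode_formula_def)
  next
    case (Suc c)
    show ?case
    proof (cases "c < m")
      case True
      then show ?thesis using Suc eval_fClauseEnd[OF True] start_le[of "Suc c"] by simp
    next
      case False
      then have "iter ?f 0 c = len" using Suc start_m by (cases "c = m") auto
      moreover have "len \<le> eval fClauseEnd A [len, len]" by (simp add: fClauseEnd_def)
      ultimately show ?thesis using False by simp
    qed
  qed
  then show ?thesis by (simp add: fClausePos_def)
qed

lemma eval_fClauses: "eval fClauses A [len] = m"
proof -
  have "(if c \<le> m then start c else len) < len \<longleftrightarrow> c < m" for c
    using start_less start_m by (auto simp: le_less)
  then have "eval fClauses A [len] = (\<Sum>c<len. of_bool (c < m))"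
    by (simp add: fClauses_def eval_fClausePos)
  then show ?thesis using sum_of_bool_less[OF m_le_len] by simp
qed

definition lstart :: "nat \<Rightarrow> nat \<Rightarrow> nat" where
  "lstart c r = start c + length (enc_lits (take r (\<phi> ! c)))"

lemma enc_lits_append: "enc_lits (xs @ ys) = enc_lits xs @ enc_lits ys"
  by (simp add: enc_lits_def)

lemma A0_lstart:
  assumes "c < m" "r < length (\<phi> ! c)"
  shows "A 0 (lstart c r + i) =
    word_array (enc_lits (\<phi> ! c ! r # drop (Suc r) (\<phi> ! c)) @ 3 # encode_formula (drop (Suc c) \<phi>)) i"
proof -
  have "\<phi> ! c = take r (\<phi> ! c) @ \<phi> ! c ! r # drop (Suc r) (\<phi> ! c)" using assms(2) by (rule id_take_nth_drop)
  then have e: "enc_lits (\<phi> ! c) = enc_lits (take r (\<phi> ! c)) @ enc_lits (\<phi> ! c ! r # drop (Suc r) (\<phi> ! c))"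
    by (metis enc_lits_append)
  show ?thesis
    unfolding lstart_def add.assoc A0_start[OF assms(1)] by (subst e) (simp add: word_array_append)
qed

lemma lstart_Suc:
  assumes "c < m" "r < length (\<phi> ! c)" "\<phi> ! c ! r = (v, b)"
  shows "lstart c (Suc r) = lstart c r + v + 2"
  using assms by (simp add: lstart_def take_Suc_conv_app_nth enc_lits_append enc_lits_simps)

lemma lstart_less: "c < m \<Longrightarrow> r \<le> length (\<phi> ! c) \<Longrightarrow> lstart c r < len"
proof -
  assume "c < m" "r \<le> length (\<phi> ! c)"
  moreover have "length (enc_lits (take r (\<phi> ! c))) \<le> length (enc_lits (\<phi> ! c))"
    by (metis append_take_drop_id enc_lits_append length_append le_add1)
  ultimately show ?thesis using start_Suc[of c] start_le[of "Suc c"] by (simp add: lstart_def)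
qed

lemma eval_fLitEnd:
  assumes "c < m" "r < length (\<phi> ! c)" "\<phi> ! c ! r = (v, b)"
  shows "eval fLitEnd A [lstart c r, len] = lstart c r + v + 1"
proof -
  note w = word_array_lit[where v = v and b = b and C = "drop (Suc r) (\<phi> ! c)" and ys = "3 # encode_formula (drop (Suc c) \<phi>)"]
  have 1: "A 0 (lstart c r + Suc v) = 3" using A0_lstart[OF assms(1,2), of "Suc v"] w(3) assms(3) by simp
  have 2: "A 0 (lstart c r + s) \<noteq> 3" if "s < Suc v" for s
    using A0_lstart[OF assms(1,2), of s] w(1) w(2)[of "s - 1"] assms(3) that by (cases s) auto
  have "Suc v \<le> len" using lstart_Suc[OF assms] lstart_less[OF assms(1), of "Suc r"] assms(2) by simp
  then have "(\<Sum>t<len. of_bool (\<forall>s<Suc t. \<not> A 0 (lstart c r + s) = 3)) = Suc v"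
    by (rule sum_first) (use 1 2 in auto)
  then show ?thesis by (simp add: fLitEnd_def)
qed

text \<open>If the delimiter of a literal is followed by another delimiter, the clause ends and the
  position stays where it is. This produces the padding in \<open>lit\<close>.\<close>

lemma eval_fLitPos:
  assumes c: "c < m"
  shows "eval fLitPos A [c, r, len] = lstart c (min r (length (\<phi> ! c) - 1))"
proof -
  let ?f = "\<lambda>i acc. min (if A 0 (eval fLitEnd A [acc, len] + 1) = 3 then acc else eval fLitEnd A [acc, len] + 1) len"
  let ?L = "length (\<phi> ! c)"
  have L: "1 \<le> ?L" using clause[OF c] by simp
  have "iter ?f (start c) r = lstart c (min r (?L - 1))"
  proof (induction r)
    case 0
    then show ?case by (simp add: lstart_def enc_lits_def)
  next
    case (Suc r)
    let ?r = "min r (?L - 1)"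
    have r: "?r < ?L" using L by auto
    obtain v b where vb: "\<phi> ! c ! ?r = (v, b)" by fastforce
    note e = eval_fLitEnd[OF c r vb]
    note w = word_array_lit[where v = v and b = b and C = "drop (Suc ?r) (\<phi> ! c)" and ys = "3 # encode_formula (drop (Suc c) \<phi>)"]
    have A: "A 0 (lstart c ?r + v + 1 + 1) =
        word_array (enc_lits (drop (Suc ?r) (\<phi> ! c)) @ 3 # encode_formula (drop (Suc c) \<phi>)) 0"
      using A0_lstart[OF c r, of "Suc (Suc v)"] w(4)[of 0] vb by (simp add: add.assoc)
    show ?case
    proof (cases "Suc ?r < ?L")
      case True
      obtain v' b' where vb': "\<phi> ! c ! Suc ?r = (v', b')" by fastforce
      have "drop (Suc ?r) (\<phi> ! c) = (v', b') # drop (Suc (Suc ?r)) (\<phi> ! c)"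
        using Cons_nth_drop_Suc[OF True] vb' by simp
      then have ne: "A 0 (lstart c ?r + v + 1 + 1) \<noteq> 3"
        unfolding A by (simp add: word_array_lit(1))
      have s: "lstart c (Suc ?r) = lstart c ?r + v + 1 + 1" using lstart_Suc[OF c r vb] by simp
      have "min (Suc r) (?L - 1) = Suc ?r" using True by auto
      then show ?thesis using Suc e ne s lstart_less[OF c, of "Suc ?r"] r by simp
    next
      case False
      then have "drop (Suc ?r) (\<phi> ! c) = []" by simp
      then have eq: "A 0 (lstart c ?r + v + 1 + 1) = 3" unfolding A by (simp add: enc_lits_simps word_array_def)
      have "min (Suc r) (?L - 1) = ?r" using False by auto
      then show ?thesis using Suc e eq lstart_less[OF c, of ?r] r by simp
    qed
  qed
  then show ?thesis using c by (simp add: fLitPos_def eval_fClausePos cong: if_cong)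
qed

lemma eval_fVar: "c < m \<Longrightarrow> eval fVar A [c, r, len] = fst (lit \<phi> c r)"
  and eval_fSign: "c < m \<Longrightarrow> eval fSign A [c, r, len] = of_bool (snd (lit \<phi> c r))"
proof -
  assume c: "c < m"
  let ?r = "min r (length (\<phi> ! c) - 1)"
  have r: "?r < length (\<phi> ! c)" using clause[OF c] by auto
  obtain v b where vb: "\<phi> ! c ! ?r = (v, b)" by fastforce
  show "eval fVar A [c, r, len] = fst (lit \<phi> c r)"
    using eval_fLitEnd[OF c r vb] vb by (simp add: fVar_def eval_fLitPos[OF c] lit_def)
  have "A 0 (lstart c ?r) = (if b then 2 else 1)"
    using A0_lstart[OF c r, of 0] vb by (simp add: word_array_lit(1))
  then show "eval fSign A [c, r, len] = of_bool (snd (lit \<phi> c r))"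
    using vb by (simp add: fSign_def eval_fLitPos[OF c] lit_def)
qed

lemma lit_less: "c < m \<Longrightarrow> fst (lit \<phi> c r) < 3 * m"
proof -
  assume c: "c < m"
  have "lit \<phi> c r \<in> set (\<phi> ! c)" unfolding lit_def using clause[OF c] by (intro nth_mem) auto
  then show ?thesis using clause[OF c] by (cases "lit \<phi> c r") auto
qed

lemma clause_sat_lit: "c < m \<Longrightarrow> clause_sat a (\<phi> ! c) \<longleftrightarrow> (\<exists>r<3. a (fst (lit \<phi> c r)) = snd (lit \<phi> c r))"
proof -
  assume c: "c < m"
  have "(\<exists>r<3. a (fst (lit \<phi> c r)) = snd (lit \<phi> c r)) \<longleftrightarrow> (\<exists>r<length (\<phi> ! c). a (fst (\<phi> ! c ! r)) = snd (\<phi> ! c ! r))"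
  proof
    assume "\<exists>r<3. a (fst (lit \<phi> c r)) = snd (lit \<phi> c r)"
    then obtain r where "a (fst (lit \<phi> c r)) = snd (lit \<phi> c r)" by blast
    then show "\<exists>r<length (\<phi> ! c). a (fst (\<phi> ! c ! r)) = snd (\<phi> ! c ! r)"
      using clause[OF c] unfolding lit_def by (intro exI[of _ "min r (length (\<phi> ! c) - 1)"]) auto
  next
    assume "\<exists>r<length (\<phi> ! c). a (fst (\<phi> ! c ! r)) = snd (\<phi> ! c ! r)"
    then obtain r where "r < length (\<phi> ! c)" "a (fst (\<phi> ! c ! r)) = snd (\<phi> ! c ! r)" by blast
    moreover from this have "min r (length (\<phi> ! c) - 1) = r" by simp
    ultimately show "\<exists>r<3. a (fst (lit \<phi> c r)) = snd (lit \<phi> c r)"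
      using clause[OF c] unfolding lit_def by (intro exI[of _ r]) auto
  qed
  also have "\<dots> \<longleftrightarrow> (\<exists>l\<in>set (\<phi> ! c). a (fst l) = snd l)" unfolding Bex_def in_set_conv_nth by blast
  also have "\<dots> \<longleftrightarrow> clause_sat a (\<phi> ! c)" unfolding clause_sat_def by (simp add: case_prod_beta)
  finally show ?thesis by blast
qed

end

subsection \<open>The graph as an expression\<close>

text \<open>
  All functions below expect the length of the input, the number of clauses, the parameter \<open>b\<close> and the level \<open>l\<close> as their
  first four arguments. Array 1 holds the choices made so far: at level \<open>l\<close>, with \<open>q = m div b + 1\<close>, the
  cells \<open>4 * q * l, \<dots>\<close> hold the values of \<open>3 * q\<close> variables and then \<open>q\<close> flags that drop blocks
  (2 for true and 1 for false).
\<close>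

abbreviation call :: "exp \<Rightarrow> exp list \<Rightarrow> exp" where
  "call f xs \<equiv> Call f (V 0 # V 1 # V 2 # V 3 # xs)"

definition eQ :: exp where "eQ = Add (eDiv (V 1) (V 2)) (Num 1)"
definition eB :: exp where "eB = Add (V 2) (Num 1)"
definition e3Q :: exp where "e3Q = eMul (Num 3) eQ"
definition eCell :: "exp \<Rightarrow> exp \<Rightarrow> exp" where
  "eCell l i = eEq (Lk 1 (Add (eMul (eMul (Num 4) eQ) l) i)) (Num 2)"
definition fSet :: exp where "fSet = eLe (eDiv (V 4) e3Q) (V 3)"
definition fVal :: exp where "fVal = eCell (eDiv (V 4) e3Q) (eMod (V 4) e3Q)"
definition fDropped :: exp where "fDropped = eEx (Add (V 3) (Num 1)) (eCell (V 5) (Add e3Q (V 4)))"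
text \<open>The condition is multiplied out to avoid a division. The constant 8 comes from the count
  of violated clauses at the last level.\<close>

definition fWeight :: "nat \<Rightarrow> exp" where
  "fWeight E = eLe (eMul (Sum eQ (eCell (V 3) (Add e3Q (V 4)))) (eMul (Num (8 * E)) (V 2))) eQ"
definition fCl :: exp where "fCl = eMod (Add (eMul eB (V 4)) (V 5)) (V 1)"
definition fPos :: exp where "fPos = eDiv (eDig (eMul (Num 2) eB) (V 4) (V 5)) (Num 2)"
definition fBit :: exp where "fBit = eEq (eMod (eDig (eMul (Num 2) eB) (V 4) (V 5)) (Num 2)) (Num 1)"
definition fPvar :: exp where
  "fPvar = Call fVar [call fCl [eDiv (V 4) (Num 3), V 5], eMod (V 4) (Num 3), V 0]"
definition fAgrees :: exp where
  "fAgrees = eAll e3Q (eOr (eNot (call fSet [call fPvar [V 5, call fPos [V 4, V 5]]]))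
     (eEq (call fVal [call fPvar [V 5, call fPos [V 4, V 5]]]) (call fBit [V 4, V 5])))"
definition fFalsified :: exp where
  "fFalsified = eAnd (eEq (call fPos [V 4, Add (eMul (Num 3) (V 5)) (V 7)]) (V 6))
     (eNot (eEq (call fBit [V 4, Add (eMul (Num 3) (V 5)) (V 7)]) (Call fSign [call fCl [V 5, V 6], V 7, V 0])))"
definition fCompat :: exp where
  "fCompat = eAnd (eAnd (call fAgrees [V 4]) (call fAgrees [V 5]))
     (eAnd (eAll e3Q (eAll e3Q
        (eOr (eNot (eEq (call fPvar [V 6, call fPos [V 4, V 6]]) (call fPvar [V 7, call fPos [V 5, V 7]])))
          (eEq (call fBit [V 4, V 6]) (call fBit [V 5, V 7])))))
      (eAll eQ (eOr (call fDropped [V 6]) (eAll eB (eEx (Num 3)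
        (eAnd (eNot (call fFalsified [V 4, V 6, V 7, V 8])) (eNot (call fFalsified [V 5, V 6, V 7, V 8]))))))))"
definition fDirect :: "nat \<Rightarrow> exp" where
  "fDirect E = eLt (eMul (Sum (V 1) (eAll (Num 3)
     (eNot (eEq (call fVal [Call fVar [V 4, V 5, V 0]]) (Call fSign [V 4, V 5, V 0]))))) (Num E)) (V 1)"
definition fEdge :: "nat \<Rightarrow> exp" where
  "fEdge E = eAnd (eNot (eEq (V 4) (V 5))) (eIf (eEq (Add (V 3) (Num 1)) (V 2)) (call (fDirect E) [])
     (eAnd (call (fWeight E) []) (call fCompat [V 4, V 5])))"
text \<open>The fifth argument is the cap \<open>P\<close>; the powers are correct as soon as
  \<open>P\<close> exceeds the number of vertices.\<close>

definition fN :: exp where "fN = ePow (eMul (Num 2) eB) e3Q (V 4)"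
definition fK :: exp where "fK = ePow eB e3Q (V 4)"
definition fSym :: "nat \<Rightarrow> exp" where
  "fSym E = eIf (eLt (V 5) (call fN [V 4])) (Num 1) (eIf (eEq (V 5) (call fN [V 4])) (Num 3)
     (eIf (eLt (V 5) (Add (Add (call fN [V 4]) (Num 1)) (call fK [V 4]))) (Num 1)
     (eIf (eEq (V 5) (Add (Add (call fN [V 4]) (Num 1)) (call fK [V 4]))) (Num 3)
     (Add (Num 1) (call (fEdge E)
       [eDiv (Sub (V 5) (Add (Add (call fN [V 4]) (Num 2)) (call fK [V 4]))) (call fN [V 4]),
        eMod (Sub (V 5) (Add (Add (call fN [V 4]) (Num 2)) (call fK [V 4]))) (call fN [V 4])])))))"
definition fLen :: exp where
  "fLen = Add (Add (Add (call fN [V 4]) (Num 2)) (call fK [V 4])) (eMul (call fN [V 4]) (call fN [V 4]))"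

lemma scoped_eQ [simp]: "4 \<le> n \<Longrightarrow> scoped eQ n" "4 \<le> n \<Longrightarrow> scoped eB n" "4 \<le> n \<Longrightarrow> scoped e3Q n"
  "4 \<le> n \<Longrightarrow> scoped (eCell a b) n \<longleftrightarrow> scoped a n \<and> scoped b n"
  by (auto simp: eQ_def eB_def e3Q_def eCell_def)

lemma scoped_graph [simp]:
  "scoped fSet 5" "scoped fVal 5" "scoped fDropped 5" "scoped (fWeight E) 4" "scoped fCl 6" "scoped fPos 6" "scoped fBit 6"
  "scoped fPvar 6" "scoped fAgrees 5" "scoped fFalsified 8" "scoped fCompat 6" "scoped (fDirect E) 4" "scoped (fEdge E) 6"
  "scoped fN 5" "scoped fK 5" "scoped (fSym E) 6" "scoped fLen 5"
proof -
  have n: "Suc (Suc (Suc (Suc 0))) = 4" "Suc 4 = 5" "Suc 5 = 6" "Suc 6 = 7" "Suc 7 = 8" "Suc 8 = 9" by simp_all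
  have n3: "Suc (Suc (Suc 0)) = 3" by simp
  show 1: "scoped fSet 5" "scoped fVal 5" "scoped fDropped 5" "scoped (fWeight E) 4" "scoped fCl 6" "scoped fPos 6" "scoped fBit 6"
    by (simp_all add: fSet_def fVal_def fDropped_def fWeight_def fCl_def fPos_def fBit_def n)
  show 2: "scoped fPvar 6" using 1 by (simp add: fPvar_def n n3)
  show 3: "scoped fAgrees 5" "scoped fFalsified 8" using 1 2 by (simp_all add: fAgrees_def fFalsified_def n n3)
  show 4: "scoped fCompat 6" using 1 2 3 by (simp add: fCompat_def n)
  show 5: "scoped (fDirect E) 4" using 1 by (simp add: fDirect_def n n3)
  show 6: "scoped (fEdge E) 6" using 1 4 5 by (simp add: fEdge_def n)
  show 7: "scoped fN 5" "scoped fK 5" by (simp_all add: fN_def fK_def)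
  show "scoped (fSym E) 6" "scoped fLen 5" using 6 7 by (simp_all add: fSym_def fLen_def n)
qed

context formula_word
begin

definition qq :: "nat \<Rightarrow> nat" where "qq b = m div b + 1"
definition var :: "nat \<Rightarrow> nat \<Rightarrow> nat" where "var c r = fst (lit \<phi> c r)"
definition sgn :: "nat \<Rightarrow> nat \<Rightarrow> bool" where "sgn c r = snd (lit \<phi> c r)"
definition cell :: "nat \<Rightarrow> (nat \<Rightarrow> nat) \<Rightarrow> nat \<Rightarrow> nat \<Rightarrow> bool" where
  "cell b z l i \<longleftrightarrow> z (4 * qq b * l + i) = 2"
definition pval :: "nat \<Rightarrow> (nat \<Rightarrow> nat) \<Rightarrow> nat \<Rightarrow> bool" where
  "pval b z x \<longleftrightarrow> cell b z (x div (3 * qq b)) (x mod (3 * qq b))"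
definition pz :: "nat \<Rightarrow> nat \<Rightarrow> (nat \<Rightarrow> nat) \<Rightarrow> nat \<Rightarrow> bool option" where
  "pz b l z x = (if x div (3 * qq b) \<le> l then Some (pval b z x) else None)"
definition Dz :: "nat \<Rightarrow> nat \<Rightarrow> (nat \<Rightarrow> nat) \<Rightarrow> nat set" where
  "Dz b l z = {i. \<exists>l'\<le>l. cell b z l' (3 * qq b + i)}"
definition weight :: "nat \<Rightarrow> nat \<Rightarrow> (nat \<Rightarrow> nat) \<Rightarrow> nat" where
  "weight b l z = card {i. i < qq b \<and> cell b z l (3 * qq b + i)}"
definition violated :: "(nat \<Rightarrow> bool) \<Rightarrow> nat" where
  "violated a = card {c. c < m \<and> \<not> clause_sat a (\<phi> ! c)}"
definition compat :: "nat \<Rightarrow> nat \<Rightarrow> (nat \<Rightarrow> nat) \<Rightarrow> nat \<Rightarrow> nat \<Rightarrow> bool" where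
  "compat b l z = csp.compat m (qq b) (Suc b) var sgn (pz b l z) (Dz b l z)"
text \<open>At the last level all variables are fixed, and the graph is complete or empty according
  to a direct count of violated clauses. A choice that drops too many blocks also yields the empty
  graph. So any machine that distinguishes the two cases answers these tests correctly, for every
  size of the graph.\<close>

definition adj :: "nat \<Rightarrow> nat \<Rightarrow> nat \<Rightarrow> (nat \<Rightarrow> nat) \<Rightarrow> nat \<Rightarrow> nat \<Rightarrow> bool" where
  "adj E b l z u v \<longleftrightarrow> u \<noteq> v \<and> (if l + 1 = b then violated (pval b z) * E < m
     else weight b l z * (8 * E * b) \<le> qq b \<and> compat b l z u v)"
text \<open>Blocks have \<open>Suc b\<close> clauses rather than \<open>b\<close>, so that \<beta>
  and \<open>kk b\<close> are at least 2 even for \<open>b = 1\<close>.\<close>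

definition NN :: "nat \<Rightarrow> nat" where "NN b = (2 * Suc b) ^ (3 * qq b)"
definition kk :: "nat \<Rightarrow> nat" where "kk b = Suc b ^ (3 * qq b)"
definition graph :: "nat \<Rightarrow> nat \<Rightarrow> nat \<Rightarrow> (nat \<Rightarrow> nat) \<Rightarrow> dks_instance" where
  "graph E b l z = (NN b, {{u, v} | u v. u < NN b \<and> v < NN b \<and> adj E b l z u v}, kk b)"

lemma qq_pos: "0 < qq b" by (simp add: qq_def)

context
  fixes b l :: nat and z :: "nat \<Rightarrow> nat"
  assumes b: "0 < b" and z: "A 1 = z"
begin

lemma z': "A (Suc 0) = z" using z by simp

lemma eval_eQ: "eval eQ A (len # m # b # l # xs) = qq b"
  "eval eB A (len # m # b # l # xs) = Suc b"
  "eval e3Q A (len # m # b # l # xs) = 3 * qq b"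
  using b by (simp_all add: eQ_def eB_def e3Q_def qq_def)

lemma eval_eCell: "eval (eCell c i) A (len # m # b # l # xs) =
    of_bool (cell b z (eval c A (len # m # b # l # xs)) (eval i A (len # m # b # l # xs)))"
  by (simp add: eCell_def eval_eQ cell_def z')

lemma eval_partial:
  "eval fSet A [len, m, b, l, x] = of_bool (x div (3 * qq b) \<le> l)"
  "eval fVal A [len, m, b, l, x] = of_bool (pval b z x)"
  "eval fDropped A [len, m, b, l, i] = of_bool (i \<in> Dz b l z)"
  "eval (fWeight E) A [len, m, b, l] = of_bool (weight b l z * (8 * E * b) \<le> qq b)"
proof -
  have q: "0 < eval e3Q A (len # m # b # l # xs)" for xs using qq_pos by (simp add: eval_eQ)
  show "eval fSet A [len, m, b, l, x] = of_bool (x div (3 * qq b) \<le> l)"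
    using q by (simp add: fSet_def eval_eQ)
  show "eval fVal A [len, m, b, l, x] = of_bool (pval b z x)"
    using q by (simp add: fVal_def eval_eCell eval_eQ pval_def)
  show "eval fDropped A [len, m, b, l, i] = of_bool (i \<in> Dz b l z)"
    by (simp add: fDropped_def eval_eCell eval_eQ Dz_def less_Suc_eq_le)
  have "{..<qq b} \<inter> {i. cell b z l (3 * qq b + i)} = {i. i < qq b \<and> cell b z l (3 * qq b + i)}" by auto
  then show "eval (fWeight E) A [len, m, b, l] = of_bool (weight b l z * (8 * E * b) \<le> qq b)"
    by (simp add: fWeight_def eval_eCell eval_eQ weight_def)
qed

interpretation G: csp m "qq b" "Suc b" var sgn "pz b l z" "Dz b l z"
  by unfold_locales (use b in simp)

lemma eval_picks:
  "eval fCl A [len, m, b, l, i, d] = G.cl i d"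
  "eval fPos A [len, m, b, l, u, j] = G.pos u j"
  "eval fBit A [len, m, b, l, u, j] = of_bool (G.bit u j)"
  "eval fPvar A [len, m, b, l, j, d] = G.pvar j d"
  using m_pos by (simp_all add: fCl_def fPos_def fBit_def fPvar_def eval_eQ G.cl_def G.pos_def G.bit_def G.pvar_def
      odd_iff_mod_2_eq_one eval_fVar var_def)

lemma cl_less: "G.cl i d < m"
  using m_pos by (simp add: G.cl_def)

lemma eval_fAgrees: "eval fAgrees A [len, m, b, l, u] = of_bool (G.agrees u)"
proof -
  have "pz b l z x \<in> {None, Some c} \<longleftrightarrow> \<not> x div (3 * qq b) \<le> l \<or> pval b z x = c" for x c
    by (auto simp: pz_def)
  then show ?thesis
    by (simp add: fAgrees_def eval_eQ eval_picks eval_partial G.agrees_def of_bool_eq_iff split del: split_of_bool)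
qed

lemma eval_fFalsified: "eval fFalsified A [len, m, b, l, u, i, d, r] = of_bool (G.falsified u i d r)"
  by (simp add: fFalsified_def eval_picks G.falsified_def eval_fSign cl_less sgn_def of_bool_eq_iff split del: split_of_bool)

lemma eval_fCompat: "eval fCompat A [len, m, b, l, u, v] = of_bool (compat b l z u v)"
proof -
  have "eval fCompat A [len, m, b, l, u, v] = of_bool (G.compat u v)"
  proof -
    let ?\<rho> = "[len, m, b, l, u, v]"
    have 1: "eval (call fAgrees [V 4]) A ?\<rho> = of_bool (G.agrees u)"
      "eval (call fAgrees [V 5]) A ?\<rho> = of_bool (G.agrees v)"
      by (simp_all add: eval_fAgrees)
    have 2: "eval (eAll e3Q (eAll e3Q
        (eOr (eNot (eEq (call fPvar [V 6, call fPos [V 4, V 6]]) (call fPvar [V 7, call fPos [V 5, V 7]])))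
          (eEq (call fBit [V 4, V 6]) (call fBit [V 5, V 7]))))) A ?\<rho> =
      of_bool (\<forall>j<3 * qq b. \<forall>j'<3 * qq b. G.pvar j (G.pos u j) = G.pvar j' (G.pos v j') \<longrightarrow> G.bit u j = G.bit v j')"
      by (simp add: eval_eQ eval_picks of_bool_eq_iff split del: split_of_bool) blast
    have 3: "eval (eAll eQ (eOr (call fDropped [V 6]) (eAll eB (eEx (Num 3)
        (eAnd (eNot (call fFalsified [V 4, V 6, V 7, V 8])) (eNot (call fFalsified [V 5, V 6, V 7, V 8]))))))) A ?\<rho> =
      of_bool (\<forall>i<qq b. i \<in> Dz b l z \<or> (\<forall>d<Suc b. \<exists>r<3. \<not> G.falsified u i d r \<and> \<not> G.falsified v i d r))"
      by (simp add: eval_eQ eval_partial eval_fFalsified)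
    show ?thesis unfolding fCompat_def eval_logic(7)[of _ _ A ?\<rho>] 1 2 3 G.compat_def of_bool_eq_0_iff by auto
  qed
  then show ?thesis by (simp add: compat_def)
qed

lemma eval_fDirect: "eval (fDirect E) A [len, m, b, l] = of_bool (violated (pval b z) * E < m)"
proof -
  have "(\<Sum>c<m. of_bool (\<forall>r<3. pval b z (fst (lit \<phi> c r)) \<noteq> snd (lit \<phi> c r)) :: nat)
      = (\<Sum>c<m. of_bool (\<not> clause_sat (pval b z) (\<phi> ! c)))"
    by (rule sum.cong) (auto simp: clause_sat_lit)
  also have "\<dots> = violated (pval b z)"
  proof -
    have "{..<m} \<inter> {c. \<not> clause_sat (pval b z) (\<phi> ! c)} = {c. c < m \<and> \<not> clause_sat (pval b z) (\<phi> ! c)}" by auto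
    then show ?thesis by (simp add: violated_def)
  qed
  moreover have "(\<Sum>c<m. eval (eAll (Num 3) (eNot (eEq (call fVal [Call fVar [V 4, V 5, V 0]]) (Call fSign [V 4, V 5, V 0]))))
        A [len, m, b, l, c])
      = (\<Sum>c<m. of_bool (\<forall>r<3. pval b z (fst (lit \<phi> c r)) \<noteq> snd (lit \<phi> c r)))"
    by (rule sum.cong[OF refl]) (simp add: eval_fVar eval_fSign eval_partial of_bool_eq_iff split del: split_of_bool)
  ultimately show ?thesis by (simp add: fDirect_def del: eval_logic(9) sum_of_bool_eq)
qed

lemma eval_fEdge: "eval (fEdge E) A [len, m, b, l, u, v] = of_bool (adj E b l z u v)"
  by (simp add: fEdge_def eval_fDirect eval_partial eval_fCompat adj_def)

lemma adj_sym: "adj E b l z u v \<longleftrightarrow> adj E b l z v u"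
  using G.compat_sym by (auto simp: adj_def compat_def)

lemma eval_NK:
  assumes "NN b < P"
  shows "eval fN A [len, m, b, l, P] = NN b" "eval fK A [len, m, b, l, P] = kk b"
proof -
  have "kk b \<le> NN b" unfolding kk_def NN_def by (rule power_mono) auto
  then show "eval fN A [len, m, b, l, P] = NN b" "eval fK A [len, m, b, l, P] = kk b"
    using assms by (simp_all add: fN_def fK_def eval_eQ NN_def kk_def)
qed

text \<open>If \<open>P\<close> is too small, the capped power equals \<open>P\<close>; so the
  program can tell whether \<open>P\<close> already exceeds the number of vertices.\<close>

lemma eval_fN: "0 < P \<Longrightarrow> eval fN A [len, m, b, l, P] = min (NN b) P"
  by (simp add: fN_def eval_eQ NN_def)

end

lemma nth_matrix:
  "x < r * n \<Longrightarrow> concat (map (\<lambda>i. map (f i) [0..<n]) [0..<r]) ! x = f (x div n) (x mod n)"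
proof (induction r)
  case (Suc r)
  have len: "length (concat (map (\<lambda>i. map (f i) [0..<n]) [0..<r])) = r * n"
    by (induction r) auto
  show ?case
  proof (cases "x < r * n")
    case True
    then show ?thesis using Suc len by (simp add: nth_append)
  next
    case False
    then have x: "x - r * n < n" using Suc.prems by simp
    then have "x div n = r" "x mod n = x - r * n"
      using False div_nat_eqI[of n r x] by (auto simp: modulo_nat_def mult.commute)
    then show ?thesis using False len x by (simp add: nth_append)
  qed
qed simp

lemma length_matrix: "length (concat (map (\<lambda>i. map (f i) [0..<n]) [0..<r])) = r * n"
  by (induction r) auto

lemma eval_fSym:
  assumes b: "0 < b" and z: "A 1 = z" and P: "NN b < P"
  shows "eval fLen A [len, m, b, l, P] = length (encode_dks (graph E b l z))"
    "eval (fSym E) A [len, m, b, l, P, i] \<le> 3"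
    "i < length (encode_dks (graph E b l z)) \<Longrightarrow>
       eval (fSym E) A [len, m, b, l, P, i] = encode_dks (graph E b l z) ! i"
proof -
  let ?n = "NN b" and ?k = "kk b"
  have n0: "0 < ?n" by (simp add: NN_def)
  have NK: "eval fN A [len, m, b, l, P] = ?n" "eval fK A [len, m, b, l, P] = ?k"
    using eval_NK[OF b z P] by auto
  have sym: "eval (fSym E) A [len, m, b, l, P, i] =
      (if i < ?n then 1 else if i = ?n then 3 else if i < ?n + 1 + ?k then 1 else if i = ?n + 1 + ?k then 3
       else 1 + of_bool (adj E b l z ((i - (?n + 2 + ?k)) div ?n) ((i - (?n + 2 + ?k)) mod ?n)))" for i
    using n0 by (simp add: fSym_def NK eval_fEdge[OF b z] cong: if_cong)
  then show "eval (fSym E) A [len, m, b, l, P, i] \<le> 3" by simp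
  let ?E = "{{u, v} | u v. u < NN b \<and> v < NN b \<and> adj E b l z u v}"
  let ?f = "\<lambda>i j. if {i, j} \<in> ?E then 2 else 1 :: nat"
  let ?mat = "concat (map (\<lambda>i. map (?f i) [0..<?n]) [0..<?n])"
  have enc: "encode_dks (graph E b l z) = replicate ?n 1 @ [3] @ replicate ?k 1 @ [3] @ ?mat"
    by (simp add: graph_def)
  have len: "length (encode_dks (graph E b l z)) = ?n + 2 + ?k + ?n * ?n"
    unfolding enc by (simp add: length_matrix)
  show "eval fLen A [len, m, b, l, P] = length (encode_dks (graph E b l z))"
    unfolding len by (simp add: fLen_def NK)
  have edge: "{i, j} \<in> ?E \<longleftrightarrow> adj E b l z i j" if "i < ?n" "j < ?n" for i j
  proof
    assume "{i, j} \<in> ?E"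
    then obtain u v where "{i, j} = {u, v}" "adj E b l z u v" by blast
    then show "adj E b l z i j" using adj_sym[OF b z] by (auto simp: doubleton_eq_iff)
  qed (use that in blast)
  assume i: "i < length (encode_dks (graph E b l z))"
  consider "i < ?n" | "i = ?n" | "?n < i" "i < ?n + 1 + ?k" | "i = ?n + 1 + ?k" | "?n + 1 + ?k < i" by linarith
  then show "eval (fSym E) A [len, m, b, l, P, i] = encode_dks (graph E b l z) ! i"
  proof cases
    case 5
    define x where "x = i - (?n + 2 + ?k)"
    have ix: "i = ?n + 2 + ?k + x" using 5 by (simp add: x_def)
    then have x: "x < ?n * ?n" using i unfolding len by simp
    then have d: "x div ?n < ?n" "x mod ?n < ?n" using n0 by (auto simp: less_mult_imp_div_less)
    have "encode_dks (graph E b l z) ! i = ?mat ! x"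
      unfolding enc by (subst ix) (simp add: nth_append)
    also have "\<dots> = ?f (x div ?n) (x mod ?n)" by (rule nth_matrix[OF x])
    also have "\<dots> = 1 + of_bool (adj E b l z (x div ?n) (x mod ?n))" using edge[OF d] by simp
    finally show ?thesis using 5 unfolding sym x_def by simp
  qed (unfold sym enc, auto simp: nth_append)
qed

lemma graph_instance: "0 < b \<Longrightarrow> graph E b l z \<in> dks_instances"
proof -
  assume "0 < b"
  have "kk b \<le> NN b" unfolding kk_def NN_def by (rule power_mono) auto
  moreover have "1 \<le> kk b" by (simp add: kk_def)
  moreover have "simple_graph (NN b) {{u, v} | u v. u < NN b \<and> v < NN b \<and> adj E b l z u v}"
    unfolding simple_graph_def adj_def by auto
  ultimately show ?thesis by (simp add: graph_def dks_instances_def)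
qed

lemma encode_dks_symbols: "set (encode_dks (graph E b l z)) \<subseteq> {1..3}"
  by (auto simp: graph_def)

end

subsection \<open>Straight-line programs with polynomial running time\<close>

text \<open>Total correctness on the domain \<open>D\<close> with time polynomial in the largest
  counter. The counters afterwards are bounded as well, since they are the input size of the next
  command.\<close>

definition transforms ::
    "nat \<Rightarrow> com \<Rightarrow> ((nat \<Rightarrow> nat \<Rightarrow> nat) \<times> nat list \<Rightarrow> bool) \<Rightarrow>
     ((nat \<Rightarrow> nat \<Rightarrow> nat) \<times> nat list \<Rightarrow> (nat \<Rightarrow> nat \<Rightarrow> nat) \<times> nat list) \<Rightarrow> bool" where
  "transforms bs c D F \<longleftrightarrow> (\<exists>T. polyb T \<and> (\<forall>x S. D x \<longrightarrow> (\<forall>y\<in>set (snd x). y \<le> S) \<longrightarrow>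
     exec c (st bs (fst x) (snd x)) (T S) (st bs (fst (F x)) (snd (F x))) \<and> (\<forall>y\<in>set (snd (F x)). y \<le> T S)))"

lemma transforms_Seq:
  assumes "transforms bs c1 D1 F1" "transforms bs c2 D2 F2"
    and D: "\<And>x. D x \<Longrightarrow> D1 x \<and> D2 (F1 x)"
  shows "transforms bs (c1 ;; c2) D (\<lambda>x. F2 (F1 x))"
proof -
  obtain T1 where T1: "polyb T1" "\<And>x S. D1 x \<Longrightarrow> \<forall>y\<in>set (snd x). y \<le> S \<Longrightarrow>
     exec c1 (st bs (fst x) (snd x)) (T1 S) (st bs (fst (F1 x)) (snd (F1 x))) \<and> (\<forall>y\<in>set (snd (F1 x)). y \<le> T1 S)"
    using assms(1) unfolding transforms_def by blast
  obtain T2 where T2: "polyb T2" "\<And>x S. D2 x \<Longrightarrow> \<forall>y\<in>set (snd x). y \<le> S \<Longrightarrow>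
     exec c2 (st bs (fst x) (snd x)) (T2 S) (st bs (fst (F2 x)) (snd (F2 x))) \<and> (\<forall>y\<in>set (snd (F2 x)). y \<le> T2 S)"
    using assms(2) unfolding transforms_def by blast
  show ?thesis
    unfolding transforms_def
  proof (intro exI[of _ "\<lambda>S. T1 S + T2 (T1 S) + 1"] conjI allI impI)
    show "polyb (\<lambda>S. T1 S + T2 (T1 S) + 1)"
      using T1(1) T2(1) by (intro polyb_intros polyb_comp[of T2 T1])
    fix x S assume x: "D x" "\<forall>y\<in>set (snd x). y \<le> S"
    note 1 = T1(2)[OF D[OF x(1), THEN conjunct1] x(2)]
    note 2 = T2(2)[OF D[OF x(1), THEN conjunct2] 1[THEN conjunct2]]
    show "exec (c1 ;; c2) (st bs (fst x) (snd x)) (T1 S + T2 (T1 S) + 1) (st bs (fst (F2 (F1 x))) (snd (F2 (F1 x))))"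
      using 1 2 by (intro exec.Seq) auto
    show "\<forall>y\<in>set (snd (F2 (F1 x))). y \<le> T1 S + T2 (T1 S) + 1" using 2 by fastforce
  qed
qed

lemma transforms_Cond:
  assumes "transforms bs c1 D1 F1" "transforms bs c2 D2 F2"
    and D: "\<And>x. D x \<Longrightarrow> k < length (snd x) \<and> (if snd x ! k \<noteq> 0 then D1 x else D2 x)"
  shows "transforms bs (Cond (bs + k) nonzero c1 c2) D (\<lambda>x. if snd x ! k \<noteq> 0 then F1 x else F2 x)"
proof -
  obtain T1 where T1: "polyb T1" "\<And>x S. D1 x \<Longrightarrow> \<forall>y\<in>set (snd x). y \<le> S \<Longrightarrow>
     exec c1 (st bs (fst x) (snd x)) (T1 S) (st bs (fst (F1 x)) (snd (F1 x))) \<and> (\<forall>y\<in>set (snd (F1 x)). y \<le> T1 S)"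
    using assms(1) unfolding transforms_def by blast
  obtain T2 where T2: "polyb T2" "\<And>x S. D2 x \<Longrightarrow> \<forall>y\<in>set (snd x). y \<le> S \<Longrightarrow>
     exec c2 (st bs (fst x) (snd x)) (T2 S) (st bs (fst (F2 x)) (snd (F2 x))) \<and> (\<forall>y\<in>set (snd (F2 x)). y \<le> T2 S)"
    using assms(2) unfolding transforms_def by blast
  show ?thesis
    unfolding transforms_def
  proof (intro exI[of _ "\<lambda>S. T1 S + T2 S + 1"] conjI allI impI)
    show "polyb (\<lambda>S. T1 S + T2 S + 1)" using T1(1) T2(1) by (intro polyb_intros)
    fix x S assume x: "D x" "\<forall>y\<in>set (snd x). y \<le> S"
    have rd: "read_tape (st bs (fst x) (snd x) (bs + k)) = (if snd x ! k = 0 then 0 else 1)"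
      using D[OF x(1)] by (simp add: st_counter read_cn)
    let ?F = "if snd x ! k \<noteq> 0 then F1 x else F2 x"
    show "exec (Cond (bs + k) nonzero c1 c2) (st bs (fst x) (snd x)) (T1 S + T2 S + 1) (st bs (fst ?F) (snd ?F))"
    proof (cases "snd x ! k \<noteq> 0")
      case True
      then have "exec c1 (st bs (fst x) (snd x)) (T1 S) (st bs (fst ?F) (snd ?F))"
        using T1(2)[OF _ x(2)] D[OF x(1)] by simp
      then have "exec (Cond (bs + k) nonzero c1 c2) (st bs (fst x) (snd x)) (T1 S + 1) (st bs (fst ?F) (snd ?F))"
        by (rule exec.CondT[rotated]) (use rd True in \<open>simp add: nonzero_def\<close>)
      then show ?thesis by (rule exec.Weaken) simp
    next
      case False
      then have "exec c2 (st bs (fst x) (snd x)) (T2 S) (st bs (fst ?F) (snd ?F))"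
        using T2(2)[OF _ x(2)] D[OF x(1)] by simp
      then have "exec (Cond (bs + k) nonzero c1 c2) (st bs (fst x) (snd x)) (T2 S + 1) (st bs (fst ?F) (snd ?F))"
        by (rule exec.CondF[rotated]) (use rd False in \<open>simp add: nonzero_def\<close>)
      then show ?thesis by (rule exec.Weaken) simp
    qed
    show "\<forall>y\<in>set (snd ?F). y \<le> T1 S + T2 S + 1"
    proof (cases "snd x ! k \<noteq> 0")
      case True
      then show ?thesis using T1(2)[OF _ x(2)] D[OF x(1)] by (auto simp: trans_le_add1)
    next
      case False
      then show ?thesis using T2(2)[OF _ x(2)] D[OF x(1)] by (auto simp: trans_le_add2 le_SucI)
    qed
  qed
qed

definition ready :: "nat \<Rightarrow> (nat \<Rightarrow> nat \<Rightarrow> nat) \<times> nat list \<Rightarrow> bool" where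
  "ready n x \<longleftrightarrow> small_arrays (fst x) \<and> length (snd x) = n"

lemma transforms_assign:
  assumes "2 \<le> bs" "scoped e n" "x < n"
  shows "transforms bs (assign bs n x e) (ready n) (\<lambda>(A, \<rho>). (A, \<rho>[x := eval e A \<rho>]))"
proof -
  obtain T where T: "polyb T" "\<And>bs A \<rho> S. 2 \<le> bs \<Longrightarrow> small_arrays A \<Longrightarrow> length \<rho> = n \<Longrightarrow> \<forall>y\<in>set \<rho>. y \<le> S \<Longrightarrow>
     eval e A \<rho> \<le> T S \<and> exec (assign bs n x e) (st bs A \<rho>) (T S) (st bs A (\<rho>[x := eval e A \<rho>]))"
    using exec_assign[OF assms(2,3)] by blast
  show ?thesis
    unfolding transforms_def
  proof (intro exI[of _ "\<lambda>S. T S + S"] conjI allI impI)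
    show "polyb (\<lambda>S. T S + S)" using T(1) by (intro polyb_intros)
    fix y :: "(nat \<Rightarrow> nat \<Rightarrow> nat) \<times> nat list" and S
    obtain A \<rho> where y: "y = (A, \<rho>)" by fastforce
    assume D: "ready n y" "\<forall>v\<in>set (snd y). v \<le> S"
    then have 1: "eval e A \<rho> \<le> T S \<and> exec (assign bs n x e) (st bs A \<rho>) (T S) (st bs A (\<rho>[x := eval e A \<rho>]))"
      using T(2)[OF assms(1)] unfolding y ready_def by simp
    let ?F = "case y of (A, \<rho>) \<Rightarrow> (A, \<rho>[x := eval e A \<rho>])"
    show "exec (assign bs n x e) (st bs (fst y) (snd y)) (T S + S) (st bs (fst ?F) (snd ?F))"
      unfolding y by (simp, rule exec.Weaken[OF 1[THEN conjunct2]]) simp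
    show "\<forall>v\<in>set (snd ?F). v \<le> T S + S"
      using 1 D(2) unfolding y by (auto simp: trans_le_add2 trans_le_add1 dest!: set_update_subset_insert[THEN subsetD])
  qed
qed

lemma transforms_fill:
  assumes "2 \<le> bs" "a < bs" "scoped off n" "scoped len n" "scoped e (Suc n)"
  shows "transforms bs (fill bs n a off len e)
    (\<lambda>(A, \<rho>). ready n (A, \<rho>) \<and>
       (\<forall>w i. eval e (A(a := w)) (\<rho> @ [i]) = eval e A (\<rho> @ [i]) \<and> eval off (A(a := w)) \<rho> = eval off A \<rho>) \<and>
       (\<forall>i<eval len A \<rho>. eval e A (\<rho> @ [i]) \<le> 3))
    (\<lambda>(A, \<rho>). (A(a := (\<lambda>j. if eval off A \<rho> \<le> j \<and> j < eval off A \<rho> + eval len A \<rho>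
                            then eval e A (\<rho> @ [j - eval off A \<rho>]) else A a j)), \<rho>))"
proof -
  obtain T where T: "polyb T" "\<And>bs A \<rho> S a. 2 \<le> bs \<Longrightarrow> small_arrays A \<Longrightarrow> length \<rho> = n \<Longrightarrow> \<forall>y\<in>set \<rho>. y \<le> S \<Longrightarrow> a < bs \<Longrightarrow>
     \<forall>w i. eval e (A(a := w)) (\<rho> @ [i]) = eval e A (\<rho> @ [i]) \<and> eval off (A(a := w)) \<rho> = eval off A \<rho> \<Longrightarrow>
     \<forall>i<eval len A \<rho>. eval e A (\<rho> @ [i]) \<le> 3 \<Longrightarrow>
     eval len A \<rho> \<le> T S \<and>
     exec (fill bs n a off len e) (st bs A \<rho>) (T S)
       (st bs (A(a := (\<lambda>j. if eval off A \<rho> \<le> j \<and> j < eval off A \<rho> + eval len A \<rho>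
                            then eval e A (\<rho> @ [j - eval off A \<rho>]) else A a j))) \<rho>)"
    using exec_fill[OF assms(3,4,5)] by blast
  show ?thesis
    unfolding transforms_def
  proof (intro exI[of _ "\<lambda>S. T S + S"] conjI allI impI)
    show "polyb (\<lambda>S. T S + S)" using T(1) by (intro polyb_intros)
    fix y :: "(nat \<Rightarrow> nat \<Rightarrow> nat) \<times> nat list" and S
    obtain A \<rho> where y: "y = (A, \<rho>)" by fastforce
    assume D: "case y of (A, \<rho>) \<Rightarrow> ready n (A, \<rho>) \<and>
       (\<forall>w i. eval e (A(a := w)) (\<rho> @ [i]) = eval e A (\<rho> @ [i]) \<and> eval off (A(a := w)) \<rho> = eval off A \<rho>) \<and>
       (\<forall>i<eval len A \<rho>. eval e A (\<rho> @ [i]) \<le> 3)" "\<forall>v\<in>set (snd y). v \<le> S"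
    let ?A = "A(a := (\<lambda>j. if eval off A \<rho> \<le> j \<and> j < eval off A \<rho> + eval len A \<rho>
                            then eval e A (\<rho> @ [j - eval off A \<rho>]) else A a j))"
    have "exec (fill bs n a off len e) (st bs A \<rho>) (T S) (st bs ?A \<rho>)"
      using T(2)[OF assms(1) _ _ _ assms(2), of A \<rho> S] D unfolding y ready_def by simp
    then have 1: "exec (fill bs n a off len e) (st bs A \<rho>) (T S + S) (st bs ?A \<rho>)" by (rule exec.Weaken) simp
    let ?F = "case y of (A, \<rho>) \<Rightarrow> (A(a := (\<lambda>j. if eval off A \<rho> \<le> j \<and> j < eval off A \<rho> + eval len A \<rho>
                            then eval e A (\<rho> @ [j - eval off A \<rho>]) else A a j)), \<rho>)"
    show "exec (fill bs n a off len e) (st bs (fst y) (snd y)) (T S + S) (st bs (fst ?F) (snd ?F))"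
      unfolding y prod.case fst_conv snd_conv by (rule 1)
    show "\<forall>v\<in>set (snd ?F). v \<le> T S + S"
      using D(2) unfolding y by (auto simp: trans_le_add2)
  qed
qed

text \<open>Halting states are never left, so the state at any halting time shows the
  verdict.\<close>

lemma accepts_iff:
  assumes "tm_state_after M w t \<in> {1, 2}"
  shows "accepts M w \<longleftrightarrow> tm_state_after M w t = 1"
proof
  have mono: "tm_state_after M w t' = tm_state_after M w t''"
    if "t' \<le> t''" "tm_state_after M w t' \<in> {1, 2}" for t' t''
  proof -
    obtain q ts where c: "(tm_step M ^^ t') (tm_init M w) = (q, ts)" by fastforce
    have "(tm_step M ^^ (t'' - t')) (q, ts) = (q, ts)"
      by (rule tm_step_halted) (use that(2) c in \<open>simp add: tm_state_after_def\<close>)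
    then show ?thesis using that(1) c unfolding tm_state_after_def
      by (metis comp_apply funpow_add le_add_diff_inverse2)
  qed
  assume "accepts M w"
  then obtain t' where t': "tm_state_after M w t' = 1" unfolding accepts_def by blast
  then show "tm_state_after M w t = 1"
    using mono[of t t'] mono[of t' t] assms by (cases "t \<le> t'") auto
qed (auto simp: accepts_def)

subsection \<open>The main loop\<close>

text \<open>
  The variables of the program are: 0 the input length, 1 the number of clauses, 2 a bound \<open>P\<close> that must exceed the
  number of vertices, 3 the parameter \<open>b\<close>, 4 the level \<open>l\<close>, 5 the current guess \<open>g\<close>, 6 whether to continue,
  7 the verdict, 8 the answer of the simulated machine, 9 a temporary.
\<close>

definition eQm :: exp where "eQm = Add (eDiv (V 1) (V 3)) (Num 1)"
definition e4Qm :: exp where "e4Qm = eMul (Num 4) eQm"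
definition args :: "exp list" where "args = [V 0, V 1, V 3, V 4, V 2]"

context
  fixes M :: tm and s E :: nat
begin

definition base :: nat where "base = 3 + tm_tapes M"

definition prog_query :: com where
  "prog_query =
     fill base 10 1 (eMul e4Qm (V 4)) e4Qm (Add (Num 1) (eDig (Num 2) (V 5) (V 10))) ;;
     (fill base 10 2 (Num 0) (Call fLen args) (Call (fSym E) (args @ [V 10])) ;; run_tm M s (base + 8))"

text \<open>Counter 9 records whether the current guess is the last one. The order matters: the
  verdict and the flag to continue are computed while \<open>b\<close> and the level still have
  their old values.\<close>

definition prog_update :: com where
  "prog_update =
     assign base 10 9 (eEq (Add (V 5) (Num 1)) (ePow (Num 2) e4Qm (V 2))) ;;
     assign base 10 7 (eAnd (V 8) (eEq (Add (V 4) (Num 1)) (V 3))) ;;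
     assign base 10 6 (eNot (eOr (V 7) (eAnd (eAnd (eNot (V 8)) (V 9)) (eEq (V 4) (Num 0))))) ;;
     assign base 10 3 (Sub (V 3) (eAnd (eNot (V 8)) (V 9))) ;;
     assign base 10 4 (eIf (V 8) (Add (V 4) (Num 1)) (eIf (V 9) (Num 0) (V 4))) ;;
     assign base 10 5 (eIf (eOr (V 8) (V 9)) (Num 0) (Add (V 5) (Num 1))) ;;
     assign base 10 8 (Num 0) ;;
     assign base 10 9 (Num 0)"

text \<open>Expressions are polynomially bounded in the counters, but the number of vertices is
  exponential in the input. So \<open>P\<close> is raised by one per pass of the main loop until it
  exceeds that number, and it is never lowered.\<close>

definition prog_body :: com where
  "prog_body =
     assign base 10 9 (eLe (V 2) (Call fN args)) ;;
     Cond (base + 9) nonzero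
       (assign base 10 9 (Num 0) ;; assign base 10 2 (Add (V 2) (Num 1)))
       (prog_query ;; prog_update)"

text \<open>The input length is counted twice, because the second counter is consumed in bringing
  the input head back to the start.\<close>

definition prog :: com where
  "prog =
     Loop 0 nonzero (mv 0 Go_Right ;; inc base ;; inc (base + 1)) ;;
     times (base + 1) (mv 0 Go_Left) ;;
     (assign base 10 1 (Call fClauses [V 0]) ;;
      assign base 10 2 (Num 1) ;;
      assign base 10 3 (V 1) ;;
      assign base 10 6 (Num 1)) ;;
     Loop (base + 6) nonzero prog_body"

end

lemma symbols_below_prog:
  assumes "turing_machine M" "2 * tm_symbols M < s" "tm_states M < s"
  shows "symbols_below s (prog M s E)"
proof -
  have "4 \<le> s" using assms unfolding turing_machine_def by auto
  then show ?thesis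
    using symbols_below_run_tm[OF assms]
    by (simp add: prog_def prog_body_def prog_query_def prog_update_def symbols_below_basic symbols_below_assign symbols_below_fill)
qed

definition arrays :: "(nat \<Rightarrow> nat) \<Rightarrow> (nat \<Rightarrow> nat) \<Rightarrow> nat \<Rightarrow> nat \<Rightarrow> nat" where
  "arrays w z a = (if a = 0 then w else if a = 1 then z else (\<lambda>_. 0))"

text \<open>The alphabet size \<open>s\<close> has to accommodate the marked symbols of
  \<open>M\<close>, which reach twice its alphabet size, and also its states, which are stored in a
  tape cell.\<close>

locale reduction =
  fixes M :: tm and s E :: nat and c d :: nat
  assumes M: "turing_machine M" and s: "2 * tm_symbols M < s" "tm_states M < s"
    and poly: "\<forall>x\<in>dks_instances. halts_within M (encode_dks x) (real (c * length (encode_dks x) ^ d + c))"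
begin

abbreviation "bs \<equiv> base M"

lemma bs: "2 \<le> bs" "2 < bs" by (simp_all add: base_def)

text \<open>The word on tape 2 has length polynomial in the counters, and \<open>M\<close> is
  polynomial in that length. The tapes from 2 on are blank before and after, which makes the query
  repeatable.\<close>

lemma transforms_run:
  assumes sc: "scoped len n" "scoped e (Suc n)" and ans: "ans < n"
  shows "transforms bs (fill bs n 2 (Num 0) len e ;; run_tm M s (bs + ans))
    (\<lambda>(A, \<rho>). ready n (A, \<rho>) \<and> (\<forall>a. 2 \<le> a \<longrightarrow> A a = (\<lambda>_. 0)) \<and>
       (\<exists>x\<in>dks_instances. set (encode_dks x) \<subseteq> {1..3} \<and> eval len A \<rho> = length (encode_dks x) \<and>
          (\<forall>i<eval len A \<rho>. eval e A (\<rho> @ [i]) = encode_dks x ! i)))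
    (\<lambda>(A, \<rho>). (A, \<rho>[ans := \<rho> ! ans + of_bool (accepts M (map (\<lambda>i. eval e A (\<rho> @ [i])) [0..<eval len A \<rho>]))]))"
proof -
  obtain T where T: "polyb T" "\<And>bs A \<rho> S a. 2 \<le> bs \<Longrightarrow> small_arrays A \<Longrightarrow> length \<rho> = n \<Longrightarrow> \<forall>y\<in>set \<rho>. y \<le> S \<Longrightarrow> a < bs \<Longrightarrow>
     \<forall>w i. eval e (A(a := w)) (\<rho> @ [i]) = eval e A (\<rho> @ [i]) \<and> eval (Num 0) (A(a := w)) \<rho> = eval (Num 0) A \<rho> \<Longrightarrow>
     \<forall>i<eval len A \<rho>. eval e A (\<rho> @ [i]) \<le> 3 \<Longrightarrow>
     eval len A \<rho> \<le> T S \<and>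
     exec (fill bs n a (Num 0) len e) (st bs A \<rho>) (T S)
       (st bs (A(a := (\<lambda>j. if eval (Num 0) A \<rho> \<le> j \<and> j < eval (Num 0) A \<rho> + eval len A \<rho>
                            then eval e A (\<rho> @ [j - eval (Num 0) A \<rho>]) else A a j))) \<rho>)"
    using exec_fill[OF _ sc, of "Num 0"] by auto
  define R where "R S = c * T S ^ d + c" for S
  define K where "K = tm_tapes M"
  show ?thesis
    unfolding transforms_def
  proof (intro exI[of _ "\<lambda>S. T S + (K * (20 * (T S + R S + 2) + 1) + 4 * R S + 20) + 1 + (S + 1)"] conjI allI impI)
    show "polyb (\<lambda>S. T S + (K * (20 * (T S + R S + 2) + 1) + 4 * R S + 20) + 1 + (S + 1))"
      unfolding R_def using T(1) by (intro polyb_intros)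
    fix y :: "(nat \<Rightarrow> nat \<Rightarrow> nat) \<times> nat list" and S
    obtain A \<rho> where y: "y = (A, \<rho>)" by fastforce
    assume "case y of (A, \<rho>) \<Rightarrow> ready n (A, \<rho>) \<and> (\<forall>a. 2 \<le> a \<longrightarrow> A a = (\<lambda>_. 0)) \<and>
       (\<exists>x\<in>dks_instances. set (encode_dks x) \<subseteq> {1..3} \<and> eval len A \<rho> = length (encode_dks x) \<and>
          (\<forall>i<eval len A \<rho>. eval e A (\<rho> @ [i]) = encode_dks x ! i))"
      and S: "\<forall>v\<in>set (snd y). v \<le> S"
    then obtain x where rdy: "small_arrays A" "length \<rho> = n" and A2: "\<And>a. 2 \<le> a \<Longrightarrow> A a = (\<lambda>_. 0)"
      and x: "x \<in> dks_instances" "set (encode_dks x) \<subseteq> {1..3}" "eval len A \<rho> = length (encode_dks x)"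
        "\<And>i. i < eval len A \<rho> \<Longrightarrow> eval e A (\<rho> @ [i]) = encode_dks x ! i"
      unfolding y ready_def by auto
    define w where "w = encode_dks x"
    have wi: "w ! i \<le> 3" if "i < length w" for i
      using x(2) nth_mem[OF that] unfolding w_def by auto
    have ev: "eval e (A(2 := u)) (\<rho> @ [i]) = eval e A (\<rho> @ [i])" for u i
      by (rule eval_cong) (use sc(2) rdy(2) in auto)
    have w_eq: "map (\<lambda>i. eval e A (\<rho> @ [i])) [0..<eval len A \<rho>] = w"
      unfolding w_def by (rule nth_equalityI) (use x(3,4) in auto)
    have 1: "eval len A \<rho> \<le> T S \<and>
     exec (fill bs n 2 (Num 0) len e) (st bs A \<rho>) (T S)
       (st bs (A(2 := (\<lambda>j. if eval (Num 0) A \<rho> \<le> j \<and> j < eval (Num 0) A \<rho> + eval len A \<rho>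
                            then eval e A (\<rho> @ [j - eval (Num 0) A \<rho>]) else A 2 j))) \<rho>)"
      by (rule T(2)[OF bs(1) rdy(1,2) _ bs(2)]) (use S x wi ev in \<open>auto simp: y w_def\<close>)
    have arr: "(\<lambda>j. if eval (Num 0) A \<rho> \<le> j \<and> j < eval (Num 0) A \<rho> + eval len A \<rho>
                            then eval e A (\<rho> @ [j - eval (Num 0) A \<rho>]) else A 2 j) = word_array w"
      using x(3,4) A2[of 2] by (auto simp: fun_eq_iff word_array_def w_def)
    have lenw: "length w \<le> T S" using 1 x(3) by (simp add: w_def)
    obtain t where t: "real t \<le> real (c * length w ^ d + c)" "tm_state_after M w t \<in> {1, 2}"
      using poly x(1) unfolding halts_within_def w_def by blast
    have "t \<le> c * length w ^ d + c" using t(1) by linarith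
    also have "\<dots> \<le> R S" unfolding R_def using lenw by (intro add_mono mult_left_mono power_mono) auto
    finally have tR: "t \<le> R S" .
    let ?\<sigma> = "st bs (A(2 := word_array w)) \<rho>"
    let ?a = "of_bool (accepts M w) :: nat"
    have acc: "(if tm_state_after M w t = 1 then Suc (\<rho> ! ans) else \<rho> ! ans) = \<rho> ! ans + ?a"
      using accepts_iff[OF t(2)] by simp
    have 2: "exec (run_tm M s (bs + ans)) ?\<sigma> (tm_tapes M * (20 * (length w + t + 2) + 1) + 4 * t + 20)
      (?\<sigma>(2 := ar (\<lambda>_. 0), bs + ans := cn (\<rho> ! ans + ?a)))"
      unfolding acc[symmetric]
    proof (rule exec_run_tm[OF M s])
      show "set w \<subseteq> {1..3}" using x(2) by (simp add: w_def)
      show "?\<sigma> 2 = ar (word_array w)" using bs(2) by (simp add: st_def)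
      show "?\<sigma> k = ar (\<lambda>_. 0)" if "3 \<le> k" "k \<le> 2 + tm_tapes M" for k
        using that A2[of k] by (simp add: st_def base_def)
      show "2 + tm_tapes M < bs + ans" by (simp add: base_def)
      show "?\<sigma> (bs + ans) = cn (\<rho> ! ans)" using ans rdy(2) by (simp add: st_counter)
    qed (rule t(2))
    have "?\<sigma>(2 := ar (\<lambda>_. 0), bs + ans := cn (\<rho> ! ans + ?a)) = st bs A (\<rho>[ans := \<rho> ! ans + ?a])"
      using ans rdy(2) bs(2) A2[of 2]
      by (auto simp: st_array_update st_update fun_upd_idem simp del: fun_upd_apply)
    note 2 = 2[unfolded this]
    let ?F = "case y of (A, \<rho>) \<Rightarrow> (A, \<rho>[ans := \<rho> ! ans + of_bool (accepts M (map (\<lambda>i. eval e A (\<rho> @ [i])) [0..<eval len A \<rho>]))])"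
    have F: "?F = (A, \<rho>[ans := \<rho> ! ans + ?a])" unfolding y by (simp add: w_eq)
    have "tm_tapes M * (20 * (length w + t + 2) + 1) \<le> K * (20 * (T S + R S + 2) + 1)"
      unfolding K_def by (intro mult_left_mono) (use lenw tR in auto)
    then show "exec (fill bs n 2 (Num 0) len e ;; run_tm M s (bs + ans)) (st bs (fst y) (snd y))
        (T S + (K * (20 * (T S + R S + 2) + 1) + 4 * R S + 20) + 1 + (S + 1)) (st bs (fst ?F) (snd ?F))"
      unfolding F unfolding y fst_conv snd_conv
      by (intro exec_SeqI[OF 1[THEN conjunct2, unfolded arr] 2]) (use tR in linarith)
    have "\<rho> ! ans \<le> S" using S ans rdy(2) unfolding y by simp
    then show "\<forall>v\<in>set (snd ?F). v \<le> T S + (K * (20 * (T S + R S + 2) + 1) + 4 * R S + 20) + 1 + (S + 1)"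
      unfolding F using S unfolding y
      by (auto dest!: set_update_subset_insert[THEN subsetD] intro: trans_le_add2)
  qed
qed

end

section \<open>The program as a function on abstract states\<close>

type_synonym state = "nat \<times> nat \<times> nat \<times> nat \<times> nat \<times> nat \<times> (nat \<Rightarrow> nat)"

definition upd :: "nat \<Rightarrow> exp \<Rightarrow> (nat \<Rightarrow> nat \<Rightarrow> nat) \<times> nat list \<Rightarrow> (nat \<Rightarrow> nat \<Rightarrow> nat) \<times> nat list" where
  "upd x e y = (fst y, (snd y)[x := eval e (fst y) (snd y)])"

lemma transforms_upd:
  assumes "2 \<le> bs" "scoped e n" "x < n" shows "transforms bs (assign bs n x e) (ready n) (upd x e)"
proof -
  have "upd x e = (\<lambda>(A, \<rho>). (A, \<rho>[x := eval e A \<rho>]))" by (auto simp: upd_def fun_eq_iff)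
  then show ?thesis using transforms_assign[OF assms] by simp
qed

lemma transforms_upd_Seq:
  assumes "2 \<le> bs" "scoped e n" "x < n" "transforms bs c (ready n) F"
  shows "transforms bs (assign bs n x e ;; c) (ready n) (\<lambda>y. F (upd x e y))"
  by (rule transforms_Seq[OF transforms_upd[OF assms(1,2,3)] assms(4)]) (auto simp: ready_def upd_def)

text \<open>The contents \<open>z\<close> of array 1 are arbitrary, so the notions of
  \<open>formula_word\<close> that are determined by \<phi> alone stay the same while the search
  rewrites array 1.\<close>

lemma formula_word_arrays:
  "\<phi> \<in> threesat_instances \<Longrightarrow> formula_word \<phi> (arrays (word_array (encode_formula \<phi>)) z)"
  by unfold_locales (auto simp: arrays_def)

lemma formula_symbols: "set (encode_formula \<phi>) \<subseteq> {1..3}"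
proof -
  have l: "set (encode_literal l) \<subseteq> {1..3}" for l by (cases l) auto
  have c: "set (encode_clause c) \<subseteq> {1..3}" for c
    unfolding encode_clause_def set_append set_concat set_map by (intro Un_least UN_least) (use l in auto)
  show ?thesis
    unfolding encode_formula_def set_concat set_map by (intro UN_least) (use c in auto)
qed

lemma small_arrays_word: "(\<And>i. z i \<le> 3) \<Longrightarrow> small_arrays (arrays (word_array (encode_formula \<phi>)) z)"
proof -
  have "word_array (encode_formula \<phi>) i \<le> 3" for i
    using formula_symbols[of \<phi>] subsetD[OF formula_symbols[of \<phi>], OF nth_mem[of i]]
    by (auto simp: word_array_def)
  then show "(\<And>i. z i \<le> 3) \<Longrightarrow> small_arrays (arrays (word_array (encode_formula \<phi>)) z)"
    by (simp add: small_arrays_def arrays_def)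
qed

definition write_guess :: "nat \<Rightarrow> nat \<Rightarrow> nat \<Rightarrow> (nat \<Rightarrow> nat) \<Rightarrow> nat \<Rightarrow> nat" where
  "write_guess q l g z j = (if 4 * q * l \<le> j \<and> j < 4 * q * l + 4 * q then 1 + dig 2 g (j - 4 * q * l) else z j)"

context reduction
begin

definition answer :: "formula \<Rightarrow> nat \<Rightarrow> nat \<Rightarrow> (nat \<Rightarrow> nat) \<Rightarrow> bool" where
  "answer \<phi> b l z \<longleftrightarrow> accepts M (encode_dks (formula_word.graph \<phi> E b l z))"

text \<open>The effect of \<open>prog_body\<close>. The components of a state are the counters 2 to
  7 and array 1; \<open>full\<close> marks the last guess of a level.\<close>

fun loop_step :: "formula \<Rightarrow> state \<Rightarrow> state" where
  "loop_step \<phi> (P, b, l, g, r, a, z) =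
     (if P \<le> formula_word.NN \<phi> b then (P + 1, b, l, g, r, a, z)
      else let q = formula_word.qq \<phi> b; z' = write_guess q l g z; yes = answer \<phi> b l z';
               full = (g + 1 = 2 ^ (4 * q)); acc = (yes \<and> l + 1 = b)
           in (P, b - of_bool (\<not> yes \<and> full), if yes then l + 1 else if full then 0 else l,
               if yes \<or> full then 0 else g + 1,
               of_bool (\<not> acc \<and> \<not> (\<not> yes \<and> full \<and> l = 0)), of_bool acc, z'))"

fun state_arrays :: "formula \<Rightarrow> state \<Rightarrow> nat \<Rightarrow> nat \<Rightarrow> nat" where
  "state_arrays \<phi> (P, b, l, g, r, a, z) = arrays (word_array (encode_formula \<phi>)) z"

fun state_vars :: "formula \<Rightarrow> state \<Rightarrow> nat list" where
  "state_vars \<phi> (P, b, l, g, r, a, z) = [formula_word.len \<phi>, formula_word.m \<phi>, P, b, l, g, r, a, 0, 0]"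

fun valid :: "formula \<Rightarrow> state \<Rightarrow> bool" where
  "valid \<phi> (P, b, l, g, r, a, z) \<longleftrightarrow> 0 < P \<and> b \<le> formula_word.m \<phi> \<and> l < b \<and>
     g < 2 ^ (4 * formula_word.qq \<phi> b) \<and> (\<forall>i. z i \<le> 3)"

lemma dig2_le: "dig 2 g i \<le> 1"
  using dig_less[of 2 g i] by simp

lemma write_guess_le: "(\<And>i. z i \<le> 3) \<Longrightarrow> write_guess q l g z i \<le> 3"
  using dig2_le[of g "i - 4 * q * l"] by (simp add: write_guess_def)

lemma eval_args:
  "eval (Call f args) A (x0 # x1 # x2 # x3 # x4 # xs) = eval f A [x0, x1, x3, x4, x2]"
  "eval (Call f (args @ [e])) A (x0 # x1 # x2 # x3 # x4 # xs) =
     eval f A [x0, x1, x3, x4, x2, eval e A (x0 # x1 # x2 # x3 # x4 # xs)]"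
  by (simp_all add: args_def)

lemma scoped_args: "5 \<le> n \<Longrightarrow> list_all (\<lambda>e. scoped e n) args" "length args = 5"
  by (simp_all add: args_def)

definition query_ok :: "(nat \<Rightarrow> nat \<Rightarrow> nat) \<times> nat list \<Rightarrow> bool" where
  "query_ok x \<longleftrightarrow> (\<exists>\<phi> P b l g r a z. \<phi> \<in> threesat_instances \<and> valid \<phi> (P, b, l, g, r, a, z) \<and> formula_word.NN \<phi> b < P \<and>
     x = (state_arrays \<phi> (P, b, l, g, r, a, z), state_vars \<phi> (P, b, l, g, r, a, z)))"

lemma transforms_query:
  obtains F where "transforms bs (prog_query M s E) query_ok F"
    "\<And>\<phi> P b l g r a z. \<phi> \<in> threesat_instances \<Longrightarrow> valid \<phi> (P, b, l, g, r, a, z) \<Longrightarrow> formula_word.NN \<phi> b < P \<Longrightarrow>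
       F (state_arrays \<phi> (P, b, l, g, r, a, z), state_vars \<phi> (P, b, l, g, r, a, z)) =
       (arrays (word_array (encode_formula \<phi>)) (write_guess (formula_word.qq \<phi> b) l g z),
        [formula_word.len \<phi>, formula_word.m \<phi>, P, b, l, g, r, a,
         of_bool (answer \<phi> b l (write_guess (formula_word.qq \<phi> b) l g z)), 0])"
proof -
  let ?off = "eMul e4Qm (V 4)" and ?e = "Add (Num 1) (eDig (Num 2) (V 5) (V 10))"
  let ?e' = "Call (fSym E) (args @ [V 10])"
  define F1 where "F1 = (\<lambda>(A, \<rho>). (A(1 := (\<lambda>j. if eval ?off A \<rho> \<le> j \<and> j < eval ?off A \<rho> + eval e4Qm A \<rho>
                            then eval ?e A (\<rho> @ [j - eval ?off A \<rho>]) else A 1 j)), \<rho>))"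
  define F2 where "F2 = (\<lambda>(A, \<rho>). (A, \<rho>[8 := \<rho> ! 8 + of_bool (accepts M
       (map (\<lambda>i. eval ?e' A (\<rho> @ [i])) [0..<eval (Call fLen args) A \<rho>]))]))"
  let ?D1 = "\<lambda>(A, \<rho>). ready 10 (A, \<rho>) \<and>
       (\<forall>w i. eval ?e (A(1 := w)) (\<rho> @ [i]) = eval ?e A (\<rho> @ [i]) \<and> eval ?off (A(1 := w)) \<rho> = eval ?off A \<rho>) \<and>
       (\<forall>i<eval e4Qm A \<rho>. eval ?e A (\<rho> @ [i]) \<le> 3)"
  let ?D2 = "\<lambda>(A, \<rho>). ready 10 (A, \<rho>) \<and> (\<forall>a. 2 \<le> a \<longrightarrow> A a = (\<lambda>_. 0)) \<and>
       (\<exists>x\<in>dks_instances. set (encode_dks x) \<subseteq> {1..3} \<and> eval (Call fLen args) A \<rho> = length (encode_dks x) \<and>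
          (\<forall>i<eval (Call fLen args) A \<rho>. eval ?e' A (\<rho> @ [i]) = encode_dks x ! i))"
  have t1: "transforms bs (fill bs 10 1 ?off e4Qm ?e) ?D1 F1"
    unfolding F1_def by (rule transforms_fill) (use bs in \<open>auto simp: e4Qm_def eQm_def\<close>)
  have t2: "transforms bs (fill bs 10 2 (Num 0) (Call fLen args) ?e' ;; run_tm M s (bs + 8)) ?D2 F2"
    unfolding F2_def by (rule transforms_run) (use scoped_args in auto)
  have *: "?D1 x \<and> ?D2 (F1 x) \<and> F1 x = (arrays (word_array (encode_formula \<phi>)) (write_guess (formula_word.qq \<phi> b) l g z),
        state_vars \<phi> (P, b, l, g, r, a, z)) \<and>
      F2 (F1 x) = (arrays (word_array (encode_formula \<phi>)) (write_guess (formula_word.qq \<phi> b) l g z),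
        [formula_word.len \<phi>, formula_word.m \<phi>, P, b, l, g, r, a,
         of_bool (answer \<phi> b l (write_guess (formula_word.qq \<phi> b) l g z)), 0])"
    if \<phi>: "\<phi> \<in> threesat_instances" and v: "valid \<phi> (P, b, l, g, r, a, z)" and P: "formula_word.NN \<phi> b < P"
      and x: "x = (state_arrays \<phi> (P, b, l, g, r, a, z), state_vars \<phi> (P, b, l, g, r, a, z))"
    for \<phi> P b l g r a z x
  proof -
    let ?z' = "write_guess (formula_word.qq \<phi> b) l g z"
    let ?A = "arrays (word_array (encode_formula \<phi>)) z" and ?A' = "arrays (word_array (encode_formula \<phi>)) ?z'"
    let ?\<rho> = "[formula_word.len \<phi>, formula_word.m \<phi>, P, b, l, g, r, a, 0, 0]"
    interpret F: formula_word \<phi> ?A by (rule formula_word_arrays[OF \<phi>])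
    interpret F': formula_word \<phi> ?A' by (rule formula_word_arrays[OF \<phi>])
    have b: "0 < b" and z3: "\<And>i. z i \<le> 3" using v by auto
    have z'3: "\<And>i. ?z' i \<le> 3" using write_guess_le[OF z3] .
    have e4: "eval e4Qm B ?\<rho> = 4 * F.qq b" for B
      using b by (simp add: e4Qm_def eQm_def F.qq_def)
    have off: "eval ?off B ?\<rho> = 4 * F.qq b * l" for B by (simp add: e4)
    have e: "eval ?e B (?\<rho> @ [i]) = 1 + dig 2 g i" for B i by simp
    have F1x: "F1 x = (?A', ?\<rho>)"
      unfolding x F1_def state_arrays.simps state_vars.simps prod.case off e4 e
      by (auto simp: arrays_def fun_eq_iff write_guess_def)
    have D1: "?D1 x"
      unfolding x state_arrays.simps state_vars.simps prod.case off e4 e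
      using small_arrays_word[of z \<phi>, OF z3] order_trans[OF dig2_le, of 2] by (auto simp: ready_def)
    have A'1: "?A' 1 = ?z'" by (simp add: arrays_def)
    let ?G = "F.graph E b l ?z'"
    note sym = F'.eval_fSym[OF b A'1 P, where E = E]
    have len: "eval (Call fLen args) ?A' ?\<rho> = length (encode_dks ?G)"
      unfolding eval_args by (rule sym(1))
    have sy: "eval ?e' ?A' (?\<rho> @ [i]) = encode_dks ?G ! i" if "i < length (encode_dks ?G)" for i
      using sym(3)[OF that] by (simp add: eval_args del: eval.simps(8))
    have inst: "?G \<in> dks_instances" "set (encode_dks ?G) \<subseteq> {1..3}"
      using F.graph_instance[OF b] F.encode_dks_symbols by auto
    have D2: "?D2 (F1 x)"
      unfolding F1x prod.case len using small_arrays_word[of ?z' \<phi>, OF z'3] inst sy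
      by (auto simp: ready_def arrays_def intro!: bexI[of _ ?G])
    have mp: "map (\<lambda>i. eval ?e' ?A' (?\<rho> @ [i])) [0..<length (encode_dks ?G)] = encode_dks ?G"
      by (rule nth_equalityI) (use sy in auto)
    have F2x: "F2 (F1 x) = (?A', [F.len, F.m, P, b, l, g, r, a, of_bool (answer \<phi> b l ?z'), 0])"
      unfolding F1x F2_def prod.case len mp by (simp add: answer_def)
    show ?thesis using D1 D2 F1x F2x by simp
  qed
  have "transforms bs (prog_query M s E) query_ok (\<lambda>x. F2 (F1 x))"
    unfolding prog_query_def
  proof (rule transforms_Seq[OF t1 t2])
    fix x assume "query_ok x"
    then obtain \<phi> P b l g r a z where H: "\<phi> \<in> threesat_instances" "valid \<phi> (P, b, l, g, r, a, z)" "formula_word.NN \<phi> b < P"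
      "x = (state_arrays \<phi> (P, b, l, g, r, a, z), state_vars \<phi> (P, b, l, g, r, a, z))"
      unfolding query_ok_def by (elim exE conjE)
    show "?D1 x \<and> ?D2 (F1 x)"
      by (rule conjI[OF *[OF H, THEN conjunct1] *[OF H, THEN conjunct2, THEN conjunct1]])
  qed
  then show ?thesis
  proof (rule that)
    fix \<phi> P b l g r a z
    assume H: "\<phi> \<in> threesat_instances" "valid \<phi> (P, b, l, g, r, a, z)" "formula_word.NN \<phi> b < P"
    show "F2 (F1 (state_arrays \<phi> (P, b, l, g, r, a, z), state_vars \<phi> (P, b, l, g, r, a, z))) =
       (arrays (word_array (encode_formula \<phi>)) (write_guess (formula_word.qq \<phi> b) l g z),
        [formula_word.len \<phi>, formula_word.m \<phi>, P, b, l, g, r, a,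
         of_bool (answer \<phi> b l (write_guess (formula_word.qq \<phi> b) l g z)), 0])"
      by (rule *[OF H refl, THEN conjunct2, THEN conjunct2, THEN conjunct2])
  qed
qed

lemma list_update_Cons_numeral: "(x # xs)[numeral k := v] = x # xs[pred_numeral k := v]"
  by (simp add: numeral_eq_Suc)

lemma transforms_update:
  obtains F where "transforms bs (prog_update M) (ready 10) F"
    "\<And>A x m P b l g r a ans. 0 < P \<Longrightarrow> 0 < b \<Longrightarrow> F (A, [x, m, P, b, l, g, r, a, of_bool ans, 0]) =
       (let full = (g + 1 = min (2 ^ (4 * (m div b + 1))) P); acc = (ans \<and> l + 1 = b) in
        (A, [x, m, P, b - of_bool (\<not> ans \<and> full), if ans then l + 1 else if full then 0 else l,
             if ans \<or> full then 0 else g + 1, of_bool (\<not> acc \<and> \<not> (\<not> ans \<and> full \<and> l = 0)), of_bool acc, 0, 0]))"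
proof -
  have n: "scoped e4Qm 10" by (simp add: e4Qm_def eQm_def)
  let ?e9 = "eEq (Add (V 5) (Num 1)) (ePow (Num 2) e4Qm (V 2))"
  let ?e7 = "eAnd (V 8) (eEq (Add (V 4) (Num 1)) (V 3))"
  let ?e6 = "eNot (eOr (V 7) (eAnd (eAnd (eNot (V 8)) (V 9)) (eEq (V 4) (Num 0))))"
  let ?e3 = "Sub (V 3) (eAnd (eNot (V 8)) (V 9))"
  let ?e4 = "eIf (V 8) (Add (V 4) (Num 1)) (eIf (V 9) (Num 0) (V 4))"
  let ?e5 = "eIf (eOr (V 8) (V 9)) (Num 0) (Add (V 5) (Num 1))"
  let ?F = "\<lambda>y. upd 9 (Num 0) (upd 8 (Num 0) (upd 5 ?e5 (upd 4 ?e4 (upd 3 ?e3 (upd 6 ?e6 (upd 7 ?e7 (upd 9 ?e9 y)))))))"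
  show ?thesis
  proof (rule that[of ?F])
    show "transforms bs (prog_update M) (ready 10) ?F"
      unfolding prog_update_def
      by (intro transforms_upd_Seq transforms_upd bs) (use n in simp_all)
    fix A x m P b l g r a ans
    assume P: "0 < (P::nat)" "0 < (b::nat)"
    define full where "full \<longleftrightarrow> g + 1 = min (2 ^ (4 * (m div b + 1))) P"
    define acc where "acc \<longleftrightarrow> ans \<and> l + 1 = b"
    let ?a = "of_bool ans"
    have 1: "upd 9 ?e9 (A, [x, m, P, b, l, g, r, a, ?a, 0]) = (A, [x, m, P, b, l, g, r, a, ?a, of_bool full])"
      using P by (simp add: upd_def list_update_Cons_numeral full_def e4Qm_def eQm_def)
    have 2: "upd 7 ?e7 (A, [x, m, P, b, l, g, r, a, ?a, of_bool full]) = (A, [x, m, P, b, l, g, r, of_bool acc, ?a, of_bool full])"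
      by (simp add: upd_def list_update_Cons_numeral acc_def)
    have 3: "upd 6 ?e6 (A, [x, m, P, b, l, g, r, of_bool acc, ?a, of_bool full]) =
        (A, [x, m, P, b, l, g, of_bool (\<not> acc \<and> \<not> (\<not> ans \<and> full \<and> l = 0)), of_bool acc, ?a, of_bool full])"
      by (simp add: upd_def list_update_Cons_numeral)
    have 4: "upd 3 ?e3 (A, [x, m, P, b, l, g, r', a', ?a, of_bool full]) =
        (A, [x, m, P, b - of_bool (\<not> ans \<and> full), l, g, r', a', ?a, of_bool full])" for r' a'
      by (simp add: upd_def list_update_Cons_numeral)
    have 5: "upd 4 ?e4 (A, [x, m, P, b', l, g, r', a', ?a, of_bool full]) =
        (A, [x, m, P, b', if ans then l + 1 else if full then 0 else l, g, r', a', ?a, of_bool full])" for b' r' a'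
      by (simp add: upd_def list_update_Cons_numeral)
    have 6: "upd 5 ?e5 (A, [x, m, P, b', l', g, r', a', ?a, of_bool full]) =
        (A, [x, m, P, b', l', if ans \<or> full then 0 else g + 1, r', a', ?a, of_bool full])" for b' l' r' a'
      by (simp add: upd_def list_update_Cons_numeral)
    have 7: "upd 9 (Num 0) (upd 8 (Num 0) (A, [x, m, P, b', l', g', r', a', ?a, of_bool full])) =
        (A, [x, m, P, b', l', g', r', a', 0, 0])" for b' l' g' r' a'
      by (simp add: upd_def list_update_Cons_numeral)
    show "?F (A, [x, m, P, b, l, g, r, a, of_bool ans, 0]) =
       (let full = (g + 1 = min (2 ^ (4 * (m div b + 1))) P); acc = (ans \<and> l + 1 = b) in
        (A, [x, m, P, b - of_bool (\<not> ans \<and> full), if ans then l + 1 else if full then 0 else l,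
             if ans \<or> full then 0 else g + 1, of_bool (\<not> acc \<and> \<not> (\<not> ans \<and> full \<and> l = 0)), of_bool acc, 0, 0]))"
      unfolding Let_def full_def[symmetric] acc_def[symmetric] 1 2 3 4 5 6 7 ..
  qed
qed

definition state_ok :: "(nat \<Rightarrow> nat \<Rightarrow> nat) \<times> nat list \<Rightarrow> bool" where
  "state_ok x \<longleftrightarrow> (\<exists>\<phi> \<tau>. \<phi> \<in> threesat_instances \<and> valid \<phi> \<tau> \<and> x = (state_arrays \<phi> \<tau>, state_vars \<phi> \<tau>))"

lemma exec_body:
  "\<exists>T. polyb T \<and> (\<forall>\<phi> \<tau> S. \<phi> \<in> threesat_instances \<longrightarrow> valid \<phi> \<tau> \<longrightarrow> (\<forall>y\<in>set (state_vars \<phi> \<tau>). y \<le> S) \<longrightarrow>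
     exec (prog_body M s E) (st bs (state_arrays \<phi> \<tau>) (state_vars \<phi> \<tau>)) (T S)
       (st bs (state_arrays \<phi> (loop_step \<phi> \<tau>)) (state_vars \<phi> (loop_step \<phi> \<tau>))))"
proof -
  obtain Fq where Fq: "transforms bs (prog_query M s E) query_ok Fq"
    "\<And>\<phi> P b l g r a z. \<phi> \<in> threesat_instances \<Longrightarrow> valid \<phi> (P, b, l, g, r, a, z) \<Longrightarrow> formula_word.NN \<phi> b < P \<Longrightarrow>
       Fq (state_arrays \<phi> (P, b, l, g, r, a, z), state_vars \<phi> (P, b, l, g, r, a, z)) =
       (arrays (word_array (encode_formula \<phi>)) (write_guess (formula_word.qq \<phi> b) l g z),
        [formula_word.len \<phi>, formula_word.m \<phi>, P, b, l, g, r, a,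
         of_bool (answer \<phi> b l (write_guess (formula_word.qq \<phi> b) l g z)), 0])"
    by (rule transforms_query) (rule that; assumption)
  obtain Fu where Fu: "transforms bs (prog_update M) (ready 10) Fu"
    "\<And>A x m P b l g r a ans. 0 < P \<Longrightarrow> 0 < b \<Longrightarrow> Fu (A, [x, m, P, b, l, g, r, a, of_bool ans, 0]) =
       (let full = (g + 1 = min (2 ^ (4 * (m div b + 1))) P); acc = (ans \<and> l + 1 = b) in
        (A, [x, m, P, b - of_bool (\<not> ans \<and> full), if ans then l + 1 else if full then 0 else l,
             if ans \<or> full then 0 else g + 1, of_bool (\<not> acc \<and> \<not> (\<not> ans \<and> full \<and> l = 0)), of_bool acc, 0, 0]))"
    by (rule transforms_update) (rule that; assumption)
  let ?Fg = "\<lambda>y. upd 2 (Add (V 2) (Num 1)) (upd 9 (Num 0) y)"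
  have tg: "transforms bs (assign bs 10 9 (Num 0) ;; assign bs 10 2 (Add (V 2) (Num 1))) (ready 10) ?Fg"
    by (intro transforms_upd_Seq transforms_upd bs) simp_all
  have tq: "transforms bs (prog_query M s E ;; prog_update M) query_ok (\<lambda>y. Fu (Fq y))"
  proof (rule transforms_Seq[OF Fq(1) Fu(1)])
    fix x assume x: "query_ok x"
    then obtain \<phi> P b l g r a z where H: "\<phi> \<in> threesat_instances" "valid \<phi> (P, b, l, g, r, a, z)" "formula_word.NN \<phi> b < P"
      "x = (state_arrays \<phi> (P, b, l, g, r, a, z), state_vars \<phi> (P, b, l, g, r, a, z))"
      unfolding query_ok_def by blast
    have "\<And>i. z i \<le> 3" using H(2) by simp
    then have "small_arrays (arrays (word_array (encode_formula \<phi>)) (write_guess (formula_word.qq \<phi> b) l g z))"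
      by (intro small_arrays_word write_guess_le)
    then show "query_ok x \<and> ready 10 (Fq x)" using x Fq(2)[OF H(1,2,3)] H(4) by (simp add: ready_def)
  qed
  let ?e = "eLe (V 2) (Call fN args)"
  let ?Fc = "\<lambda>y. if snd y ! 9 \<noteq> 0 then ?Fg y else Fu (Fq y)"
  let ?D = "\<lambda>y. ready 10 y \<and> (snd y ! 9 = 0 \<longrightarrow> query_ok y)"
  have tc: "transforms bs (Cond (bs + 9) nonzero (assign bs 10 9 (Num 0) ;; assign bs 10 2 (Add (V 2) (Num 1)))
      (prog_query M s E ;; prog_update M)) ?D ?Fc"
    by (rule transforms_Cond[OF tg tq]) (auto simp: ready_def)
  have key: "ready 10 x \<and> ?D (upd 9 ?e x) \<and>
      ?Fc (upd 9 ?e x) = (state_arrays \<phi> (loop_step \<phi> \<tau>), state_vars \<phi> (loop_step \<phi> \<tau>))"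
    if \<phi>: "\<phi> \<in> threesat_instances" and v: "valid \<phi> \<tau>" and x: "x = (state_arrays \<phi> \<tau>, state_vars \<phi> \<tau>)" for \<phi> \<tau> x
  proof -
    obtain P b l g r a z where \<tau>: "\<tau> = (P, b, l, g, r, a, z)" by (metis surj_pair)
    let ?A = "arrays (word_array (encode_formula \<phi>)) z"
    interpret F: formula_word \<phi> ?A by (rule formula_word_arrays[OF \<phi>])
    have b: "0 < b" "0 < P" and z3: "\<And>i. z i \<le> 3" using v unfolding \<tau> by auto
    have A1: "?A 1 = z" by (simp add: arrays_def)
    let ?\<rho> = "[F.len, F.m, P, b, l, g, r, a, 0, 0]"
    have x': "x = (?A, ?\<rho>)" unfolding x \<tau> by simp
    have rdy: "ready 10 x" unfolding x' using small_arrays_word[of z \<phi>, OF z3] by (simp add: ready_def)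
    have u: "upd 9 ?e x = (?A, [F.len, F.m, P, b, l, g, r, a, 0, of_bool (P \<le> F.NN b)])"
      unfolding x' using F.eval_fN[OF b(1) A1 b(2)]
      by (simp add: upd_def list_update_Cons_numeral eval_args del: eval.simps(8))
    show ?thesis
    proof (cases "P \<le> F.NN b")
      case True
      have "?Fg (?A, [F.len, F.m, P, b, l, g, r, a, 0, 1]) = (?A, [F.len, F.m, P + 1, b, l, g, r, a, 0, 0])"
        by (simp add: upd_def list_update_Cons_numeral)
      then show ?thesis using rdy True unfolding u \<tau> by (simp add: ready_def x')
    next
      case False
      have q: "query_ok (?A, ?\<rho>)" unfolding query_ok_def
        by (rule exI[of _ \<phi>], rule exI[of _ P], rule exI[of _ b], rule exI[of _ l], rule exI[of _ g],
            rule exI[of _ r], rule exI[of _ a], rule exI[of _ z]) (use \<phi> v False in \<open>simp add: \<tau>\<close>)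
      let ?z' = "write_guess (F.qq b) l g z"
      \<comment> \<open>There are at most as many guesses as vertices, so the cap \<open>P\<close>
        does not spoil the test for the last guess.\<close>
      have "(2::nat) ^ (4 * F.qq b) \<le> 2 ^ (2 * (3 * F.qq b))" by (rule power_increasing) auto
      also have "\<dots> = 4 ^ (3 * F.qq b)" by (simp add: power_mult)
      also have "\<dots> \<le> F.NN b" unfolding F.NN_def by (rule power_mono) (use b in auto)
      finally have mn: "min (2 ^ (4 * (F.m div b + 1))) P = 2 ^ (4 * F.qq b)" using False by (simp add: F.qq_def)
      have "Fq (?A, ?\<rho>) = (arrays (word_array (encode_formula \<phi>)) ?z', [F.len, F.m, P, b, l, g, r, a, of_bool (answer \<phi> b l ?z'), 0])"
        using Fq(2)[of \<phi> P b l g r a z] \<phi> v False unfolding \<tau> by simp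
      then have "Fu (Fq (?A, ?\<rho>)) = (state_arrays \<phi> (loop_step \<phi> \<tau>), state_vars \<phi> (loop_step \<phi> \<tau>))"
        using False unfolding \<tau> by (simp only: Fu(2)[OF b(2,1)] mn) (simp add: Let_def)
      then show ?thesis using rdy False q unfolding u by (simp add: ready_def x')
    qed
  qed
  have "transforms bs (prog_body M s E) state_ok (\<lambda>y. ?Fc (upd 9 ?e y))"
    unfolding prog_body_def
  proof (rule transforms_Seq[OF transforms_upd tc])
    have "scoped (Call fN args) 10" using scoped_args by simp
    then show "scoped ?e 10" by simp
  qed (use key bs in \<open>auto simp: state_ok_def\<close>)
  then obtain T where T: "polyb T" "\<And>x S. state_ok x \<Longrightarrow> \<forall>y\<in>set (snd x). y \<le> S \<Longrightarrow>
     exec (prog_body M s E) (st bs (fst x) (snd x)) (T S) (st bs (fst (?Fc (upd 9 ?e x))) (snd (?Fc (upd 9 ?e x))))"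
    unfolding transforms_def by blast
  show ?thesis
  proof (intro exI[of _ T] conjI allI impI T(1))
    fix \<phi> \<tau> S
    assume H: "\<phi> \<in> threesat_instances" "valid \<phi> \<tau>" "\<forall>y\<in>set (state_vars \<phi> \<tau>). y \<le> S"
    let ?x = "(state_arrays \<phi> \<tau>, state_vars \<phi> \<tau>)"
    have ok: "state_ok ?x" using H(1,2) unfolding state_ok_def by blast
    show "exec (prog_body M s E) (st bs (state_arrays \<phi> \<tau>) (state_vars \<phi> \<tau>)) (T S)
       (st bs (state_arrays \<phi> (loop_step \<phi> \<tau>)) (state_vars \<phi> (loop_step \<phi> \<tau>)))"
      using T(2)[OF ok, of S] H(3) key[OF H(1,2) refl] by simp
  qed
qed

definition init_state :: "formula \<Rightarrow> state" where
  "init_state \<phi> = (1, formula_word.m \<phi>, 0, 0, 1, 0, \<lambda>_. 0)"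

lemma exec_prog_init:
  "\<exists>T. polyb T \<and> (\<forall>\<phi> \<sigma> n. \<phi> \<in> threesat_instances \<longrightarrow>
     exec (Loop (bs + 6) nonzero (prog_body M s E)) (st bs (state_arrays \<phi> (init_state \<phi>)) (state_vars \<phi> (init_state \<phi>))) n \<sigma> \<longrightarrow>
     exec (prog M s E) (init_store (encode_formula \<phi>)) (T (formula_word.len \<phi>) + n) \<sigma>)"
proof -
  let ?c = "assign bs 10 1 (Call fClauses [V 0]) ;; assign bs 10 2 (Num 1) ;; assign bs 10 3 (V 1) ;; assign bs 10 6 (Num 1)"
  let ?F = "\<lambda>y. upd 6 (Num 1) (upd 3 (V 1) (upd 2 (Num 1) (upd 1 (Call fClauses [V 0]) y)))"
  have sc: "scoped (Call fClauses [V 0]) 10" using scoped_parse(7) by simp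
  have "transforms bs ?c (ready 10) ?F"
    by (intro transforms_upd_Seq transforms_upd bs) (use sc in simp_all)
  then obtain T where T: "polyb T" "\<And>x S. ready 10 x \<Longrightarrow> \<forall>y\<in>set (snd x). y \<le> S \<Longrightarrow>
     exec ?c (st bs (fst x) (snd x)) (T S) (st bs (fst (?F x)) (snd (?F x)))"
    unfolding transforms_def by blast
  have "exec (prog M s E) (init_store (encode_formula \<phi>)) (T F + 20 * F + 20 + n) \<sigma>"
    if \<phi>: "\<phi> \<in> threesat_instances" and F: "F = formula_word.len \<phi>" and
      ex: "exec (Loop (bs + 6) nonzero (prog_body M s E)) (st bs (state_arrays \<phi> (init_state \<phi>)) (state_vars \<phi> (init_state \<phi>))) n \<sigma>"
    for \<phi> \<sigma> n F
  proof -
    let ?W = "word_array (encode_formula \<phi>)"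
    let ?A = "arrays ?W (\<lambda>_. 0)"
    interpret F: formula_word \<phi> ?A by (rule formula_word_arrays[OF \<phi>])
    have Fl: "F = length (encode_formula \<phi>)" using F by (simp add: F.len_def)
    let ?\<sigma>0 = "st bs ?A (replicate 10 0)"
    \<comment> \<open>A blank tape is both the counter 0 and the blank array, so the initial store
      already has the standard layout.\<close>
    have init: "init_store (encode_formula \<phi>) = ?\<sigma>0"
    proof
      fix k
      have "cn 0 = ((\<lambda>_. 0), 0)" "ar (\<lambda>_. 0) = ((\<lambda>_. 0), 0)"
        "ar ?W = (\<lambda>i. if 0 \<le> i \<and> i < int (length (encode_formula \<phi>)) then encode_formula \<phi> ! nat i else 0, 0)"
        by (auto simp: cn_def ar_at_def word_array_def fun_eq_iff)
      then show "init_store (encode_formula \<phi>) k = ?\<sigma>0 k"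
        using bs by (simp add: init_store_def st_def arrays_def)
    qed
    let ?S = "\<lambda>i. ?\<sigma>0(0 := ar_at ?W i, bs := cn i, bs + 1 := cn i)"
    have b0: "bs \<noteq> 0" "0 < bs" using bs by auto
    have W: "?W i \<noteq> 0 \<longleftrightarrow> i < F" for i
      using subsetD[OF formula_symbols[of \<phi>], OF nth_mem[of i]] unfolding Fl by (auto simp: word_array_def)
    have 1: "exec (Loop 0 nonzero (mv 0 Go_Right ;; inc bs ;; inc (bs + 1))) (?S 0) (F * (9 + 1) + 1) (?S F)"
    proof (rule exec_Loop_seq)
      fix i assume "i < F"
      then have "nonzero (read_tape (?S i 0))" using W[of i] b0 by (simp add: read_ar_at nonzero_def)
      moreover have "exec (mv 0 Go_Right ;; inc bs ;; inc (bs + 1)) (?S i) 9 (?S (Suc i))"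
      proof -
        have 1: "exec (mv 0 Go_Right) (?S i) 1 ((?S i)(0 := ar_at ?W (Suc i)))"
          by (rule exec_mv_right) (use b0 in simp)
        let ?s1 = "(?S i)(0 := ar_at ?W (Suc i))"
        have 2: "exec (inc bs) ?s1 3 (?s1(bs := cn (Suc i)))" by (rule exec_inc) (use b0 in simp)
        let ?s2 = "?s1(bs := cn (Suc i))"
        have 3: "exec (inc (bs + 1)) ?s2 3 (?s2(bs + 1 := cn (Suc i)))" by (rule exec_inc) simp
        have 4: "?s2(bs + 1 := cn (Suc i)) = ?S (Suc i)" using b0 by (auto simp: fun_eq_iff)
        show ?thesis by (rule exec_SeqI[OF 1 exec_SeqI[OF 2 3[unfolded 4] order.refl]]) simp
      qed
      ultimately show "nonzero (read_tape (?S i 0)) \<and> exec (mv 0 Go_Right ;; inc bs ;; inc (bs + 1)) (?S i) 9 (?S (Suc i))" ..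
    next
      show "\<not> nonzero (read_tape (?S F 0))" using W[of F] b0 by (simp add: read_ar_at nonzero_def)
    qed
    have S0: "?S 0 = ?\<sigma>0" using bs by (auto simp: fun_eq_iff st_def arrays_def)
    have 2: "exec (times (bs + 1) (mv 0 Go_Left)) (?S F) (4 * F + 1) ((?S F)(0 := ar_at ?W 0, bs + 1 := cn 0))"
      by (rule exec_walk_left) (use b0 in auto)
    let ?\<rho> = "F # replicate 9 0"
    have e2: "(?S F)(0 := ar_at ?W 0, bs + 1 := cn 0) = st bs ?A ?\<rho>"
      using bs by (auto simp: fun_eq_iff st_def arrays_def nth_Cons' nth_append)
    have rdy: "ready 10 (?A, ?\<rho>)" using small_arrays_word[of "\<lambda>_. 0" \<phi>] by (simp add: ready_def)
    have FF: "?F (?A, ?\<rho>) = (state_arrays \<phi> (init_state \<phi>), state_vars \<phi> (init_state \<phi>))"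
    proof -
      have r: "?\<rho> = [F, 0, 0, 0, 0, 0, 0, 0, 0, 0]" by (simp add: numeral_eq_Suc)
      have "eval fClauses ?A [F] = F.m" using F.eval_fClauses F by simp
      then show ?thesis unfolding r init_state_def state_arrays.simps state_vars.simps F[symmetric]
        by (simp add: upd_def list_update_Cons_numeral)
    qed
    have 3: "exec ?c (st bs ?A ?\<rho>) (T F) (st bs (state_arrays \<phi> (init_state \<phi>)) (state_vars \<phi> (init_state \<phi>)))"
    proof -
      have "\<forall>y\<in>set (snd (?A, ?\<rho>)). y \<le> F" by auto
      from T(2)[OF rdy this] show ?thesis unfolding FF fst_conv snd_conv .
    qed
    show ?thesis unfolding prog_def init
      by (rule exec_SeqI[OF 1[unfolded S0] exec_SeqI[OF 2[unfolded e2] exec_SeqI[OF 3 ex order.refl] order.refl]]) simp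
  qed
  then have "\<forall>\<phi> \<sigma> n. \<phi> \<in> threesat_instances \<longrightarrow>
     exec (Loop (bs + 6) nonzero (prog_body M s E)) (st bs (state_arrays \<phi> (init_state \<phi>)) (state_vars \<phi> (init_state \<phi>))) n \<sigma> \<longrightarrow>
     exec (prog M s E) (init_store (encode_formula \<phi>))
       ((\<lambda>F. T F + 20 * F + 20) (formula_word.len \<phi>) + n) \<sigma>" by simp
  moreover have "polyb (\<lambda>F. T F + 20 * F + 20)" using T(1) by (intro polyb_intros)
  ultimately show ?thesis by blast
qed

end

subsection \<open>Correctness of the search\<close>

text \<open>Refused guesses are left in the array; the next guess at the same level overwrites them
  completely.\<close>

lemma write_guess_twice: "write_guess q l g' (write_guess q l g z) = write_guess q l g' z"
  by (auto simp: write_guess_def fun_eq_iff)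

context formula_word
begin

definition bad_blocks :: "nat \<Rightarrow> (nat \<Rightarrow> bool) \<Rightarrow> nat set \<Rightarrow> nat set" where
  "bad_blocks b a D = {i. i < qq b \<and> i \<notin> D \<and> \<not> csp.block_ok m (Suc b) var sgn a i}"

lemma bad_blocks_finite: "finite (bad_blocks b a D)"
  by (simp add: bad_blocks_def)

definition extends :: "nat \<Rightarrow> nat \<Rightarrow> (nat \<Rightarrow> nat) \<Rightarrow> (nat \<Rightarrow> bool) \<Rightarrow> bool" where
  "extends b l z a \<longleftrightarrow> (\<forall>x. x div (3 * qq b) \<le> l \<longrightarrow> pval b z x = a x)"

lemma csp_interp: "0 < b \<Longrightarrow> csp (Suc b)"
  by unfold_locales simp

lemma extends_iff: "0 < b \<Longrightarrow> csp.extends (pz b l z) a \<longleftrightarrow> extends b l z a"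
  unfolding csp.extends_def[OF csp_interp] extends_def pz_def by auto

lemma clique_complete:
  assumes b: "0 < b" and l: "l + 1 \<noteq> b" and w: "weight b l z * (8 * E * b) \<le> qq b"
    and a: "extends b l z a" "bad_blocks b a (Dz b l z) = {}"
  shows "has_k_clique (graph E b l z)"
proof -
  interpret G: csp m "qq b" "Suc b" var sgn "pz b l z" "Dz b l z" by (rule csp_interp[OF b])
  obtain S where S: "S \<subseteq> {..<G.N}" "card S = Suc b ^ (3 * qq b)" "\<And>u v. u \<in> S \<Longrightarrow> v \<in> S \<Longrightarrow> G.compat u v"
    using G.clique_of_assignment[of a] a extends_iff[OF b] unfolding bad_blocks_def by blast
  have N: "G.N = NN b" by (simp add: G.N_def NN_def)
  have "clique {{u, v} | u v. u < NN b \<and> v < NN b \<and> adj E b l z u v} S"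
    unfolding clique_def
  proof (intro ballI impI)
    fix u v assume uv: "u \<in> S" "v \<in> S" "u \<noteq> v"
    then have "adj E b l z u v" using l w S(3) unfolding adj_def compat_def by simp
    moreover have "u < NN b" "v < NN b" using uv S(1) N by auto
    ultimately show "{u, v} \<in> {{u, v} | u v. u < NN b \<and> v < NN b \<and> adj E b l z u v}" by blast
  qed
  then show ?thesis using S(1,2) N unfolding graph_def by (auto simp: kk_def)
qed

lemma clique_direct:
  assumes "l + 1 = b" "violated (pval b z) * E < m"
  shows "has_k_clique (graph E b l z)"
proof -
  have le: "kk b \<le> NN b" unfolding kk_def NN_def by (rule power_mono) auto
  have "clique {{u, v} | u v. u < NN b \<and> v < NN b \<and> adj E b l z u v} {..<kk b}"
    unfolding clique_def
  proof (intro ballI impI)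
    fix u v assume "u \<in> {..<kk b}" "v \<in> {..<kk b}" "u \<noteq> v"
    then have "u < NN b" "v < NN b" "adj E b l z u v" using assms le by (auto simp: adj_def)
    then show "{u, v} \<in> {{u, v} | u v. u < NN b \<and> v < NN b \<and> adj E b l z u v}" by blast
  qed
  then show ?thesis using le unfolding graph_def by (auto intro!: exI[of _ "{..<kk b}"])
qed

lemma kk_ge2: "0 < b \<Longrightarrow> 2 \<le> kk b"
proof -
  assume b: "0 < b"
  have "2 ^ 1 \<le> Suc b ^ 1" using b by simp
  also have "\<dots> \<le> Suc b ^ (3 * qq b)" using qq_pos[of b] by (intro power_increasing) auto
  finally show ?thesis by (simp add: kk_def)
qed

lemma empty_sparse:
  assumes "0 < b" "\<And>u v. \<not> adj E b l z u v"
  shows "all_k_subgraphs_sparse f (graph E b l z)"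
  using kk_ge2[OF assms(1)] assms(2) by (auto simp: graph_def density_def induced_edges_def)

text \<open>Clause \<open>c\<close> is entry \<open>c mod Suc b\<close> of block
  \<open>c div Suc b\<close>, and the \<open>m div b + 1\<close> blocks contain all clauses. A
  violated clause makes its block bad.\<close>

lemma violated_le: "violated a \<le> card (bad_blocks b a {}) * Suc b" if b: "0 < b"
proof -
  interpret G: csp m "qq b" "Suc b" var sgn "\<lambda>_. None" "{}" by (rule csp_interp[OF b])
  let ?C = "{c. c < m \<and> \<not> clause_sat a (\<phi> ! c)}"
  have "inj_on (\<lambda>c. (c div Suc b, c mod Suc b)) ?C"
  proof (rule inj_onI)
    fix c c' assume "(c div Suc b, c mod Suc b) = (c' div Suc b, c' mod Suc b)"
    then have "c div Suc b * Suc b + c mod Suc b = c' div Suc b * Suc b + c' mod Suc b" by simp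
    then show "c = c'" unfolding div_mult_mod_eq .
  qed
  moreover have "(\<lambda>c. (c div Suc b, c mod Suc b)) ` ?C \<subseteq> bad_blocks b a {} \<times> {..<Suc b}"
  proof
    fix x assume "x \<in> (\<lambda>c. (c div Suc b, c mod Suc b)) ` ?C"
    then obtain c where c: "c < m" "\<not> clause_sat a (\<phi> ! c)" "x = (c div Suc b, c mod Suc b)" by blast
    have "c div Suc b \<le> c div b" using b by (intro div_le_mono2) auto
    also have "\<dots> \<le> m div b" using c(1) by (intro div_le_mono) auto
    finally have "c div Suc b \<le> m div b" .
    then have "c div Suc b < qq b" by (simp add: qq_def)
    moreover have "G.cl (c div Suc b) (c mod Suc b) = c"
    proof -
      have "Suc b * (c div Suc b) + c mod Suc b = c" by (rule mult_div_mod_eq)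
      then show ?thesis using c(1) unfolding G.cl_def by simp
    qed
    moreover have "\<forall>r<3. a (var c r) \<noteq> sgn c r"
      using c(2) clause_sat_lit[OF c(1)] by (simp add: var_def sgn_def)
    ultimately have "\<not> G.block_ok a (c div Suc b)"
      unfolding G.block_ok_def by (metis mod_less_divisor zero_less_Suc)
    then show "x \<in> bad_blocks b a {} \<times> {..<Suc b}"
      using c(3) \<open>c div Suc b < qq b\<close> unfolding bad_blocks_def by simp
  qed
  ultimately have "card ?C \<le> card (bad_blocks b a {} \<times> {..<Suc b})"
    by (rule card_inj_on_le) (simp add: bad_blocks_finite)
  then show ?thesis by (simp add: violated_def card_cartesian_product)
qed

lemma violated_cong: "(\<And>x. x < 3 * m \<Longrightarrow> a x = a' x) \<Longrightarrow> violated a = violated a'"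
proof -
  assume eq: "\<And>x. x < 3 * m \<Longrightarrow> a x = a' x"
  have "clause_sat a (\<phi> ! c) = clause_sat a' (\<phi> ! c)" if "c < m" for c
    using that eq lit_less[OF that] by (simp add: clause_sat_lit)
  then have "{c. c < m \<and> \<not> clause_sat a (\<phi> ! c)} = {c. c < m \<and> \<not> clause_sat a' (\<phi> ! c)}" by auto
  then show ?thesis by (simp add: violated_def)
qed

lemma obtain_guess:
  obtains g where "g < 2 ^ (4 * qq b)" "\<And>i. i < 4 * qq b \<Longrightarrow> cell b (write_guess (qq b) l g z) l i = B i"
proof -
  let ?n = "4 * qq b"
  let ?f = "\<lambda>u. \<lambda>j\<in>{..<?n}. dig 2 u j"
  let ?h = "\<lambda>j\<in>{..<?n}. of_bool (B j) :: nat"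
  have "?h \<in> {..<?n} \<rightarrow>\<^sub>E {..<2}" by (auto simp: PiE_iff split: if_splits)
  then have "?h \<in> ?f ` {..<2 ^ ?n}" using bij_betw_imp_surj_on[OF bij_digits[of 2 ?n]] by simp
  then obtain g where g: "g < 2 ^ ?n" "?f g = ?h" by (elim imageE) simp
  have "cell b (write_guess (qq b) l g z) l i = B i" if "i < ?n" for i
  proof -
    have "dig 2 g i = of_bool (B i)" using fun_cong[OF g(2), of i] that by simp
    then show ?thesis using that by (simp add: cell_def write_guess_def)
  qed
  then show ?thesis using that g(1) by blast
qed

lemma cell_write_guess_other: "l' < l \<Longrightarrow> i < 4 * qq b \<Longrightarrow> cell b (write_guess (qq b) l g z) l' i = cell b z l' i"
proof -
  assume "l' < l" "i < 4 * qq b"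
  then have "4 * qq b * l' + i < 4 * qq b * Suc l'" by simp
  also have "\<dots> \<le> 4 * qq b * l" using \<open>l' < l\<close> by (intro mult_left_mono) auto
  finally show ?thesis by (simp add: cell_def write_guess_def)
qed

lemma pval_write_guess_other: "x div (3 * qq b) < l \<Longrightarrow> pval b (write_guess (qq b) l g z) x = pval b z x"
proof -
  assume x: "x div (3 * qq b) < l"
  have "x mod (3 * qq b) < 3 * qq b" using qq_pos[of b] by (intro mod_less_divisor) simp
  then show ?thesis unfolding pval_def using x by (intro cell_write_guess_other) auto
qed

text \<open>In contrast to \<open>Dz\<close>, only levels strictly below \<open>l\<close> are
  collected, so a guess at level \<open>l\<close> does not change this set.\<close>

definition dropped :: "nat \<Rightarrow> nat \<Rightarrow> (nat \<Rightarrow> nat) \<Rightarrow> nat set" where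
  "dropped b l z = {i. i < qq b \<and> (\<exists>l'<l. cell b z l' (3 * qq b + i))}"

lemma dropped_0: "dropped b 0 z = {}"
  by (simp add: dropped_def)

lemma dropped_write_guess: "dropped b l (write_guess (qq b) l g z) = dropped b l z"
  unfolding dropped_def using cell_write_guess_other by auto

lemma Dz_dropped: "Dz b l z \<inter> {..<qq b} = dropped b l z \<union> {i. i < qq b \<and> cell b z l (3 * qq b + i)}"
  unfolding Dz_def dropped_def by (auto simp: le_less)

lemma dropped_Suc: "dropped b (Suc l) z = Dz b l z \<inter> {..<qq b}"
  unfolding Dz_def dropped_def by (auto simp: less_Suc_eq_le)

lemma dropped_finite: "finite (dropped b l z)"
  by (simp add: dropped_def)

text \<open>The number of blocks that a single level may drop; over all \<open>b\<close> levels this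
  is at most a fraction \<open>1 / (8 * E)\<close> of the blocks.\<close>

definition tolerance :: "nat \<Rightarrow> nat \<Rightarrow> nat" where "tolerance E b = qq b div (8 * E * b)"

lemma tolerance_iff: "0 < E \<Longrightarrow> 0 < b \<Longrightarrow> w * (8 * E * b) \<le> qq b \<longleftrightarrow> w \<le> tolerance E b"
  unfolding tolerance_def by (simp add: less_eq_div_iff_mult_less_eq)

text \<open>The invariant of the search at level \<open>l\<close>.\<close>

definition promising :: "nat \<Rightarrow> nat \<Rightarrow> nat \<Rightarrow> (nat \<Rightarrow> nat) \<Rightarrow> bool" where
  "promising E b l z \<longleftrightarrow> (\<exists>a. (\<forall>x. x div (3 * qq b) < l \<longrightarrow> pval b z x = a x) \<and>
     card (bad_blocks b a (dropped b l z)) \<le> tolerance E b \<and> card (dropped b l z) \<le> l * tolerance E b)"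

text \<open>The guess is read off from the witness \<open>a\<close>: its values at this level, and
  the blocks it still violates as the ones to drop. Before the last level, \<open>a\<close>
  satisfies all remaining blocks and gives a clique; at the last level, few violated clauses remain
  and the graph is complete.\<close>

lemma good_guess:
  assumes b: "0 < b" "b \<le> m" "l < b" "0 < E"
    and a: "\<And>x. x div (3 * qq b) < l \<Longrightarrow> pval b z x = a x"
      "card (bad_blocks b a (dropped b l z)) \<le> tolerance E b" "card (dropped b l z) \<le> l * tolerance E b"
  obtains g where "g < 2 ^ (4 * qq b)" "has_k_clique (graph E b l (write_guess (qq b) l g z))"
proof -
  let ?q = "qq b" and ?V = "bad_blocks b a (dropped b l z)" and ?s = "tolerance E b"
  obtain g where g: "g < 2 ^ (4 * ?q)"
    "\<And>i. i < 4 * ?q \<Longrightarrow> cell b (write_guess ?q l g z) l i = (if i < 3 * ?q then a (3 * ?q * l + i) else i - 3 * ?q \<in> ?V)"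
    using obtain_guess[of b l z "\<lambda>i. if i < 3 * ?q then a (3 * ?q * l + i) else i - 3 * ?q \<in> ?V"] by blast
  let ?z = "write_guess ?q l g z"
  have V: "cell b ?z l (3 * ?q + i) \<longleftrightarrow> i \<in> ?V" if "i < ?q" for i using g(2)[of "3 * ?q + i"] that by simp
  have "{i. i < ?q \<and> cell b ?z l (3 * ?q + i)} = ?V" using V by (auto simp: bad_blocks_def)
  then have w: "weight b l ?z * (8 * E * b) \<le> ?q" and D: "Dz b l ?z \<inter> {..<?q} = dropped b l z \<union> ?V"
    using a(2) tolerance_iff[OF b(4,1)] unfolding weight_def Dz_dropped dropped_write_guess by auto
  have ext: "pval b ?z x = a x" if "x div (3 * ?q) \<le> l" for x
  proof (cases "x div (3 * ?q) < l")
    case True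
    then show ?thesis using a(1) pval_write_guess_other by simp
  next
    case False
    then have xl: "x div (3 * ?q) = l" using that by simp
    have lt: "x mod (3 * ?q) < 3 * ?q" using qq_pos[of b] by (intro mod_less_divisor) simp
    have "3 * ?q * l + x mod (3 * ?q) = x" unfolding xl[symmetric] by (rule mult_div_mod_eq)
    then show ?thesis using g(2)[of "x mod (3 * ?q)"] lt unfolding pval_def xl by simp
  qed
  have "has_k_clique (graph E b l ?z)"
  proof (cases "l + 1 = b")
    case False
    have "bad_blocks b a (Dz b l ?z) = {}"
    proof -
      have "i \<in> Dz b l ?z" if "i < ?q" "\<not> csp.block_ok m (Suc b) var sgn a i" for i
      proof -
        have "i \<in> dropped b l z \<union> ?V" using that by (auto simp: bad_blocks_def)
        then show ?thesis using D by blast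
      qed
      then show ?thesis by (auto simp: bad_blocks_def)
    qed
    moreover have "extends b l ?z a" using ext by (simp add: extends_def)
    ultimately show ?thesis using clique_complete[OF b(1) False w] by blast
  next
    case True
    \<comment> \<open>The \<open>b\<close> levels reach all variables, because
      \<open>b * qq b\<close> exceeds \<open>m\<close>.\<close>
    have "pval b ?z x = a x" if "x < 3 * m" for x
    proof (rule ext)
      have "m < b * ?q" using dividend_less_times_div[OF b(1), of m] by (simp add: qq_def)
      then have "x < b * (3 * ?q)" using that by simp
      then have "x div (3 * ?q) < b" by (rule less_mult_imp_div_less)
      then show "x div (3 * ?q) \<le> l" using True by simp
    qed
    then have "violated (pval b ?z) = violated a" by (rule violated_cong)
    also have "\<dots> \<le> card (bad_blocks b a {}) * Suc b" by (rule violated_le[OF b(1)])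
    also have "\<dots> \<le> (b * ?s) * Suc b"
    proof (rule mult_right_mono)
      have "bad_blocks b a {} \<subseteq> dropped b l z \<union> ?V" by (auto simp: bad_blocks_def)
      then have "card (bad_blocks b a {}) \<le> card (dropped b l z \<union> ?V)"
        by (rule card_mono[rotated]) (simp add: dropped_finite bad_blocks_finite)
      also have "\<dots> \<le> card (dropped b l z) + card ?V" by (rule card_Un_le)
      also have "\<dots> \<le> l * ?s + ?s" using a by (intro add_mono)
      also have "\<dots> = b * ?s" using True by auto
      finally show "card (bad_blocks b a {}) \<le> b * ?s" .
    qed simp
    \<comment> \<open>Origin of the constant 8: \<open>Suc b \<le> 2 * b\<close> and
      \<open>b * qq b \<le> m + b \<le> 2 * m\<close> bound the right-hand side by
      \<open>4 * m\<close>, and the remaining factor 2 makes the final inequality strict.\<close>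
    finally have "violated (pval b ?z) * (E * 8) \<le> (b * ?s) * Suc b * (E * 8)" by (rule mult_le_mono1)
    also have "\<dots> = (?s * (8 * E * b)) * Suc b" by (simp add: mult_ac)
    also have "\<dots> \<le> ?q * Suc b" using tolerance_iff[OF b(4,1), of ?s] by (intro mult_right_mono) auto
    also have "\<dots> \<le> ?q * (2 * b)" using b(1) by (intro mult_left_mono) auto
    also have "\<dots> = 2 * (b * (m div b)) + 2 * b" by (simp add: qq_def algebra_simps)
    also have "\<dots> \<le> 2 * m + 2 * m" using b(2) by (intro add_mono mult_left_mono) (auto simp: times_div_less_eq_dividend)
    finally have "violated (pval b ?z) * E < m" using m_pos by linarith
    then show ?thesis by (rule clique_direct[OF True])
  qed
  then show ?thesis using that g(1) by blast
qed

text \<open>A satisfying assignment violates no block, so it is a witness for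
  \<open>good_guess\<close> at level 0 with nothing dropped.\<close>

lemma satisfiable_guess:
  assumes b: "0 < b" "b \<le> m" "0 < E" and sat: "satisfiable \<phi>"
  obtains g where "g < 2 ^ (4 * qq b)" "has_k_clique (graph E b 0 (write_guess (qq b) 0 g z))"
proof -
  obtain a where a: "\<And>c. c < m \<Longrightarrow> clause_sat a (\<phi> ! c)"
    using sat unfolding satisfiable_def m_def by (metis nth_mem)
  interpret G: csp m "qq b" "Suc b" var sgn "\<lambda>_. None" "{}" by (rule csp_interp[OF b(1)])
  have "G.block_ok a i" for i
    unfolding G.block_ok_def
  proof (intro allI impI)
    fix d
    have "G.cl i d < m" using m_pos by (simp add: G.cl_def)
    then show "\<exists>r<3. a (var (G.cl i d) r) = sgn (G.cl i d) r"
      using a clause_sat_lit unfolding var_def sgn_def by blast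
  qed
  then have bad: "bad_blocks b a D = {}" for D by (simp add: bad_blocks_def)
  obtain g where "g < 2 ^ (4 * qq b)" "has_k_clique (graph E b 0 (write_guess (qq b) 0 g z))"
  proof (rule good_guess[OF b(1,2,1,3), of z a])
    show "card (bad_blocks b a (dropped b 0 z)) \<le> tolerance E b" unfolding bad by simp
    show "card (dropped b 0 z) \<le> 0 * tolerance E b" unfolding dropped_0 by simp
  qed simp_all
  then show ?thesis by (rule that)
qed

lemma val_violated:
  assumes "val \<phi> \<le> 1 - 1 / real E" "0 < E" shows "\<not> violated a * E < m"
proof
  assume v: "violated a * E < m"
  \<comment> \<open>There are infinitely many assignments but only finitely many counts of satisfied
    clauses, so \<open>Max\<close> in \<open>val\<close> bounds each of them.\<close>
  have fin: "finite (range (\<lambda>a. real (length (filter (clause_sat a) \<phi>)) / real (length \<phi>)))"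
  proof (rule finite_subset)
    show "range (\<lambda>a. real (length (filter (clause_sat a) \<phi>)) / real (length \<phi>))
      \<subseteq> (\<lambda>k. real k / real (length \<phi>)) ` {..length \<phi>}" by auto
  qed simp
  have "real (length (filter (clause_sat a) \<phi>)) / real (length \<phi>) \<le> val \<phi>"
    unfolding val_def by (rule Max_ge[OF fin]) blast
  then have "real (length (filter (clause_sat a) \<phi>)) / real m \<le> 1 - 1 / real E"
    using assms(1) by (simp add: m_def)
  then have 1: "real (length (filter (clause_sat a) \<phi>)) \<le> real m - real m / real E"
    using m_pos by (simp add: field_simps)
  have "length (filter (clause_sat a) \<phi>) = card {c. c < m \<and> clause_sat a (\<phi> ! c)}"
    unfolding m_def by (rule length_filter_conv_card)
  moreover have "card {c. c < m \<and> clause_sat a (\<phi> ! c)} + violated a = m"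
  proof -
    have "card ({c. c < m \<and> clause_sat a (\<phi> ! c)} \<union> {c. c < m \<and> \<not> clause_sat a (\<phi> ! c)}) =
        card {c. c < m \<and> clause_sat a (\<phi> ! c)} + card {c. c < m \<and> \<not> clause_sat a (\<phi> ! c)}"
      by (rule card_Un_disjoint) auto
    moreover have "{c. c < m \<and> clause_sat a (\<phi> ! c)} \<union> {c. c < m \<and> \<not> clause_sat a (\<phi> ! c)} = {..<m}" by auto
    ultimately show ?thesis by (simp add: violated_def)
  qed
  ultimately have "real (length (filter (clause_sat a) \<phi>)) = real m - real (violated a)" by linarith
  then have "real m / real E \<le> real (violated a)" using 1 by linarith
  then have "real m \<le> real (violated a) * real E" using assms(2) by (simp add: field_simps)
  then show False using v by (metis of_nat_le_iff of_nat_mult not_less)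
qed

end

section \<open>The search with a distinguishing machine\<close>

locale dks_reduction = reduction M s E c d for M s E c d +
  fixes f :: "nat \<Rightarrow> real"
  assumes f: "f \<longlonglongrightarrow> 0" and E: "0 < E"
    and dist: "distinguishes M encode_dks dks_instances has_k_clique (all_k_subgraphs_sparse f)"

locale search = dks_reduction M s E c d f +
  formula_word \<phi> "arrays (word_array (encode_formula \<phi>)) (\<lambda>_. 0)" for M s E c d f \<phi>
begin

lemma answer_clique: "0 < b \<Longrightarrow> has_k_clique (graph E b l z) \<Longrightarrow> answer \<phi> b l z"
  using dist graph_instance unfolding distinguishes_def answer_def by blast

lemma not_answer_sparse:
  assumes "0 < b" "all_k_subgraphs_sparse f (graph E b l z)" shows "\<not> answer \<phi> b l z"
proof -
  obtain t where t: "tm_state_after M (encode_dks (graph E b l z)) t = 2"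
    using dist graph_instance[OF assms(1)] assms(2) unfolding distinguishes_def rejects_def by blast
  then show ?thesis using accepts_iff[of M "encode_dks (graph E b l z)" t] by (simp add: answer_def)
qed

lemma answer_final:
  assumes "0 < b" "l + 1 = b" "answer \<phi> b l z" shows "violated (pval b z) * E < m"
proof (rule ccontr)
  assume "\<not> ?thesis"
  then have "\<not> adj E b l z u v" for u v using assms(2) by (simp add: adj_def)
  then show False using not_answer_sparse[OF assms(1) empty_sparse[OF assms(1)]] assms(3) by blast
qed

lemma answer_weight:
  assumes "0 < b" "l + 1 \<noteq> b" "answer \<phi> b l z" shows "weight b l z \<le> tolerance E b"
proof (rule ccontr)
  assume "\<not> ?thesis"
  then have "\<not> adj E b l z u v" for u v
    using assms(2) tolerance_iff[OF E assms(1)] by (simp add: adj_def)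
  then show False using not_answer_sparse[OF assms(1) empty_sparse[OF assms(1)]] assms(3) by blast
qed

text \<open>Trustworthiness of the positive answers for \<open>b\<close>. The last level is left out
  because the answers there are correct for every \<open>b\<close>.\<close>

definition good :: "nat \<Rightarrow> bool" where
  "good b \<longleftrightarrow> (\<forall>l z. l + 1 \<noteq> b \<longrightarrow> answer \<phi> b l z \<longrightarrow>
     (\<exists>a. extends b l z a \<and> card (bad_blocks b a (Dz b l z)) \<le> tolerance E b))"

text \<open>Only for good \<open>b\<close> does a level above 0 carry a promise. Otherwise the
  search may have advanced on a misleading answer and may get stuck later. The numbers
  \<open>b0\<close> and \<open>B\<close> occur in the analysis only, not in the program.\<close>

fun inv :: "nat \<Rightarrow> nat \<Rightarrow> state \<Rightarrow> bool" where
  "inv b0 B (P, b, l, g, r, a, z) \<longleftrightarrow> valid \<phi> (P, b, l, g, r, a, z) \<and> b0 \<le> b \<and> P \<le> B \<and> r = 1 \<and> a = 0 \<and>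
     (\<forall>g'<g. \<not> answer \<phi> b l (write_guess (qq b) l g' z)) \<and> (good b \<longrightarrow> l = 0 \<or> promising E b l z)"

text \<open>The lexicographic progress of \<open>b\<close>, \<open>l\<close> and \<open>g\<close> is
  flattened into one number, with \<open>B\<close> as the weight because guesses stay below
  \<open>B\<close>. Raising \<open>P\<close> is counted separately, as \<open>P\<close> is kept when
  \<open>b\<close> changes.\<close>

fun rank :: "nat \<Rightarrow> nat \<Rightarrow> state \<Rightarrow> nat" where
  "rank b0 B (P, b, l, g, r, a, z) = (B - P) + ((b - b0) * m + (m - l)) * B + (B - g)"

fun outcome :: "state \<Rightarrow> bool" where
  "outcome (P, b, l, g, r, a, z) \<longleftrightarrow> r = 0 \<and>
     (if a = 1 then \<exists>a'. violated a' * E < m else a = 0 \<and> \<not> satisfiable \<phi>)"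

lemma guesses_le_NN: "0 < b \<Longrightarrow> 2 ^ (4 * qq b) \<le> NN b"
proof -
  assume b: "0 < b"
  have "(2::nat) ^ (4 * qq b) \<le> 2 ^ (2 * (3 * qq b))" by (rule power_increasing) auto
  also have "\<dots> = 4 ^ (3 * qq b)" by (simp add: power_mult)
  also have "\<dots> \<le> NN b" unfolding NN_def by (rule power_mono) (use b in auto)
  finally show ?thesis .
qed

text \<open>The witness may change from level to level: only the values already fixed and the number
  of dropped blocks are passed on, and the trusted answer supplies a new assignment.\<close>

lemma promising_Suc:
  assumes b: "0 < b" "l + 1 \<noteq> b" "good b" and yes: "answer \<phi> b l z" and pr: "l = 0 \<or> promising E b l z"
  shows "promising E b (Suc l) z"
proof -
  obtain a where a: "extends b l z a" "card (bad_blocks b a (Dz b l z)) \<le> tolerance E b"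
    using b yes unfolding good_def by blast
  have "bad_blocks b a (dropped b (Suc l) z) = bad_blocks b a (Dz b l z)"
    unfolding bad_blocks_def dropped_Suc by auto
  moreover have "card (dropped b (Suc l) z) \<le> Suc l * tolerance E b"
  proof -
    have "dropped b (Suc l) z = dropped b l z \<union> {i. i < qq b \<and> cell b z l (3 * qq b + i)}"
      unfolding dropped_Suc by (rule Dz_dropped)
    then have "card (dropped b (Suc l) z) \<le> card (dropped b l z) + weight b l z"
      unfolding weight_def by (simp add: card_Un_le)
    moreover have "card (dropped b l z) \<le> l * tolerance E b"
      using pr dropped_0 unfolding promising_def by auto
    ultimately show ?thesis using answer_weight[OF b(1,2) yes] by simp
  qed
  moreover have "pval b z x = a x" if "x div (3 * qq b) < Suc l" for x
    using a(1) that unfolding extends_def by simp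
  ultimately show ?thesis using a(2) unfolding promising_def by metis
qed

lemma promising_write_guess: "promising E b l (write_guess (qq b) l g z) \<longleftrightarrow> promising E b l z"
  unfolding promising_def dropped_write_guess using pval_write_guess_other by simp

lemma exhausted:
  assumes b: "0 < b" "b \<le> m" "l < b" and no: "\<And>g. g < 2 ^ (4 * qq b) \<Longrightarrow> \<not> answer \<phi> b l (write_guess (qq b) l g z)"
  shows "\<not> promising E b l z" "l = 0 \<Longrightarrow> \<not> satisfiable \<phi>"
proof -
  show "\<not> promising E b l z"
  proof
    assume "promising E b l z"
    then obtain a where a: "\<forall>x. x div (3 * qq b) < l \<longrightarrow> pval b z x = a x"
      "card (bad_blocks b a (dropped b l z)) \<le> tolerance E b" "card (dropped b l z) \<le> l * tolerance E b"
      unfolding promising_def by blast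
    obtain g where "g < 2 ^ (4 * qq b)" "has_k_clique (graph E b l (write_guess (qq b) l g z))"
      by (rule good_guess[OF b E _ a(2,3)]) (use a(1) in auto)
    then show False using no answer_clique[OF b(1)] by blast
  qed
  show "\<not> satisfiable \<phi>" if "l = 0"
  proof
    assume "satisfiable \<phi>"
    then obtain g where "g < 2 ^ (4 * qq b)" "has_k_clique (graph E b 0 (write_guess (qq b) 0 g z))"
      using satisfiable_guess[OF b(1,2) E] by blast
    then show False using no answer_clique[OF b(1)] that by blast
  qed
qed

text \<open>The search never falls below \<open>b0\<close>. If it is stuck above level 0, no promise
  holds there, so \<open>b\<close> is not good and thus differs from a good \<open>b0\<close>; and
  \<open>b0 = 1\<close> has no level above 0.\<close>

lemma loop_step_cases:
  assumes I: "inv b0 B \<tau>" and b0: "0 < b0" "b0 = 1 \<or> good b0"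
    and B: "\<And>b. b0 \<le> b \<Longrightarrow> b \<le> m \<Longrightarrow> NN b < B"
  shows "inv b0 B (loop_step \<phi> \<tau>) \<and> rank b0 B (loop_step \<phi> \<tau>) < rank b0 B \<tau> \<or> outcome (loop_step \<phi> \<tau>)"
proof -
  obtain P b l g r a z where \<tau>: "\<tau> = (P, b, l, g, r, a, z)" by (metis surj_pair)
  have v: "0 < P" "b \<le> m" "l < b" "g < 2 ^ (4 * qq b)" "\<And>i. z i \<le> 3" "b0 \<le> b" "P \<le> B" "r = 1" "a = 0"
    and no: "\<And>g'. g' < g \<Longrightarrow> \<not> answer \<phi> b l (write_guess (qq b) l g' z)"
    and pr: "good b \<Longrightarrow> l = 0 \<or> promising E b l z"
    using I unfolding \<tau> by auto
  have b: "0 < b" using v(3) by simp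
  have NB: "NN b < B" by (rule B[OF v(6,2)])
  have gB: "g < B" using v(4) guesses_le_NN[OF b] NB by linarith
  show ?thesis
  proof (cases "P \<le> NN b")
    case True
    then have "loop_step \<phi> \<tau> = (P + 1, b, l, g, r, a, z)" by (simp add: \<tau>)
    then show ?thesis using I NB True unfolding \<tau> by simp
  next
    case False
    define z' where "z' = write_guess (qq b) l g z"
    have z'3: "\<And>i. z' i \<le> 3" unfolding z'_def by (rule write_guess_le[OF v(5)])
    have no': "\<not> answer \<phi> b l (write_guess (qq b) l g' z')" if "g' < g" for g'
      using no[OF that] by (simp add: z'_def write_guess_twice)
    have pr': "good b \<Longrightarrow> l = 0 \<or> promising E b l z'"
      using pr promising_write_guess unfolding z'_def by blast
    define yes where "yes \<longleftrightarrow> answer \<phi> b l z'"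
    define full where "full \<longleftrightarrow> g + 1 = 2 ^ (4 * qq b)"
    have step: "loop_step \<phi> \<tau> = (P, b - of_bool (\<not> yes \<and> full), if yes then l + 1 else if full then 0 else l,
               if yes \<or> full then 0 else g + 1,
               of_bool (\<not> (yes \<and> l + 1 = b) \<and> \<not> (\<not> yes \<and> full \<and> l = 0)), of_bool (yes \<and> l + 1 = b), z')"
      using False by (simp add: \<tau> Let_def z'_def yes_def full_def)
    show ?thesis
    proof (cases yes)
      case True
      show ?thesis
      proof (cases "l + 1 = b")
        case lb: True
        have "violated (pval b z') * E < m" using True answer_final[OF b lb] unfolding yes_def by blast
        then show ?thesis unfolding step using True lb by auto
      next
        case lb: False
        have st: "loop_step \<phi> \<tau> = (P, b, l + 1, 0, 1, 0, z')" unfolding step using True lb by simp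
        have "promising E b (Suc l) z'" if "good b"
          using promising_Suc[OF b lb that _ pr'[OF that]] True unfolding yes_def by blast
        moreover have "((b - b0) * m + (m - (l + 1))) * B + B = ((b - b0) * m + (m - l)) * B"
        proof -
          have "(b - b0) * m + (m - l) = Suc ((b - b0) * m + (m - (l + 1)))" using v(2,3) by simp
          then show ?thesis by simp
        qed
        then have "rank b0 B (P, b, l + 1, 0, 1, 0, z') < rank b0 B \<tau>"
          unfolding \<tau> rank.simps using gB by linarith
        ultimately show ?thesis unfolding st using v lb z'3 by simp
      qed
    next
      case no_yes: False
      show ?thesis
      proof (cases full)
        case False
        have st: "loop_step \<phi> \<tau> = (P, b, l, g + 1, 1, 0, z')" unfolding step using no_yes False by simp
        have "\<not> answer \<phi> b l (write_guess (qq b) l g' z')" if "g' < g + 1" for g'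
        proof (cases "g' = g")
          case True
          then show ?thesis using no_yes by (simp add: yes_def z'_def write_guess_twice)
        qed (use no' that in simp)
        moreover have "g + 1 < 2 ^ (4 * qq b)" using False v(4) unfolding full_def by simp
        moreover have "rank b0 B (P, b, l, g + 1, 1, 0, z') < rank b0 B \<tau>" unfolding \<tau> using gB by simp
        ultimately show ?thesis unfolding st using v z'3 pr' by simp
      next
        case True
        have all: "\<not> answer \<phi> b l (write_guess (qq b) l g' z)" if "g' < 2 ^ (4 * qq b)" for g'
        proof (cases "g' = g")
          case True
          then show ?thesis using no_yes by (simp add: yes_def z'_def)
        next
          case False
          then show ?thesis using no that \<open>full\<close> unfolding full_def by simp
        qed
        note ex = exhausted[OF b v(2,3) all]
        show ?thesis
        proof (cases "l = 0")
          case l: True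
          have "\<not> satisfiable \<phi>" by (rule ex(2)[OF _ l])
          then show ?thesis unfolding step using no_yes True l by simp
        next
          case l: False
          have st: "loop_step \<phi> \<tau> = (P, b - 1, 0, 0, 1, 0, z')" unfolding step using no_yes True l by simp
          have "\<not> good b" using pr l ex(1) by blast
          then have "b \<noteq> b0" using b0 v(3) l by auto
          then have bb: "b0 \<le> b - 1" "0 < b - 1" using v(6) b0 by auto
          have "rank b0 B (P, b - 1, 0, 0, 1, 0, z') < rank b0 B \<tau>"
          proof -
            have "(b - b0) * m = (b - 1 - b0) * m + m"
            proof -
              have "b - b0 = Suc (b - 1 - b0)" using bb by simp
              then show ?thesis by simp
            qed
            then have "Suc ((b - 1 - b0) * m + (m - 0)) \<le> (b - b0) * m + (m - l)" using v(2,3) by linarith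
            then have "Suc ((b - 1 - b0) * m + (m - 0)) * B \<le> ((b - b0) * m + (m - l)) * B"
              by (rule mult_right_mono) simp
            then show ?thesis unfolding \<tau> rank.simps using gB by (simp only: mult_Suc) linarith
          qed
          then show ?thesis unfolding st using v bb z'3 by simp
        qed
      qed
    qed
  qed
qed

text \<open>Induction on the rank. All counters stay at most \<open>len + B\<close>, so every pass
  obeys the same bound.\<close>

lemma exec_search:
  assumes b0: "0 < b0" "b0 = 1 \<or> good b0" and B: "\<And>b. b0 \<le> b \<Longrightarrow> b \<le> m \<Longrightarrow> NN b < B"
    and T: "\<forall>\<phi> \<tau> S. \<phi> \<in> threesat_instances \<longrightarrow> valid \<phi> \<tau> \<longrightarrow> (\<forall>y\<in>set (state_vars \<phi> \<tau>). y \<le> S) \<longrightarrow>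
      exec (prog_body M s E) (st bs (state_arrays \<phi> \<tau>) (state_vars \<phi> \<tau>)) (T S)
        (st bs (state_arrays \<phi> (loop_step \<phi> \<tau>)) (state_vars \<phi> (loop_step \<phi> \<tau>)))"
    and I: "inv b0 B \<tau>"
  shows "\<exists>\<tau>'. outcome \<tau>' \<and> exec (Loop (bs + 6) nonzero (prog_body M s E))
    (st bs (state_arrays \<phi> \<tau>) (state_vars \<phi> \<tau>)) ((rank b0 B \<tau> + 1) * (T (len + B) + 1) + 1)
    (st bs (state_arrays \<phi> \<tau>') (state_vars \<phi> \<tau>'))"
  using I
proof (induction "rank b0 B \<tau>" arbitrary: \<tau> rule: less_induct)
  case less
  obtain P b l g r a z where \<tau>: "\<tau> = (P, b, l, g, r, a, z)" by (metis surj_pair)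
  let ?S = "\<lambda>\<tau>. st bs (state_arrays \<phi> \<tau>) (state_vars \<phi> \<tau>)" and ?t = "T (len + B)"
  have v: "valid \<phi> \<tau>" using less.prems by (simp add: \<tau>)
  have "\<forall>y\<in>set (state_vars \<phi> \<tau>). y \<le> len + B"
  proof -
    have "g < NN b" using less.prems guesses_le_NN[of b] unfolding \<tau> by auto
    then have "g < B" using less.prems B[of b] unfolding \<tau> by auto
    then show ?thesis using less.prems m_le_len unfolding \<tau> by auto
  qed
  then have body: "exec (prog_body M s E) (?S \<tau>) ?t (?S (loop_step \<phi> \<tau>))" using T v \<phi> by blast
  have "read_tape (?S \<tau> (bs + 6)) = (if r = 0 then 0 else 1)"
    unfolding \<tau> by (subst st_counter) (auto simp: read_cn)
  then have run: "nonzero (read_tape (?S \<tau> (bs + 6)))"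
    using less.prems by (simp add: \<tau> nonzero_def)
  from loop_step_cases[OF less.prems b0 B] show ?case
  proof
    assume H: "inv b0 B (loop_step \<phi> \<tau>) \<and> rank b0 B (loop_step \<phi> \<tau>) < rank b0 B \<tau>"
    let ?k = "rank b0 B (loop_step \<phi> \<tau>)"
    obtain \<tau>' where \<tau>': "outcome \<tau>'" "exec (Loop (bs + 6) nonzero (prog_body M s E)) (?S (loop_step \<phi> \<tau>)) ((?k + 1) * (?t + 1) + 1) (?S \<tau>')"
      using less.hyps H by blast
    have "exec (Loop (bs + 6) nonzero (prog_body M s E)) (?S \<tau>) (?t + ((?k + 1) * (?t + 1) + 1) + 1) (?S \<tau>')"
      by (rule exec.LoopT[of nonzero "?S \<tau>" "bs + 6", OF run body \<tau>'(2)])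
    moreover have "?t + ((?k + 1) * (?t + 1) + 1) + 1 \<le> (rank b0 B \<tau> + 1) * (?t + 1) + 1"
    proof -
      have "(?k + 2) * (?t + 1) \<le> (rank b0 B \<tau> + 1) * (?t + 1)" by (rule mult_right_mono) (use H in auto)
      then show ?thesis by simp
    qed
    ultimately have "exec (Loop (bs + 6) nonzero (prog_body M s E)) (?S \<tau>) ((rank b0 B \<tau> + 1) * (?t + 1) + 1) (?S \<tau>')"
      by (rule exec.Weaken)
    then show ?case using \<tau>'(1) by blast
  next
    assume H: "outcome (loop_step \<phi> \<tau>)"
    obtain P' b' l' g' r' a' z' where \<tau>': "loop_step \<phi> \<tau> = (P', b', l', g', r', a', z')" by (metis surj_pair)
    have "\<not> nonzero (read_tape (?S (loop_step \<phi> \<tau>) (bs + 6)))"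
      using H unfolding \<tau>' by (subst st_counter) (auto simp: read_cn nonzero_def)
    then have "exec (Loop (bs + 6) nonzero (prog_body M s E)) (?S \<tau>) (?t + 1 + 1) (?S (loop_step \<phi> \<tau>))"
      by (intro exec.LoopT[of nonzero "?S \<tau>" "bs + 6", OF run body] exec.LoopF)
    then have "exec (Loop (bs + 6) nonzero (prog_body M s E)) (?S \<tau>) ((rank b0 B \<tau> + 1) * (?t + 1) + 1) (?S (loop_step \<phi> \<tau>))"
      by (rule exec.Weaken) simp
    then show ?case using H by blast
  qed
qed

end

context dks_reduction
begin

lemma search: "\<phi> \<in> threesat_instances \<Longrightarrow> search M s E c d f \<phi>"
  using formula_word_arrays dks_reduction_axioms by (simp add: search_def)

text \<open>If a positive answer had no backing, every extension would violate more than
  \<open>tolerance E b\<close> of the blocks that are not dropped, which is at least a fraction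
  \<open>1 / (8 * E * b)\<close> of all. For large \<open>q\<close> the graph would then be sparse,
  and \<open>M\<close> would have rejected it.\<close>

lemma eventually_good:
  assumes b: "0 < b"
  shows "\<exists>m0. \<forall>\<phi>\<in>threesat_instances. m0 \<le> length \<phi> \<longrightarrow> search.good M E \<phi> b"
proof -
  have "2 \<le> Suc b" using b by simp
  from csp_sparse[OF this f, of "8 * E * b"] obtain q0 where q0:
    "\<forall>q\<ge>q0. \<forall>m var sgn p D s0. q \<le> 8 * E * b * s0 \<longrightarrow>
      (\<forall>a. csp.extends p a \<longrightarrow> s0 \<le> card {i. i < q \<and> i \<notin> D \<and> \<not> csp.block_ok m (Suc b) var sgn a i}) \<longrightarrow>
      all_k_subgraphs_sparse f (csp.N q (Suc b), csp.edges m q (Suc b) var sgn p D, Suc b ^ (3 * q))" by blast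
  have "search.good M E \<phi> b" if \<phi>: "\<phi> \<in> threesat_instances" and len: "b * q0 \<le> length \<phi>" for \<phi>
  proof -
    interpret search M s E c d f \<phi> by (rule search[OF \<phi>])
    have "q0 \<le> m div b" using len b by (simp add: m_def less_eq_div_iff_mult_less_eq mult.commute)
    then have q: "q0 \<le> qq b" by (simp add: qq_def)
    show ?thesis
      unfolding good_def
    proof (intro allI impI)
      fix l z assume l: "l + 1 \<noteq> b" and yes: "answer \<phi> b l z"
      interpret G: csp m "qq b" "Suc b" var sgn "pz b l z" "Dz b l z" by (rule csp_interp[OF b])
      show "\<exists>a. extends b l z a \<and> card (bad_blocks b a (Dz b l z)) \<le> tolerance E b"
      proof (rule ccontr)
        assume "\<not> ?thesis"
        then have "\<forall>a. G.extends a \<longrightarrow> tolerance E b + 1 \<le> card (bad_blocks b a (Dz b l z))"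
          using extends_iff[OF b] by (simp add: not_le Suc_le_eq)
        moreover have "qq b \<le> 8 * E * b * (tolerance E b + 1)"
          using dividend_less_times_div[of "8 * E * b" "qq b"] b E by (simp add: tolerance_def)
        ultimately have "all_k_subgraphs_sparse f (G.N, G.edges, Suc b ^ (3 * qq b))"
          using q0 q unfolding bad_blocks_def by blast
        moreover have "G.edges = {{u, v} | u v. u < NN b \<and> v < NN b \<and> adj E b l z u v}"
          unfolding G.edges_def using l answer_weight[OF b l yes] tolerance_iff[OF E b]
          by (simp add: adj_def compat_def G.N_def NN_def conj_ac)
        ultimately have "all_k_subgraphs_sparse f (graph E b l z)"
          by (simp add: graph_def G.N_def NN_def kk_def)
        then show False using not_answer_sparse[OF b] yes by blast
      qed
    qed
  qed
  then show ?thesis by blast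
qed

end

subsection \<open>Running time\<close>

lemma length_concat_le:
  "(\<And>x. x \<in> set xs \<Longrightarrow> length (h x) \<le> K) \<Longrightarrow> length (concat (map h xs)) \<le> length xs * K"
  by (induction xs) (auto intro: add_mono)

text \<open>A literal takes at most \<open>3 * m + 1\<close> symbols and a clause at most
  \<open>3 * (3 * m + 1) + 1 \<le> 13 * m\<close>.\<close>

lemma length_encode_formula:
  assumes "\<phi> \<in> threesat_instances" shows "length (encode_formula \<phi>) \<le> 13 * length \<phi> ^ 2"
proof -
  let ?m = "length \<phi>"
  have m: "1 \<le> ?m" using assms by (cases \<phi>) (auto simp: threesat_instances_def)
  have "length (encode_clause C) \<le> 13 * ?m" if C: "C \<in> set \<phi>" for C
  proof -
    have "length (encode_literal x) \<le> 3 * ?m + 1" if "x \<in> set C" for x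
      using assms C that by (cases x) (fastforce simp: threesat_instances_def)
    then have "length (concat (map encode_literal C)) \<le> length C * (3 * ?m + 1)" by (rule length_concat_le)
    also have "\<dots> \<le> 3 * (3 * ?m + 1)" using assms C by (intro mult_right_mono) (auto simp: threesat_instances_def)
    finally show ?thesis using m by (simp add: encode_clause_def)
  qed
  then have "length (encode_formula \<phi>) \<le> ?m * (13 * ?m)"
    unfolding encode_formula_def by (intro length_concat_le) simp
  then show ?thesis by (simp add: power2_eq_square)
qed

context search
begin

lemma inv_init:
  assumes "0 < b0" "b0 \<le> m" "\<And>b. b0 \<le> b \<Longrightarrow> b \<le> m \<Longrightarrow> NN b < B"
  shows "inv b0 B (init_state \<phi>)"
proof -
  have "NN m < B" using assms(2,3) by simp
  then show ?thesis using assms(1,2) by (simp add: init_state_def)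
qed

lemma rank_init: "rank b0 B (init_state \<phi>) \<le> B + (m * m + m) * B + B"
proof -
  have "((m - b0) * m + (m - 0)) * B \<le> (m * m + m) * B" by (intro mult_right_mono add_mono) auto
  then show ?thesis unfolding init_state_def rank.simps by linarith
qed

end

context dks_reduction
begin

text \<open>The exponent \<open>C\<close> is chosen before \<phi>, \<open>b0\<close> and
  \<open>B\<close>. So one program obeys all these time bounds at once, without knowing which
  \<open>b0\<close> makes its answers trustworthy.\<close>

lemma exec_prog:
  "\<exists>C. \<forall>\<phi> b0 B. \<phi> \<in> threesat_instances \<longrightarrow> 0 < b0 \<longrightarrow> b0 \<le> length \<phi> \<longrightarrow> b0 = 1 \<or> search.good M E \<phi> b0 \<longrightarrow>
     (\<forall>b. b0 \<le> b \<longrightarrow> b \<le> length \<phi> \<longrightarrow> formula_word.NN \<phi> b < B) \<longrightarrow>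
     (\<exists>\<tau>. search.outcome E \<phi> \<tau> \<and> exec (prog M s E) (init_store (encode_formula \<phi>))
        ((length (encode_formula \<phi>) + B + 2) ^ C) (st bs (state_arrays \<phi> \<tau>) (state_vars \<phi> \<tau>)))"
proof -
  obtain T where T: "polyb T" "\<forall>\<phi> \<tau> S. \<phi> \<in> threesat_instances \<longrightarrow> valid \<phi> \<tau> \<longrightarrow> (\<forall>y\<in>set (state_vars \<phi> \<tau>). y \<le> S) \<longrightarrow>
      exec (prog_body M s E) (st bs (state_arrays \<phi> \<tau>) (state_vars \<phi> \<tau>)) (T S)
        (st bs (state_arrays \<phi> (loop_step \<phi> \<tau>)) (state_vars \<phi> (loop_step \<phi> \<tau>)))"
    using exec_body by blast
  obtain T' where T': "polyb T'" "\<forall>\<phi> \<sigma> n. \<phi> \<in> threesat_instances \<longrightarrow>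
     exec (Loop (bs + 6) nonzero (prog_body M s E)) (st bs (state_arrays \<phi> (init_state \<phi>)) (state_vars \<phi> (init_state \<phi>))) n \<sigma> \<longrightarrow>
     exec (prog M s E) (init_store (encode_formula \<phi>)) (T' (formula_word.len \<phi>) + n) \<sigma>"
    using exec_prog_init by blast
  obtain C' where C': "\<And>S. T' S \<le> (S + 2) ^ C'" using T'(1) unfolding polyb_def by blast
  have "polyb (\<lambda>S. (S + 2) ^ C' + ((S + (S * S + S) * S + S + 1) * (T S + 1) + 1))"
    by (intro polyb_intros T(1))
  then obtain C where C: "\<And>S. (S + 2) ^ C' + ((S + (S * S + S) * S + S + 1) * (T S + 1) + 1) \<le> (S + 2) ^ C"
    unfolding polyb_def by blast
  show ?thesis
  proof (intro exI[of _ C] allI impI)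
    fix \<phi> b0 B
    assume \<phi>: "\<phi> \<in> threesat_instances" and b0: "0 < b0" "b0 \<le> length \<phi>" "b0 = 1 \<or> search.good M E \<phi> b0"
      and B: "\<forall>b. b0 \<le> b \<longrightarrow> b \<le> length \<phi> \<longrightarrow> formula_word.NN \<phi> b < B"
    interpret search M s E c d f \<phi> by (rule search[OF \<phi>])
    have B': "\<And>b. b0 \<le> b \<Longrightarrow> b \<le> m \<Longrightarrow> NN b < B" and b0m: "b0 \<le> m" using B b0 by (auto simp: m_def)
    let ?S = "len + B" and ?r = "rank b0 B (init_state \<phi>)"
    obtain \<tau> where \<tau>: "outcome \<tau>" "exec (Loop (bs + 6) nonzero (prog_body M s E))
       (st bs (state_arrays \<phi> (init_state \<phi>)) (state_vars \<phi> (init_state \<phi>))) ((?r + 1) * (T ?S + 1) + 1)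
       (st bs (state_arrays \<phi> \<tau>) (state_vars \<phi> \<tau>))"
      using exec_search[OF b0(1,3) B' T(2) inv_init[OF b0(1) b0m B']] by blast
    have "exec (prog M s E) (init_store (encode_formula \<phi>)) (T' len + ((?r + 1) * (T ?S + 1) + 1))
       (st bs (state_arrays \<phi> \<tau>) (state_vars \<phi> \<tau>))"
      using T'(2) \<phi> \<tau>(2) by blast
    moreover have "T' len + ((?r + 1) * (T ?S + 1) + 1) \<le> (length (encode_formula \<phi>) + B + 2) ^ C"
    proof -
      have "T' len \<le> (len + 2) ^ C'" by (rule C')
      also have "\<dots> \<le> (?S + 2) ^ C'" by (rule power_mono) auto
      finally have 1: "T' len \<le> (?S + 2) ^ C'" .
      have "?r \<le> B + (m * m + m) * B + B" by (rule rank_init)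
      also have "\<dots> \<le> ?S + (?S * ?S + ?S) * ?S + ?S" using m_le_len by (intro add_mono mult_mono) auto
      finally have "(?r + 1) * (T ?S + 1) \<le> (?S + (?S * ?S + ?S) * ?S + ?S + 1) * (T ?S + 1)"
        by (intro mult_right_mono add_mono) auto
      with 1 have "T' len + ((?r + 1) * (T ?S + 1) + 1) \<le> (?S + 2) ^ C"
        using C[of ?S] by linarith
      then show ?thesis by (simp add: len_def)
    qed
    ultimately have "exec (prog M s E) (init_store (encode_formula \<phi>)) ((length (encode_formula \<phi>) + B + 2) ^ C)
       (st bs (state_arrays \<phi> \<tau>) (state_vars \<phi> \<tau>))" by (rule exec.Weaken)
    then show "\<exists>\<tau>. outcome \<tau> \<and> exec (prog M s E) (init_store (encode_formula \<phi>))
        ((length (encode_formula \<phi>) + B + 2) ^ C) (st bs (state_arrays \<phi> \<tau>) (state_vars \<phi> \<tau>))"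
      using \<tau>(1) by blast
  qed
qed

lemma sat_machine:
  obtains M' C where "turing_machine M'"
    "\<And>\<phi> b0 B. \<phi> \<in> threesat_instances \<Longrightarrow> 0 < b0 \<Longrightarrow> b0 \<le> length \<phi> \<Longrightarrow> b0 = 1 \<or> search.good M E \<phi> b0 \<Longrightarrow>
       \<forall>b. b0 \<le> b \<longrightarrow> b \<le> length \<phi> \<longrightarrow> formula_word.NN \<phi> b < B \<Longrightarrow>
       \<exists>t\<le>(length (encode_formula \<phi>) + B + 2) ^ C + 1. tm_state_after M' (encode_formula \<phi>) t \<in> {1, 2} \<and>
         (satisfiable \<phi> \<longrightarrow> tm_state_after M' (encode_formula \<phi>) t = 1) \<and>
         (val \<phi> \<le> 1 - 1 / real E \<longrightarrow> tm_state_after M' (encode_formula \<phi>) t = 2)"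
proof -
  obtain C where C: "\<forall>\<phi> b0 B. \<phi> \<in> threesat_instances \<longrightarrow> 0 < b0 \<longrightarrow> b0 \<le> length \<phi> \<longrightarrow> b0 = 1 \<or> search.good M E \<phi> b0 \<longrightarrow>
     (\<forall>b. b0 \<le> b \<longrightarrow> b \<le> length \<phi> \<longrightarrow> formula_word.NN \<phi> b < B) \<longrightarrow>
     (\<exists>\<tau>. search.outcome E \<phi> \<tau> \<and> exec (prog M s E) (init_store (encode_formula \<phi>))
        ((length (encode_formula \<phi>) + B + 2) ^ C) (st bs (state_arrays \<phi> \<tau>) (state_vars \<phi> \<tau>)))"
    using exec_prog by (elim exE)
  have "4 \<le> s" using s M unfolding turing_machine_def by linarith
  then obtain M' where M': "turing_machine M'"
    "\<And>w n \<sigma>. exec (prog M s E) (init_store w) n \<sigma> \<Longrightarrow>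
       \<exists>t\<le>n + 1. tm_state_after M' w t = (if read_tape (\<sigma> (bs + 7)) = 1 then 1 else 2)"
    using tm_of_com[OF _ symbols_below_prog[OF M s], where ans = "bs + 7"] by blast
  show ?thesis
  proof (rule that[OF M'(1)])
    fix \<phi> b0 B
    assume \<phi>: "\<phi> \<in> threesat_instances" and H: "0 < b0" "b0 \<le> length \<phi>" "b0 = 1 \<or> search.good M E \<phi> b0"
      "\<forall>b. b0 \<le> b \<longrightarrow> b \<le> length \<phi> \<longrightarrow> formula_word.NN \<phi> b < B"
    interpret search M s E c d f \<phi> by (rule search[OF \<phi>])
    obtain \<tau> where \<tau>: "outcome \<tau>" "exec (prog M s E) (init_store (encode_formula \<phi>))
        ((length (encode_formula \<phi>) + B + 2) ^ C) (st bs (state_arrays \<phi> \<tau>) (state_vars \<phi> \<tau>))"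
      using mp[OF mp[OF mp[OF mp[OF mp[OF C[THEN spec, THEN spec, THEN spec] \<phi>] H(1)] H(2)] H(3)] H(4)] by (elim exE conjE)
    obtain P b l g r a z where e: "\<tau> = (P, b, l, g, r, a, z)" by (metis surj_pair)
    have ans: "read_tape (st bs (state_arrays \<phi> \<tau>) (state_vars \<phi> \<tau>) (bs + 7)) = (if a = 0 then 0 else 1)"
      unfolding e by (subst st_counter) (auto simp: read_cn)
    have "(if (if a = 0 then 0 else 1) = (1::nat) then 1 else 2) = (if a = 0 then 2 else (1::nat))" by simp
    note M'(2)[OF \<tau>(2), unfolded ans this]
    then obtain t where t: "t \<le> (length (encode_formula \<phi>) + B + 2) ^ C + 1"
      "tm_state_after M' (encode_formula \<phi>) t = (if a = 0 then 2 else 1)"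
      by (elim exE conjE)
    have "a = 1 \<and> \<not> val \<phi> \<le> 1 - 1 / real E \<or> a = 0 \<and> \<not> satisfiable \<phi>"
      using \<tau>(1) val_violated[OF _ E] unfolding e by (auto split: if_splits)
    then show "\<exists>t\<le>(length (encode_formula \<phi>) + B + 2) ^ C + 1. tm_state_after M' (encode_formula \<phi>) t \<in> {1, 2} \<and>
         (satisfiable \<phi> \<longrightarrow> tm_state_after M' (encode_formula \<phi>) t = 1) \<and>
         (val \<phi> \<le> 1 - 1 / real E \<longrightarrow> tm_state_after M' (encode_formula \<phi>) t = 2)"
      using t by (intro exI[of _ t]) auto
  qed
qed

end

text \<open>The logarithm of \<open>NN b\<close> is at most \<open>3 * qq b * log 2 (4 * b)\<close>,
  where \<open>qq b \<le> 2 * m / b\<close>, and \<open>log 2 (4 * b) / b\<close> tends to 0. The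
  bound covers all \<open>b\<close> from \<open>b0\<close> to \<open>m\<close>, since the search may
  pass through all of them.\<close>

lemma NN_small:
  fixes \<delta> :: real
  assumes "0 < \<delta>"
  obtains b0 where "0 < b0"
    "\<And>\<phi> b. \<phi> \<in> threesat_instances \<Longrightarrow> b0 \<le> b \<Longrightarrow> b \<le> length \<phi> \<Longrightarrow> real (formula_word.NN \<phi> b) \<le> 2 powr (\<delta> * real (length \<phi>))"
proof -
  have "(\<lambda>b::nat. 6 * log 2 (4 * real b) / real b) \<longlonglongrightarrow> 0" by real_asymp
  then have "eventually (\<lambda>b. 6 * log 2 (4 * real b) / real b < \<delta>) sequentially"
    using assms by (rule order_tendstoD)
  then obtain b1 where b1: "\<And>b. b1 \<le> b \<Longrightarrow> 6 * log 2 (4 * real b) / real b < \<delta>"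
    unfolding eventually_sequentially by blast
  show ?thesis
  proof (rule that[of "Suc b1"])
    fix \<phi> b assume \<phi>: "\<phi> \<in> threesat_instances" and b: "Suc b1 \<le> b" "b \<le> length \<phi>"
    interpret formula_word \<phi> "arrays (word_array (encode_formula \<phi>)) (\<lambda>_. 0)" by (rule formula_word_arrays[OF \<phi>])
    have b': "0 < b" "b \<le> m" using b by (auto simp: m_def)
    have "b * (m div b) \<le> m" by simp
    then have "b * qq b \<le> 2 * m" using b'(2) unfolding qq_def add_mult_distrib2 by linarith
    then have "real b * real (qq b) \<le> 2 * real m" by (metis of_nat_le_iff of_nat_mult of_nat_numeral)
    then have q: "real (qq b) \<le> 2 * real m / real b" using b' by (simp add: field_simps)
    have "real (NN b) \<le> (4 * real b) ^ (3 * qq b)"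
      unfolding NN_def of_nat_power by (rule power_mono) (use b' in auto)
    also have "\<dots> = 2 powr (log 2 (4 * real b) * real (3 * qq b))"
      unfolding powr_powr[symmetric] using b' by (subst powr_realpow[symmetric]) simp_all
    also have "\<dots> \<le> 2 powr (\<delta> * real m)"
    proof (rule powr_mono)
      have "0 \<le> log 2 (4 * real b)" using b' by simp
      then have "log 2 (4 * real b) * real (3 * qq b) \<le> log 2 (4 * real b) * (3 * (2 * real m / real b))"
        using q by (intro mult_left_mono) auto
      also have "\<dots> = 6 * log 2 (4 * real b) / real b * real m" by simp
      also have "\<dots> \<le> \<delta> * real m" using b1[of b] b by (intro mult_right_mono) auto
      finally show "log 2 (4 * real b) * real (3 * qq b) \<le> \<delta> * real m" .
    qed simp
    finally show "real (NN b) \<le> 2 powr (\<delta> * real (length \<phi>))" by (simp add: m_def)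
  qed simp
qed

context dks_reduction
begin

lemma sat_subexponential:
  obtains M' where "turing_machine M'" "subexponential_time M' encode_formula threesat_instances length"
    "distinguishes M' encode_formula threesat_instances satisfiable (\<lambda>\<phi>. val \<phi> \<le> 1 - 1 / real E)"
proof -
  obtain M' C where M': "turing_machine M'" and run:
    "\<And>\<phi> b0 B. \<phi> \<in> threesat_instances \<Longrightarrow> 0 < b0 \<Longrightarrow> b0 \<le> length \<phi> \<Longrightarrow> b0 = 1 \<or> search.good M E \<phi> b0 \<Longrightarrow>
       \<forall>b. b0 \<le> b \<longrightarrow> b \<le> length \<phi> \<longrightarrow> formula_word.NN \<phi> b < B \<Longrightarrow>
       \<exists>t\<le>(length (encode_formula \<phi>) + B + 2) ^ C + 1. tm_state_after M' (encode_formula \<phi>) t \<in> {1, 2} \<and>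
         (satisfiable \<phi> \<longrightarrow> tm_state_after M' (encode_formula \<phi>) t = 1) \<and>
         (val \<phi> \<le> 1 - 1 / real E \<longrightarrow> tm_state_after M' (encode_formula \<phi>) t = 2)"
    by (rule sat_machine) (rule that; assumption)
  define bounds where "bounds m t \<longleftrightarrow> 0 < t \<and> (\<forall>\<phi>\<in>threesat_instances. length \<phi> = m \<longrightarrow> halts_within M' (encode_formula \<phi>) (real t))" for m t
  \<comment> \<open>A crude bound for all graphs with \<open>b \<ge> 1\<close>. With
    \<open>b0 = 1\<close> it shows that the machine halts with a correct verdict on every formula,
    however short.\<close>
  define B1 where "B1 m = Suc (\<Sum>b\<le>m. (2 * Suc b) ^ (3 * (m div b + 1)))" for m :: nat
  have B1: "\<forall>b. 1 \<le> b \<longrightarrow> b \<le> length \<phi> \<longrightarrow> formula_word.NN \<phi> b < B1 (length \<phi>)" if \<phi>: "\<phi> \<in> threesat_instances" for \<phi>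
  proof (intro allI impI)
    fix b assume b: "1 \<le> b" "b \<le> length \<phi>"
    interpret formula_word \<phi> "arrays (word_array (encode_formula \<phi>)) (\<lambda>_. 0)" by (rule formula_word_arrays[OF \<phi>])
    have "NN b = (2 * Suc b) ^ (3 * (length \<phi> div b + 1))" by (simp add: NN_def qq_def m_def)
    also have "\<dots> \<le> (\<Sum>b\<le>length \<phi>. (2 * Suc b) ^ (3 * (length \<phi> div b + 1)))"
      by (rule member_le_sum) (use b in auto)
    finally show "NN b < B1 (length \<phi>)" by (simp add: B1_def)
  qed
  have len1: "1 \<le> length \<phi>" if "\<phi> \<in> threesat_instances" for \<phi>
    using that by (cases \<phi>) (auto simp: threesat_instances_def)
  have "distinguishes M' encode_formula threesat_instances satisfiable (\<lambda>\<phi>. val \<phi> \<le> 1 - 1 / real E)"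
    unfolding distinguishes_def accepts_def rejects_def
    using run[OF _ zero_less_one len1 _ B1] by blast
  moreover have "subexponential_time M' encode_formula threesat_instances length"
  proof -
    have ex: "\<exists>t. bounds m t" for m
    proof (intro exI[of _ "(13 * m ^ 2 + B1 m + 2) ^ C + 1"])
      show "bounds m ((13 * m ^ 2 + B1 m + 2) ^ C + 1)"
        unfolding bounds_def
      proof (intro conjI ballI impI)
        fix \<phi> assume \<phi>: "\<phi> \<in> threesat_instances" "length \<phi> = m"
        obtain t where t: "t \<le> (length (encode_formula \<phi>) + B1 m + 2) ^ C + 1" "tm_state_after M' (encode_formula \<phi>) t \<in> {1, 2}"
          using run[OF \<phi>(1) zero_less_one len1[OF \<phi>(1)] _ B1[OF \<phi>(1)]] \<phi>(2) by blast
        note t(1)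
        also have "(length (encode_formula \<phi>) + B1 m + 2) ^ C + 1 \<le> (13 * m ^ 2 + B1 m + 2) ^ C + 1"
          using length_encode_formula[OF \<phi>(1)] \<phi>(2) by (intro add_mono power_mono) auto
        finally show "halts_within M' (encode_formula \<phi>) (real ((13 * m ^ 2 + B1 m + 2) ^ C + 1))"
          unfolding halts_within_def using t(2) of_nat_mono by blast
      qed simp
    qed
    \<comment> \<open>A single function has to work for every \<eta>, while \<open>b0\<close> and
      the thresholds depend on \<eta>. The least uniform time bound for each \<open>m\<close> does
      not refer to any of them.\<close>
    define h where "h m = (LEAST t. bounds m t)" for m
    have h: "bounds m (h m)" for m unfolding h_def using ex by (rule LeastI_ex)
    have h_le: "h m \<le> t" if "bounds m t" for m t unfolding h_def using that by (rule Least_le)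
    have small: "\<exists>m0. \<forall>m\<ge>m0. real (h m) \<le> 2 powr (\<eta> * real m)" if \<eta>: "0 < \<eta>" for \<eta>
    proof -
      \<comment> \<open>The time will be at most \<open>X ^ (2 * C + 2)\<close> with
        \<open>X = 2 powr (\<delta> * m)\<close>, and \<delta> is chosen to turn this into
        \<open>2 powr (\<eta> * m)\<close>.\<close>
      define \<delta> where "\<delta> = \<eta> / (2 * real C + 2)"
      have \<delta>: "0 < \<delta>" using \<eta> by (simp add: \<delta>_def)
      obtain b0 where b0: "0 < b0" "\<And>\<phi> b. \<phi> \<in> threesat_instances \<Longrightarrow> b0 \<le> b \<Longrightarrow> b \<le> length \<phi> \<Longrightarrow>
          real (formula_word.NN \<phi> b) \<le> 2 powr (\<delta> * real (length \<phi>))"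
        using NN_small[OF \<delta>] by blast
      obtain m1 where m1: "\<forall>\<phi>\<in>threesat_instances. m1 \<le> length \<phi> \<longrightarrow> search.good M E \<phi> b0"
        using eventually_good[OF b0(1)] by blast
      have "eventually (\<lambda>m::nat. 13 * real m ^ 2 + 4 \<le> 2 powr (\<delta> * real m)) sequentially"
        using \<delta> by real_asymp
      then obtain m2 where m2: "\<And>m. m2 \<le> m \<Longrightarrow> 13 * real m ^ 2 + 4 \<le> 2 powr (\<delta> * real m)"
        unfolding eventually_sequentially by blast
      have "real (h m) \<le> 2 powr (\<eta> * real m)" if m: "max b0 (max m1 m2) \<le> m" for m
      proof -
        define X where "X = 2 powr (\<delta> * real m)"
        have X: "13 * real m ^ 2 + 4 \<le> X" using m2[of m] m by (simp add: X_def)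
        have X2: "2 \<le> X" using X zero_le_power2[of "real m"] by linarith
        let ?B = "nat \<lfloor>X\<rfloor> + 1"
        have B: "real ?B \<le> X + 1" using X2 by simp
        let ?t = "(13 * m ^ 2 + ?B + 2) ^ C + 1"
        have "bounds m ?t"
          unfolding bounds_def
        proof (intro conjI ballI impI)
          fix \<phi> assume \<phi>: "\<phi> \<in> threesat_instances" "length \<phi> = m"
          have NB: "\<forall>b. b0 \<le> b \<longrightarrow> b \<le> length \<phi> \<longrightarrow> formula_word.NN \<phi> b < ?B"
          proof (intro allI impI)
            fix b assume "b0 \<le> b" "b \<le> length \<phi>"
            then have "real (formula_word.NN \<phi> b) \<le> X" using b0(2)[OF \<phi>(1)] \<phi>(2) unfolding X_def by blast
            then have "formula_word.NN \<phi> b \<le> nat \<lfloor>X\<rfloor>" by (simp add: le_nat_floor)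
            then show "formula_word.NN \<phi> b < ?B" by simp
          qed
          have "b0 \<le> length \<phi>" "b0 = 1 \<or> search.good M E \<phi> b0" using m m1 \<phi> by auto
          from run[OF \<phi>(1) b0(1) this NB] obtain t where
            t: "t \<le> (length (encode_formula \<phi>) + ?B + 2) ^ C + 1" "tm_state_after M' (encode_formula \<phi>) t \<in> {1, 2}"
            by blast
          note t(1)
          also have "(length (encode_formula \<phi>) + ?B + 2) ^ C + 1 \<le> ?t"
            using length_encode_formula[OF \<phi>(1)] \<phi>(2) by (intro add_mono power_mono) auto
          finally show "halts_within M' (encode_formula \<phi>) (real ?t)"
            unfolding halts_within_def using t(2) of_nat_mono by blast
        qed simp
        then have "real (h m) \<le> real ?t" using h_le of_nat_mono by blast
        also have "\<dots> = (13 * real m ^ 2 + real ?B + 2) ^ C + 1" by simp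
        also have "\<dots> \<le> (X * X) ^ C + 1"
        proof -
          have "13 * real m ^ 2 + real ?B + 2 \<le> 2 * X" using X B by linarith
          also have "\<dots> \<le> X * X" using X2 by (intro mult_right_mono) auto
          finally show ?thesis by (intro add_mono power_mono) auto
        qed
        also have "\<dots> \<le> X * X * (X * X) ^ C"
        proof -
          have "1 \<le> X * X" using mult_mono[of 1 X 1 X] X2 by simp
          then have Y: "1 \<le> (X * X) ^ C" by (rule one_le_power)
          have "2 \<le> X * X" using mult_mono[of 2 X 1 X] X2 by simp
          then have "2 * (X * X) ^ C \<le> X * X * (X * X) ^ C" using Y by (intro mult_right_mono) auto
          then show ?thesis using Y by linarith
        qed
        also have "\<dots> = X ^ (2 * C + 2)" by (simp add: power_mult power2_eq_square power_add)
        also have "\<dots> = X powr real (2 * C + 2)" using X2 by (intro powr_realpow[symmetric]) simp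
        also have "\<dots> = 2 powr (\<delta> * real m * real (2 * C + 2))" unfolding X_def by (rule powr_powr)
        also have "\<delta> * real m * real (2 * C + 2) = \<eta> * real m" by (simp add: \<delta>_def field_simps)
        finally show ?thesis .
      qed
      then show ?thesis by blast
    qed
    have pos: "0 < real (h m)" for m using h[of m] by (simp add: bounds_def)
    have "(\<lambda>m. log 2 (real (h m))) \<in> o(\<lambda>m. real m)"
    proof (rule landau_o.smallI)
      fix \<eta> :: real assume "0 < \<eta>"
      from small[OF this] obtain m0 where m0: "\<And>m. m0 \<le> m \<Longrightarrow> real (h m) \<le> 2 powr (\<eta> * real m)" by blast
      have "norm (log 2 (real (h m))) \<le> \<eta> * norm (real m)" if "m0 \<le> m" for m
      proof -
        have "log 2 (real (h m)) \<le> log 2 (2 powr (\<eta> * real m))"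
          using m0[OF that] pos[of m] by (intro log_mono) auto
        moreover have "0 \<le> log 2 (real (h m))" using pos[of m] by simp
        ultimately show ?thesis by simp
      qed
      then show "eventually (\<lambda>m. norm (log 2 (real (h m))) \<le> \<eta> * norm (real m)) sequentially"
        unfolding eventually_sequentially by blast
    qed
    moreover have "\<forall>\<phi>\<in>threesat_instances. halts_within M' (encode_formula \<phi>) (2 powr (log 2 (real (h (length \<phi>)))))"
      using h pos by (simp add: bounds_def)
    ultimately show ?thesis unfolding subexponential_time_def by blast
  qed
  ultimately show ?thesis using M' that by blast
qed

end

theorem theorem1p2:
  fixes f :: "nat \<Rightarrow> real"
  assumes "f \<longlonglongrightarrow> 0"
    and "gap_ETH"
  shows "\<not> (\<exists>M. turing_machine M \<and>
               polynomial_time M encode_dks dks_instances \<and>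
               distinguishes M encode_dks dks_instances
                 has_k_clique (all_k_subgraphs_sparse f))"
proof
  assume "\<exists>M. turing_machine M \<and> polynomial_time M encode_dks dks_instances \<and>
    distinguishes M encode_dks dks_instances has_k_clique (all_k_subgraphs_sparse f)"
  then obtain M c d where M: "turing_machine M" "distinguishes M encode_dks dks_instances has_k_clique (all_k_subgraphs_sparse f)"
    "\<forall>x\<in>dks_instances. halts_within M (encode_dks x) (real (c * length (encode_dks x) ^ d + c))"
    unfolding polynomial_time_def by blast
  obtain \<epsilon> :: real where \<epsilon>: "0 < \<epsilon>" "\<not> (\<exists>M. turing_machine M \<and>
       subexponential_time M encode_formula threesat_instances length \<and>
       distinguishes M encode_formula threesat_instances satisfiable (\<lambda>\<phi>. val \<phi> \<le> 1 - \<epsilon>))"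
    using assms(2) unfolding gap_ETH_def by blast
  \<comment> \<open>Passing from \<epsilon> to the smaller \<open>1 / E\<close> enlarges the set of
    formulas to be rejected, so a machine for the gap \<open>1 / E\<close> also refutes the
    hypothesis for \<epsilon>.\<close>
  obtain E where E': "0 < E" "1 / real E < \<epsilon>"
    using ex_inverse_of_nat_less[OF \<epsilon>(1)] by (auto simp: inverse_eq_divide)
  interpret dks_reduction M "2 * tm_symbols M + tm_states M + 1" E c d f
    by unfold_locales (use M E' assms(1) in \<open>auto simp: turing_machine_def\<close>)
  obtain M' where M': "turing_machine M'" "subexponential_time M' encode_formula threesat_instances length"
    "distinguishes M' encode_formula threesat_instances satisfiable (\<lambda>\<phi>. val \<phi> \<le> 1 - 1 / real E)"
    by (rule sat_subexponential)
  have "val \<phi> \<le> 1 - 1 / real E" if "val \<phi> \<le> 1 - \<epsilon>" for \<phi> using that E'(2) by linarith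
  then have "distinguishes M' encode_formula threesat_instances satisfiable (\<lambda>\<phi>. val \<phi> \<le> 1 - \<epsilon>)"
    using M'(3) unfolding distinguishes_def by blast
  then show False using \<epsilon>(2) M'(1,2) by blast
qed

end
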